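(* Let $A=\mathcal F_R(\mathrm{SL}(2))$ and let $h:A\to\mu_l(M)\mu_r(M)$ be the Haar functional, i.e. the $\mathbb C$-linear map determined by $$h(f(\lambda)g(\mu)t_{kj}^N)=f(\lambda)g(\mu)\,\delta_{0N},\qquad f,g\in M,\ N\in\mathbb Z_{\ge0},\ 0\le j,k\le N.$$ Then $h$ is both the unique left-invariant integral and the unique right-invariant integral on $A$ whose value at $1$ is $1$.
   Context: Fix $0<q<1$ and put $q^x=e^{x\log q}$. $M$ is the field of meromorphic functions on $\mathfrak h^*=\mathbb C$; $T_af(\lambda)=f(\lambda+a)$. Put $$F(\lambda)=\frac{q^{2(\lambda+1)}-q^{-2}}{q^{2(\lambda+1)}-1},\quad G(\lambda)=\frac{(q^{2(\lambda+1)}-q^2)(q^{2(\lambda+1)}-q^{-2})}{(q^{2(\lambda+1)}-1)^2},$$ $$H(\lambda,\mu)=\frac{(q-q^{-1})(q^{2(\lambda+\mu+2)}-1)}{(q^{2(\lambda+1)}-1)(q^{2(\mu+1)}-1)},\quad I(\lambda,\mu)=\frac{(q-q^{-1})(q^{2(\mu+1)}-q^{2(\lambda+1)})}{(q^{2(\lambda+1)}-1)(q^{2(\mu+1)}-1)}.$$ $\mathcal F_R(\mathrm M(2))$ is the unital associative complex algebra generated by $\alpha,\beta,\gamma,\delta$ and two copies of $M$, whose elements are written $f(\lambda)=\mu_l(f)$ and $f(\mu)=\mu_r(f)$, with relations $f(\lambda)g(\mu)=g(\mu)f(\lambda)$; $f(\lambda)\alpha=\alpha f(\lambda+1)$, $f(\mu)\alpha=\alpha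 f(\mu+1)$, $f(\lambda)\beta=\beta f(\lambda+1)$, $f(\mu)\beta=\beta f(\mu-1)$, $f(\lambda)\gamma=\gamma f(\lambda-1)$, $f(\mu)\gamma=\gamma f(\mu+1)$, $f(\lambda)\delta=\delta f(\lambda-1)$, $f(\mu)\delta=\delta f(\mu-1)$; $\alpha\beta=qF(\mu-1)\beta\alpha$, $\alpha\gamma=qF(\lambda)\gamma\alpha$, $\beta\delta=qF(\lambda)\delta\beta$, $\gamma\delta=qF(\mu-1)\delta\gamma$; $\alpha\delta-\delta\alpha=H(\lambda,\mu)\gamma\beta$, $G(\mu)\alpha\delta-G(\lambda)\delta\alpha=H(\lambda,\mu)\beta\gamma$, $\beta\gamma-G(\mu)\gamma\beta=I(\lambda,\mu)\delta\alpha$, $\beta\gamma-G(\lambda)\gamma\beta=I(\lambda,\mu)\alpha\delta$. It is bigraded by $\alpha\in\mathcal F_{11}$, $\beta\in\mathcal F_{1,-1}$, $\gamma\in\mathcal F_{-1,1}$, $\delta\in\mathcal F_{-1,-1}$, $f(\lambda),f(\mu)\in\mathcal F_{00}$. $\mathcal F_R(\mathrm{SL}(2))$ is its quotient by $c=1$, where $c=\alpha\delta-qF(\lambda)\gamma\beta$ is central. For $A=\mathcal F_R(\mathrm{SL}(2))$, $A\widetilde\otimes A=\bigoplus_{a,b,c}A_{ac}\otimes A_{cb}$ modulo $f(\mu)x\otimes y=x\otimes f(\lambda)y$, with factorwise multiplication; the coproduct is the algebra homomorphism with $\Delta(\alpha)=\alpha\otimes\alpha+\beta\otimes\gamma$,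 $\Delta(\beta)=\alpha\otimes\beta+\beta\otimes\delta$, $\Delta(\gamma)=\gamma\otimes\alpha+\delta\otimes\gamma$, $\Delta(\delta)=\gamma\otimes\beta+\delta\otimes\delta$, $\Delta(f(\lambda))=f(\lambda)\otimes1$, $\Delta(f(\mu))=1\otimes f(\mu)$. The counit $\varepsilon:A\to D_{\mathfrak h}$ (difference operators on $M$) is the algebra homomorphism with $\varepsilon(\alpha)=T_{-1}$, $\varepsilon(\delta)=T_1$, $\varepsilon(\beta)=\varepsilon(\gamma)=0$, $\varepsilon(f(\lambda))=\varepsilon(f(\mu))=f$. The matrix elements $t_{kj}^N\in A$ ($0\le k,j\le N$) are defined by $\Delta(\gamma^{N-k}\alpha^k)=\sum_{j=0}^Nt_{kj}^N\otimes\gamma^{N-j}\alpha^j$; over all $N\ge0$ they form a basis of $A$ as a left module over $\mu_l(M)\mu_r(M)\simeq M\otimes M$. A left-invariant integral on an $\mathfrak h$-bialgebroid $A$ is a $\mathbb C$-linear map $h:A\to\mu_l(M)\mu_r(M)\subseteq A_{00}$ preserving the bigrading and the left actions of $\mu_l(M)$ and $\mu_r(M)$ (an $\mathfrak h$-prealgebra homomorphism) such that $h=(\mathrm{id}\otimes\varepsilon\circ h)\circ\Delta$ under the identification $x\simeq x\otimes T_{-b}\simeq T_{-a}\otimes x$ ($x\in A_{ab}$) of $A$ with $A\widetilde\otimes D_{\mathfrak h}$ and $D_{\mathfrak h}\widetilde\otimes A$; a right-invariant integral satisfies instead $h=(\varepsilon\circ h\otimes\mathrm{id})\circ\Delta$.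 Explicitly, if $\Delta(a)=\sum_ia_i'\otimes a_i''$ and elements of $\mu_l(M)\mu_r(M)$ are written as functions of $(\lambda,\mu)$, left-invariance means $h(a)(\lambda,\mu)=\sum_ih(a_i'')(\mu,\mu)\,a_i'$ and right-invariance means $h(a)(\lambda,\mu)=\sum_ih(a_i')(\lambda,\lambda)\,a_i''$. *)

theory Defs
  imports
    "HOL-Complex_Analysis.Complex_Analysis"
    "HOL-Algebra.QuotRing"
    "HOL-Algebra.Module"
    "HOL-Library.Poly_Mapping"
    "HOL-Library.FuncSet"
begin

section \<open>The field of meromorphic functions and its shifts\<close>

text \<open>A meromorphic function is represented by its unique representative that takes its limit
  at every non-pole and the value 0 at every pole.\<close>

definition Mero :: "(complex, complex \<Rightarrow> complex) module" where
  "Mero = \<lparr>carrier = {f. f nicely_meromorphic_on UNIV},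
           mult = (\<lambda>f g. remove_sings (\<lambda>z. f z * g z)),
           one = (\<lambda>_. 1),
           zero = (\<lambda>_. 0),
           add = (\<lambda>f g. remove_sings (\<lambda>z. f z + g z)),
           smult = (\<lambda>c f z. c * f z)\<rparr>"

definition shift :: "complex \<Rightarrow> (complex \<Rightarrow> complex) \<Rightarrow> complex \<Rightarrow> complex" where
  "shift a f = (\<lambda>z. f (z + a))"

definition qpow :: "real \<Rightarrow> complex \<Rightarrow> complex" where
  "qpow q z = exp (z * of_real (ln q))"

definition Ffun :: "real \<Rightarrow> complex \<Rightarrow> complex" where
  "Ffun q = remove_sings (\<lambda>z. (qpow q (2 * (z + 1)) - qpow q (-2)) / (qpow q (2 * (z + 1)) - 1))"

definition Gfun :: "real \<Rightarrow> complex \<Rightarrow> complex" where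
  "Gfun q = remove_sings (\<lambda>z.
     (qpow q (2 * (z + 1)) - qpow q 2) * (qpow q (2 * (z + 1)) - qpow q (-2))
       / (qpow q (2 * (z + 1)) - 1) ^ 2)"

definition Ufun :: "real \<Rightarrow> complex \<Rightarrow> complex" where
  "Ufun q = (\<lambda>z. qpow q (2 * (z + 1)))"

definition Vfun :: "real \<Rightarrow> complex \<Rightarrow> complex" where
  "Vfun q = remove_sings (\<lambda>z. 1 / (qpow q (2 * (z + 1)) - 1))"


section \<open>Complex algebras\<close>

definition alg_hom ::
    "(complex, 'a, 'm) module_scheme \<Rightarrow> (complex, 'b, 'n) module_scheme \<Rightarrow> ('a \<Rightarrow> 'b) set" where
  "alg_hom R S = {\<phi> \<in> ring_hom R S. \<forall>c. \<forall>x\<in>carrier R. \<phi> (c \<odot>\<^bsub>R\<^esub> x) = c \<odot>\<^bsub>S\<^esub> \<phi> x}"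

definition monoid_algebra :: "('g, 'm) monoid_scheme \<Rightarrow> (complex, 'g \<Rightarrow>\<^sub>0 complex) module" where
  "monoid_algebra G =
     \<lparr>carrier = {p. Poly_Mapping.keys p \<subseteq> carrier G},
      mult = (\<lambda>p r. \<Sum>x\<in>Poly_Mapping.keys p. \<Sum>y\<in>Poly_Mapping.keys r.
                Poly_Mapping.single (x \<otimes>\<^bsub>G\<^esub> y) (Poly_Mapping.lookup p x * Poly_Mapping.lookup r y)),
      one = Poly_Mapping.single \<one>\<^bsub>G\<^esub> 1,
      zero = 0,
      add = (+),
      smult = (\<lambda>c. Poly_Mapping.map ((*) c))\<rparr>"

definition quot_algebra ::
    "(complex, 'b, 'm) module_scheme \<Rightarrow> 'b set \<Rightarrow> (complex, 'b set) module" where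
  "quot_algebra R I =
     ring.extend (R Quot I) (module.fields (\<lambda>c X. \<Union>x\<in>X. I +>\<^bsub>R\<^esub> (c \<odot>\<^bsub>R\<^esub> x)))"

text \<open>Bigraded complex algebras with two moment maps from \<^term>\<open>Mero\<close>. Only integral
  weights occur in the algebra considered below.\<close>

record 'b halgebra = "(complex, 'b) module" +
  lmom :: "(complex \<Rightarrow> complex) \<Rightarrow> 'b"
  rmom :: "(complex \<Rightarrow> complex) \<Rightarrow> 'b"
  grade :: "int \<Rightarrow> int \<Rightarrow> 'b set"


section \<open>The algebra \<open>\<F>\<^sub>R(SL(2))\<close>\<close>

datatype gen = GenA | GenB | GenC | GenD
  | GenL "complex \<Rightarrow> complex" | GenR "complex \<Rightarrow> complex"

type_synonym word = "gen list"
type_synonym falg = "word \<Rightarrow>\<^sub>0 complex"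
type_synonym sl2 = "falg set"

definition generators :: "gen set" where
  "generators = {GenA, GenB, GenC, GenD} \<union> GenL ` carrier Mero \<union> GenR ` carrier Mero"

definition free_monoid :: "word monoid" where
  "free_monoid = \<lparr>carrier = lists generators, mult = (@), one = []\<rparr>"

definition free_alg :: "(complex, falg) module" where
  "free_alg = monoid_algebra free_monoid"

fun gen_ldeg :: "gen \<Rightarrow> int" where
  "gen_ldeg GenA = 1" | "gen_ldeg GenB = 1" | "gen_ldeg GenC = -1" | "gen_ldeg GenD = -1"
| "gen_ldeg (GenL f) = 0" | "gen_ldeg (GenR f) = 0"

fun gen_rdeg :: "gen \<Rightarrow> int" where
  "gen_rdeg GenA = 1" | "gen_rdeg GenB = -1" | "gen_rdeg GenC = 1" | "gen_rdeg GenD = -1"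
| "gen_rdeg (GenL f) = 0" | "gen_rdeg (GenR f) = 0"

definition words_of_bidegree :: "int \<Rightarrow> int \<Rightarrow> word set" where
  "words_of_bidegree a b =
     {w \<in> lists generators. sum_list (map gen_ldeg w) = a \<and> sum_list (map gen_rdeg w) = b}"

abbreviation fmult :: "falg \<Rightarrow> falg \<Rightarrow> falg" (infixl \<open>\<star>\<close> 75) where
  "x \<star> y \<equiv> x \<otimes>\<^bsub>free_alg\<^esub> y"

abbreviation fgen :: "gen \<Rightarrow> falg" where "fgen g \<equiv> Poly_Mapping.single [g] 1"
abbreviation fa :: falg where "fa \<equiv> fgen GenA"
abbreviation fb :: falg where "fb \<equiv> fgen GenB"
abbreviation fc :: falg where "fc \<equiv> fgen GenC"
abbreviation fd :: falg where "fd \<equiv> fgen GenD"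
abbreviation fl :: "(complex \<Rightarrow> complex) \<Rightarrow> falg" where "fl f \<equiv> fgen (GenL f)"
abbreviation fr :: "(complex \<Rightarrow> complex) \<Rightarrow> falg" where "fr f \<equiv> fgen (GenR f)"
abbreviation fscal :: "complex \<Rightarrow> falg" where "fscal c \<equiv> Poly_Mapping.single [] c"

text \<open>With \<open>u = q^(2(\<lambda>+1))\<close> and \<open>v = q^(2(\<mu>+1))\<close>, so that
  \<open>u v = q^(2(\<lambda>+\<mu>+2))\<close>, the two-variable coefficients are \<open>H = (q - 1/q) (u v - 1) / ((u - 1) (v - 1))\<close> and
  \<open>I = (q - 1/q) (v - u) / ((u - 1) (v - 1))\<close>, so they lie in the tensor square of the
  meromorphic functions. \<^term>\<open>Ufun\<close> gives \<open>u, v\<close> and \<^term>\<open>Vfun\<close> gives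
  \<open>1/(u - 1), 1/(v - 1)\<close>.\<close>

definition fH :: "real \<Rightarrow> falg" where
  "fH q = fscal (of_real (q - 1 / q)) \<star> (fl (Ufun q) \<star> fr (Ufun q) - fscal 1)
            \<star> fl (Vfun q) \<star> fr (Vfun q)"

definition fI :: "real \<Rightarrow> falg" where
  "fI q = fscal (of_real (q - 1 / q)) \<star> (fr (Ufun q) - fl (Ufun q)) \<star> fl (Vfun q) \<star> fr (Vfun q)"

text \<open>The first eight rules say that the two copies of the meromorphic functions are embedded
  as unital complex subalgebras; the last one is \<open>c = 1\<close>, imposed together with the relations of
  \<open>\<F>\<^sub>R(M(2))\<close>.\<close>

inductive sl2_rel :: "real \<Rightarrow> falg \<Rightarrow> falg \<Rightarrow> bool" for q :: real where
  "f \<in> carrier Mero \<Longrightarrow> g \<in> carrier Mero \<Longrightarrow> sl2_rel q (fl (f \<oplus>\<^bsub>Mero\<^esub> g)) (fl f + fl g)"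
| "f \<in> carrier Mero \<Longrightarrow> g \<in> carrier Mero \<Longrightarrow> sl2_rel q (fl (f \<otimes>\<^bsub>Mero\<^esub> g)) (fl f \<star> fl g)"
| "f \<in> carrier Mero \<Longrightarrow> sl2_rel q (fl (c \<odot>\<^bsub>Mero\<^esub> f)) (fscal c \<star> fl f)"
| "sl2_rel q (fl \<one>\<^bsub>Mero\<^esub>) (fscal 1)"
| "f \<in> carrier Mero \<Longrightarrow> g \<in> carrier Mero \<Longrightarrow> sl2_rel q (fr (f \<oplus>\<^bsub>Mero\<^esub> g)) (fr f + fr g)"
| "f \<in> carrier Mero \<Longrightarrow> g \<in> carrier Mero \<Longrightarrow> sl2_rel q (fr (f \<otimes>\<^bsub>Mero\<^esub> g)) (fr f \<star> fr g)"
| "f \<in> carrier Mero \<Longrightarrow> sl2_rel q (fr (c \<odot>\<^bsub>Mero\<^esub> f)) (fscal c \<star> fr f)"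
| "sl2_rel q (fr \<one>\<^bsub>Mero\<^esub>) (fscal 1)"
| "f \<in> carrier Mero \<Longrightarrow> g \<in> carrier Mero \<Longrightarrow> sl2_rel q (fl f \<star> fr g) (fr g \<star> fl f)"
| "f \<in> carrier Mero \<Longrightarrow> sl2_rel q (fl f \<star> fa) (fa \<star> fl (shift 1 f))"
| "f \<in> carrier Mero \<Longrightarrow> sl2_rel q (fr f \<star> fa) (fa \<star> fr (shift 1 f))"
| "f \<in> carrier Mero \<Longrightarrow> sl2_rel q (fl f \<star> fb) (fb \<star> fl (shift 1 f))"
| "f \<in> carrier Mero \<Longrightarrow> sl2_rel q (fr f \<star> fb) (fb \<star> fr (shift (-1) f))"
| "f \<in> carrier Mero \<Longrightarrow> sl2_rel q (fl f \<star> fc) (fc \<star> fl (shift (-1) f))"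
| "f \<in> carrier Mero \<Longrightarrow> sl2_rel q (fr f \<star> fc) (fc \<star> fr (shift 1 f))"
| "f \<in> carrier Mero \<Longrightarrow> sl2_rel q (fl f \<star> fd) (fd \<star> fl (shift (-1) f))"
| "f \<in> carrier Mero \<Longrightarrow> sl2_rel q (fr f \<star> fd) (fd \<star> fr (shift (-1) f))"
| "sl2_rel q (fa \<star> fb) (fscal (of_real q) \<star> fr (shift (-1) (Ffun q)) \<star> fb \<star> fa)"
| "sl2_rel q (fa \<star> fc) (fscal (of_real q) \<star> fl (Ffun q) \<star> fc \<star> fa)"
| "sl2_rel q (fb \<star> fd) (fscal (of_real q) \<star> fl (Ffun q) \<star> fd \<star> fb)"
| "sl2_rel q (fc \<star> fd) (fscal (of_real q) \<star> fr (shift (-1) (Ffun q)) \<star> fd \<star> fc)"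
| "sl2_rel q (fa \<star> fd - fd \<star> fa) (fH q \<star> fc \<star> fb)"
| "sl2_rel q (fr (Gfun q) \<star> fa \<star> fd - fl (Gfun q) \<star> fd \<star> fa) (fH q \<star> fb \<star> fc)"
| "sl2_rel q (fb \<star> fc - fr (Gfun q) \<star> fc \<star> fb) (fI q \<star> fd \<star> fa)"
| "sl2_rel q (fb \<star> fc - fl (Gfun q) \<star> fc \<star> fb) (fI q \<star> fa \<star> fd)"
| "sl2_rel q (fa \<star> fd - fscal (of_real q) \<star> fl (Ffun q) \<star> fc \<star> fb) (fscal 1)"

definition sl2_ideal :: "real \<Rightarrow> falg set" where
  "sl2_ideal q = Idl\<^bsub>free_alg\<^esub> {x - y | x y. sl2_rel q x y}"

definition sl2_class :: "real \<Rightarrow> falg \<Rightarrow> sl2" where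
  "sl2_class q x = sl2_ideal q +>\<^bsub>free_alg\<^esub> x"

definition SL2 :: "real \<Rightarrow> sl2 halgebra" where
  "SL2 q = module.extend (quot_algebra free_alg (sl2_ideal q))
     (halgebra.fields
       (\<lambda>f. sl2_class q (fl f))
       (\<lambda>f. sl2_class q (fr f))
       (\<lambda>a b. sl2_class q ` {x. Poly_Mapping.keys x \<subseteq> words_of_bidegree a b}))"

definition alpha :: "real \<Rightarrow> sl2" where "alpha q = sl2_class q fa"
definition beta :: "real \<Rightarrow> sl2" where "beta q = sl2_class q fb"
definition gamma :: "real \<Rightarrow> sl2" where "gamma q = sl2_class q fc"
definition delta :: "real \<Rightarrow> sl2" where "delta q = sl2_class q fd"


section \<open>The tensor product of bigraded algebras\<close>

text \<open>The tensor product is presented as the span of symbols \<open>(x, y)\<close> with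
  \<open>x \<in> B\<^sub>a\<^sub>c\<close>, \<open>y \<in> C\<^sub>c\<^sub>b\<close>, multiplied componentwise, modulo bilinearity and the
  balancing relation \<open>f(\<mu>)x \<otimes> y = x \<otimes> f(\<lambda>)y\<close>. For bigraded algebras in which
  the moment maps are shifted by the degree, these relations span a two-sided
  ideal, so generating an ideal by them adds nothing to their linear span.\<close>

definition composable :: "('b, 'm) halgebra_scheme \<Rightarrow> ('c, 'n) halgebra_scheme \<Rightarrow> ('b \<times> 'c) set" where
  "composable B C = {(x, y). \<exists>a c b. x \<in> grade B a c \<and> y \<in> grade C c b}"

definition pair_algebra ::
    "('b, 'm) halgebra_scheme \<Rightarrow> ('c, 'n) halgebra_scheme \<Rightarrow> (complex, 'b \<times> 'c \<Rightarrow>\<^sub>0 complex) module" where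
  "pair_algebra B C = monoid_algebra ((B \<times>\<times> C)\<lparr>carrier := composable B C\<rparr>)"

abbreviation pure_tens :: "'b \<Rightarrow> 'c \<Rightarrow> 'b \<times> 'c \<Rightarrow>\<^sub>0 complex" where
  "pure_tens x y \<equiv> Poly_Mapping.single (x, y) 1"

inductive tensor_rel ::
    "('b, 'm) halgebra_scheme \<Rightarrow> ('c, 'n) halgebra_scheme
      \<Rightarrow> ('b \<times> 'c \<Rightarrow>\<^sub>0 complex) \<Rightarrow> ('b \<times> 'c \<Rightarrow>\<^sub>0 complex) \<Rightarrow> bool" for B C where
  "x \<in> grade B a c \<Longrightarrow> x' \<in> grade B a c \<Longrightarrow> y \<in> grade C c b \<Longrightarrow>
     tensor_rel B C (pure_tens (x \<oplus>\<^bsub>B\<^esub> x') y) (pure_tens x y + pure_tens x' y)"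
| "x \<in> grade B a c \<Longrightarrow> y \<in> grade C c b \<Longrightarrow> y' \<in> grade C c b \<Longrightarrow>
     tensor_rel B C (pure_tens x (y \<oplus>\<^bsub>C\<^esub> y')) (pure_tens x y + pure_tens x y')"
| "x \<in> grade B a c \<Longrightarrow> y \<in> grade C c b \<Longrightarrow>
     tensor_rel B C (pure_tens (s \<odot>\<^bsub>B\<^esub> x) y) (Poly_Mapping.single (x, y) s)"
| "x \<in> grade B a c \<Longrightarrow> y \<in> grade C c b \<Longrightarrow>
     tensor_rel B C (pure_tens x (s \<odot>\<^bsub>C\<^esub> y)) (Poly_Mapping.single (x, y) s)"
| "x \<in> grade B a c \<Longrightarrow> y \<in> grade C c b \<Longrightarrow> f \<in> carrier Mero \<Longrightarrow>
     tensor_rel B C (pure_tens (rmom B f \<otimes>\<^bsub>B\<^esub> x) y) (pure_tens x (lmom C f \<otimes>\<^bsub>C\<^esub> y))"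

definition tensor_ideal ::
    "('b, 'm) halgebra_scheme \<Rightarrow> ('c, 'n) halgebra_scheme \<Rightarrow> ('b \<times> 'c \<Rightarrow>\<^sub>0 complex) set" where
  "tensor_ideal B C = Idl\<^bsub>pair_algebra B C\<^esub> {p - p' | p p'. tensor_rel B C p p'}"

definition tensor_algebra ::
    "('b, 'm) halgebra_scheme \<Rightarrow> ('c, 'n) halgebra_scheme
      \<Rightarrow> (complex, ('b \<times> 'c \<Rightarrow>\<^sub>0 complex) set) module" where
  "tensor_algebra B C = quot_algebra (pair_algebra B C) (tensor_ideal B C)"

definition tens ::
    "('b, 'm) halgebra_scheme \<Rightarrow> ('c, 'n) halgebra_scheme \<Rightarrow> 'b \<Rightarrow> 'c
      \<Rightarrow> ('b \<times> 'c \<Rightarrow>\<^sub>0 complex) set" where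
  "tens B C x y = tensor_ideal B C +>\<^bsub>pair_algebra B C\<^esub> pure_tens x y"


section \<open>Difference operators\<close>

definition Dh :: "(complex, (complex \<Rightarrow> complex) \<Rightarrow> (complex \<Rightarrow> complex)) module" where
  "Dh = \<lparr>carrier = {\<lambda>g\<in>carrier Mero. \<Oplus>\<^bsub>Mero\<^esub>i\<in>{..<n}. f i \<otimes>\<^bsub>Mero\<^esub> shift (a i) g
                     | (n::nat) f (a :: nat \<Rightarrow> complex). f \<in> {..<n} \<rightarrow> carrier Mero},
         mult = compose (carrier Mero),
         one = (\<lambda>g\<in>carrier Mero. g),
         zero = (\<lambda>g\<in>carrier Mero. \<zero>\<^bsub>Mero\<^esub>),
         add = (\<lambda>D E. \<lambda>g\<in>carrier Mero. D g \<oplus>\<^bsub>Mero\<^esub> E g),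
         smult = (\<lambda>c D. \<lambda>g\<in>carrier Mero. c \<odot>\<^bsub>Mero\<^esub> D g)\<rparr>"

definition mult_op :: "(complex \<Rightarrow> complex) \<Rightarrow> (complex \<Rightarrow> complex) \<Rightarrow> (complex \<Rightarrow> complex)" where
  "mult_op f = (\<lambda>g\<in>carrier Mero. f \<otimes>\<^bsub>Mero\<^esub> g)"

definition shift_op :: "complex \<Rightarrow> (complex \<Rightarrow> complex) \<Rightarrow> (complex \<Rightarrow> complex)" where
  "shift_op a = restrict (shift a) (carrier Mero)"


section \<open>Coproduct, counit and matrix elements\<close>

definition is_coproduct :: "real \<Rightarrow> (sl2 \<Rightarrow> (sl2 \<times> sl2 \<Rightarrow>\<^sub>0 complex) set) \<Rightarrow> bool" where
  "is_coproduct q \<phi> \<longleftrightarrow>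
     (let A = SL2 q; AA = tensor_algebra A A; t = tens A A in
        \<phi> \<in> alg_hom A AA
      \<and> \<phi> (alpha q) = t (alpha q) (alpha q) \<oplus>\<^bsub>AA\<^esub> t (beta q) (gamma q)
      \<and> \<phi> (beta q) = t (alpha q) (beta q) \<oplus>\<^bsub>AA\<^esub> t (beta q) (delta q)
      \<and> \<phi> (gamma q) = t (gamma q) (alpha q) \<oplus>\<^bsub>AA\<^esub> t (delta q) (gamma q)
      \<and> \<phi> (delta q) = t (gamma q) (beta q) \<oplus>\<^bsub>AA\<^esub> t (delta q) (delta q)
      \<and> (\<forall>f\<in>carrier Mero. \<phi> (lmom A f) = t (lmom A f) \<one>\<^bsub>A\<^esub>)
      \<and> (\<forall>f\<in>carrier Mero. \<phi> (rmom A f) = t \<one>\<^bsub>A\<^esub> (rmom A f)))"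

definition coprod :: "real \<Rightarrow> sl2 \<Rightarrow> (sl2 \<times> sl2 \<Rightarrow>\<^sub>0 complex) set" where
  "coprod q = (THE \<phi>. \<phi> \<in> extensional (carrier (SL2 q)) \<and> is_coproduct q \<phi>)"

definition is_counit :: "real \<Rightarrow> (sl2 \<Rightarrow> (complex \<Rightarrow> complex) \<Rightarrow> (complex \<Rightarrow> complex)) \<Rightarrow> bool" where
  "is_counit q \<epsilon> \<longleftrightarrow>
     \<epsilon> \<in> alg_hom (SL2 q) Dh
   \<and> \<epsilon> (alpha q) = shift_op (-1) \<and> \<epsilon> (delta q) = shift_op 1
   \<and> \<epsilon> (beta q) = \<zero>\<^bsub>Dh\<^esub> \<and> \<epsilon> (gamma q) = \<zero>\<^bsub>Dh\<^esub>
   \<and> (\<forall>f\<in>carrier Mero. \<epsilon> (lmom (SL2 q) f) = mult_op f \<and> \<epsilon> (rmom (SL2 q) f) = mult_op f)"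

definition counit :: "real \<Rightarrow> sl2 \<Rightarrow> (complex \<Rightarrow> complex) \<Rightarrow> (complex \<Rightarrow> complex)" where
  "counit q = (THE \<epsilon>. \<epsilon> \<in> extensional (carrier (SL2 q)) \<and> is_counit q \<epsilon>)"

text \<open>\<open>\<gamma>^(N-j) \<alpha>^j\<close> has left degree \<open>2j - N\<close>, so the coefficient of
  \<open>\<gamma>^(N-j) \<alpha>^j\<close> in \<open>\<Delta>(\<gamma>^(N-k) \<alpha>^k)\<close> has bidegree \<open>(2k - N, 2j - N)\<close>.\<close>

definition corep_vec :: "real \<Rightarrow> nat \<Rightarrow> nat \<Rightarrow> sl2" where
  "corep_vec q N k = gamma q [^]\<^bsub>SL2 q\<^esub> (N - k) \<otimes>\<^bsub>SL2 q\<^esub> alpha q [^]\<^bsub>SL2 q\<^esub> k"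

definition is_matrix_row :: "real \<Rightarrow> nat \<Rightarrow> nat \<Rightarrow> (nat \<Rightarrow> sl2) \<Rightarrow> bool" where
  "is_matrix_row q N k t \<longleftrightarrow>
     (\<forall>j\<le>N. t j \<in> grade (SL2 q) (2 * int k - int N) (2 * int j - int N))
   \<and> coprod q (corep_vec q N k) =
       (\<Oplus>\<^bsub>tensor_algebra (SL2 q) (SL2 q)\<^esub>j\<in>{..N}. tens (SL2 q) (SL2 q) (t j) (corep_vec q N j))"

definition matel :: "real \<Rightarrow> nat \<Rightarrow> nat \<Rightarrow> nat \<Rightarrow> sl2" where
  "matel q N k j = (THE x. \<exists>t. is_matrix_row q N k t \<and> x = t j)"


section \<open>Integrals and the Haar functional\<close>

definition base :: "('b, 'm) halgebra_scheme \<Rightarrow> 'b set" where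
  "base A = {\<Oplus>\<^bsub>A\<^esub>i\<in>{..<n}. lmom A (f i) \<otimes>\<^bsub>A\<^esub> rmom A (g i)
              | (n::nat) f g. f \<in> {..<n} \<rightarrow> carrier Mero \<and> g \<in> {..<n} \<rightarrow> carrier Mero}"

definition clinear_to_base :: "('b, 'm) halgebra_scheme \<Rightarrow> ('b \<Rightarrow> 'b) set" where
  "clinear_to_base A =
     {h \<in> carrier A \<rightarrow>\<^sub>E base A.
        (\<forall>x\<in>carrier A. \<forall>y\<in>carrier A. h (x \<oplus>\<^bsub>A\<^esub> y) = h x \<oplus>\<^bsub>A\<^esub> h y)
      \<and> (\<forall>c. \<forall>x\<in>carrier A. h (c \<odot>\<^bsub>A\<^esub> x) = c \<odot>\<^bsub>A\<^esub> h x)}"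

definition prealgebra_hom_to_base :: "('b, 'm) halgebra_scheme \<Rightarrow> ('b \<Rightarrow> 'b) set" where
  "prealgebra_hom_to_base A =
     {h \<in> clinear_to_base A.
        (\<forall>a b. h ` grade A a b \<subseteq> grade A a b)
      \<and> (\<forall>f\<in>carrier Mero. \<forall>x\<in>carrier A.
            h (lmom A f \<otimes>\<^bsub>A\<^esub> x) = lmom A f \<otimes>\<^bsub>A\<^esub> h x
          \<and> h (rmom A f \<otimes>\<^bsub>A\<^esub> x) = rmom A f \<otimes>\<^bsub>A\<^esub> h x)}"

text \<open>\<open>represents A Z n x y\<close>: \<open>Z = \<Sum>\<^sub>i x\<^sub>i \<otimes> y\<^sub>i\<close> with homogeneous composable terms. For
  \<open>z = \<Sum> f\<^sub>i(\<lambda>)g\<^sub>i(\<mu>)\<close> in the base, \<open>\<epsilon>(z)\<close> is multiplication by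
  \<open>\<Sum> f\<^sub>i g\<^sub>i\<close>, the restriction of \<open>z\<close> to the diagonal; it is recovered by applying
  \<open>\<epsilon>(z)\<close> to 1.\<close>

definition represents ::
    "('b, 'm) halgebra_scheme \<Rightarrow> ('b \<times> 'b \<Rightarrow>\<^sub>0 complex) set
      \<Rightarrow> nat \<Rightarrow> (nat \<Rightarrow> 'b) \<Rightarrow> (nat \<Rightarrow> 'b) \<Rightarrow> bool" where
  "represents A Z n x y \<longleftrightarrow>
     (\<forall>i<n. (x i, y i) \<in> composable A A)
   \<and> Z = (\<Oplus>\<^bsub>tensor_algebra A A\<^esub>i\<in>{..<n}. tens A A (x i) (y i))"

definition diag :: "('b \<Rightarrow> (complex \<Rightarrow> complex) \<Rightarrow> (complex \<Rightarrow> complex)) \<Rightarrow> 'b \<Rightarrow> complex \<Rightarrow> complex" where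
  "diag \<epsilon> z = \<epsilon> z \<one>\<^bsub>Mero\<^esub>"

definition left_integral ::
    "('b, 'm) halgebra_scheme \<Rightarrow> ('b \<Rightarrow> ('b \<times> 'b \<Rightarrow>\<^sub>0 complex) set)
      \<Rightarrow> ('b \<Rightarrow> (complex \<Rightarrow> complex) \<Rightarrow> (complex \<Rightarrow> complex)) \<Rightarrow> ('b \<Rightarrow> 'b) \<Rightarrow> bool" where
  "left_integral A \<Delta> \<epsilon> h \<longleftrightarrow>
     h \<in> prealgebra_hom_to_base A
   \<and> (\<forall>a\<in>carrier A. \<forall>n x y. represents A (\<Delta> a) n x y \<longrightarrow>
        h a = (\<Oplus>\<^bsub>A\<^esub>i\<in>{..<n}. rmom A (diag \<epsilon> (h (y i))) \<otimes>\<^bsub>A\<^esub> x i))"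

definition right_integral ::
    "('b, 'm) halgebra_scheme \<Rightarrow> ('b \<Rightarrow> ('b \<times> 'b \<Rightarrow>\<^sub>0 complex) set)
      \<Rightarrow> ('b \<Rightarrow> (complex \<Rightarrow> complex) \<Rightarrow> (complex \<Rightarrow> complex)) \<Rightarrow> ('b \<Rightarrow> 'b) \<Rightarrow> bool" where
  "right_integral A \<Delta> \<epsilon> h \<longleftrightarrow>
     h \<in> prealgebra_hom_to_base A
   \<and> (\<forall>a\<in>carrier A. \<forall>n x y. represents A (\<Delta> a) n x y \<longrightarrow>
        h a = (\<Oplus>\<^bsub>A\<^esub>i\<in>{..<n}. lmom A (diag \<epsilon> (h (x i))) \<otimes>\<^bsub>A\<^esub> y i))"

definition is_haar :: "real \<Rightarrow> (sl2 \<Rightarrow> sl2) \<Rightarrow> bool" where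
  "is_haar q h \<longleftrightarrow>
     h \<in> clinear_to_base (SL2 q)
   \<and> (\<forall>f\<in>carrier Mero. \<forall>g\<in>carrier Mero. \<forall>N. \<forall>k\<le>N. \<forall>j\<le>N.
        h (lmom (SL2 q) f \<otimes>\<^bsub>SL2 q\<^esub> rmom (SL2 q) g \<otimes>\<^bsub>SL2 q\<^esub> matel q N k j) =
          (if N = 0 then lmom (SL2 q) f \<otimes>\<^bsub>SL2 q\<^esub> rmom (SL2 q) g else \<zero>\<^bsub>SL2 q\<^esub>))"

definition haar :: "real \<Rightarrow> sl2 \<Rightarrow> sl2" where
  "haar q = (THE h. is_haar q h)"

end

theory Submission
  imports Defs "HOL-Computational_Algebra.Polynomial"
begin

text \<open>Dynamical \<open>q\<close>-integers \<open>[x] = q^x - q^(-x)\<close> turn \<open>q F\<close> into \<open>\<phi>(\<lambda>) = [\<lambda> + 2] / [\<lambda> + 1]\<close>, and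
  all relations can be written with \<open>\<phi>\<close> alone. Multiplying \<open>\<Delta>(\<gamma>^(n-k) \<alpha>^k)\<close> by
  \<open>\<Delta>(\<gamma>)\<close> or \<open>\<Delta>(\<alpha>)\<close> gives explicit recursions for the matrix elements \<open>t^n_kj\<close>, from which
  \<open>\<Delta>(t_kj) = \<Sum>\<^sub>i t_ki \<otimes> t_ij\<close> follows by induction, and which can be solved for the products of
  generators with \<open>t^n_kj\<close>; hence the \<open>f(\<lambda>)g(\<mu>)t^n_kj\<close> span the algebra. For the Haar functional
  to be well defined, the component at \<open>t^0_00\<close> of a vanishing combination must vanish. Only
  bidegree \<open>(0, 0)\<close> matters, and there a family of representations by difference operators with a
  parameter \<open>\<zeta>\<close> sends \<open>t^(2m)_mm\<close> to a polynomial of degree \<open>m\<close> in \<open>\<zeta>\<close>, which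
  separates the different \<open>m\<close>.

  Both invariance properties are read off from the formula for \<open>\<Delta>(t_kj)\<close>: the restriction of the
  Haar functional to the diagonal kills every \<open>t^n_ij\<close> with \<open>n > 0\<close>. Conversely, an integral \<open>h\<close> has
  \<open>h(t_kj)\<close> in the base, so it is fixed by the Haar functional, while invariance writes it as a
  combination of the \<open>t_ki\<close> (or the \<open>t_ij\<close>), which the Haar functional kills for \<open>n > 0\<close>.\<close>

text \<open>The size of a quotient by generators and relations is not known in advance, and
  \<open>coprod\<close>, \<open>counit\<close>, \<open>matel\<close> and \<open>haar\<close> are
  definite descriptions. Every algebra homomorphism out of the algebra therefore comes from one
  universal property, and the locale \<open>sl2_data\<close> collects what a target must satisfy; it
  is instantiated for the algebra itself, its tensor square, the difference operators
  \<open>Dh\<close> and the model \<open>Endo\<close>. Full linear independence is avoided. The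
  model sends f(\<lambda>)g(\<mu>) to f(\<lambda>)g(\<lambda> + s) for each shift s; when these sums
  vanish for all s, separation of variables gives \<Sum> f(\<lambda>)g(\<mu>) = 0 inside the
  algebra, whatever the moment maps identify. The parameter \<zeta> cannot be dispensed with: for a
  single \<zeta> and s every element of bidegree (0, 0) acts as multiplication by one function, and
  the different levels m could not be told apart.\<close>

section \<open>The field of meromorphic functions\<close>

text \<open>A type, rather than the carrier of \<open>Mero\<close>, so that the class
  \<open>field\<close> applies and quotients can be simplified freely; \<open>mval\<close> leads
  back to \<open>Mero\<close>.\<close>

typedef mero = "{f. f nicely_meromorphic_on UNIV}" morphisms mval mero_of
  by (rule exI[of _ "\<lambda>_. 0"]) auto

setup_lifting type_definition_mero

lemma mval_nicely: "mval f nicely_meromorphic_on UNIV"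
  using mval[of f] by simp

lemma mval_meromorphic: "mval f meromorphic_on A"
  using mval_nicely[of f] meromorphic_on_subset unfolding nicely_meromorphic_on_def by blast

lemma remove_sings_nicely_meromorphic_id:
  assumes "f nicely_meromorphic_on UNIV"
  shows "remove_sings f = f"
proof
  fix z
  have "(is_pole f z \<and> f z = 0) \<or> f \<midarrow>z\<rightarrow> f z"
    using assms by (auto simp: nicely_meromorphic_on_def)
  then show "remove_sings f z = f z" by (auto intro: remove_sings_eqI)
qed

lemma eventually_cosparse_UNIV_iff:
  "eventually P (cosparse UNIV) \<longleftrightarrow> (\<forall>z::complex. eventually P (at z))"
  by (simp add: eventually_cosparse_open_eq)

text \<open>\<open>remove_sings\<close> depends only on germs on punctured neighbourhoods, so
  exceptions on a discrete set are invisible to it.\<close>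

lemma remove_sings_eq_of_ae:
  assumes "f nicely_meromorphic_on UNIV" "\<forall>\<^sub>\<approx>z\<in>UNIV. h z = f z"
  shows "remove_sings h = f"
proof -
  have "remove_sings h z = remove_sings f z" for z
    by (rule remove_sings_cong) (use assms(2) in \<open>auto simp: eventually_cosparse_UNIV_iff\<close>)
  then show ?thesis using remove_sings_nicely_meromorphic_id[OF assms(1)] by auto
qed

text \<open>A discrete set of exceptional points is harmless; the field axioms below therefore
  reduce to pointwise identities off such a set.\<close>

lemma mero_eqI:
  assumes "\<forall>\<^sub>\<approx>z\<in>UNIV. mval f z = mval g z"
  shows "f = g"
  using remove_sings_eq_of_ae[OF mval_nicely assms] remove_sings_nicely_meromorphic_id[OF mval_nicely[of f]]
  by (simp add: mval_inject)

lemma remove_sings_eq_mval: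
  assumes "\<forall>\<^sub>\<approx>z\<in>UNIV. mval f z = h z"
  shows "remove_sings h = mval f"
  by (rule remove_sings_eq_of_ae[OF mval_nicely]) (use assms in \<open>auto elim!: eventually_mono\<close>)

instantiation mero :: field
begin

lift_definition zero_mero :: mero is "\<lambda>_. 0" by auto
lift_definition one_mero :: mero is "\<lambda>_. 1" by auto
lift_definition uminus_mero :: "mero \<Rightarrow> mero" is "\<lambda>f z. - f z" by auto
text \<open>Unlike for sums and products no singularity has to be removed: zeros and poles change
  places, and both carry the value 0.\<close>

lift_definition inverse_mero :: "mero \<Rightarrow> mero" is "\<lambda>f z. inverse (f z)"
  by (auto intro: nicely_meromorphic_on_inverse)
lift_definition plus_mero :: "mero \<Rightarrow> mero \<Rightarrow> mero" is "\<lambda>f g. remove_sings (\<lambda>z. f z + g z)"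
  by (intro remove_sings_nicely_meromorphic meromorphic_intros) (auto simp: nicely_meromorphic_on_def)
lift_definition times_mero :: "mero \<Rightarrow> mero \<Rightarrow> mero" is "\<lambda>f g. remove_sings (\<lambda>z. f z * g z)"
  by (intro remove_sings_nicely_meromorphic meromorphic_intros) (auto simp: nicely_meromorphic_on_def)
definition minus_mero :: "mero \<Rightarrow> mero \<Rightarrow> mero" where "minus_mero f g = f + (- g)"
definition divide_mero :: "mero \<Rightarrow> mero \<Rightarrow> mero" where "divide_mero f g = f * inverse g"

lemma mval_plus_ae: "\<forall>\<^sub>\<approx>z\<in>UNIV. mval (f + g) z = mval f z + mval g z"
  unfolding plus_mero.rep_eq
  by (intro eventually_remove_sings_eq meromorphic_intros mval_meromorphic)

lemma mval_times_ae: "\<forall>\<^sub>\<approx>z\<in>UNIV. mval (f * g) z = mval f z * mval g z"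
  unfolding times_mero.rep_eq
  by (intro eventually_remove_sings_eq meromorphic_intros mval_meromorphic)

text \<open>The identity theorem: zeros, and poles with their conventional value 0, are isolated
  unless the function is 0 everywhere.\<close>

lemma mval_nonzero_ae:
  assumes "f \<noteq> 0"
  shows "\<forall>\<^sub>\<approx>z\<in>UNIV. mval f z \<noteq> 0"
proof -
  have "(\<forall>z\<in>UNIV. mval f z = 0) \<or> (\<forall>\<^sub>\<approx>z\<in>UNIV. mval f z \<noteq> 0)"
    by (rule nicely_meromorphic_imp_constant_or_avoid) (auto intro: mval_nicely)
  moreover have "\<not> (\<forall>z\<in>UNIV. mval f z = 0)"
    using assms by (auto simp: mval_inject[symmetric] zero_mero.rep_eq fun_eq_iff)
  ultimately show ?thesis by blast
qed

instance
proof
  fix f g h :: mero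
  show "f * g * h = f * (g * h)"
    by (rule mero_eqI, use mval_times_ae[of "f * g" h] mval_times_ae[of f g] mval_times_ae[of g h]
      mval_times_ae[of f "g * h"] in eventually_elim) (simp add: mult.assoc)
  show "f * g = g * f"
    by (rule mero_eqI, use mval_times_ae[of f g] mval_times_ae[of g f] in eventually_elim) (simp add: mult.commute)
  show "1 * f = f"
    by (rule mero_eqI, use mval_times_ae[of 1 f] in eventually_elim) (simp add: one_mero.rep_eq)
  show "f + g + h = f + (g + h)"
    by (rule mero_eqI, use mval_plus_ae[of "f + g" h] mval_plus_ae[of f g] mval_plus_ae[of g h]
      mval_plus_ae[of f "g + h"] in eventually_elim) simp
  show "f + g = g + f"
    by (rule mero_eqI, use mval_plus_ae[of f g] mval_plus_ae[of g f] in eventually_elim) simp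
  show "0 + f = f"
    by (rule mero_eqI, use mval_plus_ae[of 0 f] in eventually_elim) (simp add: zero_mero.rep_eq)
  show "- f + f = 0"
    by (rule mero_eqI, use mval_plus_ae[of "-f" f] in eventually_elim) (simp add: zero_mero.rep_eq uminus_mero.rep_eq)
  show "f - g = f + - g" by (simp add: minus_mero_def)
  show "(f + g) * h = f * h + g * h"
    by (rule mero_eqI, use mval_times_ae[of "f + g" h] mval_plus_ae[of f g] mval_times_ae[of f h]
      mval_times_ae[of g h] mval_plus_ae[of "f * h" "g * h"] in eventually_elim) (simp add: algebra_simps)
  show "(0::mero) \<noteq> 1"
    by (auto simp: mval_inject[symmetric] zero_mero.rep_eq one_mero.rep_eq fun_eq_iff)
  show "f div g = f * inverse g" by (simp add: divide_mero_def)
  show "inverse (0::mero) = 0"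
    by (auto simp: mval_inject[symmetric] zero_mero.rep_eq inverse_mero.rep_eq)
  assume "f \<noteq> 0"
  show "inverse f * f = 1"
    by (rule mero_eqI, use mval_times_ae[of "inverse f" f] mval_nonzero_ae[OF \<open>f \<noteq> 0\<close>] in eventually_elim)
      (simp add: inverse_mero.rep_eq one_mero.rep_eq)
qed

end

lift_definition mconst :: "complex \<Rightarrow> mero" is "\<lambda>c _. c" by auto

lemma nicely_meromorphic_shift:
  assumes "f nicely_meromorphic_on UNIV"
  shows "shift a f nicely_meromorphic_on UNIV"
proof -
  have "(\<lambda>z. f (z + a)) meromorphic_on UNIV"
    by (rule meromorphic_on_compose[of f UNIV]) 
      (use assms in \<open>auto simp: nicely_meromorphic_on_def intro!: analytic_intros\<close>)
  moreover have "(is_pole (\<lambda>z. f (z + a)) z \<and> f (z + a) = 0) \<or> (\<lambda>z. f (z + a)) \<midarrow>z\<rightarrow> f (z + a)" for z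
  proof -
    have eq: "filtermap (\<lambda>z. z + a) (at z) = at (z + a)"
      using filtermap_at_shift[of "-a" z] by simp
    have "(is_pole f (z + a) \<and> f (z + a) = 0) \<or> f \<midarrow>(z + a)\<rightarrow> f (z + a)"
      using assms by (auto simp: nicely_meromorphic_on_def)
    then show ?thesis
      unfolding is_pole_def eq[symmetric] filterlim_filtermap by simp
  qed
  ultimately show ?thesis unfolding shift_def nicely_meromorphic_on_def by auto
qed

lift_definition mshift :: "complex \<Rightarrow> mero \<Rightarrow> mero" is shift
  by (auto intro: nicely_meromorphic_shift)

lemma ae_shift:
  assumes "\<forall>\<^sub>\<approx>z\<in>UNIV. P z"
  shows "\<forall>\<^sub>\<approx>z\<in>UNIV. P (z + (a::complex))"
  unfolding eventually_cosparse_UNIV_iff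
proof
  fix z
  have eq: "filtermap (\<lambda>z. z + a) (at z) = at (z + a)"
    using filtermap_at_shift[of "-a" z] by simp
  have "eventually P (filtermap (\<lambda>z. z + a) (at z))"
    using assms unfolding eq eventually_cosparse_UNIV_iff by blast
  then show "eventually (\<lambda>z. P (z + a)) (at z)" by (simp add: eventually_filtermap)
qed

lemma mshift_plus [simp]: "mshift a (f + g) = mshift a f + mshift a g"
  by (rule mero_eqI, use ae_shift[OF mval_plus_ae[of f g], of a] mval_plus_ae[of "mshift a f" "mshift a g"]
    in eventually_elim) (simp add: mshift.rep_eq shift_def)

lemma mshift_times [simp]: "mshift a (f * g) = mshift a f * mshift a g"
  by (rule mero_eqI, use ae_shift[OF mval_times_ae[of f g], of a] mval_times_ae[of "mshift a f" "mshift a g"]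
    in eventually_elim) (simp add: mshift.rep_eq shift_def)

lemma mshift_const [simp]: "mshift a (mconst c) = mconst c"
  by transfer (simp add: shift_def)

lemma mconst_0 [simp]: "mconst 0 = 0" by transfer simp
lemma mconst_1 [simp]: "mconst 1 = 1" by transfer simp
lemma mconst_inject [simp]: "mconst c = mconst d \<longleftrightarrow> c = d" by transfer (auto dest: fun_cong)
lemma mconst_eq_0_iff [simp]: "mconst c = 0 \<longleftrightarrow> c = 0"
  using mconst_inject[of c 0] by (simp del: mconst_inject)

lemma mshift_0 [simp]: "mshift a 0 = 0" and mshift_1 [simp]: "mshift a 1 = 1"
  using mshift_const[of a 0] mshift_const[of a 1] by simp_all

lemma mconst_add: "mconst (c + d) = mconst c + mconst d"
  by (rule mero_eqI, use mval_plus_ae[of "mconst c" "mconst d"] in eventually_elim) (simp add: mconst.rep_eq)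
lemma mconst_mult: "mconst (c * d) = mconst c * mconst d"
  by (rule mero_eqI, use mval_times_ae[of "mconst c" "mconst d"] in eventually_elim) (simp add: mconst.rep_eq)
lemma mconst_uminus: "mconst (- c) = - mconst c"
  by transfer simp
lemma mconst_diff: "mconst (c - d) = mconst c - mconst d"
  using mconst_add[of c "-d"] by (simp add: mconst_uminus)
lemma mconst_inverse: "mconst (inverse c) = inverse (mconst c)"
  by transfer simp
lemma mconst_divide: "mconst (c / d) = mconst c / mconst d"
  by (simp add: divide_inverse mconst_mult mconst_inverse)

lemma mshift_uminus [simp]: "mshift a (- f) = - mshift a f"
  by transfer (simp add: shift_def)
lemma mshift_minus [simp]: "mshift a (f - g) = mshift a f - mshift a g"
  using mshift_plus[of a f "-g"] by simp
lemma mshift_inverse [simp]: "mshift a (inverse f) = inverse (mshift a f)"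
  by transfer (simp add: shift_def)
lemma mshift_divide [simp]: "mshift a (f / g) = mshift a f / mshift a g"
  by (simp add: divide_inverse)
lemma mshift_mshift [simp]: "mshift a (mshift b f) = mshift (a + b) f"
  by transfer (simp add: shift_def add_ac)
lemma mshift_zero [simp]: "mshift 0 f = f"
  by transfer (simp add: shift_def)
lemma mshift_eq_0_iff [simp]: "mshift a f = 0 \<longleftrightarrow> f = 0"
  by (metis mshift_0 mshift_mshift mshift_zero add.right_inverse)
lemma carrier_Mero: "carrier Mero = range mval"
  by (auto simp: Mero_def mval_nicely) (metis mem_Collect_eq mval_cases rangeI)

lemma mval_in_carrier [simp, intro]: "mval f \<in> carrier Mero"
  by (simp add: carrier_Mero)

lemma Mero_add [simp]: "mval f \<oplus>\<^bsub>Mero\<^esub> mval g = mval (f + g)"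
  by (simp add: Mero_def plus_mero.rep_eq)
lemma Mero_mult [simp]: "mval f \<otimes>\<^bsub>Mero\<^esub> mval g = mval (f * g)"
  by (simp add: Mero_def times_mero.rep_eq)
lemma Mero_one: "\<one>\<^bsub>Mero\<^esub> = mval 1"
  by (simp add: Mero_def one_mero.rep_eq)
lemma Mero_zero: "\<zero>\<^bsub>Mero\<^esub> = mval 0"
  by (simp add: Mero_def zero_mero.rep_eq)
text \<open>An equality at every point, because a constant factor preserves limits and the value 0
  at poles; it matches the pointwise \<open>smult\<close> of \<open>Mero\<close>.\<close>

lemma mval_const_mult: "mval (mconst c * f) = (\<lambda>z. c * mval f z)"
  unfolding times_mero.rep_eq mconst.rep_eq
  by (rule remove_sings_nicely_meromorphic_id) (auto intro: mval_nicely)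
lemma Mero_smult [simp]: "c \<odot>\<^bsub>Mero\<^esub> mval f = mval (mconst c * f)"
  by (simp add: Mero_def mval_const_mult)
lemma shift_mval [simp]: "shift a (mval f) = mval (mshift a f)"
  by (simp add: mshift.rep_eq)

section \<open>Separation of variables\<close>

lemma mval_sum_ae: "finite I \<Longrightarrow> \<forall>\<^sub>\<approx>z\<in>UNIV. mval (\<Sum>i\<in>I. f i) z = (\<Sum>i\<in>I. mval (f i) z)"
proof (induction I rule: finite_induct)
  case empty
  then show ?case by (simp add: zero_mero.rep_eq)
next
  case (insert i I)
  show ?case
    using insert.IH mval_plus_ae[of "f i" "sum f I"]
    by eventually_elim (simp add: insert.hyps)
qed

lemma mval_isCont_ae: "\<forall>\<^sub>\<approx>z\<in>UNIV. isCont (mval f) z"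
  using meromorphic_on_imp_analytic_cosparse[OF mval_meromorphic]
  by (rule eventually_mono) (rule analytic_at_imp_isCont)

lemma ae_ex: "(\<forall>\<^sub>\<approx>z\<in>UNIV. P z) \<Longrightarrow> \<exists>z::complex. P z"
  using eventually_happens[of P "cosparse UNIV"] by auto

text \<open>Sums of \<^typ>\<open>mero\<close> agree with pointwise sums only off a discrete set, which here depends
  on \<open>s\<close>; continuity at the points in question removes the exception.\<close>

lemma two_variable_sum_at_point:
  assumes fin: "finite I" and zero: "(\<Sum>i\<in>I. f i * mshift s (g i)) = 0"
    and f: "\<And>i. i \<in> I \<Longrightarrow> isCont (mval (f i)) z"
    and g: "\<And>i. i \<in> I \<Longrightarrow> isCont (mval (g i)) (z + s)"
  shows "(\<Sum>i\<in>I. mval (f i) z * mval (g i) (z + s)) = 0"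
proof -
  have "\<forall>\<^sub>\<approx>w\<in>UNIV. \<forall>i\<in>I. mval (f i * mshift s (g i)) w = mval (f i) w * mval (mshift s (g i)) w"
    using fin by (auto simp: eventually_ball_finite_distrib intro: mval_times_ae)
  then have "\<forall>\<^sub>\<approx>w\<in>UNIV. (\<Sum>i\<in>I. mval (f i) w * mval (g i) (w + s)) = 0"
    using mval_sum_ae[OF fin, of "\<lambda>i. f i * mshift s (g i)"] unfolding zero
    by eventually_elim (simp add: zero_mero.rep_eq mshift.rep_eq shift_def)
  then have "\<forall>\<^sub>F w in at z. (\<Sum>i\<in>I. mval (f i) w * mval (g i) (w + s)) = 0"
    by (simp add: eventually_cosparse_UNIV_iff)
  then have "(\<lambda>w. \<Sum>i\<in>I. mval (f i) w * mval (g i) (w + s)) \<midarrow>z\<rightarrow> 0"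
    by (rule tendsto_eventually)
  moreover have "isCont (\<lambda>w. \<Sum>i\<in>I. mval (f i) w * mval (g i) (w + s)) z"
    by (intro continuous_intros f isCont_o2[where f = "\<lambda>w. w + s"] g) auto
  then have "(\<lambda>w. \<Sum>i\<in>I. mval (f i) w * mval (g i) (w + s)) \<midarrow>z\<rightarrow> (\<Sum>i\<in>I. mval (f i) z * mval (g i) (z + s))"
    by (rule isContD)
  ultimately show ?thesis using LIM_unique by blast
qed

text \<open>With z fixed, s = w - z moves the second argument over all points w. The identities
  along all lines \<mu> = \<lambda> + s thus combine into one identity in w whose coefficients are
  the constants f(z).\<close>

lemma separate_variables:
  assumes fin: "finite I" and zero: "\<And>s. (\<Sum>i\<in>I. f i * mshift s (g i)) = 0"
    and f: "\<And>i. i \<in> I \<Longrightarrow> isCont (mval (f i)) z"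
  shows "(\<Sum>i\<in>I. mconst (mval (f i) z) * g i) = 0"
proof (rule mero_eqI)
  have g: "\<forall>\<^sub>\<approx>w\<in>UNIV. \<forall>i\<in>I. isCont (mval (g i)) w"
    using fin by (auto simp: eventually_ball_finite_distrib intro: mval_isCont_ae)
  show "\<forall>\<^sub>\<approx>w\<in>UNIV. mval (\<Sum>i\<in>I. mconst (mval (f i) z) * g i) w = mval 0 w"
    using g mval_sum_ae[OF fin, of "\<lambda>i. mconst (mval (f i) z) * g i"]
  proof eventually_elim
    case (elim w)
    have "(\<Sum>i\<in>I. mval (f i) z * mval (g i) (z + (w - z))) = 0"
      by (rule two_variable_sum_at_point[OF fin zero f]) (use elim in auto)
    then show ?case using elim by (simp add: mval_const_mult zero_mero.rep_eq)
  qed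
qed

section \<open>Powers of q and dynamical q-integers\<close>

lemma qpow_add: "qpow q (a + b) = qpow q a * qpow q b"
  by (simp add: qpow_def exp_add ring_distribs)
lemma qpow_0 [simp]: "qpow q 0 = 1"
  by (simp add: qpow_def)
lemma qpow_nonzero [simp]: "qpow q a \<noteq> 0"
  by (simp add: qpow_def)
lemma qpow_minus: "qpow q (- a) = inverse (qpow q a)"
  by (simp add: qpow_def exp_minus)

locale q_param =
  fixes q :: real
  assumes q_pos: "0 < q" and q_less_1: "q < 1"
begin

lemma qpow_1 [simp]: "qpow q 1 = of_real q"
  using q_pos by (simp add: qpow_def exp_of_real)

lemma qpow_of_nat: "qpow q (of_nat n) = of_real q ^ n"
  by (induction n) (simp_all add: qpow_add)

lemma q_square_neq_1:
  assumes "n > 0" shows "(of_real q :: complex) ^ n \<noteq> 1"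
proof -
  have "q ^ n < 1" using q_pos q_less_1 assms by (simp add: power_less_one_iff)
  then have "(of_real (q ^ n) :: complex) \<noteq> of_real 1" unfolding of_real_eq_iff by simp
  then show ?thesis by simp
qed

text \<open>\<open>br c\<close> is [z + c] as a function of z, without the usual normalising
  denominator q - 1/q; \<open>qn n\<close> is the constant [n].\<close>

definition br :: "complex \<Rightarrow> mero" where
  "br c = mero_of (\<lambda>z. qpow q (z + c) - qpow q (- (z + c)))"
definition qz :: mero where "qz = mero_of (qpow q)"
definition qn :: "int \<Rightarrow> mero" where
  "qn n = mconst (qpow q (of_int n) - qpow q (- of_int n))"
text \<open>The even companion q^x + q^(-x) of the bracket: a product [n][x] is a difference of two
  of its values.\<close>

definition brc :: "complex \<Rightarrow> mero" where
  "brc c = mconst (qpow q c) * qz + mconst (qpow q (- c)) * inverse qz"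

lemma mval_mero_of_analytic: "f analytic_on UNIV \<Longrightarrow> mval (mero_of f) = f"
  by (rule mero_of_inverse) (simp add: analytic_on_imp_nicely_meromorphic_on)

lemma mval_qz: "mval qz = qpow q"
  unfolding qz_def qpow_def by (rule mval_mero_of_analytic) (intro analytic_intros)
lemma mval_br: "mval (br c) = (\<lambda>z. qpow q (z + c) - qpow q (- (z + c)))"
  unfolding br_def qpow_def by (rule mval_mero_of_analytic) (intro analytic_intros)

lemma br_altdef: "br c = mconst (qpow q c) * qz - mconst (qpow q (- c)) * inverse qz"
proof (rule mero_eqI)
  have *: "qpow q (- (z + c)) = qpow q (- c) * inverse (qpow q z)" for z
    unfolding qpow_minus qpow_add by simp
  show "\<forall>\<^sub>\<approx>z\<in>UNIV. mval (br c) z = mval (mconst (qpow q c) * qz - mconst (qpow q (- c)) * inverse qz) z"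
    using mval_plus_ae[of "mconst (qpow q c) * qz" "- (mconst (qpow q (- c)) * inverse qz)"]
  proof eventually_elim
    case (elim z)
    then show ?case
      unfolding mval_br * qpow_add
      by (simp add: uminus_mero.rep_eq mval_const_mult inverse_mero.rep_eq mval_qz)
  qed
qed

lemma qz_nonzero [simp]: "qz \<noteq> 0"
  by (auto simp: mval_inject[symmetric] zero_mero.rep_eq mval_qz fun_eq_iff)

text \<open>q is not a root of unity; this is what allows the multiplication formulas for matrix
  elements to be divided by [n].\<close>

lemma qn_nonzero: "n \<noteq> 0 \<Longrightarrow> qn n \<noteq> 0"
proof -
  have *: "qn (int m) \<noteq> 0" if "m > 0" for m
  proof
    assume "qn (int m) = 0"
    then have "(of_real q :: complex) ^ m * of_real q ^ m = 1"
      using q_pos by (simp add: qn_def qpow_of_nat qpow_minus field_simps)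
    then show False using q_square_neq_1[of "m + m"] that by (simp add: power_add)
  qed
  have "qn (- k) = - qn k" for k by (simp add: qn_def flip: mconst_uminus)
  then show "n \<noteq> 0 \<Longrightarrow> qn n \<noteq> 0"
    using *[of "nat n"] *[of "nat (- n)"] by (cases "n > 0") auto
qed

lemma br_nonzero [simp]: "br c \<noteq> 0"
proof
  assume "br c = 0"
  then have "mval (br c) (1 - c) = 0" by (simp add: zero_mero.rep_eq)
  then have "qpow q 1 - qpow q (- 1) = 0" by (simp add: mval_br)
  moreover have "qn 1 \<noteq> 0" by (rule qn_nonzero) simp
  ultimately show False by (simp add: qn_def)
qed

lemma mshift_br [simp]: "mshift a (br c) = br (c + a)"
  by (simp add: mval_inject[symmetric] mshift.rep_eq shift_def mval_br algebra_simps)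
lemma mshift_qn [simp]: "mshift a (qn n) = qn n"
  by (simp add: qn_def)

lemma qpow_diff: "qpow q (a - b) = qpow q a * inverse (qpow q b)"
  using qpow_add[of q a "- b"] by (simp add: qpow_minus)

lemma qn_times_br: "qn n * br c = brc (c + of_int n) - brc (c - of_int n)"
proof -
  have "qpow q (- (c - of_int n)) = inverse (qpow q c) * qpow q (of_int n)"
    unfolding qpow_minus qpow_diff by simp
  then show ?thesis
    unfolding qn_def br_altdef brc_def qpow_diff qpow_add qpow_minus
    by (simp add: mconst_diff mconst_mult algebra_simps)
qed

text \<open>After splitting every product by \<open>qn_times_br\<close> the left-hand side
  telescopes.\<close>

lemma qn_br_identity:
  "qn n * br 0 - qn j * br (of_int (n - j)) + qn (j + 1) * br (of_int (n - j + 1)) = qn (n + 1) * br 1"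
  unfolding qn_times_br by (simp add: algebra_simps)

text \<open>It turns the leading coefficient in \<open>em_step\<close> into an explicit nonzero
  function.\<close>

lemma qn_br_identity2:
  "qn (m + j) * br 1 - qn j * br (of_int m + 1) = qn m * br (1 - of_int j)"
  unfolding qn_times_br by (simp add: algebra_simps)

lemma qn_0 [simp]: "qn 0 = 0" by (simp add: qn_def)

definition kappa :: mero where "kappa = mconst (of_real (q + 1 / q))"

lemma br_recurrence: "br (c + 1) + br (c - 1) = kappa * br c"
proof -
  have i: "inverse (of_real q * x) = of_real (1/q) * inverse x"
    "inverse (x * inverse (of_real q)) = inverse x * of_real q"
    "inverse (of_real q) = (of_real (1/q) :: complex)"
      "inverse (x * of_real (1/q)) = inverse x * of_real q" for x :: complex
    by (simp_all add: divide_inverse)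
  show ?thesis
    unfolding kappa_def br_altdef qpow_diff qpow_add qpow_minus qpow_1 of_real_add
      mult.commute[of "qpow q c" "of_real q"] i mconst_add mconst_mult
    by (simp only: algebra_simps)
qed

definition phi :: mero where "phi = br 2 / br 1"

lemma phi_nonzero [simp]: "phi \<noteq> 0"
  by (simp add: phi_def)

text \<open>The ratio of consecutive values of a solution of a second-order recurrence solves the
  associated Riccati equation. Consequently \<open>kappa - phi\<close> inverts the shifted
  \<open>phi\<close>.\<close>

lemma phi_riccati: "phi + inverse (mshift (-1) phi) = kappa"
  using br_recurrence[of 1] by (simp add: phi_def field_simps)

lemma mshift_phi: "mshift (-1) phi * (kappa - phi) = 1"
  unfolding phi_riccati[symmetric] by simp

text \<open>Field versions of \<open>Ufun\<close>, \<open>Vfun\<close>, \<open>Ffun\<close> and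
  \<open>Gfun\<close>. Once \<open>mval_Uf\<close>, \<open>mval_Vf\<close>, \<open>mval_Ff\<close>
  and \<open>mval_Gf\<close> identify them, only field arithmetic remains.\<close>

definition Uf :: mero where "Uf = mconst (of_real q ^ 2) * qz ^ 2"
definition Vf :: mero where "Vf = inverse (Uf - 1)"
definition Ff :: mero where "Ff = (Uf - inverse (mconst (of_real q ^ 2))) / (Uf - 1)"
definition Gf :: mero where
  "Gf = (Uf - mconst (of_real q ^ 2)) * (Uf - inverse (mconst (of_real q ^ 2))) / (Uf - 1) ^ 2"

text \<open>A name for the constant q, so that \<open>field_simps\<close> meets one atom instead of
  nested \<open>mconst\<close> terms.\<close>

definition cq :: mero where "cq = mconst (of_real q)"

lemma cq_nonzero [simp]: "cq \<noteq> 0" using q_pos by (simp add: cq_def)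

lemma cq_simps:
  "mconst (of_real q) = cq" "mconst (of_real q ^ 2) = cq * cq"
  "mconst (of_real (q - 1 / q)) = cq - inverse cq" "kappa = cq + inverse cq"
  by (simp_all add: cq_def kappa_def power2_eq_square mconst_mult mconst_diff mconst_add
      mconst_divide inverse_eq_divide)

lemma qpow_2: "qpow q 2 = of_real q ^ 2" "qpow q (-2) = inverse (of_real q ^ 2)"
  using qpow_of_nat[of 2] qpow_minus[of q 2] by auto

lemma br_1: "br 1 = cq * qz - inverse cq * inverse qz"
  unfolding br_altdef qpow_minus mconst_inverse by (simp add: cq_def)

lemma br_2: "br 2 = (cq * cq) * qz - inverse (cq * cq) * inverse qz"
  unfolding br_altdef qpow_minus qpow_2 mconst_inverse cq_simps ..

lemma Uf_minus_1: "Uf - 1 = cq * qz * br 1"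
  unfolding Uf_def cq_simps br_1 by (simp add: power2_eq_square field_simps)

lemma Uf_neq_1: "Uf - 1 \<noteq> 0"
  by (simp add: Uf_minus_1)

lemma phi_Ff: "phi = mconst (of_real q) * Ff"
proof -
  have "br 2 * (Uf - 1) = cq * (Uf - inverse (cq * cq)) * br 1"
    unfolding Uf_def cq_simps br_1 br_2 by (simp add: power2_eq_square field_simps)
  then show ?thesis
    unfolding Ff_def phi_def cq_simps using Uf_neq_1 br_nonzero[of 1]
    by (simp add: nonzero_divide_eq_eq nonzero_eq_divide_eq mult.commute)
qed

text \<open>Partial fractions. Since \<open>phi\<close> is affine in \<open>Vf\<close>, it absorbs
  the denominators of H and I, which become affine in \<open>phi\<close>.\<close>

lemma phi_Vf: "phi = mconst (of_real q) + mconst (of_real (q - 1 / q)) * Vf"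
proof -
  have "x \<noteq> 0 \<Longrightarrow> cq * ((x + 1 - inverse (cq * cq)) / x) = cq + (cq - inverse cq) * inverse x" for x
    by (simp add: field_simps)
  from this[OF Uf_neq_1] show ?thesis unfolding phi_Ff Ff_def Vf_def cq_simps by simp
qed

lemma Uf_Vf: "Uf * Vf = 1 + Vf"
  using Uf_neq_1 by (simp add: Vf_def field_simps)

lemma kappa_minus_phi: "kappa - phi = inverse cq * ((Uf - cq * cq) / (Uf - 1))"
proof -
  have "x \<noteq> 0 \<Longrightarrow> cq + inverse cq - cq * ((x + 1 - inverse (cq * cq)) / x)
      = inverse cq * ((x + 1 - cq * cq) / x)" for x
    by (simp add: field_simps)
  from this[OF Uf_neq_1] show ?thesis unfolding phi_Ff Ff_def cq_simps by simp
qed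

text \<open>As \<open>kappa - phi\<close> is 1/\<phi>(x - 1), this is the quotient
  \<phi>(x)/\<phi>(x - 1) written without a shift.\<close>

lemma Gf_phi: "Gf = phi * (kappa - phi)"
  unfolding kappa_minus_phi unfolding phi_Ff Ff_def Gf_def cq_simps by (simp add: power2_eq_square)

lemma qpow_shift2: "qpow q (2 * (z + 1)) = of_real q ^ 2 * qpow q z ^ 2"
  unfolding mult_2 qpow_add qpow_1 by (simp add: power2_eq_square)

lemma mval_Uf: "mval Uf = Ufun q"
proof -
  have "qz ^ 2 = mero_of (\<lambda>z. qpow q z ^ 2)"
    by (rule mero_eqI, use mval_times_ae[of qz qz] in eventually_elim)
      (simp add: power2_eq_square mval_qz, subst mval_mero_of_analytic,
        auto simp: qpow_def intro!: analytic_intros)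
  moreover have "mval (mero_of (\<lambda>z. qpow q z ^ 2)) = (\<lambda>z. qpow q z ^ 2)"
    by (rule mval_mero_of_analytic) (auto simp: qpow_def intro!: analytic_intros)
  ultimately show ?thesis
    unfolding Uf_def mval_const_mult Ufun_def qpow_shift2 by simp
qed

lemma mval_minus_const_ae: "\<forall>\<^sub>\<approx>z\<in>UNIV. mval (f - mconst c) z = mval f z - c"
  using mval_plus_ae[of f "- mconst c"]
  by eventually_elim (simp add: uminus_mero.rep_eq mconst.rep_eq)

lemma mval_Vf: "mval Vf = Vfun q"
  unfolding Vfun_def
proof (rule remove_sings_eq_mval[symmetric])
  show "\<forall>\<^sub>\<approx>z\<in>UNIV. mval Vf z = 1 / (qpow q (2 * (z + 1)) - 1)"
    using mval_minus_const_ae[of Uf 1]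
    by eventually_elim (simp add: Vf_def inverse_mero.rep_eq mval_Uf Ufun_def divide_inverse)
qed

lemma mval_Ff: "mval Ff = Ffun q"
  unfolding Ffun_def
proof (rule remove_sings_eq_mval[symmetric])
  show "\<forall>\<^sub>\<approx>z\<in>UNIV. mval Ff z = (qpow q (2 * (z + 1)) - qpow q (-2)) / (qpow q (2 * (z + 1)) - 1)"
    using mval_minus_const_ae[of Uf 1] mval_minus_const_ae[of Uf "inverse (of_real q ^ 2)"]
      mval_times_ae[of "Uf - mconst (inverse (of_real q ^ 2))" "inverse (Uf - mconst 1)"]
    by eventually_elim
      (simp add: Ff_def divide_inverse inverse_mero.rep_eq mval_Uf Ufun_def qpow_2 mconst_inverse)
qed

lemma mval_Gf: "mval Gf = Gfun q"
  unfolding Gfun_def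
proof (rule remove_sings_eq_mval[symmetric])
  have eq: "Gf = ((Uf - mconst (of_real q ^ 2)) * (Uf - mconst (inverse (of_real q ^ 2))))
      * (inverse (Uf - mconst 1) * inverse (Uf - mconst 1))"
    by (simp add: Gf_def divide_inverse power2_eq_square flip: mconst_inverse)
  show "\<forall>\<^sub>\<approx>z\<in>UNIV. mval Gf z = (qpow q (2 * (z + 1)) - qpow q 2) * (qpow q (2 * (z + 1)) - qpow q (-2))
       / (qpow q (2 * (z + 1)) - 1) ^ 2"
    unfolding eq
    using mval_minus_const_ae[of Uf 1] mval_minus_const_ae[of Uf "inverse (of_real q ^ 2)"]
      mval_minus_const_ae[of Uf "of_real q ^ 2"]
      mval_times_ae[of "(Uf - mconst (of_real q ^ 2)) * (Uf - mconst (inverse (of_real q ^ 2)))"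
        "inverse (Uf - mconst 1) * inverse (Uf - mconst 1)"]
      mval_times_ae[of "Uf - mconst (of_real q ^ 2)" "Uf - mconst (inverse (of_real q ^ 2))"]
      mval_times_ae[of "inverse (Uf - mconst 1)" "inverse (Uf - mconst 1)"]
    by eventually_elim
      (simp add: divide_inverse inverse_mero.rep_eq mval_Uf Ufun_def qpow_2 power2_eq_square)
qed

end

section \<open>Complex algebras with an explicit carrier\<close>

locale calg = ring S for S (structure) +
  assumes smult_closed [simp, intro]: "x \<in> carrier S \<Longrightarrow> c \<odot>\<^bsub>S\<^esub> x \<in> carrier S"
    and smult_l_distr: "x \<in> carrier S \<Longrightarrow> (c + d) \<odot>\<^bsub>S\<^esub> x = c \<odot>\<^bsub>S\<^esub> x \<oplus>\<^bsub>S\<^esub> d \<odot>\<^bsub>S\<^esub> x"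
    and smult_r_distr: "\<lbrakk>x \<in> carrier S; y \<in> carrier S\<rbrakk>
      \<Longrightarrow> c \<odot>\<^bsub>S\<^esub> (x \<oplus>\<^bsub>S\<^esub> y) = c \<odot>\<^bsub>S\<^esub> x \<oplus>\<^bsub>S\<^esub> c \<odot>\<^bsub>S\<^esub> y"
    and smult_smult: "x \<in> carrier S \<Longrightarrow> c \<odot>\<^bsub>S\<^esub> (d \<odot>\<^bsub>S\<^esub> x) = (c * d) \<odot>\<^bsub>S\<^esub> x"
    and smult_one [simp]: "x \<in> carrier S \<Longrightarrow> (1::complex) \<odot>\<^bsub>S\<^esub> x = x"
    and smult_mult_left: "\<lbrakk>x \<in> carrier S; y \<in> carrier S\<rbrakk>
      \<Longrightarrow> (c \<odot>\<^bsub>S\<^esub> x) \<otimes>\<^bsub>S\<^esub> y = c \<odot>\<^bsub>S\<^esub> (x \<otimes>\<^bsub>S\<^esub> y)"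
    and smult_mult_right: "\<lbrakk>x \<in> carrier S; y \<in> carrier S\<rbrakk>
      \<Longrightarrow> x \<otimes>\<^bsub>S\<^esub> (c \<odot>\<^bsub>S\<^esub> y) = c \<odot>\<^bsub>S\<^esub> (x \<otimes>\<^bsub>S\<^esub> y)"
begin

lemma smult_zero_left [simp]: "x \<in> carrier S \<Longrightarrow> 0 \<odot>\<^bsub>S\<^esub> x = \<zero>"
  using smult_l_distr[of x 0 0] by (simp add: add.l_cancel_one)

lemma smult_zero_right [simp]: "c \<odot>\<^bsub>S\<^esub> \<zero> = \<zero>"
  using smult_smult[of \<zero> c 0] by simp

lemma smult_minus_one: "x \<in> carrier S \<Longrightarrow> (-1) \<odot>\<^bsub>S\<^esub> x = \<ominus> x"
  using smult_l_distr[of x "-1" 1] by (simp add: minus_equality)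

lemma smult_eq_mult: "x \<in> carrier S \<Longrightarrow> c \<odot>\<^bsub>S\<^esub> x = (c \<odot>\<^bsub>S\<^esub> \<one>) \<otimes> x"
  by (simp add: smult_mult_left)

lemma smult_finsum:
  "f \<in> I \<rightarrow> carrier S \<Longrightarrow> c \<odot>\<^bsub>S\<^esub> finsum S f I = (\<Oplus>i\<in>I. c \<odot>\<^bsub>S\<^esub> f i)"
proof (induction I rule: infinite_finite_induct)
  case (insert i I)
  then show ?case by (subst (1 2) finsum_insert) (auto simp: smult_r_distr Pi_iff)
qed (simp_all add: finsum_infinite)

end

lemma calgI:
  assumes "ring S"
    and "\<And>c x. x \<in> carrier S \<Longrightarrow> c \<odot>\<^bsub>S\<^esub> x \<in> carrier S"
    and "\<And>c d x. x \<in> carrier S \<Longrightarrow> (c + d) \<odot>\<^bsub>S\<^esub> x = c \<odot>\<^bsub>S\<^esub> x \<oplus>\<^bsub>S\<^esub> d \<odot>\<^bsub>S\<^esub> x"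
    and "\<And>c x y. \<lbrakk>x \<in> carrier S; y \<in> carrier S\<rbrakk>
      \<Longrightarrow> c \<odot>\<^bsub>S\<^esub> (x \<oplus>\<^bsub>S\<^esub> y) = c \<odot>\<^bsub>S\<^esub> x \<oplus>\<^bsub>S\<^esub> c \<odot>\<^bsub>S\<^esub> y"
    and "\<And>c d x. x \<in> carrier S \<Longrightarrow> c \<odot>\<^bsub>S\<^esub> (d \<odot>\<^bsub>S\<^esub> x) = (c * d) \<odot>\<^bsub>S\<^esub> x"
    and "\<And>x. x \<in> carrier S \<Longrightarrow> (1::complex) \<odot>\<^bsub>S\<^esub> x = x"
    and "\<And>c x y. \<lbrakk>x \<in> carrier S; y \<in> carrier S\<rbrakk>
      \<Longrightarrow> (c \<odot>\<^bsub>S\<^esub> x) \<otimes>\<^bsub>S\<^esub> y = c \<odot>\<^bsub>S\<^esub> (x \<otimes>\<^bsub>S\<^esub> y)"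
    and "\<And>c x y. \<lbrakk>x \<in> carrier S; y \<in> carrier S\<rbrakk>
      \<Longrightarrow> x \<otimes>\<^bsub>S\<^esub> (c \<odot>\<^bsub>S\<^esub> y) = c \<odot>\<^bsub>S\<^esub> (x \<otimes>\<^bsub>S\<^esub> y)"
  shows "calg S"
  using assms by (auto simp: calg_def calg_axioms_def)

lemma alg_homI:
  assumes "calg R" "calg S"
    and "\<And>x. x \<in> carrier R \<Longrightarrow> f x \<in> carrier S"
    and "\<And>x y. x \<in> carrier R \<Longrightarrow> y \<in> carrier R \<Longrightarrow> f (x \<oplus>\<^bsub>R\<^esub> y) = f x \<oplus>\<^bsub>S\<^esub> f y"
    and "\<And>x y. x \<in> carrier R \<Longrightarrow> y \<in> carrier R \<Longrightarrow> f (x \<otimes>\<^bsub>R\<^esub> y) = f x \<otimes>\<^bsub>S\<^esub> f y"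
    and "f \<one>\<^bsub>R\<^esub> = \<one>\<^bsub>S\<^esub>"
    and "\<And>c x. x \<in> carrier R \<Longrightarrow> f (c \<odot>\<^bsub>R\<^esub> x) = c \<odot>\<^bsub>S\<^esub> f x"
  shows "f \<in> alg_hom R S"
  using assms by (auto simp: alg_hom_def ring_hom_def)

locale calg_hom = R: calg R + S: calg S for R (structure) and S (structure) +
  fixes h
  assumes hom: "h \<in> alg_hom R S"
begin

lemma closed [simp, intro]: "x \<in> carrier R \<Longrightarrow> h x \<in> carrier S"
  using hom by (auto simp: alg_hom_def ring_hom_def)
lemma add [simp]: "x \<in> carrier R \<Longrightarrow> y \<in> carrier R \<Longrightarrow> h (x \<oplus>\<^bsub>R\<^esub> y) = h x \<oplus>\<^bsub>S\<^esub> h y"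
  using hom by (auto simp: alg_hom_def ring_hom_def)
lemma mult [simp]: "x \<in> carrier R \<Longrightarrow> y \<in> carrier R \<Longrightarrow> h (x \<otimes>\<^bsub>R\<^esub> y) = h x \<otimes>\<^bsub>S\<^esub> h y"
  using hom by (auto simp: alg_hom_def ring_hom_def)
lemma one [simp]: "h \<one>\<^bsub>R\<^esub> = \<one>\<^bsub>S\<^esub>"
  using hom by (auto simp: alg_hom_def ring_hom_def)
lemma smult [simp]: "x \<in> carrier R \<Longrightarrow> h (c \<odot>\<^bsub>R\<^esub> x) = c \<odot>\<^bsub>S\<^esub> h x"
  using hom by (auto simp: alg_hom_def ring_hom_def)
lemma zero [simp]: "h \<zero>\<^bsub>R\<^esub> = \<zero>\<^bsub>S\<^esub>"
  using add[of "\<zero>\<^bsub>R\<^esub>" "\<zero>\<^bsub>R\<^esub>"] by (simp add: S.add.l_cancel_one del: add)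
lemma minus [simp]: "x \<in> carrier R \<Longrightarrow> h (\<ominus>\<^bsub>R\<^esub> x) = \<ominus>\<^bsub>S\<^esub> h x"
  using smult[of x "-1"] by (simp add: R.smult_minus_one S.smult_minus_one del: smult)
lemma diff [simp]: "x \<in> carrier R \<Longrightarrow> y \<in> carrier R \<Longrightarrow> h (x \<ominus>\<^bsub>R\<^esub> y) = h x \<ominus>\<^bsub>S\<^esub> h y"
  by (simp add: a_minus_def)
end

section \<open>Monoid algebras\<close>

abbreviation "keys \<equiv> Poly_Mapping.keys"
abbreviation "lookup \<equiv> Poly_Mapping.lookup"
abbreviation "single \<equiv> Poly_Mapping.single"

lemma sum_single_lookup:
  fixes p :: "'a \<Rightarrow>\<^sub>0 complex"
  assumes "finite X" "keys p \<subseteq> X"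
  shows "(\<Sum>x\<in>X. single x (lookup p x)) = p"
proof (rule poly_mapping_eqI)
  fix k
  have "lookup (\<Sum>x\<in>X. single x (lookup p x)) k = (\<Sum>x\<in>X. if x = k then lookup p x else 0)"
    by (simp add: lookup_sum lookup_single when_def)
  also have "\<dots> = lookup p k"
    using assms by (auto simp: sum.delta' in_keys_iff)
  finally show "lookup (\<Sum>x\<in>X. single x (lookup p x)) k = lookup p k" .
qed

text \<open>Induction on the support; the bound on the keys is carried along because the case
  \<open>add\<close> asks for it for both summands.\<close>

lemma poly_mapping_span_induct [consumes 1, case_names zero single add]:
  fixes p :: "'a \<Rightarrow>\<^sub>0 complex"
  assumes "keys p \<subseteq> X"
    and zero: "P 0"
    and single: "\<And>x c. x \<in> X \<Longrightarrow> P (single x c)"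
    and add: "\<And>p r. keys p \<subseteq> X \<Longrightarrow> keys r \<subseteq> X \<Longrightarrow> P p \<Longrightarrow> P r \<Longrightarrow> P (p + r)"
  shows "P p"
proof -
  have "P (\<Sum>x\<in>Y. single x (lookup p x)) \<and> keys (\<Sum>x\<in>Y. single x (lookup p x)) \<subseteq> X"
    if "finite Y" "Y \<subseteq> X" for Y
    using that
  proof (induction Y rule: finite_induct)
    case empty
    then show ?case using zero by simp
  next
    case (insert y Y)
    have "keys (single y (lookup p y)) \<subseteq> X" using insert.prems by auto
    moreover have "keys (single y (lookup p y) + (\<Sum>x\<in>Y. single x (lookup p x))) \<subseteq> X"
      using insert by (intro order.trans[OF keys_add]) auto
    ultimately show ?case using insert by (simp add: add single)
  qed
  from this[of "keys p"] show ?thesis using assms(1) by (simp add: sum_single_lookup)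
qed

lemma map_mult_single [simp]: "Poly_Mapping.map ((*) c) (single x d) = single x (c * d :: complex)"
  by (rule poly_mapping_eqI) (simp add: Poly_Mapping.map.rep_eq lookup_single when_def)
lemma lookup_map_mult [simp]: "lookup (Poly_Mapping.map ((*) c) p) x = c * lookup p x" for c :: complex
  by (simp add: Poly_Mapping.map.rep_eq when_def)
lemma map_mult_add: "Poly_Mapping.map ((*) c) (p + r) = Poly_Mapping.map ((*) c) p + Poly_Mapping.map ((*) c) r"
  for c :: complex
  by (rule poly_mapping_eqI) (simp add: lookup_add ring_distribs)
lemma map_mult_zero [simp]: "Poly_Mapping.map ((*) c) 0 = 0" for c :: complex
  by (rule poly_mapping_eqI) simp
lemma keys_map_mult: "keys (Poly_Mapping.map ((*) c) p) \<subseteq> keys p" for c :: complex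
  by (auto simp: in_keys_iff)

locale monoid_alg = G: monoid G for G (structure)
begin

abbreviation "K \<equiv> monoid_algebra G"

lemma simps:
  "carrier K = {p. keys p \<subseteq> carrier G}" "\<one>\<^bsub>K\<^esub> = single \<one> 1" "\<zero>\<^bsub>K\<^esub> = 0" "x \<oplus>\<^bsub>K\<^esub> y = x + y"
  "c \<odot>\<^bsub>K\<^esub> x = Poly_Mapping.map ((*) c) x"
  by (simp_all add: monoid_algebra_def)

text \<open>Index sets larger than the supports allow both sides of a distributive law to be summed
  over the same set.\<close>

lemma mult_eq_sum:
  assumes "finite X" "keys p \<subseteq> X" "finite Y" "keys r \<subseteq> Y"
  shows "p \<otimes>\<^bsub>K\<^esub> r = (\<Sum>x\<in>X. \<Sum>y\<in>Y. single (x \<otimes> y) (lookup p x * lookup r y))"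
proof -
  have "(\<Sum>x\<in>X. \<Sum>y\<in>Y. single (x \<otimes> y) (lookup p x * lookup r y))
      = (\<Sum>x\<in>keys p. \<Sum>y\<in>Y. single (x \<otimes> y) (lookup p x * lookup r y))"
    using assms by (intro sum.mono_neutral_right) (auto simp: in_keys_iff)
  also have "\<dots> = (\<Sum>x\<in>keys p. \<Sum>y\<in>keys r. single (x \<otimes> y) (lookup p x * lookup r y))"
    using assms by (intro sum.cong refl sum.mono_neutral_right) (auto simp: in_keys_iff)
  finally show ?thesis by (simp add: monoid_algebra_def)
qed

lemma single_mult [simp]: "single x c \<otimes>\<^bsub>K\<^esub> single y d = single (x \<otimes> y) (c * d)"
  by (subst mult_eq_sum[of "{x}" _ "{y}"]) auto

lemma K_l_distr: "(p + p') \<otimes>\<^bsub>K\<^esub> r = p \<otimes>\<^bsub>K\<^esub> r + p' \<otimes>\<^bsub>K\<^esub> r"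
  by (subst (1 2 3) mult_eq_sum[of "keys p \<union> keys p'" _ "keys r"])
    (use keys_add[of p p'] in \<open>auto simp: lookup_add ring_distribs single_add sum.distrib\<close>)

lemma K_r_distr: "p \<otimes>\<^bsub>K\<^esub> (r + r') = p \<otimes>\<^bsub>K\<^esub> r + p \<otimes>\<^bsub>K\<^esub> r'"
  by (subst (1 2 3) mult_eq_sum[of "keys p" _ "keys r \<union> keys r'"])
    (use keys_add[of r r'] in \<open>auto simp: lookup_add ring_distribs single_add sum.distrib\<close>)

lemma zero_mult [simp]: "0 \<otimes>\<^bsub>K\<^esub> r = 0" "r \<otimes>\<^bsub>K\<^esub> 0 = 0"
  by (simp_all add: monoid_algebra_def)

lemma mult_closed: "keys p \<subseteq> carrier G \<Longrightarrow> keys r \<subseteq> carrier G \<Longrightarrow> keys (p \<otimes>\<^bsub>K\<^esub> r) \<subseteq> carrier G"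
proof (induction p rule: poly_mapping_span_induct)
  case (single x c)
  from single(2) show ?case
  proof (induction r rule: poly_mapping_span_induct)
    case (single y d)
    then show ?case using \<open>x \<in> carrier G\<close> by auto
  next
    case (add p r)
    then show ?case using keys_add[of "single x c \<otimes>\<^bsub>K\<^esub> p" "single x c \<otimes>\<^bsub>K\<^esub> r"] by (auto simp: K_r_distr)
  qed auto
next
  case (add p p')
  then show ?case using keys_add[of "p \<otimes>\<^bsub>K\<^esub> r" "p' \<otimes>\<^bsub>K\<^esub> r"] by (auto simp: K_l_distr)
qed auto

lemma mult_assoc:
  "keys p \<subseteq> carrier G \<Longrightarrow> keys r \<subseteq> carrier G \<Longrightarrow> keys s \<subseteq> carrier G
    \<Longrightarrow> (p \<otimes>\<^bsub>K\<^esub> r) \<otimes>\<^bsub>K\<^esub> s = p \<otimes>\<^bsub>K\<^esub> (r \<otimes>\<^bsub>K\<^esub> s)"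
proof (induction p rule: poly_mapping_span_induct)
  case (single x c)
  from single(2,3) show ?case
  proof (induction r rule: poly_mapping_span_induct)
    case (single y d)
    from single(2) show ?case
    proof (induction s rule: poly_mapping_span_induct)
      case (single z e)
      then show ?case using \<open>x \<in> carrier G\<close> \<open>y \<in> carrier G\<close> by (simp add: G.m_assoc mult.assoc)
    qed (simp_all add: K_r_distr)
  qed (simp_all add: K_r_distr K_l_distr)
qed (simp_all add: K_l_distr)

lemma one_mult: "keys p \<subseteq> carrier G \<Longrightarrow> single \<one> 1 \<otimes>\<^bsub>K\<^esub> p = p"
  by (induction p rule: poly_mapping_span_induct) (simp_all add: K_r_distr)
lemma mult_one: "keys p \<subseteq> carrier G \<Longrightarrow> p \<otimes>\<^bsub>K\<^esub> single \<one> 1 = p"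
  by (induction p rule: poly_mapping_span_induct) (simp_all add: K_l_distr)

lemma map_mult_left: "keys p \<subseteq> carrier G \<Longrightarrow> keys r \<subseteq> carrier G \<Longrightarrow>
  Poly_Mapping.map ((*) c) p \<otimes>\<^bsub>K\<^esub> r = Poly_Mapping.map ((*) c) (p \<otimes>\<^bsub>K\<^esub> r)"
proof (induction p rule: poly_mapping_span_induct)
  case (single x d)
  from single(2) show ?case
    by (induction r rule: poly_mapping_span_induct) (simp_all add: K_r_distr map_mult_add mult.assoc mult.left_commute)
qed (simp_all add: K_l_distr map_mult_add)

lemma map_mult_right: "keys p \<subseteq> carrier G \<Longrightarrow> keys r \<subseteq> carrier G \<Longrightarrow>
  p \<otimes>\<^bsub>K\<^esub> Poly_Mapping.map ((*) c) r = Poly_Mapping.map ((*) c) (p \<otimes>\<^bsub>K\<^esub> r)"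
proof (induction p rule: poly_mapping_span_induct)
  case (single x d)
  from single(2) show ?case
    by (induction r rule: poly_mapping_span_induct) (simp_all add: K_r_distr map_mult_add mult.assoc mult.left_commute)
qed (simp_all add: K_l_distr map_mult_add)

lemma keys_add_closed: "keys p \<subseteq> X \<Longrightarrow> keys r \<subseteq> X \<Longrightarrow> keys (p + r) \<subseteq> X"
  using keys_add[of p r] by blast

lemma is_calg: "calg K"
proof (rule calgI)
  show "ring K"
  proof (rule ringI)
    show "abelian_group K"
      by (rule abelian_groupI)
        (auto simp: simps add_ac keys_add_closed intro!: exI[of _ "- _ :: _ \<Rightarrow>\<^sub>0 complex"]
          simp flip: Bex_def intro!: bexI[of _ "- _ :: _ \<Rightarrow>\<^sub>0 complex"])
    show "monoid K"
      by (rule monoidI) (auto simp: simps mult_closed[THEN subsetD] mult_assoc one_mult mult_one)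
  qed (auto simp: simps K_l_distr K_r_distr)
qed (auto simp: simps map_mult_left map_mult_right map_mult_add keys_map_mult[THEN subsetD]
    intro!: poly_mapping_eqI simp: lookup_add ring_distribs)

sublocale calg K by (rule is_calg)

end

definition linext :: "(complex, 'b, 'm) module_scheme \<Rightarrow> ('g \<Rightarrow> 'b) \<Rightarrow> ('g \<Rightarrow>\<^sub>0 complex) \<Rightarrow> 'b" where
  "linext S \<theta> p = (\<Oplus>\<^bsub>S\<^esub>x\<in>keys p. lookup p x \<odot>\<^bsub>S\<^esub> \<theta> x)"

context calg
begin

lemma linext_eq_finsum:
  assumes "finite X" "keys p \<subseteq> X" "\<And>x. x \<in> X \<Longrightarrow> \<theta> x \<in> carrier S"
  shows "linext S \<theta> p = (\<Oplus>x\<in>X. lookup p x \<odot>\<^bsub>S\<^esub> \<theta> x)"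
  unfolding linext_def
  by (rule add.finprod_mono_neutral_cong_left) (use assms in \<open>auto simp: in_keys_iff\<close>)

lemma linext_closed:
  "keys p \<subseteq> X \<Longrightarrow> (\<And>x. x \<in> X \<Longrightarrow> \<theta> x \<in> carrier S) \<Longrightarrow> linext S \<theta> p \<in> carrier S"
  unfolding linext_def by (intro finsum_closed) auto

lemma linext_single: "\<theta> x \<in> carrier S \<Longrightarrow> linext S \<theta> (single x c) = c \<odot>\<^bsub>S\<^esub> \<theta> x"
  by (subst linext_eq_finsum[of "{x}"]) auto

lemma linext_zero [simp]: "linext S \<theta> 0 = \<zero>"
  by (simp add: linext_def)

lemma linext_add:
  assumes "keys p \<subseteq> X" "keys r \<subseteq> X" "\<And>x. x \<in> X \<Longrightarrow> \<theta> x \<in> carrier S"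
  shows "linext S \<theta> (p + r) = linext S \<theta> p \<oplus> linext S \<theta> r"
proof -
  let ?Y = "keys p \<union> keys r"
  have "linext S \<theta> s = (\<Oplus>x\<in>?Y. lookup s x \<odot>\<^bsub>S\<^esub> \<theta> x)" if "keys s \<subseteq> ?Y" for s
    using that by (rule linext_eq_finsum[rotated]) (use assms in auto)
  moreover have "(\<Oplus>x\<in>?Y. lookup (p + r) x \<odot>\<^bsub>S\<^esub> \<theta> x)
      = (\<Oplus>x\<in>?Y. lookup p x \<odot>\<^bsub>S\<^esub> \<theta> x \<oplus> lookup r x \<odot>\<^bsub>S\<^esub> \<theta> x)"
    by (rule finsum_cong') (use assms in \<open>auto simp: lookup_add smult_l_distr\<close>)
  moreover have "\<dots> = (\<Oplus>x\<in>?Y. lookup p x \<odot>\<^bsub>S\<^esub> \<theta> x) \<oplus> (\<Oplus>x\<in>?Y. lookup r x \<odot>\<^bsub>S\<^esub> \<theta> x)"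
    by (rule finsum_addf) (use assms in auto)
  ultimately show ?thesis using keys_add[of p r] by simp
qed

lemma linext_smult:
  assumes "keys p \<subseteq> X" "\<And>x. x \<in> X \<Longrightarrow> \<theta> x \<in> carrier S"
  shows "linext S \<theta> (Poly_Mapping.map ((*) c) p) = c \<odot>\<^bsub>S\<^esub> linext S \<theta> p"
proof -
  have "linext S \<theta> (Poly_Mapping.map ((*) c) p) = (\<Oplus>x\<in>keys p. (c * lookup p x) \<odot>\<^bsub>S\<^esub> \<theta> x)"
    by (subst linext_eq_finsum[of "keys p"]) (use assms keys_map_mult[of c p] in auto)
  also have "\<dots> = (\<Oplus>x\<in>keys p. c \<odot>\<^bsub>S\<^esub> (lookup p x \<odot>\<^bsub>S\<^esub> \<theta> x))"
    by (rule finsum_cong') (use assms in \<open>auto simp: smult_smult\<close>)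
  also have "\<dots> = c \<odot>\<^bsub>S\<^esub> linext S \<theta> p"
    unfolding linext_def by (rule smult_finsum[symmetric]) (use assms in auto)
  finally show ?thesis .
qed

end

text \<open>Universal property of the monoid algebra: both sides of the product rule are bilinear,
  so monomials suffice.\<close>

lemma linext_alg_hom:
  assumes "monoid G" "calg S" and cl: "\<And>x. x \<in> carrier G \<Longrightarrow> \<theta> x \<in> carrier S"
    and one: "\<theta> \<one>\<^bsub>G\<^esub> = \<one>\<^bsub>S\<^esub>"
    and mult: "\<And>x y. x \<in> carrier G \<Longrightarrow> y \<in> carrier G \<Longrightarrow> \<theta> (x \<otimes>\<^bsub>G\<^esub> y) = \<theta> x \<otimes>\<^bsub>S\<^esub> \<theta> y"
  shows "linext S \<theta> \<in> alg_hom (monoid_algebra G) S"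
proof -
  interpret G: monoid_alg G using assms(1) by (simp add: monoid_alg_def)
  interpret S: calg S by fact
  note lin = S.linext_add[where X = "carrier G" and \<theta> = \<theta>, OF _ _ cl]
    S.linext_smult[where X = "carrier G" and \<theta> = \<theta>, OF _ cl]
    S.linext_closed[where X = "carrier G" and \<theta> = \<theta>, OF _ cl]
  show ?thesis
  proof (rule alg_homI)
    fix p r assume "p \<in> carrier (monoid_algebra G)" "r \<in> carrier (monoid_algebra G)"
    then have "keys p \<subseteq> carrier G" "keys r \<subseteq> carrier G" by (auto simp: G.simps)
    then show "linext S \<theta> (p \<otimes>\<^bsub>monoid_algebra G\<^esub> r) = linext S \<theta> p \<otimes>\<^bsub>S\<^esub> linext S \<theta> r"
    proof (induction p rule: poly_mapping_span_induct)
      case zero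
      then show ?case by (simp add: lin)
    next
      case (single x c)
      from single(2) show ?case
      proof (induction r rule: poly_mapping_span_induct)
        case zero
        then show ?case using single(1) by (simp add: S.linext_single cl)
      next
        case (single y d)
        then show ?case using \<open>x \<in> carrier G\<close>
          by (simp add: S.linext_single cl mult S.smult_mult_left S.smult_mult_right S.smult_smult mult.commute)
      next
        case (add p r)
        have "keys (single x c) \<subseteq> carrier G" using single(1) by auto
        with add show ?case
          by (simp add: G.K_r_distr lin G.mult_closed S.r_distr)
      qed
    next
      case (add p p')
      then show ?case by (simp add: G.K_l_distr lin G.mult_closed S.l_distr)
    qed
  qed (auto simp: G.is_calg assms(2) G.simps lin S.linext_single cl one)
qed

text \<open>\<open>SL2\<close> adds moment maps and a grading to the record of the quotient algebra;
  this changes the type but none of the operations.\<close>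

lemma calg_cong:
  assumes "calg S" "carrier S' = carrier S" "mult S' = mult S" "one S' = one S" "zero S' = zero S"
    "add S' = add S" "smult S' = smult S"
  shows "calg S'"
proof -
  interpret calg S by fact
  show ?thesis
  proof (rule calgI)
    show "ring S'"
    proof (rule ringI)
      show "abelian_group S'"
      proof (rule abelian_groupI)
        show "\<exists>y\<in>carrier S'. y \<oplus>\<^bsub>S'\<^esub> x = \<zero>\<^bsub>S'\<^esub>" if "x \<in> carrier S'" for x
          using that assms by (intro bexI[of _ "\<ominus>\<^bsub>S\<^esub> x"]) (auto simp: l_neg)
      qed (use assms in \<open>auto simp: a_ac\<close>)
      show "monoid S'"
        by (rule monoidI) (use assms in \<open>auto simp: m_assoc\<close>)
    qed (use assms in \<open>auto simp: l_distr r_distr\<close>)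
  qed (use assms in \<open>auto simp: smult_l_distr smult_r_distr smult_smult smult_mult_left smult_mult_right\<close>)
qed

section \<open>Quotient algebras\<close>

lemma quot_algebra_simps:
  "carrier (quot_algebra R I) = carrier (R Quot I)" "mult (quot_algebra R I) = mult (R Quot I)"
  "one (quot_algebra R I) = one (R Quot I)" "zero (quot_algebra R I) = zero (R Quot I)"
  "add (quot_algebra R I) = add (R Quot I)"
  "smult (quot_algebra R I) = (\<lambda>c X. \<Union>x\<in>X. I +>\<^bsub>R\<^esub> (c \<odot>\<^bsub>R\<^esub> x))"
  by (simp_all add: quot_algebra_def ring.defs module.defs)

lemma (in ring) minus_eq_zero_iff: "x \<in> carrier R \<Longrightarrow> y \<in> carrier R \<Longrightarrow> x \<ominus> y = \<zero> \<longleftrightarrow> x = y"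
proof
  assume *: "x \<in> carrier R" "y \<in> carrier R" "x \<ominus> y = \<zero>"
  have "x = (x \<ominus> y) \<oplus> y" using *(1,2) by algebra
  also have "\<dots> = y" unfolding *(3) using *(2) by simp
  finally show "x = y" .
qed (simp add: a_minus_def r_neg)

locale calg_ideal = calg R + ideal I R for I and R (structure)
begin

abbreviation "Q \<equiv> quot_algebra R I"

lemma Q_carrier: "carrier Q = (\<lambda>x. I +> x) ` carrier R"
  by (auto simp: quot_algebra_simps FactRing_simps)
lemma Q_add: "x \<in> carrier R \<Longrightarrow> y \<in> carrier R \<Longrightarrow> (I +> x) \<oplus>\<^bsub>Q\<^esub> (I +> y) = I +> (x \<oplus> y)"
  by (simp add: quot_algebra_simps FactRing_def a_rcos_sum)
lemma Q_mult: "x \<in> carrier R \<Longrightarrow> y \<in> carrier R \<Longrightarrow> (I +> x) \<otimes>\<^bsub>Q\<^esub> (I +> y) = I +> (x \<otimes> y)"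
  by (simp add: quot_algebra_simps FactRing_def rcoset_mult_add)
lemma Q_one: "\<one>\<^bsub>Q\<^esub> = I +> \<one>"
  by (simp add: quot_algebra_simps FactRing_def)
lemma Q_zero: "\<zero>\<^bsub>Q\<^esub> = I +> \<zero>"
  using a_rcos_const[OF zero_closed] by (simp add: quot_algebra_simps FactRing_def)

lemma Q_eq_iff: "x \<in> carrier R \<Longrightarrow> y \<in> carrier R \<Longrightarrow> I +> x = I +> y \<longleftrightarrow> x \<ominus> y \<in> I"
  using quotient_eq_iff_same_a_r_cos[OF is_ideal, of x y] by simp

text \<open>A ring ideal is a subspace because the scalar c acts as multiplication by the element
  c1.\<close>

lemma smult_I: "x \<in> I \<Longrightarrow> c \<odot>\<^bsub>R\<^esub> x \<in> I"
  using smult_eq_mult[of x c] I_l_closed[of x "c \<odot>\<^bsub>R\<^esub> \<one>"] a_Hcarr[of x] by simp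

lemma smult_diff: "x \<in> carrier R \<Longrightarrow> y \<in> carrier R \<Longrightarrow> c \<odot>\<^bsub>R\<^esub> x \<ominus> c \<odot>\<^bsub>R\<^esub> y = c \<odot>\<^bsub>R\<^esub> (x \<ominus> y)"
proof -
  assume *: "x \<in> carrier R" "y \<in> carrier R"
  then have "c \<odot>\<^bsub>R\<^esub> (x \<ominus> y) = c \<odot>\<^bsub>R\<^esub> x \<oplus> c \<odot>\<^bsub>R\<^esub> ((-1) \<odot>\<^bsub>R\<^esub> y)"
    by (simp add: a_minus_def smult_minus_one smult_r_distr)
  also have "c \<odot>\<^bsub>R\<^esub> ((-1) \<odot>\<^bsub>R\<^esub> y) = (-1) \<odot>\<^bsub>R\<^esub> (c \<odot>\<^bsub>R\<^esub> y)"
    using * by (simp add: smult_smult)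
  finally show ?thesis using * by (simp add: a_minus_def smult_minus_one)
qed

lemma Q_smult:
  assumes "x \<in> carrier R"
  shows "c \<odot>\<^bsub>Q\<^esub> (I +> x) = I +> (c \<odot>\<^bsub>R\<^esub> x)"
proof -
  \<comment> \<open>All members of a coset yield the same coset after scaling, so the union in the
    definition of the scalar product is this one coset.\<close>
  have "I +> (c \<odot>\<^bsub>R\<^esub> y) = I +> (c \<odot>\<^bsub>R\<^esub> x)" if "y \<in> I +> x" for y
  proof -
    have y: "y \<in> carrier R" using that assms a_r_coset_subset_G[OF a_subset] by blast
    have "I +> y = I +> x" using a_repr_independence[OF that assms a_subgroup] by simp
    then show ?thesis
      using y assms smult_I[of "y \<ominus> x" c] by (simp add: Q_eq_iff smult_diff)
  qed
  moreover have "x \<in> I +> x" using assms by (rule a_rcos_self)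
  ultimately show ?thesis unfolding quot_algebra_simps by blast
qed

lemma Q_calg: "calg Q"
proof (rule calgI)
  show "ring Q"
  proof (rule ringI)
    show "abelian_group Q"
    proof (rule abelian_groupI)
      show "\<exists>y\<in>carrier Q. y \<oplus>\<^bsub>Q\<^esub> x = \<zero>\<^bsub>Q\<^esub>" if x: "x \<in> carrier Q" for x
      proof -
        from x obtain r where r: "r \<in> carrier R" "x = I +> r" by (auto simp: Q_carrier)
        then show ?thesis
          by (intro bexI[of _ "I +> (\<ominus> r)"]) (auto simp: Q_carrier Q_add Q_zero l_neg)
      qed
    qed (auto simp: Q_carrier Q_add Q_zero a_ac)
    show "monoid Q"
      by (rule monoidI) (auto simp: Q_carrier Q_mult Q_one m_assoc)
  qed (auto simp: Q_carrier Q_mult Q_add l_distr r_distr)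
qed (auto simp: Q_carrier Q_mult Q_add Q_smult smult_l_distr smult_r_distr smult_smult
      smult_mult_left smult_mult_right)

lemma Q_hom: "(\<lambda>x. I +> x) \<in> alg_hom R Q"
  by (rule alg_homI[OF calg_axioms Q_calg])
    (auto simp: Q_carrier Q_mult Q_add Q_smult Q_one)

text \<open>The representative picked by \<open>SOME\<close> does not matter, since f takes equal
  values on elements whose difference lies in I.\<close>

lemma Q_universal:
  assumes "calg S" "f \<in> alg_hom R S" "\<And>x. x \<in> I \<Longrightarrow> f x = \<zero>\<^bsub>S\<^esub>"
  shows "\<exists>\<phi>\<in>alg_hom Q S. \<forall>x\<in>carrier R. \<phi> (I +> x) = f x"
proof -
  interpret f: calg_hom R S f
    using assms(1,2) calg_axioms by (simp add: calg_hom_def calg_hom_axioms_def)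
  define \<phi> where "\<phi> X = f (SOME x. x \<in> carrier R \<and> X = I +> x)" for X
  have eq: "\<phi> (I +> x) = f x" if x: "x \<in> carrier R" for x
  proof -
    define y where "y = (SOME y. y \<in> carrier R \<and> I +> x = I +> y)"
    have y: "y \<in> carrier R \<and> I +> x = I +> y"
      unfolding y_def by (rule someI[of _ x]) (use x in auto)
    then have "f (x \<ominus> y) = \<zero>\<^bsub>S\<^esub>" using x by (intro assms(3)) (simp flip: Q_eq_iff)
    then have "f x = f y" using x y by (simp add: f.S.minus_eq_zero_iff)
    then show ?thesis by (simp add: \<phi>_def y_def)
  qed
  have "\<phi> \<in> alg_hom Q S"
    by (rule alg_homI[OF Q_calg assms(1)]) (auto simp: Q_carrier eq Q_add Q_mult Q_smult Q_one)
  with eq show ?thesis by blast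
qed

end

lemma (in calg_hom) kernel_ideal: "ideal {x \<in> carrier R. h x = \<zero>\<^bsub>S\<^esub>} R"
proof (rule idealI)
  show "subgroup {x \<in> carrier R. h x = \<zero>\<^bsub>S\<^esub>} (add_monoid R)"
    by (rule R.add.subgroupI) (auto simp flip: a_inv_def intro!: exI[of _ "\<zero>\<^bsub>R\<^esub>"])
qed (auto simp: R.ring_axioms)

lemma (in monoid_alg) uminus: "x \<in> carrier K \<Longrightarrow> \<ominus>\<^bsub>K\<^esub> x = - x"
  by (rule add.inv_equality[folded a_inv_def]) (auto simp: simps)

lemma (in monoid_alg) minus: "x \<in> carrier K \<Longrightarrow> y \<in> carrier K \<Longrightarrow> x - y = x \<ominus>\<^bsub>K\<^esub> y"
  by (simp add: a_minus_def uminus) (simp add: simps)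

section \<open>The algebra as a quotient\<close>

lemma free_monoid_simps [simp]: "carrier free_monoid = lists generators" "mult free_monoid = (@)"
  "\<one>\<^bsub>free_monoid\<^esub> = []"
  by (simp_all add: free_monoid_def)

interpretation F: monoid_alg free_monoid
  rewrites "monoid_algebra free_monoid = free_alg"
  by (unfold_locales) (auto simp: free_alg_def)

lemma generators_simps [simp]: "GenA \<in> generators" "GenB \<in> generators" "GenC \<in> generators" "GenD \<in> generators"
  "GenL f \<in> generators \<longleftrightarrow> f \<in> carrier Mero" "GenR f \<in> generators \<longleftrightarrow> f \<in> carrier Mero"
  by (auto simp: generators_def)

lemma single_in_free_alg [simp]: "w \<in> lists generators \<Longrightarrow> single w z \<in> carrier free_alg"
  by (auto simp: F.simps)

lemma minus_in_free_alg [simp]: "x \<in> carrier free_alg \<Longrightarrow> y \<in> carrier free_alg \<Longrightarrow> x - y \<in> carrier free_alg"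
  by (simp add: F.minus)

lemma plus_free_alg: "x + y = x \<oplus>\<^bsub>free_alg\<^esub> y"
  by (simp add: F.simps)

lemma Mero_closed [simp]:
  "f \<in> carrier Mero \<Longrightarrow> g \<in> carrier Mero \<Longrightarrow> f \<oplus>\<^bsub>Mero\<^esub> g \<in> carrier Mero"
  "f \<in> carrier Mero \<Longrightarrow> g \<in> carrier Mero \<Longrightarrow> f \<otimes>\<^bsub>Mero\<^esub> g \<in> carrier Mero"
  "f \<in> carrier Mero \<Longrightarrow> z \<odot>\<^bsub>Mero\<^esub> f \<in> carrier Mero"
  "f \<in> carrier Mero \<Longrightarrow> shift s f \<in> carrier Mero"
  "\<one>\<^bsub>Mero\<^esub> \<in> carrier Mero" "\<zero>\<^bsub>Mero\<^esub> \<in> carrier Mero"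
  by (auto simp: carrier_Mero Mero_one Mero_zero simp del: carrier_Mero[symmetric])

context q_param
begin

lemma fun_in_Mero [simp]: "Ffun q \<in> carrier Mero" "Gfun q \<in> carrier Mero" "Ufun q \<in> carrier Mero"
  "Vfun q \<in> carrier Mero"
  by (simp_all flip: mval_Ff mval_Gf mval_Uf mval_Vf)

lemma fH_fI_closed [simp]: "fH q \<in> carrier free_alg" "fI q \<in> carrier free_alg"
  by (simp_all add: fH_def fI_def)

lemma sl2_rel_closed:
  assumes "sl2_rel q x y"
  shows "x \<in> carrier free_alg \<and> y \<in> carrier free_alg"
  using assms by cases (simp_all add: plus_free_alg)

abbreviation "SL \<equiv> SL2 q"
abbreviation "cls \<equiv> sl2_class q"

lemma rel_set_closed: "{x - y | x y. sl2_rel q x y} \<subseteq> carrier free_alg"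
  using sl2_rel_closed by auto

lemma sl2_calg_ideal: "calg_ideal (sl2_ideal q) free_alg"
  unfolding calg_ideal_def sl2_ideal_def
  using F.genideal_ideal[OF rel_set_closed] F.calg_axioms by simp

sublocale I: calg_ideal "sl2_ideal q" free_alg
  by (rule sl2_calg_ideal)

lemma SL2_simps:
  "carrier SL = carrier I.Q" "mult SL = mult I.Q" "one SL = one I.Q" "zero SL = zero I.Q"
  "add SL = add I.Q" "smult SL = smult I.Q"
  "lmom SL f = cls (fl f)" "rmom SL f = cls (fr f)"
  "grade SL i j = cls ` {x. keys x \<subseteq> words_of_bidegree i j}"
  by (simp_all add: SL2_def module.defs halgebra.defs)

sublocale A: calg SL
  by (rule calg_cong[OF I.Q_calg]) (simp_all add: SL2_simps)

lemma cls_alg_hom: "cls \<in> alg_hom free_alg SL"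
  using I.Q_hom by (simp add: alg_hom_def ring_hom_def SL2_simps sl2_class_def[abs_def])

sublocale cls: calg_hom free_alg SL cls
  using cls_alg_hom F.calg_axioms A.calg_axioms by (simp add: calg_hom_def calg_hom_axioms_def)

lemma SL_carrier: "carrier SL = cls ` carrier free_alg"
  by (simp add: SL2_simps I.Q_carrier sl2_class_def)

lemma cls_rel: "sl2_rel q x y \<Longrightarrow> cls x = cls y"
proof -
  assume r: "sl2_rel q x y"
  note cl = sl2_rel_closed[OF r]
  have "x - y \<in> sl2_ideal q"
    using F.genideal_self[OF rel_set_closed] r unfolding sl2_ideal_def by blast
  then show ?thesis using cl unfolding sl2_class_def by (simp only: I.Q_eq_iff F.minus)
qed

lemma cls_plus: "x \<in> carrier free_alg \<Longrightarrow> y \<in> carrier free_alg \<Longrightarrow> cls (x + y) = cls x \<oplus>\<^bsub>SL\<^esub> cls y"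
  by (simp add: plus_free_alg)
lemma cls_minus: "x \<in> carrier free_alg \<Longrightarrow> y \<in> carrier free_alg \<Longrightarrow> cls (x - y) = cls x \<ominus>\<^bsub>SL\<^esub> cls y"
  by (simp add: F.minus)
lemma cls_scal: "cls (fscal z) = z \<odot>\<^bsub>SL\<^esub> \<one>\<^bsub>SL\<^esub>"
proof -
  have "fscal z = z \<odot>\<^bsub>free_alg\<^esub> \<one>\<^bsub>free_alg\<^esub>" by (simp add: F.simps)
  then show ?thesis by simp
qed

text \<open>Words go to products of generator images, linear combinations follow, and the kernel,
  being an ideal, contains \<open>sl2_ideal\<close> as soon as it contains the relations. The
  extension is built inside the proof, so \<open>rel\<close> speaks of every homomorphism with the
  prescribed values.\<close>

lemma SL2_universal:
  assumes S: "calg S" and cl: "\<And>g. g \<in> generators \<Longrightarrow> \<theta> g \<in> carrier S"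
    and rel: "\<And>h x y. h \<in> alg_hom free_alg S \<Longrightarrow> (\<And>g. g \<in> generators \<Longrightarrow> h (fgen g) = \<theta> g)
      \<Longrightarrow> sl2_rel q x y \<Longrightarrow> h x = h y"
  shows "\<exists>\<phi>\<in>alg_hom SL S. \<forall>g\<in>generators. \<phi> (cls (fgen g)) = \<theta> g"
proof -
  interpret S: calg S by fact
  define \<Theta> where "\<Theta> w = foldr (\<lambda>g x. \<theta> g \<otimes>\<^bsub>S\<^esub> x) w \<one>\<^bsub>S\<^esub>" for w
  have Tcl: "\<Theta> w \<in> carrier S" if "w \<in> lists generators" for w
    using that by (induction w) (auto simp: \<Theta>_def cl)
  have Tapp: "\<Theta> (v @ w) = \<Theta> v \<otimes>\<^bsub>S\<^esub> \<Theta> w" if "v \<in> lists generators" "w \<in> lists generators" for v w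
    using that Tcl
    by (induction v) (auto simp: \<Theta>_def cl S.m_assoc)
  have "linext S \<Theta> \<in> alg_hom (monoid_algebra free_monoid) S"
    by (rule linext_alg_hom[OF F.G.monoid_axioms S]) (auto simp: Tcl Tapp, simp add: \<Theta>_def)
  then have h: "linext S \<Theta> \<in> alg_hom free_alg S" by (simp add: free_alg_def)
  have hg: "linext S \<Theta> (fgen g) = \<theta> g" if "g \<in> generators" for g
    using that Tcl[of "[g]"] cl[of g] by (simp add: S.linext_single) (simp add: \<Theta>_def)
  interpret h: calg_hom free_alg S "linext S \<Theta>"
    using h S F.calg_axioms by (simp add: calg_hom_def calg_hom_axioms_def)
  have "sl2_ideal q \<subseteq> {x \<in> carrier free_alg. linext S \<Theta> x = \<zero>\<^bsub>S\<^esub>}"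
    unfolding sl2_ideal_def
  proof (rule F.genideal_minimal[OF h.kernel_ideal], safe)
    fix x y assume r: "sl2_rel q x y"
    from sl2_rel_closed[OF r] rel[OF h hg r]
    show "x - y \<in> carrier free_alg" "linext S \<Theta> (x - y) = \<zero>\<^bsub>S\<^esub>"
      by (auto simp: F.minus S.minus_eq_zero_iff)
  qed
  then have "\<exists>\<phi>\<in>alg_hom I.Q S. \<forall>x\<in>carrier free_alg. \<phi> (sl2_ideal q +>\<^bsub>free_alg\<^esub> x) = linext S \<Theta> x"
    by (intro I.Q_universal[OF S h]) auto
  then obtain \<phi> where "\<phi> \<in> alg_hom I.Q S" "\<forall>x\<in>carrier free_alg. \<phi> (cls x) = linext S \<Theta> x"
    by (auto simp: sl2_class_def)
  then show ?thesis
    using hg by (intro bexI[of _ \<phi>]) (auto simp: alg_hom_def ring_hom_def SL2_simps)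
qed

text \<open>Words are peeled off from the left, the side on which the recursions for the matrix
  elements multiply.\<close>

lemma word_induct [consumes 1, case_names one gen add smult]:
  assumes "x \<in> carrier SL"
    and one: "P \<one>\<^bsub>SL\<^esub>"
    and gen: "\<And>g x. g \<in> generators \<Longrightarrow> x \<in> carrier SL \<Longrightarrow> P x \<Longrightarrow> P (cls (fgen g) \<otimes>\<^bsub>SL\<^esub> x)"
    and add: "\<And>x y. x \<in> carrier SL \<Longrightarrow> y \<in> carrier SL \<Longrightarrow> P x \<Longrightarrow> P y \<Longrightarrow> P (x \<oplus>\<^bsub>SL\<^esub> y)"
    and smult: "\<And>x z. x \<in> carrier SL \<Longrightarrow> P x \<Longrightarrow> P (z \<odot>\<^bsub>SL\<^esub> x)"
  shows "P x"
proof -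
  from assms(1) obtain p where p: "keys p \<subseteq> lists generators" "x = cls p"
    by (auto simp: SL_carrier F.simps)
  have word: "P (cls (single w 1))" if "w \<in> lists generators" for w
    using that
  proof (induction w)
    case Nil
    have "cls (single [] 1) = \<one>\<^bsub>SL\<^esub>" using cls.one by (simp add: F.simps)
    then show ?case using one by simp
  next
    case (Cons g w)
    have eq: "single (g # w) 1 = fgen g \<star> single w 1" by simp
    have w: "single w 1 \<in> carrier free_alg"
      using Cons.hyps by (intro single_in_free_alg) auto
    have "cls (fgen g \<star> single w 1) = cls (fgen g) \<otimes>\<^bsub>SL\<^esub> cls (single w 1)"
      using Cons.hyps w by (intro cls.mult) auto
    then show ?case
      unfolding eq using Cons.hyps Cons.IH w by (simp only:) (intro gen cls.closed)
  qed
  from p(1) have "P (cls p)"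
  proof (induction p rule: poly_mapping_span_induct)
    case zero
    have "0 \<odot>\<^bsub>SL\<^esub> \<one>\<^bsub>SL\<^esub> = cls 0" using cls.zero by (simp add: F.simps)
    then show ?case using smult[OF A.one_closed one, of 0] by simp
  next
    case (single w z)
    have eq: "single w z = z \<odot>\<^bsub>free_alg\<^esub> single w 1" by (simp add: F.simps)
    have w: "single w 1 \<in> carrier free_alg"
      using single by (intro single_in_free_alg) auto
    show ?case
      unfolding eq cls.smult[OF w] by (intro smult cls.closed w word single)
  next
    case (add p r)
    then have "p \<in> carrier free_alg" "r \<in> carrier free_alg" by (auto simp: F.simps)
    with add show ?case by (auto simp: cls_plus intro!: assms(4))
  qed
  then show ?thesis using p by simp
qed

end

context ring
begin

lemma add_diff_eq: "\<lbrakk>x \<in> carrier R; y \<in> carrier R; z \<in> carrier R\<rbrakk> \<Longrightarrow> x \<oplus> (y \<ominus> z) = (x \<oplus> y) \<ominus> z"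
  and diff_add_eq: "\<lbrakk>x \<in> carrier R; y \<in> carrier R; z \<in> carrier R\<rbrakk> \<Longrightarrow> (x \<ominus> y) \<oplus> z = (x \<oplus> z) \<ominus> y"
  and diff_diff_eq: "\<lbrakk>x \<in> carrier R; y \<in> carrier R; z \<in> carrier R\<rbrakk> \<Longrightarrow> (x \<ominus> y) \<ominus> z = x \<ominus> (y \<oplus> z)"
  and diff_diff_eq2: "\<lbrakk>x \<in> carrier R; y \<in> carrier R; z \<in> carrier R\<rbrakk> \<Longrightarrow> x \<ominus> (y \<ominus> z) = (x \<oplus> z) \<ominus> y"
  by (simp_all add: a_minus_def minus_add a_ac)

lemma diff_eq_eq: "\<lbrakk>x \<in> carrier R; y \<in> carrier R; z \<in> carrier R\<rbrakk> \<Longrightarrow> x \<ominus> y = z \<longleftrightarrow> x = z \<oplus> y"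
  by (metis a_minus_def add.inv_solve_right)

lemma eq_diff_eq: "\<lbrakk>x \<in> carrier R; y \<in> carrier R; z \<in> carrier R\<rbrakk> \<Longrightarrow> z = x \<ominus> y \<longleftrightarrow> z \<oplus> y = x"
  using diff_eq_eq[of x y z] by metis

lemma l_diff_distr: "\<lbrakk>x \<in> carrier R; y \<in> carrier R; z \<in> carrier R\<rbrakk> \<Longrightarrow> (x \<ominus> y) \<otimes> z = x \<otimes> z \<ominus> y \<otimes> z"
  and r_diff_distr: "\<lbrakk>x \<in> carrier R; y \<in> carrier R; z \<in> carrier R\<rbrakk> \<Longrightarrow> z \<otimes> (x \<ominus> y) = z \<otimes> x \<ominus> z \<otimes> y"
  by (simp_all add: a_minus_def l_distr r_distr l_minus r_minus)

text \<open>The role of \<open>algebra_simps\<close> in noncommutative rings with a carrier: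
  differences are moved across equations until sums of right-nested products remain.\<close>

lemmas rs = add_diff_eq diff_add_eq diff_diff_eq diff_diff_eq2 diff_eq_eq eq_diff_eq
  l_diff_distr r_diff_distr l_distr r_distr m_assoc a_assoc a_comm a_lcomm

end

section \<open>The defining relations\<close>

text \<open>The relations in the form in which only the solution \<open>\<phi> = q F\<close> of the Riccati
  equation \<open>\<phi>(x) + 1/\<phi>(x - 1) = q + 1/q\<close> occurs:
  \<open>H = \<phi>(\<lambda>) + \<phi>(\<mu>) - (q + 1/q)\<close>, \<open>I = \<phi>(\<lambda>) - \<phi>(\<mu>)\<close>, \<open>G(x) = \<phi>(x) / \<phi>(x - 1)\<close>.\<close>

locale sl2_base = q_param q + calg S for q and S :: "(complex, 'b, 'm) module_scheme" (structure) +
  fixes L R :: "mero \<Rightarrow> 'b" and a b c d :: 'b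
  assumes closed [simp, intro]: "L f \<in> carrier S" "R f \<in> carrier S" "a \<in> carrier S" "b \<in> carrier S"
      "c \<in> carrier S" "d \<in> carrier S"
    and L_add: "L (f + g) = L f \<oplus> L g" and L_mult: "L (f * g) = L f \<otimes> L g"
    and L_const: "L (mconst z) = z \<odot>\<^bsub>S\<^esub> \<one>"
    and R_add: "R (f + g) = R f \<oplus> R g" and R_mult: "R (f * g) = R f \<otimes> R g"
    and R_const: "R (mconst z) = z \<odot>\<^bsub>S\<^esub> \<one>"
    and LR_comm: "L f \<otimes> R g = R g \<otimes> L f"
    and La: "L f \<otimes> a = a \<otimes> L (mshift 1 f)" and Ra: "R f \<otimes> a = a \<otimes> R (mshift 1 f)"
    and Lb: "L f \<otimes> b = b \<otimes> L (mshift 1 f)" and Rb: "R f \<otimes> b = b \<otimes> R (mshift (-1) f)"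
    and Lc: "L f \<otimes> c = c \<otimes> L (mshift (-1) f)" and Rc: "R f \<otimes> c = c \<otimes> R (mshift 1 f)"
    and Ld: "L f \<otimes> d = d \<otimes> L (mshift (-1) f)" and Rd: "R f \<otimes> d = d \<otimes> R (mshift (-1) f)"
    and ab: "a \<otimes> b = R (mshift (-1) phi) \<otimes> (b \<otimes> a)"
    and ac: "a \<otimes> c = L phi \<otimes> (c \<otimes> a)"
    and bd: "b \<otimes> d = L phi \<otimes> (d \<otimes> b)"
    and cd: "c \<otimes> d = R (mshift (-1) phi) \<otimes> (d \<otimes> c)"
begin

lemma L_1 [simp]: "L 1 = \<one>" and R_1 [simp]: "R 1 = \<one>"
  using L_const[of 1] R_const[of 1] by simp_all
lemma L_0 [simp]: "L 0 = \<zero>" and R_0 [simp]: "R 0 = \<zero>"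
  using L_const[of 0] R_const[of 0] by simp_all
lemma L_const_R: "L (mconst z) = R (mconst z)"
  by (simp add: L_const R_const)

lemma L_uminus: "L (- f) = \<ominus> L f"
  using L_add[of "- f" f] by (intro minus_equality[symmetric]) auto
lemma R_uminus: "R (- f) = \<ominus> R f"
  using R_add[of "- f" f] by (intro minus_equality[symmetric]) auto
lemma L_minus: "L (f - g) = L f \<ominus> L g"
  using L_add[of f "- g"] by (simp add: L_uminus a_minus_def)
lemma R_minus: "R (f - g) = R f \<ominus> R g"
  using R_add[of f "- g"] by (simp add: R_uminus a_minus_def)

lemma L_comm: "L f \<otimes> L g = L g \<otimes> L f" and R_comm: "R f \<otimes> R g = R g \<otimes> R f"
  by (simp_all flip: L_mult R_mult add: mult.commute)

lemma const_central: "x \<in> carrier S \<Longrightarrow> x \<otimes> R (mconst z) = R (mconst z) \<otimes> x"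
  by (simp add: R_const smult_mult_left smult_mult_right)

lemma aL: "a \<otimes> L f = L (mshift (-1) f) \<otimes> a" and aR: "a \<otimes> R f = R (mshift (-1) f) \<otimes> a"
  and bL: "b \<otimes> L f = L (mshift (-1) f) \<otimes> b" and bR: "b \<otimes> R f = R (mshift 1 f) \<otimes> b"
  and cL: "c \<otimes> L f = L (mshift 1 f) \<otimes> c" and cR: "c \<otimes> R f = R (mshift (-1) f) \<otimes> c"
  and dL: "d \<otimes> L f = L (mshift 1 f) \<otimes> d" and dR: "d \<otimes> R f = R (mshift 1 f) \<otimes> d"
  by (simp_all add: La Ra Lb Rb Lc Rc Ld Rd)

lemma R_prod: "x \<in> carrier S \<Longrightarrow> R f \<otimes> (R g \<otimes> x) = R (f * g) \<otimes> x"
  by (simp add: R_mult m_assoc)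
lemma L_prod: "x \<in> carrier S \<Longrightarrow> L f \<otimes> (L g \<otimes> x) = L (f * g) \<otimes> x"
  by (simp add: L_mult m_assoc)
lemma RL_left: "x \<in> carrier S \<Longrightarrow> R f \<otimes> (L g \<otimes> x) = L g \<otimes> (R f \<otimes> x)"
  by (simp add: LR_comm[symmetric] m_assoc[symmetric])

lemma LR_left: "x \<in> carrier S \<Longrightarrow> R g \<otimes> (L f \<otimes> x) = L f \<otimes> (R g \<otimes> x)"
  by (rule RL_left)

lemma push_left:
  assumes "x \<in> carrier S"
  shows "a \<otimes> (L f \<otimes> x) = L (mshift (-1) f) \<otimes> (a \<otimes> x)" "a \<otimes> (R f \<otimes> x) = R (mshift (-1) f) \<otimes> (a \<otimes> x)"
    "b \<otimes> (L f \<otimes> x) = L (mshift (-1) f) \<otimes> (b \<otimes> x)" "b \<otimes> (R f \<otimes> x) = R (mshift 1 f) \<otimes> (b \<otimes> x)"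
    "c \<otimes> (L f \<otimes> x) = L (mshift 1 f) \<otimes> (c \<otimes> x)" "c \<otimes> (R f \<otimes> x) = R (mshift (-1) f) \<otimes> (c \<otimes> x)"
    "d \<otimes> (L f \<otimes> x) = L (mshift 1 f) \<otimes> (d \<otimes> x)" "d \<otimes> (R f \<otimes> x) = R (mshift 1 f) \<otimes> (d \<otimes> x)"
  using assms by (simp_all add: aL aR bL bR cL cR dL dR flip: m_assoc)

definition H' :: 'b where "H' = L phi \<oplus> R phi \<ominus> L kappa"
definition I' :: 'b where "I' = L phi \<ominus> R phi"

lemma H'_closed [simp, intro]: "H' \<in> carrier S" and I'_closed [simp, intro]: "I' \<in> carrier S"
  by (simp_all add: H'_def I'_def)

definition qq :: mero where "qq = mconst (of_real (q - 1 / q))"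
lemmas phi_qq = phi_Vf[folded qq_def]

text \<open>UV = 1 + V in each variable amounts to (u v - 1)/((u - 1)(v - 1)) = 1 + 1/(u - 1) + 1/(v
  - 1), and \<open>phi\<close> is affine in 1/(u - 1).\<close>

lemma H_expr: "(of_real (q - 1 / q) \<odot>\<^bsub>S\<^esub> \<one>) \<otimes> (L Uf \<otimes> R Uf \<ominus> \<one>) \<otimes> L Vf \<otimes> R Vf = H'"
proof -
  have UV: "L Uf \<otimes> L Vf = \<one> \<oplus> L Vf" "R Uf \<otimes> R Vf = \<one> \<oplus> R Vf"
    by (simp_all add: Uf_Vf L_add R_add flip: L_mult R_mult)
  have LV: "L qq \<otimes> L Vf = L phi \<ominus> L (mconst (of_real q))"
    by (simp add: phi_qq L_add L_mult rs)
  have RV: "L qq \<otimes> R Vf = R phi \<ominus> L (mconst (of_real q))"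
    by (simp add: phi_qq R_add R_mult qq_def L_const_R rs)
  have k: "L qq = L (mconst (of_real q)) \<oplus> L (mconst (of_real q)) \<ominus> L kappa"
    unfolding L_add[symmetric] L_minus[symmetric]
    by (simp add: kappa_def qq_def flip: mconst_add mconst_diff)
  have "(L Uf \<otimes> R Uf \<ominus> \<one>) \<otimes> L Vf \<otimes> R Vf
      = L Uf \<otimes> (R Uf \<otimes> L Vf) \<otimes> R Vf \<ominus> L Vf \<otimes> R Vf"
    by (simp add: rs)
  also have "\<dots> = (L Uf \<otimes> L Vf) \<otimes> (R Uf \<otimes> R Vf) \<ominus> L Vf \<otimes> R Vf"
    by (simp add: m_assoc LR_left)
  also have "\<dots> = \<one> \<oplus> L Vf \<oplus> R Vf"
    unfolding UV by (simp add: rs)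
  finally have "L qq \<otimes> ((L Uf \<otimes> R Uf \<ominus> \<one>) \<otimes> L Vf \<otimes> R Vf) = L qq \<oplus> L qq \<otimes> L Vf \<oplus> L qq \<otimes> R Vf"
    by (simp add: rs)
  also have "\<dots> = H'"
    unfolding LV RV unfolding k H'_def by (simp add: rs)
  finally show ?thesis by (simp add: L_const m_assoc qq_def)
qed

text \<open>Here (v - u)/((u - 1)(v - 1)) = 1/(u - 1) - 1/(v - 1), and the constant term of
  \<open>phi\<close> drops out of the difference.\<close>

lemma I_expr: "(of_real (q - 1 / q) \<odot>\<^bsub>S\<^esub> \<one>) \<otimes> (R Uf \<ominus> L Uf) \<otimes> L Vf \<otimes> R Vf = I'"
proof -
  have UV: "L Uf \<otimes> L Vf = \<one> \<oplus> L Vf" "R Uf \<otimes> R Vf = \<one> \<oplus> R Vf"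
    by (simp_all add: Uf_Vf L_add R_add flip: L_mult R_mult)
  have LV: "L qq \<otimes> L Vf = L phi \<ominus> L (mconst (of_real q))"
    by (simp add: phi_qq L_add L_mult rs)
  have RV: "L qq \<otimes> R Vf = R phi \<ominus> L (mconst (of_real q))"
    by (simp add: phi_qq R_add R_mult qq_def L_const_R rs)
  have "(R Uf \<ominus> L Uf) \<otimes> L Vf \<otimes> R Vf
      = (R Uf \<otimes> L Vf) \<otimes> R Vf \<ominus> (L Uf \<otimes> L Vf) \<otimes> R Vf"
    by (simp add: rs)
  also have "\<dots> = L Vf \<otimes> (R Uf \<otimes> R Vf) \<ominus> (L Uf \<otimes> L Vf) \<otimes> R Vf"
    by (simp add: m_assoc LR_left)
  also have "\<dots> = L Vf \<ominus> R Vf"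
    unfolding UV by (simp add: rs)
  finally have e: "(R Uf \<ominus> L Uf) \<otimes> L Vf \<otimes> R Vf = L Vf \<ominus> R Vf" .
  have "L qq \<otimes> ((R Uf \<ominus> L Uf) \<otimes> L Vf \<otimes> R Vf) = L qq \<otimes> L Vf \<ominus> L qq \<otimes> R Vf"
    unfolding e by (simp add: rs)
  also have "\<dots> = I'"
    unfolding LV RV I'_def by (simp add: rs)
  finally show ?thesis by (simp add: L_const m_assoc qq_def)
qed

lemma L_kappa: "L kappa = R kappa"
  by (simp add: kappa_def L_const_R)

lemma RR: "R phi \<otimes> R kappa = R kappa \<otimes> R phi"
  "x \<in> carrier S \<Longrightarrow> R phi \<otimes> (R kappa \<otimes> x) = R kappa \<otimes> (R phi \<otimes> x)"
  by (simp_all add: R_comm[of phi kappa] m_assoc[symmetric])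

lemma Gf_L: "L Gf = R kappa \<otimes> L phi \<ominus> L phi \<otimes> L phi"
  unfolding Gf_phi by (simp add: right_diff_distrib mult.commute L_minus L_mult L_kappa)

lemma Gf_R: "R Gf = R kappa \<otimes> R phi \<ominus> R phi \<otimes> R phi"
  unfolding Gf_phi by (simp add: right_diff_distrib mult.commute R_minus R_mult)

end

text \<open>The remaining relations solved for \<alpha>\<delta>, \<delta>\<alpha> and
  \<beta>\<gamma> in terms of \<gamma>\<beta>. As oriented rules they let every relation of the
  presentation be verified by rewriting.\<close>

locale sl2_data = sl2_base +
  assumes ad: "a \<otimes> d = \<one> \<oplus> L phi \<otimes> (c \<otimes> b)"
    and da: "d \<otimes> a = \<one> \<oplus> R (kappa - phi) \<otimes> (c \<otimes> b)"
    and bc: "b \<otimes> c = L phi \<otimes> (R (kappa - phi) \<otimes> (c \<otimes> b)) \<oplus> (L phi \<ominus> R phi)"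
begin

lemma rel_ad_da: "a \<otimes> d \<ominus> d \<otimes> a = H' \<otimes> c \<otimes> b"
  unfolding ad da H'_def L_kappa R_minus by (simp add: rs LR_left RR LR_comm[symmetric])

lemma rel_det: "a \<otimes> d \<ominus> L phi \<otimes> c \<otimes> b = \<one>"
  unfolding ad by (simp add: rs)

lemma rel_bc2: "b \<otimes> c \<ominus> L Gf \<otimes> c \<otimes> b = I' \<otimes> a \<otimes> d"
  unfolding I'_def Gf_L by (simp add: bc ad R_minus rs LR_left RR LR_comm[symmetric])

lemma rel_bc1: "b \<otimes> c \<ominus> R Gf \<otimes> c \<otimes> b = I' \<otimes> d \<otimes> a"
  unfolding I'_def Gf_R by (simp add: bc da R_minus rs LR_left RR LR_comm[symmetric])

lemma rel_G: "R Gf \<otimes> a \<otimes> d \<ominus> L Gf \<otimes> d \<otimes> a = H' \<otimes> b \<otimes> c"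
  unfolding H'_def Gf_R Gf_L L_kappa
  by (simp add: bc ad da R_minus rs LR_left RR LR_comm[symmetric])

end

text \<open>The equations are solved in turn: \<open>3\<close> gives ad, with it \<open>1\<close>
  gives da, and \<open>2\<close> gives bc.\<close>

lemma (in sl2_base) sl2_dataI:
  assumes 1: "a \<otimes> d \<ominus> d \<otimes> a = H' \<otimes> c \<otimes> b"
    and 2: "b \<otimes> c \<ominus> L Gf \<otimes> c \<otimes> b = I' \<otimes> a \<otimes> d"
    and 3: "a \<otimes> d \<ominus> L phi \<otimes> c \<otimes> b = \<one>"
  shows "sl2_data q S L R a b c d"
proof unfold_locales
  have ad: "a \<otimes> d = (a \<otimes> d \<ominus> L phi \<otimes> c \<otimes> b) \<oplus> L phi \<otimes> (c \<otimes> b)"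
    by (simp add: rs)
  then show ad: "a \<otimes> d = \<one> \<oplus> L phi \<otimes> (c \<otimes> b)" unfolding 3 .
  have "d \<otimes> a = a \<otimes> d \<ominus> H' \<otimes> c \<otimes> b"
    unfolding 1[symmetric] by (simp add: rs)
  also have "\<dots> = \<one> \<oplus> R (kappa - phi) \<otimes> (c \<otimes> b)"
    unfolding ad H'_def L_kappa R_minus by (simp add: rs)
  finally show "d \<otimes> a = \<one> \<oplus> R (kappa - phi) \<otimes> (c \<otimes> b)" .
  have "b \<otimes> c = (b \<otimes> c \<ominus> L Gf \<otimes> c \<otimes> b) \<oplus> L Gf \<otimes> (c \<otimes> b)"
    by (simp add: rs)
  also have "\<dots> = I' \<otimes> (\<one> \<oplus> L phi \<otimes> (c \<otimes> b)) \<oplus> L Gf \<otimes> (c \<otimes> b)"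
    unfolding 2 by (simp add: m_assoc ad)
  finally have bc: "b \<otimes> c = I' \<otimes> (\<one> \<oplus> L phi \<otimes> (c \<otimes> b)) \<oplus> L Gf \<otimes> (c \<otimes> b)" .
  show "b \<otimes> c = L phi \<otimes> (R (kappa - phi) \<otimes> (c \<otimes> b)) \<oplus> (L phi \<ominus> R phi)"
    unfolding bc I'_def Gf_L R_minus by (simp add: rs LR_left RR LR_comm[symmetric])
qed

context q_param
begin

definition LA :: "mero \<Rightarrow> sl2" where "LA f = cls (fl (mval f))"
definition RA :: "mero \<Rightarrow> sl2" where "RA f = cls (fr (mval f))"

lemma lmom_SL: "lmom SL (mval f) = LA f" and rmom_SL: "rmom SL (mval f) = RA f"
  by (simp_all add: LA_def RA_def SL2_simps)

lemma mult_cls: "x \<in> carrier free_alg \<Longrightarrow> y \<in> carrier free_alg \<Longrightarrow> cls x \<otimes>\<^bsub>SL\<^esub> cls y = cls (x \<star> y)"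
  by simp

lemma fgen_closed [simp]: "fa \<in> carrier free_alg" "fb \<in> carrier free_alg" "fc \<in> carrier free_alg"
  "fd \<in> carrier free_alg" "fl (mval f) \<in> carrier free_alg" "fr (mval f) \<in> carrier free_alg"
  by simp_all

lemma fun_mval: "Ffun q = mval Ff" "Gfun q = mval Gf" "Ufun q = mval Uf" "Vfun q = mval Vf"
  by (simp_all add: mval_Ff mval_Gf mval_Uf mval_Vf)

sublocale A: sl2_base q SL LA RA "alpha q" "beta q" "gamma q" "delta q"
proof unfold_locales
  fix f g :: mero and z
  note defs = LA_def RA_def alpha_def beta_def gamma_def delta_def
  note mc = mval_in_carrier
  show "LA f \<in> carrier SL" "RA f \<in> carrier SL" "alpha q \<in> carrier SL" "beta q \<in> carrier SL"
      "gamma q \<in> carrier SL" "delta q \<in> carrier SL"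
    unfolding defs by (intro cls.closed fgen_closed)+
  show "LA (f + g) = LA f \<oplus>\<^bsub>SL\<^esub> LA g"
    using cls_rel[OF sl2_rel.intros(1)[OF mc mc, of q f g]] by (simp add: defs cls_plus)
  show "LA (f * g) = LA f \<otimes>\<^bsub>SL\<^esub> LA g"
    using cls_rel[OF sl2_rel.intros(2)[OF mc mc, of q f g]] by (simp add: defs mult_cls del: cls.mult)
  show "LA (mconst z) = z \<odot>\<^bsub>SL\<^esub> \<one>\<^bsub>SL\<^esub>"
    using cls_rel[OF sl2_rel.intros(3)[OF mc, of q z 1]] cls_rel[OF sl2_rel.intros(4)[of q]]
    by (simp add: defs Mero_one cls_scal A.smult_mult_left del: F.single_mult)
  show "RA (f + g) = RA f \<oplus>\<^bsub>SL\<^esub> RA g"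
    using cls_rel[OF sl2_rel.intros(5)[OF mc mc, of q f g]] by (simp add: defs cls_plus)
  show "RA (f * g) = RA f \<otimes>\<^bsub>SL\<^esub> RA g"
    using cls_rel[OF sl2_rel.intros(6)[OF mc mc, of q f g]] by (simp add: defs mult_cls del: cls.mult)
  show "RA (mconst z) = z \<odot>\<^bsub>SL\<^esub> \<one>\<^bsub>SL\<^esub>"
    using cls_rel[OF sl2_rel.intros(7)[OF mc, of q z 1]] cls_rel[OF sl2_rel.intros(8)[of q]]
    by (simp add: defs Mero_one cls_scal A.smult_mult_left del: F.single_mult)
  show "LA f \<otimes>\<^bsub>SL\<^esub> RA g = RA g \<otimes>\<^bsub>SL\<^esub> LA f"
    using cls_rel[OF sl2_rel.intros(9)[OF mc mc, of q f g]] by (simp add: defs mult_cls del: cls.mult)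
  show "LA f \<otimes>\<^bsub>SL\<^esub> alpha q = alpha q \<otimes>\<^bsub>SL\<^esub> LA (mshift 1 f)"
    using cls_rel[OF sl2_rel.intros(10)[OF mc, of q f]] by (simp add: defs mult_cls del: cls.mult)
  show "RA f \<otimes>\<^bsub>SL\<^esub> alpha q = alpha q \<otimes>\<^bsub>SL\<^esub> RA (mshift 1 f)"
    using cls_rel[OF sl2_rel.intros(11)[OF mc, of q f]] by (simp add: defs mult_cls del: cls.mult)
  show "LA f \<otimes>\<^bsub>SL\<^esub> beta q = beta q \<otimes>\<^bsub>SL\<^esub> LA (mshift 1 f)"
    using cls_rel[OF sl2_rel.intros(12)[OF mc, of q f]] by (simp add: defs mult_cls del: cls.mult)
  show "RA f \<otimes>\<^bsub>SL\<^esub> beta q = beta q \<otimes>\<^bsub>SL\<^esub> RA (mshift (-1) f)"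
    using cls_rel[OF sl2_rel.intros(13)[OF mc, of q f]] by (simp add: defs mult_cls del: cls.mult)
  show "LA f \<otimes>\<^bsub>SL\<^esub> gamma q = gamma q \<otimes>\<^bsub>SL\<^esub> LA (mshift (-1) f)"
    using cls_rel[OF sl2_rel.intros(14)[OF mc, of q f]] by (simp add: defs mult_cls del: cls.mult)
  show "RA f \<otimes>\<^bsub>SL\<^esub> gamma q = gamma q \<otimes>\<^bsub>SL\<^esub> RA (mshift 1 f)"
    using cls_rel[OF sl2_rel.intros(15)[OF mc, of q f]] by (simp add: defs mult_cls del: cls.mult)
  show "LA f \<otimes>\<^bsub>SL\<^esub> delta q = delta q \<otimes>\<^bsub>SL\<^esub> LA (mshift (-1) f)"
    using cls_rel[OF sl2_rel.intros(16)[OF mc, of q f]] by (simp add: defs mult_cls del: cls.mult)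
  show "RA f \<otimes>\<^bsub>SL\<^esub> delta q = delta q \<otimes>\<^bsub>SL\<^esub> RA (mshift (-1) f)"
    using cls_rel[OF sl2_rel.intros(17)[OF mc, of q f]] by (simp add: defs mult_cls del: cls.mult)
  have phi: "LA phi = cls (fscal (of_real q) \<star> fl (mval Ff))"
    using cls_rel[OF sl2_rel.intros(3)[OF mc, of q "of_real q" Ff]] by (simp add: LA_def phi_Ff)
  have phis: "RA (mshift (-1) phi) = cls (fscal (of_real q) \<star> fr (mval (mshift (-1) Ff)))"
    using cls_rel[OF sl2_rel.intros(7)[OF mc, of q "of_real q" "mshift (-1) Ff"]] by (simp add: RA_def phi_Ff)
  show "alpha q \<otimes>\<^bsub>SL\<^esub> beta q = RA (mshift (-1) phi) \<otimes>\<^bsub>SL\<^esub> (beta q \<otimes>\<^bsub>SL\<^esub> alpha q)"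
    using cls_rel[OF sl2_rel.intros(18)[of q]] unfolding phis unfolding fun_mval shift_mval defs
    by (simp add: A.m_assoc del: F.single_mult)
  show "alpha q \<otimes>\<^bsub>SL\<^esub> gamma q = LA phi \<otimes>\<^bsub>SL\<^esub> (gamma q \<otimes>\<^bsub>SL\<^esub> alpha q)"
    using cls_rel[OF sl2_rel.intros(19)[of q]] unfolding phi unfolding fun_mval shift_mval defs
    by (simp add: A.m_assoc del: F.single_mult)
  show "beta q \<otimes>\<^bsub>SL\<^esub> delta q = LA phi \<otimes>\<^bsub>SL\<^esub> (delta q \<otimes>\<^bsub>SL\<^esub> beta q)"
    using cls_rel[OF sl2_rel.intros(20)[of q]] unfolding phi unfolding fun_mval shift_mval defs
    by (simp add: A.m_assoc del: F.single_mult)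
  show "gamma q \<otimes>\<^bsub>SL\<^esub> delta q = RA (mshift (-1) phi) \<otimes>\<^bsub>SL\<^esub> (delta q \<otimes>\<^bsub>SL\<^esub> gamma q)"
    using cls_rel[OF sl2_rel.intros(21)[of q]] unfolding phis unfolding fun_mval shift_mval defs
    by (simp add: A.m_assoc del: F.single_mult)
qed

lemma cls_fH: "cls (fH q) = A.H'" and cls_fI: "cls (fI q) = A.I'"
  unfolding A.H_expr[symmetric] A.I_expr[symmetric] fH_def fI_def fun_mval LA_def RA_def
  by (simp_all add: cls_minus cls_scal del: F.single_mult)

lemma SL_sl2_data: "sl2_data q SL LA RA (alpha q) (beta q) (gamma q) (delta q)"
proof (rule A.sl2_dataI)
  note defs = LA_def RA_def alpha_def beta_def gamma_def delta_def
  have phi: "LA phi = cls (fscal (of_real q) \<star> fl (mval Ff))"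
    using cls_rel[OF sl2_rel.intros(3)[OF mval_in_carrier, of q "of_real q" Ff]] by (simp add: LA_def phi_Ff)
  note [simp] = fH_fI_closed[unfolded free_alg_def, folded free_alg_def]
  show "alpha q \<otimes>\<^bsub>SL\<^esub> delta q \<ominus>\<^bsub>SL\<^esub> delta q \<otimes>\<^bsub>SL\<^esub> alpha q = A.H' \<otimes>\<^bsub>SL\<^esub> gamma q \<otimes>\<^bsub>SL\<^esub> beta q"
    using cls_rel[OF sl2_rel.intros(22)[of q]] unfolding cls_fH[symmetric] defs
    by (simp add: cls_minus del: F.single_mult)
  show "beta q \<otimes>\<^bsub>SL\<^esub> gamma q \<ominus>\<^bsub>SL\<^esub> LA Gf \<otimes>\<^bsub>SL\<^esub> gamma q \<otimes>\<^bsub>SL\<^esub> beta q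
      = A.I' \<otimes>\<^bsub>SL\<^esub> alpha q \<otimes>\<^bsub>SL\<^esub> delta q"
    using cls_rel[OF sl2_rel.intros(25)[of q]] unfolding cls_fI[symmetric] defs fun_mval
    by (simp add: cls_minus del: F.single_mult)
  show "alpha q \<otimes>\<^bsub>SL\<^esub> delta q \<ominus>\<^bsub>SL\<^esub> LA phi \<otimes>\<^bsub>SL\<^esub> gamma q \<otimes>\<^bsub>SL\<^esub> beta q = \<one>\<^bsub>SL\<^esub>"
    using cls_rel[OF sl2_rel.intros(26)[of q]] unfolding phi unfolding defs fun_mval
    by (simp add: cls_minus cls_scal del: F.single_mult)
qed

end

sublocale q_param \<subseteq> A: sl2_data q "SL2 q" LA RA "alpha q" "beta q" "gamma q" "delta q"
  by (rule SL_sl2_data)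

context q_param
begin

text \<open>The form of the universal property that serves the model, the coproduct and the counit
  alike: a homomorphism costs one instance of the locale.\<close>

lemma SL2_universal_data:
  assumes "sl2_data q S L R a b c d"
  shows "\<exists>\<phi>\<in>alg_hom SL S. \<phi> (alpha q) = a \<and> \<phi> (beta q) = b \<and> \<phi> (gamma q) = c \<and> \<phi> (delta q) = d
    \<and> (\<forall>f. \<phi> (LA f) = L f) \<and> (\<forall>f. \<phi> (RA f) = R f)"
proof -
  interpret S: sl2_data q S L R a b c d by fact
  define \<theta> where "\<theta> g = (case g of GenA \<Rightarrow> a | GenB \<Rightarrow> b | GenC \<Rightarrow> c | GenD \<Rightarrow> d
    | GenL f \<Rightarrow> L (mero_of f) | GenR f \<Rightarrow> R (mero_of f))" for g
  have "\<exists>\<phi>\<in>alg_hom SL S. \<forall>g\<in>generators. \<phi> (cls (fgen g)) = \<theta> g"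
  proof (rule SL2_universal[OF S.calg_axioms])
    show "\<theta> g \<in> carrier S" for g by (cases g) (auto simp: \<theta>_def)
    fix h x y assume h: "h \<in> alg_hom free_alg S" and hg: "\<And>g. g \<in> generators \<Longrightarrow> h (fgen g) = \<theta> g"
      and r: "sl2_rel q x y"
    interpret h: calg_hom free_alg S h
      using h F.calg_axioms S.calg_axioms by (simp add: calg_hom_def calg_hom_axioms_def)
    have g: "h fa = a" "h fb = b" "h fc = c" "h fd = d" "h (fl (mval f)) = L f" "h (fr (mval f)) = R f" for f
      by (simp_all add: hg, simp_all add: \<theta>_def mval_inverse)
    have sc: "h (fscal z) = z \<odot>\<^bsub>S\<^esub> \<one>\<^bsub>S\<^esub>" for z
    proof -
      have "fscal z = z \<odot>\<^bsub>free_alg\<^esub> \<one>\<^bsub>free_alg\<^esub>" by (simp add: F.simps)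
      then show ?thesis by simp
    qed
    have pl: "h (x + y) = h x \<oplus>\<^bsub>S\<^esub> h y" "h (x - y) = h x \<ominus>\<^bsub>S\<^esub> h y"
      if "x \<in> carrier free_alg" "y \<in> carrier free_alg" for x y
      using that by (simp_all add: plus_free_alg F.minus)
    have FL: "(of_real q \<odot>\<^bsub>S\<^esub> \<one>\<^bsub>S\<^esub>) \<otimes>\<^bsub>S\<^esub> L Ff = L phi"
      "(of_real q \<odot>\<^bsub>S\<^esub> \<one>\<^bsub>S\<^esub>) \<otimes>\<^bsub>S\<^esub> R (mshift (-1) Ff) = R (mshift (-1) phi)"
      by (simp_all add: phi_Ff S.L_mult S.R_mult S.L_const S.R_const)
    have HI: "h (fH q) = S.H'" "h (fI q) = S.I'"
      unfolding S.H_expr[symmetric] S.I_expr[symmetric] fH_def fI_def fun_mval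
      by (simp_all add: pl g sc del: F.single_mult)
    note hs = g sc pl HI FL fun_mval
    from r show "h x = h y"
    proof cases
      case (1 f g)
      then show ?thesis by (auto simp: carrier_Mero hs S.L_add)
    next
      case (2 f g)
      then show ?thesis by (auto simp: carrier_Mero hs S.L_mult simp del: F.single_mult)
    next
      case (3 f z)
      then show ?thesis by (auto simp: carrier_Mero hs S.L_mult S.L_const simp del: F.single_mult)
    next
      case 4
      then show ?thesis by (auto simp: Mero_one hs)
    next
      case (5 f g)
      then show ?thesis by (auto simp: carrier_Mero hs S.R_add)
    next
      case (6 f g)
      then show ?thesis by (auto simp: carrier_Mero hs S.R_mult simp del: F.single_mult)
    next
      case (7 f z)
      then show ?thesis by (auto simp: carrier_Mero hs S.R_mult S.R_const simp del: F.single_mult)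
    next
      case 8
      then show ?thesis by (auto simp: Mero_one hs)
    next
      case (9 f g)
      then show ?thesis by (auto simp: carrier_Mero hs S.LR_comm simp del: F.single_mult)
    next
      case (10 f)
      then show ?thesis by (auto simp: carrier_Mero hs S.La simp del: F.single_mult)
    next
      case (11 f)
      then show ?thesis by (auto simp: carrier_Mero hs S.Ra simp del: F.single_mult)
    next
      case (12 f)
      then show ?thesis by (auto simp: carrier_Mero hs S.Lb simp del: F.single_mult)
    next
      case (13 f)
      then show ?thesis by (auto simp: carrier_Mero hs S.Rb simp del: F.single_mult)
    next
      case (14 f)
      then show ?thesis by (auto simp: carrier_Mero hs S.Lc simp del: F.single_mult)
    next
      case (15 f)
      then show ?thesis by (auto simp: carrier_Mero hs S.Rc simp del: F.single_mult)
    next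
      case (16 f)
      then show ?thesis by (auto simp: carrier_Mero hs S.Ld simp del: F.single_mult)
    next
      case (17 f)
      then show ?thesis by (auto simp: carrier_Mero hs S.Rd simp del: F.single_mult)
    next
      case 18
      then show ?thesis by (simp add: hs S.ab S.m_assoc del: F.single_mult)
    next
      case 19
      then show ?thesis by (simp add: hs S.ac S.m_assoc del: F.single_mult)
    next
      case 20
      then show ?thesis by (simp add: hs S.bd S.m_assoc del: F.single_mult)
    next
      case 21
      then show ?thesis by (simp add: hs S.cd S.m_assoc del: F.single_mult)
    next
      case 22
      then show ?thesis by (simp add: hs S.rel_ad_da del: F.single_mult)
    next
      case 23
      then show ?thesis by (simp add: hs S.rel_G del: F.single_mult)
    next
      case 24
      then show ?thesis by (simp add: hs S.rel_bc1 del: F.single_mult)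
    next
      case 25
      then show ?thesis by (simp add: hs S.rel_bc2 del: F.single_mult)
    next
      case 26
      then show ?thesis by (simp add: hs S.rel_det del: F.single_mult)
    qed
  qed
  then obtain \<phi> where "\<phi> \<in> alg_hom SL S" and \<phi>: "\<And>g. g \<in> generators \<Longrightarrow> \<phi> (cls (fgen g)) = \<theta> g" by blast
  then show ?thesis
    by (intro bexI[of _ \<phi>])
      (simp_all add: alpha_def beta_def gamma_def delta_def LA_def RA_def \<phi>, simp_all add: \<theta>_def mval_inverse)
qed

lemma SL_induct [consumes 1, case_names one alpha beta gamma delta L R add smult]:
  assumes "x \<in> carrier SL" "P \<one>\<^bsub>SL\<^esub>"
    and "\<And>x. x \<in> carrier SL \<Longrightarrow> P x \<Longrightarrow> P (alpha q \<otimes>\<^bsub>SL\<^esub> x)"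
    and "\<And>x. x \<in> carrier SL \<Longrightarrow> P x \<Longrightarrow> P (beta q \<otimes>\<^bsub>SL\<^esub> x)"
    and "\<And>x. x \<in> carrier SL \<Longrightarrow> P x \<Longrightarrow> P (gamma q \<otimes>\<^bsub>SL\<^esub> x)"
    and "\<And>x. x \<in> carrier SL \<Longrightarrow> P x \<Longrightarrow> P (delta q \<otimes>\<^bsub>SL\<^esub> x)"
    and "\<And>f x. x \<in> carrier SL \<Longrightarrow> P x \<Longrightarrow> P (LA f \<otimes>\<^bsub>SL\<^esub> x)"
    and "\<And>f x. x \<in> carrier SL \<Longrightarrow> P x \<Longrightarrow> P (RA f \<otimes>\<^bsub>SL\<^esub> x)"
    and "\<And>x y. x \<in> carrier SL \<Longrightarrow> y \<in> carrier SL \<Longrightarrow> P x \<Longrightarrow> P y \<Longrightarrow> P (x \<oplus>\<^bsub>SL\<^esub> y)"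
    and "\<And>x z. x \<in> carrier SL \<Longrightarrow> P x \<Longrightarrow> P (z \<odot>\<^bsub>SL\<^esub> x)"
  shows "P x"
  using assms(1,2)
proof (induction x rule: word_induct)
  case (gen g x)
  from \<open>g \<in> generators\<close> show ?case
    using gen assms(3-8)[of x] assms(7,8)[of x]
    unfolding generators_def carrier_Mero alpha_def beta_def gamma_def delta_def LA_def RA_def by auto
qed (use assms in auto)

lemma alg_hom_eqI:
  assumes S: "calg S" and "\<phi> \<in> alg_hom SL S" "\<psi> \<in> alg_hom SL S"
    and "\<phi> (alpha q) = \<psi> (alpha q)" "\<phi> (beta q) = \<psi> (beta q)" "\<phi> (gamma q) = \<psi> (gamma q)"
      "\<phi> (delta q) = \<psi> (delta q)" "\<And>f. \<phi> (LA f) = \<psi> (LA f)" "\<And>f. \<phi> (RA f) = \<psi> (RA f)"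
    and "x \<in> carrier SL"
  shows "\<phi> x = \<psi> x"
proof -
  interpret \<phi>: calg_hom SL S \<phi>
    using assms(1,2) A.calg_axioms by (simp add: calg_hom_def calg_hom_axioms_def)
  interpret \<psi>: calg_hom SL S \<psi>
    using assms(1,3) A.calg_axioms by (simp add: calg_hom_def calg_hom_axioms_def)
  from \<open>x \<in> carrier SL\<close> show ?thesis
    by (induction x rule: SL_induct) (simp_all add: assms)
qed

end

section \<open>Matrix elements\<close>

context q_param
begin

text \<open>For m \<ge> 0 this is the product \<phi>(\<lambda>)\<phi>(\<lambda> +
  1)...\<phi>(\<lambda> + m - 1), which appears when \<alpha> is moved past \<gamma>^m, see
  \<open>al_ga_pow\<close>.\<close>

definition Phi :: "int \<Rightarrow> mero" where "Phi m = br (of_int m + 1) / br 1"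

lemma Phi_nonzero [simp]: "Phi m \<noteq> 0" by (simp add: Phi_def)
lemma Phi_0 [simp]: "Phi 0 = 1" by (simp add: Phi_def)

lemma Phi_rec: "Phi (m + 1) = phi * mshift 1 (Phi m)"
  by (simp add: Phi_def phi_def add_ac)

lemma Phi_shift: "mshift (-1) (Phi (m + 1)) = mshift (-1) phi * Phi m"
  by (simp add: Phi_rec)

text \<open>The coefficient equation behind \<open>solve_step\<close>. Since
  \<open>kappa - phi\<close> is [\<lambda>]/[\<lambda> + 1], it reduces to
  \<open>qn_br_identity\<close>.\<close>

lemma Phi_identity:
  "(kappa - phi) * qn n - Phi (n - j - 1) * qn j + qn (j + 1) * Phi (n - j) = qn (n + 1)"
proof -
  have "kappa - phi = br 0 / br 1"
    using br_recurrence[of 1] by (simp add: phi_def field_simps)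
  then show ?thesis
    unfolding Phi_def using qn_br_identity[of n j] by (simp only:) (simp add: field_simps)
qed

end

context sl2_data
begin

text \<open>The relations as rules that still apply in front of a further factor x, as needed for
  products nested to the right.\<close>

lemma push_rel:
  assumes "x \<in> carrier S"
  shows "a \<otimes> (b \<otimes> x) = R (mshift (-1) phi) \<otimes> (b \<otimes> (a \<otimes> x))"
    "a \<otimes> (c \<otimes> x) = L phi \<otimes> (c \<otimes> (a \<otimes> x))"
    "b \<otimes> (d \<otimes> x) = L phi \<otimes> (d \<otimes> (b \<otimes> x))"
    "c \<otimes> (d \<otimes> x) = R (mshift (-1) phi) \<otimes> (d \<otimes> (c \<otimes> x))"
    "a \<otimes> (d \<otimes> x) = x \<oplus> L phi \<otimes> (c \<otimes> (b \<otimes> x))"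
    "d \<otimes> (a \<otimes> x) = x \<oplus> R (kappa - phi) \<otimes> (c \<otimes> (b \<otimes> x))"
    "b \<otimes> (c \<otimes> x) = L phi \<otimes> (R (kappa - phi) \<otimes> (c \<otimes> (b \<otimes> x))) \<oplus> (L phi \<ominus> R phi) \<otimes> x"
proof -
  have "a \<otimes> (b \<otimes> x) = (a \<otimes> b) \<otimes> x" "a \<otimes> (c \<otimes> x) = (a \<otimes> c) \<otimes> x" "b \<otimes> (d \<otimes> x) = (b \<otimes> d) \<otimes> x"
    "c \<otimes> (d \<otimes> x) = (c \<otimes> d) \<otimes> x" "a \<otimes> (d \<otimes> x) = (a \<otimes> d) \<otimes> x" "d \<otimes> (a \<otimes> x) = (d \<otimes> a) \<otimes> x"
    "b \<otimes> (c \<otimes> x) = (b \<otimes> c) \<otimes> x"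
    using assms by (simp_all add: m_assoc)
  note this[unfolded ab ac bd cd ad da bc]
  with assms show "a \<otimes> (b \<otimes> x) = R (mshift (-1) phi) \<otimes> (b \<otimes> (a \<otimes> x))"
    "a \<otimes> (c \<otimes> x) = L phi \<otimes> (c \<otimes> (a \<otimes> x))"
    "b \<otimes> (d \<otimes> x) = L phi \<otimes> (d \<otimes> (b \<otimes> x))"
    "c \<otimes> (d \<otimes> x) = R (mshift (-1) phi) \<otimes> (d \<otimes> (c \<otimes> x))"
    "a \<otimes> (d \<otimes> x) = x \<oplus> L phi \<otimes> (c \<otimes> (b \<otimes> x))"
    "d \<otimes> (a \<otimes> x) = x \<oplus> R (kappa - phi) \<otimes> (c \<otimes> (b \<otimes> x))"
    "b \<otimes> (c \<otimes> x) = L phi \<otimes> (R (kappa - phi) \<otimes> (c \<otimes> (b \<otimes> x))) \<oplus> (L phi \<ominus> R phi) \<otimes> x"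
    by (simp_all add: m_assoc l_distr)
qed

lemma L_left:
  assumes "x \<in> carrier S"
  shows "L f \<otimes> (L g \<otimes> x) = L g \<otimes> (L f \<otimes> x)"
  unfolding L_prod[OF assms] mult.commute[of f g] ..

lemma R_left:
  assumes "x \<in> carrier S"
  shows "R f \<otimes> (R g \<otimes> x) = R g \<otimes> (R f \<otimes> x)"
  unfolding R_prod[OF assms] mult.commute[of f g] ..

lemmas normalize = rs push_left push_rel L_mult R_mult R_minus LR_left L_left R_left

text \<open>Moment maps send nonzero functions to units, because the inverse function is again
  meromorphic.\<close>

lemma R_cancel:
  assumes "f \<noteq> 0" "x \<in> carrier S" "y \<in> carrier S" "R f \<otimes> x = R f \<otimes> y"
  shows "x = y"
proof -
  have "R (inverse f) \<otimes> (R f \<otimes> x) = R (inverse f) \<otimes> (R f \<otimes> y)" unfolding assms(4) ..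
  then show ?thesis unfolding R_prod[OF assms(2)] R_prod[OF assms(3)] using assms(1-3) by simp
qed

text \<open>The matrix elements, with integer indices so that boundary terms vanish by themselves.
  Expanding \<open>\<Delta>(\<gamma> x)\<close> and \<open>\<Delta>(\<alpha> x)\<close> for \<open>x = \<gamma>^(n-k) \<alpha>^k\<close> explains the two recursions.\<close>

primrec tm :: "nat \<Rightarrow> int \<Rightarrow> int \<Rightarrow> 'a" where
  "tm 0 k j = (if k = 0 \<and> j = 0 then \<one> else \<zero>)"
| "tm (Suc n) k j = (if k = int n + 1
     then b \<otimes> tm n (int n) j \<oplus> R (Phi (int n + 1 - j)) \<otimes> (a \<otimes> tm n (int n) (j - 1))
     else d \<otimes> tm n k j \<oplus> R (Phi (int n + 1 - j)) \<otimes> (c \<otimes> tm n k (j - 1)))"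

declare tm.simps(2) [simp del]

text \<open>t^(n-1)_kj with the convention that t^(-1) vanishes; it is the lower term of the
  multiplication formulas \<open>c_tm\<close> and \<open>ba_step\<close>.\<close>

definition tlow :: "nat \<Rightarrow> int \<Rightarrow> int \<Rightarrow> 'a" where
  "tlow n k j = (case n of 0 \<Rightarrow> \<zero> | Suc m \<Rightarrow> tm m k j)"

lemma tlow_simps [simp]: "tlow 0 k j = \<zero>" "tlow (Suc n) k j = tm n k j"
  by (simp_all add: tlow_def)

lemma tm_closed [simp, intro]: "tm n k j \<in> carrier S"
  by (induction n arbitrary: k j) (simp_all add: tm.simps(2))
lemma tlow_closed [simp, intro]: "tlow n k j \<in> carrier S"
  by (cases n) simp_all

lemma tm_eq_0: "k < 0 \<or> k > int n \<or> j < 0 \<or> j > int n \<Longrightarrow> tm n k j = \<zero>"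
proof (induction n arbitrary: k j)
  case (Suc n)
  have "int n + 1 - j = int n - j + 1" by simp
  from Suc.prems show ?case
    unfolding tm.simps(2)
    by (cases "k = int n + 1") (auto simp: Suc.IH)
qed auto

lemma tm_row_d: "k \<le> int n \<Longrightarrow>
  tm (Suc n) k j = d \<otimes> tm n k j \<oplus> R (Phi (int n + 1 - j)) \<otimes> (c \<otimes> tm n k (j - 1))"
  by (simp add: tm.simps(2))

text \<open>The inductive step of \<open>tm_row_b\<close> freed from indices: s0, s1, s2 stand for
  entries of level n and t1, t2 for entries of level n + 1. Besides the relations only the shift
  rule for \<open>Phi\<close> enters, through Q.\<close>

lemma E2_step:
  assumes cl: "s0 \<in> carrier S" "s1 \<in> carrier S" "s2 \<in> carrier S" "t1 \<in> carrier S" "t2 \<in> carrier S"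
    and Q: "Q = phi * mshift 1 P"
    and t1: "L W \<otimes> t1 = b \<otimes> s0 \<oplus> R P \<otimes> (a \<otimes> s1)"
    and t2: "L W \<otimes> t2 = b \<otimes> s1 \<oplus> R Q \<otimes> (a \<otimes> s2)"
  shows "L (phi * mshift 1 W) \<otimes> (d \<otimes> t1 \<oplus> R Q \<otimes> (c \<otimes> t2))
    = b \<otimes> (d \<otimes> s0 \<oplus> R P \<otimes> (c \<otimes> s1)) \<oplus> R Q \<otimes> (a \<otimes> (d \<otimes> s1 \<oplus> R Q \<otimes> (c \<otimes> s2)))"
proof -
  have "L (phi * mshift 1 W) \<otimes> (d \<otimes> t1 \<oplus> R Q \<otimes> (c \<otimes> t2))
      = L phi \<otimes> (d \<otimes> (L W \<otimes> t1)) \<oplus> L phi \<otimes> (R Q \<otimes> (c \<otimes> (L W \<otimes> t2)))"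
    using cl by (simp add: push_left L_mult m_assoc r_distr LR_left)
  then show ?thesis
    unfolding t1 t2 using cl by (simp add: normalize Q)
qed

text \<open>Comes from expanding \<Delta>(\<alpha> x) in every row: \<alpha> passes \<gamma>^(n-k)
  at the price of the factor Phi(n - k) on the left. The definition of \<open>tm\<close> records
  this for the last row only, so the other rows take an induction.\<close>

lemma tm_row_b: "0 \<le> k \<Longrightarrow> k \<le> int n \<Longrightarrow>
  L (Phi (int n - k)) \<otimes> tm (Suc n) (k + 1) j
    = b \<otimes> tm n k j \<oplus> R (Phi (int n + 1 - j)) \<otimes> (a \<otimes> tm n k (j - 1))"
proof (induction n arbitrary: k j)
  case 0
  then show ?case by (simp add: tm.simps(2))
next
  case (Suc n)
  show ?case
  proof (cases "k = int (Suc n)")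
    case True
    then show ?thesis by (simp add: tm.simps(2)[of "Suc n"])
  next
    case False
    then have k: "k \<le> int n" using Suc.prems by simp
    have W: "Phi (int (Suc n) - k) = phi * mshift 1 (Phi (int n - k))"
      using Phi_rec[of "int n - k"] by (simp add: algebra_simps)
    have Q: "Phi (int (Suc n) + 1 - j) = phi * mshift 1 (Phi (int n + 1 - j))"
      using Phi_rec[of "int n + 1 - j"] by (simp add: algebra_simps)
    have t2: "L (Phi (int n - k)) \<otimes> tm (Suc n) (k + 1) (j - 1) = b \<otimes> tm n k (j - 1)
        \<oplus> R (Phi (int (Suc n) + 1 - j)) \<otimes> (a \<otimes> tm n k (j - 2))"
      using Suc.IH[OF Suc.prems(1) k, of "j - 1"] by (simp add: algebra_simps)
    have e: "tm (Suc n) k (j - 1) = d \<otimes> tm n k (j - 1)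
        \<oplus> R (Phi (int (Suc n) + 1 - j)) \<otimes> (c \<otimes> tm n k (j - 2))"
      using tm_row_d[OF k, of "j - 1"] by (simp add: algebra_simps)
    have f: "tm (Suc (Suc n)) (k + 1) j = d \<otimes> tm (Suc n) (k + 1) j
        \<oplus> R (Phi (int (Suc n) + 1 - j)) \<otimes> (c \<otimes> tm (Suc n) (k + 1) (j - 1))"
      by (rule tm_row_d) (use k in simp)
    show ?thesis
      unfolding f W e tm_row_d[OF k, of j]
      by (rule E2_step[OF _ _ _ _ _ Q Suc.IH[OF Suc.prems(1) k] t2]) simp_all
  qed
qed

text \<open>The relation \<alpha>\<delta> = 1 + \<phi>(\<lambda>)\<gamma>\<beta> applied to the row
  recursion; it trades \<alpha> for \<gamma>, whose action is computed in
  \<open>c_tm\<close>.\<close>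

lemma tm_row_a:
  assumes "0 \<le> k" "k \<le> int n"
  shows "a \<otimes> tm (Suc n) k j = tm n k j \<oplus> L (Phi (int n + 1 - k)) \<otimes> (c \<otimes> tm (Suc n) (k + 1) j)"
proof -
  have W: "Phi (int n + 1 - k) = phi * mshift 1 (Phi (int n - k))"
    using Phi_rec[of "int n - k"] by (simp add: algebra_simps)
  have "L (Phi (int n + 1 - k)) \<otimes> (c \<otimes> tm (Suc n) (k + 1) j)
      = L phi \<otimes> (c \<otimes> (L (Phi (int n - k)) \<otimes> tm (Suc n) (k + 1) j))"
    by (simp add: W push_left L_mult m_assoc)
  then show ?thesis
    unfolding tm_row_b[OF assms] tm_row_d[OF assms(2)]
    by (simp add: push_left push_rel r_distr LR_left a_assoc)
qed

lemma R_combine: "x \<in> carrier S \<Longrightarrow> R f \<otimes> x \<oplus> R g \<otimes> x \<ominus> R h \<otimes> x = R (f + g - h) \<otimes> x"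
  by (simp add: R_add R_minus l_distr l_diff_distr)

text \<open>The linear equation for \<open>X = \<gamma> t\<close> (or \<open>X = \<alpha> t\<close>) met in the inductive step below.\<close>

lemma solve_step:
  assumes cl: "X \<in> carrier S" "Y \<in> carrier S"
    and eq: "R (qn n) \<otimes> X \<oplus> R (mshift (-1) phi) \<otimes> (R (qn (j + 1)) \<otimes> (R (Phi (n - j)) \<otimes> X))
      = R (mshift (-1) phi) \<otimes> Y \<oplus> R (mshift (-1) phi) \<otimes> (R (Phi (n - j - 1)) \<otimes> (R (qn j) \<otimes> X))"
  shows "R (qn (n + 1)) \<otimes> X = Y"
proof -
  \<comment> \<open>By the Riccati equation \<open>kappa - phi\<close> undoes the factor
    \<open>mshift (-1) phi\<close>; multiplying by it isolates Y.\<close>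
  have k: "R (kappa - phi) \<otimes> (R (mshift (-1) phi) \<otimes> x) = x" if "x \<in> carrier S" for x
    using that mshift_phi by (simp add: R_prod mult.commute)
  have "R (kappa - phi) \<otimes> (R (qn n) \<otimes> X) \<oplus> R (qn (j + 1)) \<otimes> (R (Phi (n - j)) \<otimes> X)
      = Y \<oplus> R (Phi (n - j - 1)) \<otimes> (R (qn j) \<otimes> X)"
    using arg_cong[OF eq, of "\<lambda>x. R (kappa - phi) \<otimes> x"] cl by (simp add: r_distr k)
  then have "Y = R (kappa - phi) \<otimes> (R (qn n) \<otimes> X) \<oplus> R (qn (j + 1)) \<otimes> (R (Phi (n - j)) \<otimes> X)
      \<ominus> R (Phi (n - j - 1)) \<otimes> (R (qn j) \<otimes> X)"
    using cl by (simp add: eq_diff_eq)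
  also have "\<dots> = R ((kappa - phi) * qn n + qn (j + 1) * Phi (n - j) - Phi (n - j - 1) * qn j) \<otimes> X"
    using cl R_combine by (simp only: R_prod)
  \<comment> \<open>The coefficients of X collapse to the single q-integer [n + 1].\<close>
  also have "(kappa - phi) * qn n + qn (j + 1) * Phi (n - j) - Phi (n - j - 1) * qn j = qn (n + 1)"
    using Phi_identity[of n j] by (simp add: algebra_simps)
  finally show ?thesis by simp
qed

lemma Phi_shift': "mshift (-1) (Phi m) = mshift (-1) phi * Phi (m - 1)"
  using Phi_shift[of "m - 1"] by simp

text \<open>Moving \<gamma> through the recursion for t0 makes the unknown \<gamma> t0 reappear
  through the hypothesis on s1, hence a linear equation for it. In \<open>c_tm\<close> the letters
  s, u, t are entries of levels n, n - 1 and n + 1.\<close>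

lemma solve_row:
  assumes cl: "s0 \<in> carrier S" "s1 \<in> carrier S" "u0 \<in> carrier S" "u1 \<in> carrier S" "t0 \<in> carrier S" "t1 \<in> carrier S"
    and t0: "t0 = d \<otimes> s0 \<oplus> R (Phi (n - j)) \<otimes> (c \<otimes> s1)"
    and s0: "R (qn n) \<otimes> (c \<otimes> s0) = R (qn (j + 1)) \<otimes> t1 \<ominus> R (qn k) \<otimes> u0"
    and s1: "R (qn n) \<otimes> (c \<otimes> s1) = R (qn j) \<otimes> t0 \<ominus> R (qn k) \<otimes> u1"
  shows "R (qn (n + 1)) \<otimes> (c \<otimes> t0) = R (qn (j + 1)) \<otimes> (d \<otimes> t1 \<oplus> R (Phi (n - j)) \<otimes> (c \<otimes> t0))
    \<ominus> R (qn k) \<otimes> (d \<otimes> u0 \<oplus> R (Phi (n - j - 1)) \<otimes> (c \<otimes> u1))"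
proof (rule solve_step)
  have "R (qn n) \<otimes> (c \<otimes> t0) = R (mshift (-1) phi) \<otimes> (d \<otimes> (R (qn n) \<otimes> (c \<otimes> s0)))
      \<oplus> R (mshift (-1) phi) \<otimes> (R (Phi (n - j - 1)) \<otimes> (c \<otimes> (R (qn n) \<otimes> (c \<otimes> s1))))"
    unfolding t0 using cl by (simp add: push_left push_rel r_distr R_left Phi_shift' R_mult m_assoc)
  also have "\<dots> = R (mshift (-1) phi) \<otimes> (R (qn (j + 1)) \<otimes> (d \<otimes> t1) \<ominus> R (qn k) \<otimes> (d \<otimes> u0))
      \<oplus> R (mshift (-1) phi) \<otimes> (R (Phi (n - j - 1)) \<otimes> (R (qn j) \<otimes> (c \<otimes> t0) \<ominus> R (qn k) \<otimes> (c \<otimes> u1)))"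
    unfolding s0 s1 using cl by (simp add: push_left r_diff_distr)
  finally have X: "R (qn n) \<otimes> (c \<otimes> t0) = \<dots>" .
  show "R (qn n) \<otimes> (c \<otimes> t0) \<oplus> R (mshift (-1) phi) \<otimes> (R (qn (j + 1)) \<otimes> (R (Phi (n - j)) \<otimes> (c \<otimes> t0)))
      = R (mshift (-1) phi) \<otimes> (R (qn (j + 1)) \<otimes> (d \<otimes> t1 \<oplus> R (Phi (n - j)) \<otimes> (c \<otimes> t0))
        \<ominus> R (qn k) \<otimes> (d \<otimes> u0 \<oplus> R (Phi (n - j - 1)) \<otimes> (c \<otimes> u1)))
      \<oplus> R (mshift (-1) phi) \<otimes> (R (Phi (n - j - 1)) \<otimes> (R (qn j) \<otimes> (c \<otimes> t0)))"
    unfolding X using cl by (simp add: rs R_left)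
qed (use cl in auto)

text \<open>The last row obeys the recursion with \<alpha> and \<beta> instead. The term
  \<gamma>\<beta> s0 is recovered from \<delta>\<alpha> s0, and the 1 in that relation leaves the
  lower term s0.\<close>

lemma solve_top_c:
  assumes cl: "s0 \<in> carrier S" "s1 \<in> carrier S" "t0 \<in> carrier S" "t1 \<in> carrier S"
    and t0: "t0 = b \<otimes> s0 \<oplus> R (Phi (n - j)) \<otimes> (a \<otimes> s1)"
    and s0: "R (qn n) \<otimes> (a \<otimes> s0) = R (qn (j + 1)) \<otimes> t1"
    and s1: "R (qn n) \<otimes> (a \<otimes> s1) = R (qn j) \<otimes> t0"
  shows "R (qn (n + 1)) \<otimes> (c \<otimes> t0) = R (qn (j + 1)) \<otimes> (d \<otimes> t1 \<oplus> R (Phi (n - j)) \<otimes> (c \<otimes> t0))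
    \<ominus> R (qn n) \<otimes> s0"
proof (rule solve_step)
  let ?p = "mshift (-1) phi"
  have k: "R ?p \<otimes> (R (kappa - phi) \<otimes> x) = x" if "x \<in> carrier S" for x
    using that mshift_phi by (simp add: R_prod)
  have "R (qn n) \<otimes> (c \<otimes> t0) = R (qn n) \<otimes> (c \<otimes> (b \<otimes> s0))
      \<oplus> R ?p \<otimes> (R (Phi (n - j - 1)) \<otimes> (c \<otimes> (R (qn n) \<otimes> (a \<otimes> s1))))"
    unfolding t0 using cl by (simp add: push_left r_distr R_left Phi_shift' R_mult m_assoc)
  then have X: "R (qn n) \<otimes> (c \<otimes> t0) = R (qn n) \<otimes> (c \<otimes> (b \<otimes> s0))
      \<oplus> R ?p \<otimes> (R (Phi (n - j - 1)) \<otimes> (R (qn j) \<otimes> (c \<otimes> t0)))"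
    unfolding s1 using cl by (simp add: push_left)
  have "R ?p \<otimes> (R (qn (j + 1)) \<otimes> (d \<otimes> t1)) = R ?p \<otimes> (d \<otimes> (R (qn n) \<otimes> (a \<otimes> s0)))"
    unfolding s0 using cl by (simp add: push_left)
  also have "\<dots> = R (qn n) \<otimes> (R ?p \<otimes> s0 \<oplus> R ?p \<otimes> (R (kappa - phi) \<otimes> (c \<otimes> (b \<otimes> s0))))"
    using cl by (simp add: push_left push_rel r_distr R_left del: mshift_minus)
  finally have D: "R ?p \<otimes> (R (qn (j + 1)) \<otimes> (d \<otimes> t1)) = R (qn n) \<otimes> (R ?p \<otimes> s0) \<oplus> R (qn n) \<otimes> (c \<otimes> (b \<otimes> s0))"
    using cl by (simp add: k r_distr)
  show "R (qn n) \<otimes> (c \<otimes> t0) \<oplus> R ?p \<otimes> (R (qn (j + 1)) \<otimes> (R (Phi (n - j)) \<otimes> (c \<otimes> t0)))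
      = R ?p \<otimes> (R (qn (j + 1)) \<otimes> (d \<otimes> t1 \<oplus> R (Phi (n - j)) \<otimes> (c \<otimes> t0)) \<ominus> R (qn n) \<otimes> s0)
      \<oplus> R ?p \<otimes> (R (Phi (n - j - 1)) \<otimes> (R (qn j) \<otimes> (c \<otimes> t0)))"
    using cl X D by (simp add: rs R_left)
qed (use cl in auto)

lemma solve_top_a:
  assumes cl: "s0 \<in> carrier S" "s1 \<in> carrier S" "t0 \<in> carrier S" "t1 \<in> carrier S"
    and t0: "t0 = b \<otimes> s0 \<oplus> R (Phi (n - j)) \<otimes> (a \<otimes> s1)"
    and s0: "R (qn n) \<otimes> (a \<otimes> s0) = R (qn (j + 1)) \<otimes> t1"
    and s1: "R (qn n) \<otimes> (a \<otimes> s1) = R (qn j) \<otimes> t0"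
  shows "R (qn (n + 1)) \<otimes> (a \<otimes> t0) = R (qn (j + 1)) \<otimes> (b \<otimes> t1 \<oplus> R (Phi (n - j)) \<otimes> (a \<otimes> t0))"
proof (rule solve_step)
  let ?p = "mshift (-1) phi"
  have "R (qn n) \<otimes> (a \<otimes> t0) = R ?p \<otimes> (b \<otimes> (R (qn n) \<otimes> (a \<otimes> s0)))
      \<oplus> R ?p \<otimes> (R (Phi (n - j - 1)) \<otimes> (a \<otimes> (R (qn n) \<otimes> (a \<otimes> s1))))"
    unfolding t0 using cl by (simp add: push_left push_rel r_distr R_left Phi_shift' R_mult m_assoc)
  then have X: "R (qn n) \<otimes> (a \<otimes> t0) = R ?p \<otimes> (R (qn (j + 1)) \<otimes> (b \<otimes> t1))
      \<oplus> R ?p \<otimes> (R (Phi (n - j - 1)) \<otimes> (R (qn j) \<otimes> (a \<otimes> t0)))"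
    unfolding s0 s1 using cl by (simp add: push_left)
  show "R (qn n) \<otimes> (a \<otimes> t0) \<oplus> R ?p \<otimes> (R (qn (j + 1)) \<otimes> (R (Phi (n - j)) \<otimes> (a \<otimes> t0)))
      = R ?p \<otimes> (R (qn (j + 1)) \<otimes> (b \<otimes> t1 \<oplus> R (Phi (n - j)) \<otimes> (a \<otimes> t0)))
      \<oplus> R ?p \<otimes> (R (Phi (n - j - 1)) \<otimes> (R (qn j) \<otimes> (a \<otimes> t0)))"
    using cl X by (simp add: rs R_left)
qed (use cl in auto)

text \<open>The last row has the highest possible left degree, so the two-term product formula has
  no lower term here.\<close>

lemma a_tm_top:
  "R (qn (int n + 1)) \<otimes> (a \<otimes> tm n (int n) j) = R (qn (j + 1)) \<otimes> tm (Suc n) (int n + 1) (j + 1)"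
proof (induction n arbitrary: j)
  case 0
  then show ?case by (cases "j = 0"; cases "j = -1") (auto simp: tm.simps(2))
next
  case (Suc n)
  have t: "tm (Suc (Suc n)) (int (Suc n) + 1) (j + 1) = b \<otimes> tm (Suc n) (int (Suc n)) (j + 1)
      \<oplus> R (Phi (int (Suc n) - j)) \<otimes> (a \<otimes> tm (Suc n) (int (Suc n)) j)"
    by (simp add: tm.simps(2)[of "Suc n"] Groups.add_diff_eq)
  show ?case
    unfolding t
    by (rule solve_top_a[of "tm n (int n) j" "tm n (int n) (j - 1)"])
      (use Suc.IH[of j] Suc.IH[of "j - 1"] in \<open>simp_all add: add.commute\<close>, simp add: tm.simps(2) add.commute)
qed

text \<open>A Clebsch-Gordan formula: \<gamma> is an entry of the two-dimensional corepresentation,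
  so the product only has components at the levels n + 1 and n - 1. The factor [n + 1] keeps
  denominators out of the induction.\<close>

lemma c_tm: "k \<le> int n \<Longrightarrow>
  R (qn (int n + 1)) \<otimes> (c \<otimes> tm n k j) = R (qn (j + 1)) \<otimes> tm (Suc n) k (j + 1) \<ominus> R (qn k) \<otimes> tlow n (k - 1) j"
proof (induction n arbitrary: k j)
  case 0
  then show ?case by (cases "j = 0"; cases "j = -1") (auto simp: tm.simps(2) a_minus_def)
next
  case (Suc n)
  have t: "tm (Suc (Suc n)) k (j + 1) = d \<otimes> tm (Suc n) k (j + 1)
      \<oplus> R (Phi (int (Suc n) - j)) \<otimes> (c \<otimes> tm (Suc n) k j)"
    using tm_row_d[OF Suc.prems, of "j + 1"] by (simp add: Groups.add_diff_eq)
  show ?case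
  proof (cases "k = int (Suc n)")
    case True
    have "tlow (Suc n) (k - 1) j = tm n (int n) j" using True by simp
    then show ?thesis
      unfolding t unfolding True
      by (simp only:) (rule solve_top_c[of "tm n (int n) j" "tm n (int n) (j - 1)"],
        use a_tm_top[of n j] a_tm_top[of n "j - 1"] in \<open>simp_all add: add.commute\<close>, simp add: tm.simps(2) add.commute)
  next
    case False
    then have k: "k \<le> int n" using Suc.prems by simp
    have u: "tlow (Suc n) (k - 1) j = d \<otimes> tlow n (k - 1) j
        \<oplus> R (Phi (int (Suc n) - j - 1)) \<otimes> (c \<otimes> tlow n (k - 1) (j - 1))"
    proof (cases n)
      case 0
      then show ?thesis using k by simp
    next
      case (Suc m)
      then show ?thesis using k tm_row_d[of "k - 1" m j] by (simp add: Groups.add_diff_eq add.commute)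
    qed
    show ?thesis
      unfolding t u
      by (rule solve_row[of "tm n k j" "tm n k (j - 1)"])
        (use Suc.IH[OF k, of j] Suc.IH[OF k, of "j - 1"] tm_row_d[OF k, of j] in \<open>simp_all add: add.commute\<close>)
  qed
qed

end

section \<open>The bigrading\<close>

context q_param
begin

abbreviation "gr \<equiv> grade SL"

lemma gr_iff: "x \<in> gr i j \<longleftrightarrow> (\<exists>p. keys p \<subseteq> words_of_bidegree i j \<and> x = cls p)"
  by (auto simp: SL2_simps)

lemma words_of_bidegree_generators: "words_of_bidegree i j \<subseteq> lists generators"
  by (auto simp: words_of_bidegree_def)

lemma gr_carrier [simp, intro]: "x \<in> gr i j \<Longrightarrow> x \<in> carrier SL"
  using words_of_bidegree_generators[of i j] unfolding gr_iff SL_carrier by (force simp: F.simps)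

lemma cls_in_gr: "keys p \<subseteq> words_of_bidegree i j \<Longrightarrow> cls p \<in> gr i j"
  by (auto simp: gr_iff)

lemma gr_zero [simp, intro]: "\<zero>\<^bsub>SL\<^esub> \<in> gr i j"
  using cls_in_gr[of 0 i j] cls.zero by (simp add: F.simps)

lemma gr_add [intro]:
  assumes "x \<in> gr i j" "y \<in> gr i j"
  shows "x \<oplus>\<^bsub>SL\<^esub> y \<in> gr i j"
proof -
  from assms obtain p r where p: "keys p \<subseteq> words_of_bidegree i j" "x = cls p"
    and r: "keys r \<subseteq> words_of_bidegree i j" "y = cls r" by (auto simp: gr_iff)
  have "cls (p + r) = x \<oplus>\<^bsub>SL\<^esub> y"
    unfolding p r using p(1) r(1) words_of_bidegree_generators[of i j] by (intro cls_plus) (auto simp: F.simps)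
  moreover have "keys (p + r) \<subseteq> words_of_bidegree i j" using p(1) r(1) keys_add[of p r] by auto
  ultimately show ?thesis using cls_in_gr by metis
qed

lemma gr_smult [intro]:
  assumes "x \<in> gr i j"
  shows "z \<odot>\<^bsub>SL\<^esub> x \<in> gr i j"
proof -
  from assms obtain p where p: "keys p \<subseteq> words_of_bidegree i j" "x = cls p" by (auto simp: gr_iff)
  have "p \<in> carrier free_alg" using p(1) words_of_bidegree_generators[of i j] by (auto simp: F.simps)
  then have "cls (z \<odot>\<^bsub>free_alg\<^esub> p) = z \<odot>\<^bsub>SL\<^esub> x" unfolding p by simp
  moreover have "keys (z \<odot>\<^bsub>free_alg\<^esub> p) \<subseteq> words_of_bidegree i j"
    using p(1) keys_map_mult[of z p] by (auto simp: F.simps)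
  ultimately show ?thesis using cls_in_gr by metis
qed

lemma gr_uminus [intro]: "x \<in> gr i j \<Longrightarrow> \<ominus>\<^bsub>SL\<^esub> x \<in> gr i j"
  using gr_smult[of x i j "-1"] by (simp add: A.smult_minus_one)

lemma gr_minus [intro]: "x \<in> gr i j \<Longrightarrow> y \<in> gr i j \<Longrightarrow> x \<ominus>\<^bsub>SL\<^esub> y \<in> gr i j"
  unfolding a_minus_def by (intro gr_add gr_uminus)

lemma word_in_gr: "w \<in> words_of_bidegree i j \<Longrightarrow> cls (single w 1) \<in> gr i j"
  by (rule cls_in_gr) auto

lemma gr_one [simp, intro]: "\<one>\<^bsub>SL\<^esub> \<in> gr 0 0"
  using word_in_gr[of "[]" 0 0] cls.one by (simp add: F.simps words_of_bidegree_def)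

lemma gr_gens [simp, intro]: "alpha q \<in> gr 1 1" "beta q \<in> gr 1 (-1)" "gamma q \<in> gr (-1) 1"
  "delta q \<in> gr (-1) (-1)" "LA f \<in> gr 0 0" "RA f \<in> gr 0 0"
  unfolding alpha_def beta_def gamma_def delta_def LA_def RA_def
  by (auto intro!: word_in_gr simp: words_of_bidegree_def)

text \<open>The bidegree is an argument of P because multiplication by a generator changes
  it.\<close>

lemma gr_induct [consumes 1, case_names zero one gens L R add smult]:
  assumes "x \<in> gr i j"
    and zero: "\<And>i j. P i j \<zero>\<^bsub>SL\<^esub>"
    and one: "P 0 0 \<one>\<^bsub>SL\<^esub>"
    and gens: "\<And>i j g m n x. x \<in> gr i j \<Longrightarrow> P i j x
      \<Longrightarrow> (g, m, n) \<in> {(alpha q, 1, 1), (beta q, 1, -1), (gamma q, -1, 1), (delta q, -1, -1)}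
      \<Longrightarrow> P (m + i) (n + j) (g \<otimes>\<^bsub>SL\<^esub> x)"
    and L: "\<And>i j f x. x \<in> gr i j \<Longrightarrow> P i j x \<Longrightarrow> P i j (LA f \<otimes>\<^bsub>SL\<^esub> x)"
    and R: "\<And>i j f x. x \<in> gr i j \<Longrightarrow> P i j x \<Longrightarrow> P i j (RA f \<otimes>\<^bsub>SL\<^esub> x)"
    and add: "\<And>i j x y. x \<in> gr i j \<Longrightarrow> y \<in> gr i j \<Longrightarrow> P i j x \<Longrightarrow> P i j y \<Longrightarrow> P i j (x \<oplus>\<^bsub>SL\<^esub> y)"
    and smult: "\<And>i j z x. x \<in> gr i j \<Longrightarrow> P i j x \<Longrightarrow> P i j (z \<odot>\<^bsub>SL\<^esub> x)"
  shows "P i j x"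
proof -
  from assms(1) obtain p where p: "keys p \<subseteq> words_of_bidegree i j" "x = cls p" by (auto simp: gr_iff)
  have word: "P i j (cls (single w 1))" if "w \<in> words_of_bidegree i j" for w i j
    using that
  proof (induction w arbitrary: i j)
    case Nil
    have "cls (single [] 1) = \<one>\<^bsub>SL\<^esub>" using cls.one by (simp add: F.simps)
    then show ?case using one Nil by (simp add: words_of_bidegree_def)
  next
    case (Cons g w)
    let ?i = "i - gen_ldeg g" and ?j = "j - gen_rdeg g"
    have g: "g \<in> generators" and w: "w \<in> lists generators" and w': "w \<in> words_of_bidegree ?i ?j"
      using Cons.prems by (auto simp: words_of_bidegree_def)
    have wc: "single w 1 \<in> carrier free_alg" using w by (intro single_in_free_alg)
    have gc: "fgen g \<in> carrier free_alg" using g by (intro single_in_free_alg) simp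
    have eq: "single (g # w) 1 = fgen g \<star> single w 1" by simp
    have "P i j (cls (fgen g) \<otimes>\<^bsub>SL\<^esub> cls (single w 1))"
      using g gens[OF word_in_gr[OF w'] Cons.IH[OF w'], of "cls (fgen g)" "gen_ldeg g" "gen_rdeg g"]
        L[OF word_in_gr[OF w'] Cons.IH[OF w']] R[OF word_in_gr[OF w'] Cons.IH[OF w']]
      unfolding generators_def carrier_Mero alpha_def beta_def gamma_def delta_def LA_def RA_def by auto
    then show ?case unfolding eq by (subst cls.mult[OF gc wc])
  qed
  from p(1) have "P i j (cls p)"
  proof (induction p rule: poly_mapping_span_induct)
    case zero
    then show ?case using assms(2)[of i j] cls.zero by (simp add: F.simps)
  next
    case (single w z)
    have eq: "single w z = z \<odot>\<^bsub>free_alg\<^esub> single w 1" by (simp add: F.simps)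
    have w: "single w 1 \<in> carrier free_alg"
      using single words_of_bidegree_generators[of i j] by (intro single_in_free_alg) auto
    show ?case
      unfolding eq cls.smult[OF w] by (intro smult word_in_gr word single)
  next
    case (add p r)
    then have "p \<in> carrier free_alg" "r \<in> carrier free_alg"
      using words_of_bidegree_generators[of i j] by (auto simp: F.simps)
    with add show ?case using assms(7)[of "cls p" i j "cls r"] cls_in_gr by (simp add: cls_plus)
  qed
  then show ?thesis using p by simp
qed

lemma gr_mult:
  assumes "x \<in> gr i j" "y \<in> gr k l"
  shows "x \<otimes>\<^bsub>SL\<^esub> y \<in> gr (i + k) (j + l)"
proof -
  from assms obtain p r where p: "keys p \<subseteq> words_of_bidegree i j" "x = cls p"
    and r: "keys r \<subseteq> words_of_bidegree k l" "y = cls r" by (auto simp: gr_iff)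
  have pc: "p \<in> carrier free_alg" "r \<in> carrier free_alg"
    using p(1) r(1) words_of_bidegree_generators by (force simp: F.simps)+
  have "keys (p \<star> r) \<subseteq> words_of_bidegree (i + k) (j + l)"
    using p(1)
  proof (induction p rule: poly_mapping_span_induct)
    case (single v c)
    from r(1) show ?case
    proof (induction r rule: poly_mapping_span_induct)
      case (single w d)
      then show ?case using \<open>v \<in> _\<close> by (auto simp: words_of_bidegree_def)
    next
      case (add p r)
      then show ?case using keys_add[of "single v c \<star> p" "single v c \<star> r"] by (auto simp: F.K_r_distr)
    qed auto
  next
    case (add p p')
    then show ?case using keys_add[of "p \<star> r" "p' \<star> r"] by (auto simp: F.K_l_distr)
  qed auto
  then have "cls (p \<star> r) \<in> gr (i + k) (j + l)" by (rule cls_in_gr)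
  then show ?thesis using p r pc by simp
qed

lemma gr_mult':
  assumes "x \<in> gr i j" "y \<in> gr k l" "m = i + k" "n = j + l"
  shows "x \<otimes>\<^bsub>SL\<^esub> y \<in> gr m n"
  using gr_mult[OF assms(1,2)] assms(3,4) by simp

lemma gr_LR [intro]: "x \<in> gr i j \<Longrightarrow> LA f \<otimes>\<^bsub>SL\<^esub> x \<in> gr i j" "x \<in> gr i j \<Longrightarrow> RA f \<otimes>\<^bsub>SL\<^esub> x \<in> gr i j"
  using gr_mult[of "LA f" 0 0 x i j] gr_mult[of "RA f" 0 0 x i j] by simp_all

text \<open>It holds for the generators, and shifts add up in products. This is why the balancing
  relation of the tensor product survives multiplication by homogeneous elements.\<close>

lemma gr_comm:
  assumes "x \<in> gr i j"
  shows "x \<otimes>\<^bsub>SL\<^esub> LA f = LA (mshift (- of_int i) f) \<otimes>\<^bsub>SL\<^esub> x"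
    "x \<otimes>\<^bsub>SL\<^esub> RA f = RA (mshift (- of_int j) f) \<otimes>\<^bsub>SL\<^esub> x"
proof -
  have "(\<forall>f. x \<otimes>\<^bsub>SL\<^esub> LA f = LA (mshift (- of_int i) f) \<otimes>\<^bsub>SL\<^esub> x) \<and>
    (\<forall>f. x \<otimes>\<^bsub>SL\<^esub> RA f = RA (mshift (- of_int j) f) \<otimes>\<^bsub>SL\<^esub> x)"
    using assms
  proof (induction x rule: gr_induct)
    case (gens i j g m n x)
    then have x: "x \<in> carrier SL" by auto
    have "(g, m, n) = (alpha q, 1, 1) \<or> (g, m, n) = (beta q, 1, -1) \<or> (g, m, n) = (gamma q, -1, 1)
        \<or> (g, m, n) = (delta q, -1, -1)"
      using gens.hyps by auto
    then show ?case
      using x by (elim disjE) (simp_all add: A.m_assoc gens.IH A.push_left add.commute)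
  next
    case (L i j f x)
    then have x: "x \<in> carrier SL" by auto
    then show ?case by (simp add: A.m_assoc L.IH A.L_prod A.LR_left mult.commute)
  next
    case (R i j f x)
    then have x: "x \<in> carrier SL" by auto
    then show ?case by (simp add: A.m_assoc R.IH A.R_prod A.LR_left mult.commute)
  next
    case (add i j x y)
    then have "x \<in> carrier SL" "y \<in> carrier SL" by auto
    with add.IH show ?case by (simp add: A.l_distr A.r_distr)
  next
    case (smult i j z x)
    then have "x \<in> carrier SL" by auto
    with smult.IH show ?case by (simp add: A.smult_mult_left A.smult_mult_right)
  qed auto
  then show "x \<otimes>\<^bsub>SL\<^esub> LA f = LA (mshift (- of_int i) f) \<otimes>\<^bsub>SL\<^esub> x"
    "x \<otimes>\<^bsub>SL\<^esub> RA f = RA (mshift (- of_int j) f) \<otimes>\<^bsub>SL\<^esub> x" by auto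
qed

section \<open>A model by difference operators\<close>

type_synonym idx = "int \<times> int \<times> complex \<times> complex"

text \<open>Vectors are families of meromorphic functions of \<open>\<lambda>\<close>. The index records the bidegree, the
  difference \<open>s = \<mu> - \<lambda>\<close> and the eigenvalue \<open>\<zeta>\<close> of the central element
  \<open>br(\<lambda>+2) br(\<mu>) \<gamma>\<beta> - q^(\<mu>-\<lambda>-1) - q^(\<lambda>-\<mu>+1)\<close>.\<close>

definition Endo :: "(complex, (idx \<Rightarrow> mero) \<Rightarrow> (idx \<Rightarrow> mero)) module" where
  "Endo = \<lparr>carrier = {D. (\<forall>v w. D (\<lambda>i. v i + w i) = (\<lambda>i. D v i + D w i))
                  \<and> (\<forall>z v. D (\<lambda>i. mconst z * v i) = (\<lambda>i. mconst z * D v i))},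
          mult = (\<circ>), one = id, zero = (\<lambda>v i. 0), add = (\<lambda>D E v i. D v i + E v i),
          smult = (\<lambda>z D v i. mconst z * D v i)\<rparr>"

lemma Endo_calg: "calg Endo"
proof (rule calgI)
  show "ring Endo"
  proof (rule ringI)
    show "abelian_group Endo"
    proof (rule abelian_groupI)
      show "\<exists>E\<in>carrier Endo. E \<oplus>\<^bsub>Endo\<^esub> D = \<zero>\<^bsub>Endo\<^esub>" if "D \<in> carrier Endo" for D
        using that by (intro bexI[of _ "\<lambda>v i. - D v i"]) (auto simp: Endo_def fun_eq_iff)
    qed (auto simp: Endo_def fun_eq_iff algebra_simps)
    show "monoid Endo" by (rule monoidI) (auto simp: Endo_def)
  qed (auto simp: Endo_def fun_eq_iff)
qed (auto simp: Endo_def fun_eq_iff mconst_add mconst_mult ring_distribs mult.assoc)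

text \<open>A weight operator of bidegree (m, n): \<lambda> is shifted by -m and \<mu> by -n, hence
  s = \<mu> - \<lambda> by m - n, while \<zeta> stays fixed.\<close>

definition opr :: "int \<Rightarrow> int \<Rightarrow> (complex \<Rightarrow> complex \<Rightarrow> mero) \<Rightarrow> (idx \<Rightarrow> mero) \<Rightarrow> idx \<Rightarrow> mero" where
  "opr m n K v = (\<lambda>(i, j, s, \<zeta>). K s \<zeta> * mshift (- of_int m) (v (i - m, j - n, s - of_int n + of_int m, \<zeta>)))"

definition ch :: "complex \<Rightarrow> mero" where "ch x = mconst (qpow q x + qpow q (- x))"

lemma ch_minus: "ch (- x) = ch x" by (simp add: ch_def add.commute)

text \<open>The right-hand side depends on x + y alone, so products of brackets with equal sums of
  arguments differ by a constant. The nontrivial relations of the model rest on this.\<close>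

lemma br_mult:
  "br x * br y + ch (x - y) = mconst (qpow q (x + y)) * qz ^ 2 + mconst (qpow q (- (x + y))) * inverse qz ^ 2"
proof -
  have e: "qpow q (- (x - y)) = qpow q y * inverse (qpow q x)" "qpow q (x - y) = qpow q x * inverse (qpow q y)"
    "qpow q (- (x + y)) = inverse (qpow q x) * inverse (qpow q y)"
    unfolding qpow_minus qpow_diff qpow_add by simp_all
  have qq: "qz * (inverse qz * f) = f" for f by simp
  show ?thesis
    unfolding br_altdef ch_def e qpow_add qpow_minus
    by (simp add: mconst_add mconst_mult power2_eq_square algebra_simps qq)
qed

lemma br_mult_eq: "x + y = x' + y' \<Longrightarrow> br x * br y + ch (x - y) = br x' * br y' + ch (x' - y')"
  unfolding br_mult by (simp only:)

lemma mshift_ch [simp]: "mshift a (ch x) = ch x"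
  by (simp add: ch_def)

text \<open>With \<alpha> normalised to a pure shift, \<alpha>\<gamma> =
  \<phi>(\<lambda>)\<gamma>\<alpha> suggests 1/[\<lambda> + 2] for \<gamma>. The eigenvalue \<zeta>
  of the central element fixes \<gamma>\<beta> and with it \<beta>, and \<delta>\<alpha> = 1 +
  (kappa - \<phi>(\<mu>))\<gamma>\<beta> determines \<delta>.\<close>

definition opA where "opA = opr 1 1 (\<lambda>s \<zeta>. 1)"
definition opB where "opB = opr 1 (-1) (\<lambda>s \<zeta>. (mconst \<zeta> + ch (1 + s)) / br (1 + s))"
definition opC where "opC = opr (-1) 1 (\<lambda>s \<zeta>. 1 / br 2)"
definition opD where "opD = opr (-1) (-1) (\<lambda>s \<zeta>. 1 + (mconst \<zeta> + ch (s - 1)) / (br 2 * br (1 + s)))"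
definition opL :: "mero \<Rightarrow> (idx \<Rightarrow> mero) \<Rightarrow> idx \<Rightarrow> mero" where "opL f = opr 0 0 (\<lambda>s \<zeta>. f)"
definition opR :: "mero \<Rightarrow> (idx \<Rightarrow> mero) \<Rightarrow> idx \<Rightarrow> mero" where "opR f = opr 0 0 (\<lambda>s \<zeta>. mshift s f)"

lemmas op_defs = opA_def opB_def opC_def opD_def opL_def opR_def

lemma opr_in_Endo [simp]: "opr m n K \<in> carrier Endo"
  by (auto simp: Endo_def opr_def fun_eq_iff ring_distribs mult.left_commute)

lemma Endo_opr:
  "opr m n K \<otimes>\<^bsub>Endo\<^esub> opr m' n' K'
    = opr (m + m') (n + n') (\<lambda>s \<zeta>. K s \<zeta> * mshift (- of_int m) (K' (s - of_int n + of_int m) \<zeta>))"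
  "opr m n K \<oplus>\<^bsub>Endo\<^esub> opr m n K'' = opr m n (\<lambda>s \<zeta>. K s \<zeta> + K'' s \<zeta>)"
  "\<one>\<^bsub>Endo\<^esub> = opr 0 0 (\<lambda>s \<zeta>. 1)" "z \<odot>\<^bsub>Endo\<^esub> opr m n K = opr m n (\<lambda>s \<zeta>. mconst z * K s \<zeta>)"
  by (auto simp: Endo_def opr_def fun_eq_iff algebra_simps)

sublocale E: calg Endo by (rule Endo_calg)

lemma Endo_opr_minus:
  "opr m n K \<ominus>\<^bsub>Endo\<^esub> opr m n K'' = opr m n (\<lambda>s \<zeta>. K s \<zeta> - K'' s \<zeta>)"
  unfolding a_minus_def E.smult_minus_one[OF opr_in_Endo, symmetric] Endo_opr
  by (simp add: mconst_uminus)

lemma opr_cong: "(\<And>s \<zeta>. K s \<zeta> = K' s \<zeta>) \<Longrightarrow> opr m n K = opr m n K'"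
  by (rule arg_cong[where f = "opr m n"]) (rule ext)+

lemma kappa_phi: "kappa - phi = br 0 / br 1"
  using br_recurrence[of 1] by (simp add: phi_def field_simps)

lemma model_identities:
  "br 1 * br (2 + s) + ch (1 + s) = br 2 * br (1 + s) + ch (s - 1)"
  "br 3 * br s + ch (s - 3) = br 2 * br (1 + s) + ch (s - 1)"
  using br_mult_eq[of 1 "2 + s" 2 "1 + s"] br_mult_eq[of 3 s 2 "1 + s"]
    ch_minus[of "1 + s"] ch_minus[of "s - 1"] ch_minus[of "s - 3"]
  by (simp_all add: algebra_simps)

lemma phi_shifts:
  "mshift s phi = br (2 + s) / br (1 + s)" "mshift (s - 1) phi = br (1 + s) / br s"
  "mshift s (kappa - phi) = br s / br (1 + s)"
  unfolding kappa_phi unfolding phi_def by (simp_all add: add_ac) 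

text \<open>The commutative algebra behind three relations of the model: A, B, C, D become brackets,
  N and M become \<zeta> plus a constant \<open>ch\<close>, and the hypothesis is one of
  \<open>model_identities'\<close>.\<close>

lemma field_identities:
  fixes A B C D N M :: "'a :: field"
  assumes nz: "A \<noteq> 0" "B \<noteq> 0" "C \<noteq> 0" "D \<noteq> 0" and eq: "A * B + N = C * D + M"
  shows "N * (1 + N / (A * B)) / D = C * ((1 + M / (C * D)) * N) / (A * B)"
    "(1 + N / (A * B)) / C = D * (1 + M / (C * D)) / (B * A)"
    "N / (D * A) = (C / A) * M / (D * C) + (C / A - B / D)"
proof -
  have a: "1 + N / (A * B) = (C * D + M) / (A * B)"
    unfolding eq[symmetric] using nz by (simp add: add_divide_distrib)
  have b: "1 + M / (C * D) = (C * D + M) / (C * D)"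
    using nz by (simp add: add_divide_distrib)
  note 1 = a b
  show "N * (1 + N / (A * B)) / D = C * ((1 + M / (C * D)) * N) / (A * B)"
    "(1 + N / (A * B)) / C = D * (1 + M / (C * D)) / (B * A)"
    unfolding 1 using nz by (simp_all add: field_simps)
  have "N = C * D + M - A * B" using eq by (simp add: algebra_simps)
  then show "N / (D * A) = (C / A) * M / (D * C) + (C / A - B / D)"
    using nz by (simp add: field_simps)
qed

lemma model_identities':
  "br 1 * br (2 + s) + (mconst \<zeta> + ch (1 + s)) = br 2 * br (1 + s) + (mconst \<zeta> + ch (s - 1))"
  "br 3 * br s + (mconst \<zeta> + ch (s - 3)) = br 2 * br (1 + s) + (mconst \<zeta> + ch (s - 1))"
  using model_identities[of s] by (simp_all add: algebra_simps)

lemmas model_fields = field_identities[OF br_nonzero br_nonzero br_nonzero br_nonzero model_identities'(1)]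
  field_identities[OF br_nonzero br_nonzero br_nonzero br_nonzero model_identities'(2)]

lemma Endo_rel1: "opA \<otimes>\<^bsub>Endo\<^esub> opB = opR (mshift (-1) phi) \<otimes>\<^bsub>Endo\<^esub> (opB \<otimes>\<^bsub>Endo\<^esub> opA)"
  unfolding op_defs Endo_opr by (auto intro!: opr_cong simp: phi_shifts)

lemma Endo_rel2: "opA \<otimes>\<^bsub>Endo\<^esub> opC = opL phi \<otimes>\<^bsub>Endo\<^esub> (opC \<otimes>\<^bsub>Endo\<^esub> opA)"
  unfolding op_defs Endo_opr by (auto intro!: opr_cong simp: phi_def)

lemma Endo_rel3: "opB \<otimes>\<^bsub>Endo\<^esub> opD = opL phi \<otimes>\<^bsub>Endo\<^esub> (opD \<otimes>\<^bsub>Endo\<^esub> opB)"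
  unfolding op_defs Endo_opr using model_fields(1) by (auto intro!: opr_cong simp: phi_def)

lemma Endo_rel4: "opC \<otimes>\<^bsub>Endo\<^esub> opD = opR (mshift (-1) phi) \<otimes>\<^bsub>Endo\<^esub> (opD \<otimes>\<^bsub>Endo\<^esub> opC)"
  unfolding op_defs Endo_opr using model_fields(5) by (auto intro!: opr_cong simp: phi_shifts)

lemma Endo_rel5: "opA \<otimes>\<^bsub>Endo\<^esub> opD = \<one>\<^bsub>Endo\<^esub> \<oplus>\<^bsub>Endo\<^esub> opL phi \<otimes>\<^bsub>Endo\<^esub> (opC \<otimes>\<^bsub>Endo\<^esub> opB)"
  unfolding op_defs Endo_opr by (auto intro!: opr_cong simp: Endo_opr phi_def)

lemma Endo_rel6: "opD \<otimes>\<^bsub>Endo\<^esub> opA = \<one>\<^bsub>Endo\<^esub> \<oplus>\<^bsub>Endo\<^esub> opR (kappa - phi) \<otimes>\<^bsub>Endo\<^esub> (opC \<otimes>\<^bsub>Endo\<^esub> opB)"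
  unfolding op_defs Endo_opr phi_shifts by (auto intro!: opr_cong simp: Endo_opr)

lemma Endo_rel7: "opB \<otimes>\<^bsub>Endo\<^esub> opC = opL phi \<otimes>\<^bsub>Endo\<^esub> (opR (kappa - phi) \<otimes>\<^bsub>Endo\<^esub> (opC \<otimes>\<^bsub>Endo\<^esub> opB))
    \<oplus>\<^bsub>Endo\<^esub> (opL phi \<ominus>\<^bsub>Endo\<^esub> opR phi)"
  unfolding op_defs Endo_opr phi_shifts Endo_opr_minus unfolding phi_def
  using model_fields(3) by (auto intro!: opr_cong simp: Endo_opr)

lemma Endo_data: "sl2_data q Endo opL opR opA opB opC opD"
proof unfold_locales
  fix f g :: mero and z
  show "opL f \<in> carrier Endo" "opR f \<in> carrier Endo" "opA \<in> carrier Endo" "opB \<in> carrier Endo"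
    "opC \<in> carrier Endo" "opD \<in> carrier Endo" by (simp_all add: op_defs)
  show "opL (f + g) = opL f \<oplus>\<^bsub>Endo\<^esub> opL g" "opL (f * g) = opL f \<otimes>\<^bsub>Endo\<^esub> opL g"
    "opL (mconst z) = z \<odot>\<^bsub>Endo\<^esub> \<one>\<^bsub>Endo\<^esub>" "opR (f + g) = opR f \<oplus>\<^bsub>Endo\<^esub> opR g"
    "opR (f * g) = opR f \<otimes>\<^bsub>Endo\<^esub> opR g" "opR (mconst z) = z \<odot>\<^bsub>Endo\<^esub> \<one>\<^bsub>Endo\<^esub>"
    "opL f \<otimes>\<^bsub>Endo\<^esub> opR g = opR g \<otimes>\<^bsub>Endo\<^esub> opL f"
    by (simp_all add: op_defs Endo_opr mult.commute)
  show "opL f \<otimes>\<^bsub>Endo\<^esub> opA = opA \<otimes>\<^bsub>Endo\<^esub> opL (mshift 1 f)"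
    "opR f \<otimes>\<^bsub>Endo\<^esub> opA = opA \<otimes>\<^bsub>Endo\<^esub> opR (mshift 1 f)"
    "opL f \<otimes>\<^bsub>Endo\<^esub> opB = opB \<otimes>\<^bsub>Endo\<^esub> opL (mshift 1 f)"
    "opR f \<otimes>\<^bsub>Endo\<^esub> opB = opB \<otimes>\<^bsub>Endo\<^esub> opR (mshift (-1) f)"
    "opL f \<otimes>\<^bsub>Endo\<^esub> opC = opC \<otimes>\<^bsub>Endo\<^esub> opL (mshift (-1) f)"
    "opR f \<otimes>\<^bsub>Endo\<^esub> opC = opC \<otimes>\<^bsub>Endo\<^esub> opR (mshift 1 f)"
    "opL f \<otimes>\<^bsub>Endo\<^esub> opD = opD \<otimes>\<^bsub>Endo\<^esub> opL (mshift (-1) f)"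
    "opR f \<otimes>\<^bsub>Endo\<^esub> opD = opD \<otimes>\<^bsub>Endo\<^esub> opR (mshift (-1) f)"
    by (simp_all add: op_defs Endo_opr mult.commute)
qed (fact Endo_rel1 Endo_rel2 Endo_rel3 Endo_rel4 Endo_rel5 Endo_rel6 Endo_rel7)+

end

section \<open>Separating the elements t^(2m)_mm by their values in the model\<close>

lemma poly_triangular:
  fixes P :: "nat \<Rightarrow> mero poly"
  assumes deg: "\<And>m. degree (P m) = m" and nz: "\<And>m. P m \<noteq> 0"
    and "(\<Sum>m\<le>M. Polynomial.smult (r m) (P m)) = 0" "m \<le> M"
  shows "r m = 0"
  using assms(3,4)
proof (induction M arbitrary: m)
  case 0
  have "Polynomial.smult (r 0) (P 0) = 0" using 0(1) by simp
  then show ?case using 0(2) nz[of 0] by (simp only: smult_eq_0_iff) simp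
next
  case (Suc M)
  let ?S = "\<Sum>m\<le>M. Polynomial.smult (r m) (P m)"
  have S: "?S + Polynomial.smult (r (Suc M)) (P (Suc M)) = 0"
    using Suc.prems(1) by (simp only: sum.atMost_Suc)
  \<comment> \<open>In degree M + 1 only the last summand survives, because the others have smaller
    degree.\<close>
  have "coeff ?S (Suc M) = (\<Sum>m\<le>M. coeff (Polynomial.smult (r m) (P m)) (Suc M))"
    by (rule coeff_sum)
  also have "\<dots> = 0"
  proof (rule sum.neutral, rule ballI)
    fix m assume "m \<in> {..M}"
    then have "coeff (P m) (Suc M) = 0" using deg[of m] by (intro coeff_eq_0) simp
    then show "coeff (Polynomial.smult (r m) (P m)) (Suc M) = 0" by (simp only: coeff_smult mult_zero_right)
  qed
  finally have "coeff (Polynomial.smult (r (Suc M)) (P (Suc M))) (Suc M) = 0"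
    using arg_cong[OF S, of "\<lambda>p. coeff p (Suc M)"] by (simp only: coeff_add coeff_0 add_0)
  moreover have "coeff (P (Suc M)) (Suc M) \<noteq> 0"
    using leading_coeff_0_iff[of "P (Suc M)"] nz[of "Suc M"] unfolding deg by blast
  ultimately have r: "r (Suc M) = 0" by (simp only: coeff_smult mult_eq_0_iff) blast
  have "?S = 0" using S unfolding r by (simp only: smult_0_left add_0_right)
  show ?case
  proof (cases "m = Suc M")
    case False
    then show ?thesis using Suc.IH[OF \<open>?S = 0\<close>, of m] Suc.prems(2) by linarith
  qed (use r in blast)
qed

context q_param
begin

definition model :: "sl2 \<Rightarrow> (idx \<Rightarrow> mero) \<Rightarrow> idx \<Rightarrow> mero" where
  "model = (SOME \<phi>. \<phi> \<in> alg_hom SL Endo \<and> \<phi> (alpha q) = opA \<and> \<phi> (beta q) = opB \<and> \<phi> (gamma q) = opC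
    \<and> \<phi> (delta q) = opD \<and> (\<forall>f. \<phi> (LA f) = opL f) \<and> (\<forall>f. \<phi> (RA f) = opR f))"

lemma model: "model \<in> alg_hom SL Endo" "model (alpha q) = opA" "model (beta q) = opB" "model (gamma q) = opC"
  "model (delta q) = opD" "model (LA f) = opL f" "model (RA f) = opR f"
proof -
  have "\<exists>\<phi>. \<phi> \<in> alg_hom SL Endo \<and> \<phi> (alpha q) = opA \<and> \<phi> (beta q) = opB \<and> \<phi> (gamma q) = opC
    \<and> \<phi> (delta q) = opD \<and> (\<forall>f. \<phi> (LA f) = opL f) \<and> (\<forall>f. \<phi> (RA f) = opR f)"
    using SL2_universal_data[OF Endo_data] by blast
  from someI_ex[OF this] show "model \<in> alg_hom SL Endo" "model (alpha q) = opA" "model (beta q) = opB" "model (gamma q) = opC"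
    "model (delta q) = opD" "model (LA f) = opL f" "model (RA f) = opR f"
    unfolding model_def by blast+
qed

sublocale m: calg_hom SL Endo model
  using model(1) A.calg_axioms E.calg_axioms by (simp add: calg_hom_def calg_hom_axioms_def)

text \<open>The model applied to the vector that is 1 in bidegree (0, 0) for all s and \<zeta>; an
  element of bidegree (a, b) is then visible only at the indices (a, b, s, \<zeta>).\<close>

definition pv :: "sl2 \<Rightarrow> idx \<Rightarrow> mero" where
  "pv x = model x (\<lambda>(i, j, s, \<zeta>). if i = 0 \<and> j = 0 then 1 else 0)"

lemma pv_add: "x \<in> carrier SL \<Longrightarrow> y \<in> carrier SL \<Longrightarrow> pv (x \<oplus>\<^bsub>SL\<^esub> y) i = pv x i + pv y i"
  by (simp add: pv_def) (simp add: Endo_def)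
lemma pv_smult: "x \<in> carrier SL \<Longrightarrow> pv (z \<odot>\<^bsub>SL\<^esub> x) i = mconst z * pv x i"
  by (simp add: pv_def) (simp add: Endo_def)
lemma pv_zero [simp]: "pv \<zero>\<^bsub>SL\<^esub> i = 0"
  by (simp add: pv_def) (simp add: Endo_def)
lemma pv_minus: "x \<in> carrier SL \<Longrightarrow> y \<in> carrier SL \<Longrightarrow> pv (x \<ominus>\<^bsub>SL\<^esub> y) i = pv x i - pv y i"
  using pv_add[of x "\<ominus>\<^bsub>SL\<^esub> y" i] pv_smult[of y "-1" i]
  by (simp add: a_minus_def A.smult_minus_one mconst_uminus)
lemma pv_one: "pv \<one>\<^bsub>SL\<^esub> (i, j, s, \<zeta>) = (if i = 0 \<and> j = 0 then 1 else 0)"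
  by (simp add: pv_def) (simp add: Endo_def)
lemma pv_mult:
  assumes "x \<in> carrier SL"
  shows "pv (LA f \<otimes>\<^bsub>SL\<^esub> x) (i, j, s, \<zeta>) = f * pv x (i, j, s, \<zeta>)"
    "pv (RA f \<otimes>\<^bsub>SL\<^esub> x) (i, j, s, \<zeta>) = mshift s f * pv x (i, j, s, \<zeta>)"
    "pv (alpha q \<otimes>\<^bsub>SL\<^esub> x) (i, j, s, \<zeta>) = mshift (-1) (pv x (i - 1, j - 1, s, \<zeta>))"
    "pv (beta q \<otimes>\<^bsub>SL\<^esub> x) (i, j, s, \<zeta>)
      = (mconst \<zeta> + ch (1 + s)) / br (1 + s) * mshift (-1) (pv x (i - 1, j + 1, 2 + s, \<zeta>))"
    "pv (gamma q \<otimes>\<^bsub>SL\<^esub> x) (i, j, s, \<zeta>) = 1 / br 2 * mshift 1 (pv x (i + 1, j - 1, s - 2, \<zeta>))"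
    "pv (delta q \<otimes>\<^bsub>SL\<^esub> x) (i, j, s, \<zeta>)
      = (1 + (mconst \<zeta> + ch (s - 1)) / (br 2 * br (1 + s))) * mshift 1 (pv x (i + 1, j + 1, s, \<zeta>))"
  using assms unfolding pv_def
  by (simp_all add: model(2-)) (simp_all add: Endo_def op_defs opr_def)

lemma pv_graded: "x \<in> gr a b \<Longrightarrow> (i, j) \<noteq> (a, b) \<Longrightarrow> pv x (i, j, s, \<zeta>) = 0"
proof (induction x arbitrary: i j s rule: gr_induct)
  case (gens a b g m n x)
  then have x: "x \<in> carrier SL" by auto
  have "(g, m, n) = (alpha q, 1, 1) \<or> (g, m, n) = (beta q, 1, -1) \<or> (g, m, n) = (gamma q, -1, 1)
      \<or> (g, m, n) = (delta q, -1, -1)"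
    using gens.hyps by auto
  moreover have "pv x (i - m, j - n, t, \<zeta>) = 0" for t by (rule gens.IH) (use gens.prems in auto)
  ultimately show ?case using x by (elim disjE) (simp_all add: pv_mult)
next
  case (add i j x y)
  then have "x \<in> carrier SL" "y \<in> carrier SL" by auto
  with add show ?case by (simp add: pv_add)
next
  case (smult i j z x)
  then have "x \<in> carrier SL" by auto
  with smult show ?case by (simp add: pv_smult)
next
  case (L i j f x)
  then have "x \<in> carrier SL" by auto
  with L show ?case by (simp add: pv_mult)
next
  case (R i j f x)
  then have "x \<in> carrier SL" by auto
  with R show ?case by (simp add: pv_mult)
qed (auto simp: pv_one)

lemma tm_graded: "A.tm n k j \<in> gr (2 * k - int n) (2 * j - int n)"
proof (induction n arbitrary: k j)
  case (Suc n)
  have "beta q \<otimes>\<^bsub>SL\<^esub> A.tm n k j \<in> gr (2 * (k + 1) - int (Suc n)) (2 * j - int (Suc n))"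
    "alpha q \<otimes>\<^bsub>SL\<^esub> A.tm n k (j - 1) \<in> gr (2 * (k + 1) - int (Suc n)) (2 * j - int (Suc n))"
    "delta q \<otimes>\<^bsub>SL\<^esub> A.tm n k j \<in> gr (2 * k - int (Suc n)) (2 * j - int (Suc n))"
    "gamma q \<otimes>\<^bsub>SL\<^esub> A.tm n k (j - 1) \<in> gr (2 * k - int (Suc n)) (2 * j - int (Suc n))" for k j
    by (rule gr_mult'[OF gr_gens(2) Suc.IH] gr_mult'[OF gr_gens(1) Suc.IH] gr_mult'[OF gr_gens(4) Suc.IH]
      gr_mult'[OF gr_gens(3) Suc.IH]; simp)+
  note h = this(1)[of "int n" j] this(2)[of "int n" j] this(3)[of k j] this(4)[of k j]
  show ?case
  proof (cases "k = int n + 1")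
    case True
    then show ?thesis
      using gr_add[OF h(1) gr_LR(2)[OF h(2)]] by (simp add: A.tm.simps(2))
  next
    case False
    then show ?thesis
      using gr_add[OF h(3) gr_LR(2)[OF h(4)]] by (simp add: A.tm.simps(2))
  qed
qed auto

text \<open>The values of \<open>t^(2m)_(mm)\<close> in the model are polynomials of degree \<open>m\<close> in \<open>\<zeta>\<close>, because
  \<open>\<gamma>\<beta>\<close> acts on them by a three-term recurrence.\<close>

definition em :: "nat \<Rightarrow> complex \<Rightarrow> complex \<Rightarrow> mero" where
  "em m s \<zeta> = pv (A.tm (2 * m) (int m) (int m)) (0, 0, s, \<zeta>)"

lemma em_0 [simp]: "em 0 s \<zeta> = 1"
  by (simp add: em_def pv_one)

text \<open>Below the last row \<alpha> is traded for \<gamma> by \<open>tm_row_a\<close> and the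
  result expanded by \<open>c_tm\<close>; in the last row this is \<open>a_tm_top\<close>, where the
  lower terms vanish.\<close>

lemma ba_step:
  fixes n :: nat and k j :: int
  assumes "0 \<le> k" "k \<le> int n"
  shows "RA (qn (int n + 1)) \<otimes>\<^bsub>SL\<^esub> (alpha q \<otimes>\<^bsub>SL\<^esub> A.tm n k j)
    = RA (qn (int n + 1)) \<otimes>\<^bsub>SL\<^esub> A.tlow n k j
      \<oplus>\<^bsub>SL\<^esub> LA (Phi (int n - k)) \<otimes>\<^bsub>SL\<^esub> (RA (qn (j + 1)) \<otimes>\<^bsub>SL\<^esub> A.tm (Suc n) (k + 1) (j + 1)
        \<ominus>\<^bsub>SL\<^esub> RA (qn (k + 1)) \<otimes>\<^bsub>SL\<^esub> A.tlow n k j)"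
proof (cases "k = int n")
  case True
  have "A.tlow n k j = \<zero>\<^bsub>SL\<^esub>"
    using True by (cases n) (simp_all add: A.tm_eq_0)
  then show ?thesis
    using A.a_tm_top[of n j] True by (simp add: a_minus_def A.r_null)
next
  case False
  with assms obtain m where n: "n = Suc m" by (cases n) auto
  have k: "k \<le> int m" using False assms n by simp
  have "RA (qn (int n + 1)) \<otimes>\<^bsub>SL\<^esub> (alpha q \<otimes>\<^bsub>SL\<^esub> A.tm n k j)
      = RA (qn (int n + 1)) \<otimes>\<^bsub>SL\<^esub> A.tlow n k j
        \<oplus>\<^bsub>SL\<^esub> LA (Phi (int n - k)) \<otimes>\<^bsub>SL\<^esub> (RA (qn (int n + 1)) \<otimes>\<^bsub>SL\<^esub> (gamma q \<otimes>\<^bsub>SL\<^esub> A.tm n (k + 1) j))"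
    unfolding n A.tm_row_a[OF assms(1) k]
    by (simp add: A.r_distr A.LR_left add.commute add_diff_eq)
  then show ?thesis
    using A.c_tm[of "k + 1" n j] k n by simp
qed

text \<open>This lemma and \<open>solve_for_next\<close> do the field arithmetic of
  \<open>em_step\<close> with atoms in place of long expressions.\<close>

lemma collect_terms:
  fixes d :: "'f :: field"
  assumes "d * (N / B * E) = P * (d * x) - r * (d * y + P * (qm * x - w * y))"
  shows "(d / B) * (N * E) = P * (d - r * qm) * x - r * (d - P * w) * y"
proof -
  have "(d / B) * (N * E) = d * (N / B * E)" by simp
  also have "\<dots> = P * (d - r * qm) * x - r * (d - P * w) * y"
    unfolding assms by (simp add: algebra_simps)
  finally show ?thesis .
qed

lemma solve_for_next:
  fixes D :: "'f :: field"
  assumes "D \<noteq> 0" "D * (N * E0) + x * E0 + k * (u * E0 + F) = x * E1"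
  shows "(x / D) * E1 = (N + (x / D + k * u / D)) * E0 + (k / D) * F"
proof -
  have "(x * E1) / D = (D * (N * E0) + x * E0 + k * (u * E0 + F)) / D" using assms(2) by simp
  with assms(1) show ?thesis by (simp add: field_simps)
qed

text \<open>The product \<gamma>\<beta> t^(2m)_mm is computed twice: in the model it multiplies by
  (\<zeta> + ch(s - 1))/([\<lambda> + 2][\<lambda> + s]), and the multiplication formulas express it
  through the neighbours m + 1, m, m - 1. The coefficients are chosen before \<zeta>, as a
  recurrence for polynomials in \<zeta> requires.\<close>

lemma em_step:
  "\<exists>a b c. a \<noteq> 0 \<and> (\<forall>\<zeta>. a * em (Suc m) s \<zeta> = ((mconst \<zeta> + ch (s - 1)) + b) * em m s \<zeta>
    + (if m = 0 then 0 else c * em (m - 1) s \<zeta>))"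
proof -
  let ?n = "2 * m" and ?k = "int m"
  \<comment> \<open>The two components of \<beta> t^(2m)_mm, both of bidegree (1, -1);
    \<open>?X\<close> and \<open>?Y\<close> are the values of \<gamma>T and \<gamma>W.\<close>
  define T where "T = A.tm (Suc (2 * m)) (int m + 1) (int m)"
  define W where "W = A.tlow (2 * m) (int m) (int m - 1)"
  let ?X = "\<lambda>\<zeta>. 1 / br 2 * mshift 1 (pv T (1, -1, s - 2, \<zeta>))"
  let ?Y = "\<lambda>\<zeta>. 1 / br 2 * mshift 1 (pv W (1, -1, s - 2, \<zeta>))"
  have [simp]: "T \<in> carrier SL" "W \<in> carrier SL" by (simp_all add: T_def W_def)
  define N where "N \<zeta> = mconst \<zeta> + ch (s - 1)" for \<zeta>
  define d where "d = qn (2 * int m + 1)"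
  have d0: "d \<noteq> 0" unfolding d_def by (rule qn_nonzero) simp
  define p r where "p = Phi (int m)" and "r = Phi (int m + 1)"
  have b: "RA d \<otimes>\<^bsub>SL\<^esub> (beta q \<otimes>\<^bsub>SL\<^esub> A.tm (2 * m) (int m) (int m))
      = LA p \<otimes>\<^bsub>SL\<^esub> (RA d \<otimes>\<^bsub>SL\<^esub> T) \<ominus>\<^bsub>SL\<^esub> RA r \<otimes>\<^bsub>SL\<^esub> (RA d \<otimes>\<^bsub>SL\<^esub> W
        \<oplus>\<^bsub>SL\<^esub> LA p \<otimes>\<^bsub>SL\<^esub> (RA (qn (int m)) \<otimes>\<^bsub>SL\<^esub> T \<ominus>\<^bsub>SL\<^esub> RA (qn (int m + 1)) \<otimes>\<^bsub>SL\<^esub> W))"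
  proof -
    have "LA p \<otimes>\<^bsub>SL\<^esub> T = beta q \<otimes>\<^bsub>SL\<^esub> A.tm (2 * m) (int m) (int m)
        \<oplus>\<^bsub>SL\<^esub> RA r \<otimes>\<^bsub>SL\<^esub> (alpha q \<otimes>\<^bsub>SL\<^esub> A.tm (2 * m) (int m) (int m - 1))"
      using A.tm_row_b[of "int m" "2 * m" "int m"] by (simp add: T_def p_def r_def)
    then have "RA d \<otimes>\<^bsub>SL\<^esub> (LA p \<otimes>\<^bsub>SL\<^esub> T) = RA d \<otimes>\<^bsub>SL\<^esub> (beta q \<otimes>\<^bsub>SL\<^esub> A.tm (2 * m) (int m) (int m))
        \<oplus>\<^bsub>SL\<^esub> RA r \<otimes>\<^bsub>SL\<^esub> (RA d \<otimes>\<^bsub>SL\<^esub> (alpha q \<otimes>\<^bsub>SL\<^esub> A.tm (2 * m) (int m) (int m - 1)))"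
      by (simp add: A.r_distr A.R_left)
    moreover have "RA d \<otimes>\<^bsub>SL\<^esub> (alpha q \<otimes>\<^bsub>SL\<^esub> A.tm (2 * m) (int m) (int m - 1))
        = RA d \<otimes>\<^bsub>SL\<^esub> W
        \<oplus>\<^bsub>SL\<^esub> LA p \<otimes>\<^bsub>SL\<^esub> (RA (qn (int m)) \<otimes>\<^bsub>SL\<^esub> T \<ominus>\<^bsub>SL\<^esub> RA (qn (int m + 1)) \<otimes>\<^bsub>SL\<^esub> W)"
      using ba_step[of "int m" "2 * m" "int m - 1"] by (simp add: d_def p_def T_def W_def)
    ultimately show ?thesis by (simp add: A.eq_diff_eq A.LR_left)
  qed
  \<comment> \<open>The identity \<open>b\<close> multiplied by \<gamma> and evaluated: functions of
    \<mu> are shifted by s - 2 and, in passing \<gamma>, by 1.\<close>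
  have b': "d * (N \<zeta> / (br 2 * br s) * em m s \<zeta>)
      = mshift 1 p * (d * ?X \<zeta>) - mshift (s - 1) r * (d * ?Y \<zeta>
        + mshift 1 p * (qn (int m) * ?X \<zeta> - qn (int m + 1) * ?Y \<zeta>))" for \<zeta>
  proof -
    have "1 / br 2 * mshift 1 (pv (RA d \<otimes>\<^bsub>SL\<^esub> (beta q \<otimes>\<^bsub>SL\<^esub> A.tm (2 * m) (int m) (int m))) (1, -1, s - 2, \<zeta>))
        = d * (N \<zeta> / (br 2 * br s) * em m s \<zeta>)"
      by (simp add: pv_mult d_def em_def N_def add.commute diff_add_eq_diff_diff_swap)
    then show ?thesis
      unfolding b by (simp add: pv_mult pv_add pv_minus d_def ring_distribs)
  qed
  have c: "qn (2 * int m + 2) * ?X \<zeta> = qn (int m + 1) * em (Suc m) s \<zeta> - qn (int m + 1) * em m s \<zeta>" for \<zeta>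
  proof -
    have "RA (qn (2 * int m + 2)) \<otimes>\<^bsub>SL\<^esub> (gamma q \<otimes>\<^bsub>SL\<^esub> T) = RA (qn (int m + 1)) \<otimes>\<^bsub>SL\<^esub> A.tm (2 * Suc m) (int (Suc m)) (int (Suc m))
        \<ominus>\<^bsub>SL\<^esub> RA (qn (int m + 1)) \<otimes>\<^bsub>SL\<^esub> A.tm (2 * m) (int m) (int m)"
      using A.c_tm[of "int m + 1" "Suc (2 * m)" "int m"] by (simp add: T_def add.commute)
    from arg_cong[OF this, of "\<lambda>x. pv x (0, 0, s, \<zeta>)"] show ?thesis
      by (simp add: pv_mult pv_minus em_def)
  qed
  \<comment> \<open>For m = 0 there is no level below and W vanishes, but m - 1 would denote 0
    again; hence the case distinction.\<close>
  have c': "\<exists>u v. \<forall>\<zeta>. ?Y \<zeta> = u * em m s \<zeta> + (if m = 0 then 0 else v * em (m - 1) s \<zeta>)"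
  proof (cases m)
    case 0
    then have "W = \<zero>\<^bsub>SL\<^esub>" by (simp add: W_def)
    then show ?thesis using 0 by (intro exI[of _ 0]) simp
  next
    case (Suc l)
    have q0: "qn (2 * int l + 2) \<noteq> 0" by (rule qn_nonzero) simp
    have "W = A.tm (Suc (2 * l)) (int l + 1) (int l)" by (simp add: W_def Suc add.commute)
    then have "RA (qn (2 * int l + 2)) \<otimes>\<^bsub>SL\<^esub> (gamma q \<otimes>\<^bsub>SL\<^esub> W) = RA (qn (int l + 1)) \<otimes>\<^bsub>SL\<^esub> A.tm (2 * Suc l) (int (Suc l)) (int (Suc l))
        \<ominus>\<^bsub>SL\<^esub> RA (qn (int l + 1)) \<otimes>\<^bsub>SL\<^esub> A.tm (2 * l) (int l) (int l)"
      using A.c_tm[of "int l + 1" "Suc (2 * l)" "int l"] by (simp add: add.commute)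
    from arg_cong[OF this, of "\<lambda>x. pv x (0, 0, s, _)"]
    have "qn (2 * int l + 2) * ?Y \<zeta> = qn (int l + 1) * em m s \<zeta> - qn (int l + 1) * em (m - 1) s \<zeta>" for \<zeta>
      by (simp add: pv_mult pv_minus em_def Suc)
    then have "?Y \<zeta> = (qn (int l + 1) / qn (2 * int l + 2)) * em m s \<zeta>
        + (- qn (int l + 1) / qn (2 * int l + 2)) * em (m - 1) s \<zeta>" for \<zeta>
      using q0 by (simp add: field_simps)
    moreover have m0: "m \<noteq> 0" using Suc by simp
    ultimately show ?thesis unfolding if_not_P[OF m0] by blast
  qed
  then obtain u v where Y: "\<And>\<zeta>. ?Y \<zeta> = u * em m s \<zeta> + (if m = 0 then 0 else v * em (m - 1) s \<zeta>)"
    by blast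
  define e where "e = qn (2 * int m + 2)"
  have e0: "e \<noteq> 0" unfolding e_def by (rule qn_nonzero) simp
  define w where "w = qn (int m + 1)"
  have w0: "w \<noteq> 0" unfolding w_def by (rule qn_nonzero) simp
  have X: "?X \<zeta> = w / e * em (Suc m) s \<zeta> - w / e * em m s \<zeta>" for \<zeta>
  proof -
    have "?X \<zeta> = (e * ?X \<zeta>) / e" using e0 by simp
    also have "e * ?X \<zeta> = w * em (Suc m) s \<zeta> - w * em m s \<zeta>" using c[of \<zeta>] unfolding e_def w_def .
    finally show ?thesis by (simp only: diff_divide_distrib times_divide_eq_left)
  qed
  \<comment> \<open>The coefficient of \<open>?X\<close> is nonzero by
    \<open>qn_br_identity2\<close>, so that the recurrence can be solved for the next value.\<close>
  have lead: "d - mshift (s - 1) r * qn (int m) = w * br (s - of_int (int m)) / br s"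
    using arg_cong[OF qn_br_identity2[of "int m + 1" "int m"], of "mshift (s - 1)"]
    by (simp add: r_def Phi_def d_def w_def field_simps add_ac)
  define D where "D = d / (br 2 * br s)"
  have D0: "D \<noteq> 0" using d0 by (simp add: D_def)
  define K where "K = mshift 1 p * (d - mshift (s - 1) r * qn (int m))"
  have K0: "K \<noteq> 0" unfolding K_def lead using w0 by (simp add: p_def)
  define K' where "K' = mshift (s - 1) r * (d - mshift 1 p * w)"
  have eq: "D * (N \<zeta> * em m s \<zeta>) = K * ?X \<zeta> - K' * ?Y \<zeta>" for \<zeta>
    unfolding D_def K_def K'_def w_def by (rule collect_terms[OF b'[of \<zeta>]])
  have "(K * w / e / D) * em (Suc m) s \<zeta> = (N \<zeta> + (K * w / e / D + K' * u / D)) * em m s \<zeta>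
      + (if m = 0 then 0 else (K' * v / D) * em (m - 1) s \<zeta>)" for \<zeta>
  proof -
    have "D * (N \<zeta> * em m s \<zeta>) + K * w / e * em m s \<zeta> + K' * (u * em m s \<zeta> + (if m = 0 then 0 else v * em (m - 1) s \<zeta>))
        = K * w / e * em (Suc m) s \<zeta>"
      unfolding eq unfolding X Y by (simp add: algebra_simps)
    from solve_for_next[OF D0 this] show ?thesis by (cases "m = 0") (simp_all add: mult.assoc)
  qed
  moreover have "K * w / e / D \<noteq> 0" using K0 w0 e0 D0 by simp
  ultimately show ?thesis unfolding N_def by blast
qed

lemma em_poly: "\<exists>P. degree P = m \<and> P \<noteq> 0 \<and> (\<forall>\<zeta>. em m s \<zeta> = poly P (mconst \<zeta>))"
proof (induction m rule: less_induct)
  case (less m)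
  show ?case
  proof (cases m)
    case 0
    then show ?thesis by (intro exI[of _ 1]) simp
  next
    case (Suc n)
    from less[of n] Suc obtain P where P: "degree P = n" "P \<noteq> 0" "\<And>\<zeta>. em n s \<zeta> = poly P (mconst \<zeta>)" by auto
    obtain a b c where a: "a \<noteq> 0" and eq: "\<And>\<zeta>. a * em (Suc n) s \<zeta> = ((mconst \<zeta> + ch (s - 1)) + b) * em n s \<zeta>
      + (if n = 0 then 0 else c * em (n - 1) s \<zeta>)" using em_step[of n s] by blast
    have "\<exists>Q. degree Q \<le> n \<and> (\<forall>\<zeta>. (if n = 0 then 0 else c * em (n - 1) s \<zeta>) = poly Q (mconst \<zeta>))"
    proof (cases "n = 0")
      case True
      then show ?thesis by (intro exI[of _ 0]) simp
    next
      case False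
      have "n - 1 < m" using Suc by simp
      from less[OF this] obtain Q where "degree Q = n - 1" "\<And>\<zeta>. em (n - 1) s \<zeta> = poly Q (mconst \<zeta>)" by blast
      then show ?thesis using False by (intro exI[of _ "Polynomial.smult c Q"]) auto
    qed
    then obtain Q where Q: "degree Q \<le> n" "\<And>\<zeta>. (if n = 0 then 0 else c * em (n - 1) s \<zeta>) = poly Q (mconst \<zeta>)" by blast
    \<comment> \<open>The linear factor raises the degree by one, and Q is of too low degree to
      interfere.\<close>
    let ?lin = "[:ch (s - 1) + b, 1:]"
    let ?P = "Polynomial.smult (inverse a) (?lin * P + Q)"
    have "degree (?lin * P) = Suc n" using P by (subst degree_mult_eq) auto
    then have "degree (?lin * P + Q) = Suc n" using Q(1) by (subst degree_add_eq_left) auto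
    then have "degree ?P = Suc n" using a by simp
    moreover have "em (Suc n) s \<zeta> = poly ?P (mconst \<zeta>)" for \<zeta>
    proof -
      have aa: "a * (inverse a * x) = x" for x using a by simp
      have "a * em (Suc n) s \<zeta> = a * poly ?P (mconst \<zeta>)"
        unfolding eq Q(2) P(3)[of \<zeta>] by (simp only: poly_smult poly_add poly_mult poly_pCons poly_0 aa) (simp add: algebra_simps)
      then show ?thesis using a by simp
    qed
    moreover have "?P \<noteq> 0" using \<open>degree ?P = Suc n\<close> by (metis degree_0 nat.distinct(1))
    ultimately show ?thesis unfolding Suc by blast
  qed
qed

text \<open>A polynomial over the field of meromorphic functions that has every constant as a root
  is zero, because there are infinitely many constants.\<close>

lemma em_independent:
  assumes "\<And>\<zeta>. (\<Sum>m\<le>M. r m * em m s \<zeta>) = 0" "m \<le> M"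
  shows "r m = 0"
proof -
  have "\<forall>m. \<exists>P. degree P = m \<and> P \<noteq> 0 \<and> (\<forall>\<zeta>. em m s \<zeta> = poly P (mconst \<zeta>))" using em_poly by blast
  then obtain P where P: "\<And>m. degree (P m) = m" "\<And>m. P m \<noteq> 0" "\<And>m \<zeta>. em m s \<zeta> = poly (P m) (mconst \<zeta>)"
    by metis
  let ?S = "\<Sum>m\<le>M. Polynomial.smult (r m) (P m)"
  have "poly ?S (mconst \<zeta>) = 0" for \<zeta>
    using assms(1)[of \<zeta>] by (simp add: poly_sum P(3))
  then have "range mconst \<subseteq> {x. poly ?S x = 0}" by auto
  moreover have "infinite (range mconst)"
    by (simp add: finite_image_iff inj_def infinite_UNIV_char_0)
  ultimately have "?S = 0" using poly_roots_finite infinite_super by blast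
  then show ?thesis using poly_triangular[OF P(1,2)] assms(2) by blast
qed

end

section \<open>The Haar functional\<close>

context sl2_base
begin

text \<open>Lists of pairs represent elements of the tensor square of the meromorphic functions; an
  induction on the length can then eliminate the head.\<close>

definition LRsum :: "(mero \<times> mero) list \<Rightarrow> 'b" where
  "LRsum ps = foldr (\<lambda>p x. L (fst p) \<otimes> R (snd p) \<oplus> x) ps \<zero>"

lemma LRsum_simps [simp]: "LRsum [] = \<zero>" "LRsum (p # ps) = L (fst p) \<otimes> R (snd p) \<oplus> LRsum ps"
  by (simp_all add: LRsum_def)
lemma LRsum_closed [simp, intro]: "LRsum ps \<in> carrier S"
  by (induction ps) simp_all
lemma LRsum_append: "LRsum (ps @ rs) = LRsum ps \<oplus> LRsum rs"
  by (induction ps) (simp_all add: a_assoc)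

lemma L_const_swap: "L (mconst z * f) \<otimes> R g = L f \<otimes> R (mconst z * g)"
  by (simp add: L_mult R_mult L_const_R m_assoc const_central[symmetric])

text \<open>A step of Gaussian elimination in the tensor square: multiples of f are split off from
  all first factors and collected into one term.\<close>

lemma LRsum_eliminate:
  "LRsum (map (\<lambda>p. (fst p - mconst (w p) * f, snd p)) ps) \<oplus> L f \<otimes> R (\<Sum>p\<leftarrow>ps. mconst (w p) * snd p) = LRsum ps"
proof (induction ps)
  case Nil
  then show ?case by simp
next
  case (Cons p ps)
  let ?A = "LRsum (map (\<lambda>p. (fst p - mconst (w p) * f, snd p)) ps)"
    and ?B = "L f \<otimes> R (\<Sum>p\<leftarrow>ps. mconst (w p) * snd p)"
  have "L (fst p - mconst (w p) * f) \<otimes> R (snd p) \<oplus> L f \<otimes> R (mconst (w p) * snd p) = L (fst p) \<otimes> R (snd p)"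
    by (simp add: L_minus l_diff_distr L_const_swap diff_add_eq) (simp add: rs)
  then have "L (fst p) \<otimes> R (snd p) \<oplus> LRsum ps
      = (L (fst p - mconst (w p) * f) \<otimes> R (snd p) \<oplus> L f \<otimes> R (mconst (w p) * snd p)) \<oplus> (?A \<oplus> ?B)"
    unfolding Cons.IH by simp
  then show ?case by (simp add: R_add r_distr a_ac)
qed

text \<open>The model only sees f(\<lambda>)g(\<lambda> + s), so the vanishing of \<Sum>
  f(\<lambda>)g(\<mu>) in the algebra has to follow from vanishing along all lines. Evaluation of
  the first factors at a point z gives a linear relation among the second ones, which removes one
  pair.\<close>

lemma LRsum_zero_of_vanishing:
  assumes "\<And>s. (\<Sum>p\<leftarrow>ps. fst p * mshift s (snd p)) = 0"
  shows "LRsum ps = \<zero>"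
  using assms
proof (induction "length ps" arbitrary: ps)
  case 0
  then show ?case by simp
next
  case (Suc n)
  then obtain p ps' where ps: "ps = p # ps'" by (cases ps) auto
  show ?case
  proof (cases "fst p = 0")
    case True
    then have "LRsum ps' = \<zero>"
      using Suc.hyps Suc.prems by (intro Suc.hyps(1)) (simp_all add: ps)
    then show ?thesis using True by (simp add: ps)
  next
    case False
    have "\<forall>\<^sub>\<approx>z\<in>UNIV. \<forall>i\<in>{..<length ps}. isCont (mval (fst (ps ! i))) z"
      by (auto simp: eventually_ball_finite_distrib simp del: lessThan_iff intro: mval_isCont_ae)
    with mval_nonzero_ae[OF False]
    have "\<forall>\<^sub>\<approx>z\<in>UNIV. mval (fst p) z \<noteq> 0 \<and> (\<forall>i<length ps. isCont (mval (fst (ps ! i))) z)"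
      by eventually_elim auto
    \<comment> \<open>The point avoids the zeros of the first function and all discontinuities, as
      \<open>separate_variables\<close> and the division below require.\<close>
    then obtain z where z: "mval (fst p) z \<noteq> 0" "\<And>i. i < length ps \<Longrightarrow> isCont (mval (fst (ps ! i))) z"
      using ae_ex[of "\<lambda>z. mval (fst p) z \<noteq> 0 \<and> (\<forall>i<length ps. isCont (mval (fst (ps ! i))) z)"] by auto
    have "(\<Sum>i\<in>{..<length ps}. mconst (mval (fst (ps ! i)) z) * snd (ps ! i)) = 0"
    proof (rule separate_variables)
      show "(\<Sum>i<length ps. fst (ps ! i) * mshift s (snd (ps ! i))) = 0" for s
        using Suc.prems[of s] by (simp add: sum_list_sum_nth atLeast0LessThan)
    qed (use z in auto)
    then have g: "(\<Sum>p\<leftarrow>ps. mconst (mval (fst p) z) * snd p) = 0"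
      by (simp add: sum_list_sum_nth atLeast0LessThan)
    \<comment> \<open>Dividing by the value at z solves the relation for the second factor of
      p.\<close>
    define w where "w p' = mval (fst p') z / mval (fst p) z" for p' :: "mero \<times> mero"
    have "(\<Sum>p'\<leftarrow>ps. mconst (w p') * snd p') = mconst (1 / mval (fst p) z) * (\<Sum>p\<leftarrow>ps. mconst (mval (fst p) z) * snd p)"
      by (simp add: sum_list_const_mult[symmetric] w_def mconst_divide mult.assoc o_def)
    then have g: "snd p + (\<Sum>p'\<leftarrow>ps'. mconst (w p') * snd p') = 0"
      unfolding g using z(1) by (simp add: ps w_def)
    let ?qs = "map (\<lambda>p'. (fst p' - mconst (w p') * fst p, snd p')) ps'"
    have "LRsum ?qs = \<zero>"
    proof (rule Suc.hyps(1))
      show "n = length ?qs" using Suc.hyps(2) by (simp add: ps)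
      fix s
      have "(\<Sum>p'\<leftarrow>?qs. fst p' * mshift s (snd p'))
          = (\<Sum>p'\<leftarrow>ps'. fst p' * mshift s (snd p')) - fst p * mshift s (\<Sum>p'\<leftarrow>ps'. mconst (w p') * snd p')"
        by (induction ps') (simp_all add: algebra_simps)
      also have "(\<Sum>p'\<leftarrow>ps'. mconst (w p') * snd p') = - snd p"
        using g by (simp add: add_eq_0_iff)
      finally show "(\<Sum>p'\<leftarrow>?qs. fst p' * mshift s (snd p')) = 0"
        using Suc.prems[of s] by (simp add: ps add.commute)
    qed
    then have "LRsum ps' = L (fst p) \<otimes> R (\<Sum>p'\<leftarrow>ps'. mconst (w p') * snd p')"
      using LRsum_eliminate[of w "fst p" ps'] by simp
    then have "LRsum ps = L (fst p) \<otimes> R (snd p + (\<Sum>p'\<leftarrow>ps'. mconst (w p') * snd p'))"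
      by (simp add: ps R_add r_distr)
    then show ?thesis unfolding g by simp
  qed
qed

end

section \<open>The span of the matrix elements\<close>

type_synonym tterm = "mero \<times> mero \<times> nat \<times> int \<times> int"

context q_param
begin

fun tval :: "tterm \<Rightarrow> sl2" where "tval (f, g, n, k, j) = LA f \<otimes>\<^bsub>SL\<^esub> (RA g \<otimes>\<^bsub>SL\<^esub> A.tm n k j)"
fun tL :: "mero \<Rightarrow> tterm \<Rightarrow> tterm" where "tL h (f, g, n, k, j) = (h * f, g, n, k, j)"
fun tR :: "mero \<Rightarrow> tterm \<Rightarrow> tterm" where "tR h (f, g, n, k, j) = (f, h * g, n, k, j)"
fun valid :: "tterm \<Rightarrow> bool" where "valid (f, g, n, k, j) \<longleftrightarrow> 0 \<le> k \<and> k \<le> int n \<and> 0 \<le> j \<and> j \<le> int n"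
fun bideg :: "tterm \<Rightarrow> int \<times> int" where "bideg (f, g, n, k, j) = (2 * k - int n, 2 * j - int n)"

lemma tval_closed [simp, intro]: "tval t \<in> carrier SL" by (cases t) simp

lemma tL_tR_simps [simp]: "valid (tL h t) = valid t" "valid (tR h t) = valid t" "bideg (tL h t) = bideg t"
  "bideg (tR h t) = bideg t" "tval (tL h t) = LA h \<otimes>\<^bsub>SL\<^esub> tval t" "tval (tR h t) = RA h \<otimes>\<^bsub>SL\<^esub> tval t"
  by (cases t; simp add: A.L_prod A.R_prod A.LR_left)+

definition sumv :: "tterm list \<Rightarrow> sl2" where "sumv xs = foldr (\<lambda>t x. tval t \<oplus>\<^bsub>SL\<^esub> x) xs \<zero>\<^bsub>SL\<^esub>"

lemma sumv_simps [simp]: "sumv [] = \<zero>\<^bsub>SL\<^esub>" "sumv (t # xs) = tval t \<oplus>\<^bsub>SL\<^esub> sumv xs"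
  by (simp_all add: sumv_def)
lemma sumv_closed [simp, intro]: "sumv xs \<in> carrier SL" by (induction xs) simp_all
lemma sumv_append: "sumv (xs @ ys) = sumv xs \<oplus>\<^bsub>SL\<^esub> sumv ys"
  by (induction xs) (simp_all add: A.a_assoc)

text \<open>The predicate on bidegrees makes one argument serve twice: for a single bidegree it
  yields homogeneous expansions of homogeneous elements, and for the constantly true predicate it
  yields spanning.\<close>

definition Sp :: "(int \<times> int \<Rightarrow> bool) \<Rightarrow> sl2 set" where
  "Sp Q = {sumv xs | xs. \<forall>t\<in>set xs. valid t \<and> Q (bideg t)}"

lemma SpI: "\<forall>t\<in>set xs. valid t \<and> Q (bideg t) \<Longrightarrow> sumv xs \<in> Sp Q" by (auto simp: Sp_def)

lemma Sp_closed: "x \<in> Sp Q \<Longrightarrow> x \<in> carrier SL" by (auto simp: Sp_def)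

lemma Sp_zero [simp, intro]: "\<zero>\<^bsub>SL\<^esub> \<in> Sp Q"
  using SpI[of "[]" Q] by simp

lemma Sp_add: "x \<in> Sp Q \<Longrightarrow> y \<in> Sp Q \<Longrightarrow> x \<oplus>\<^bsub>SL\<^esub> y \<in> Sp Q"
proof -
  assume "x \<in> Sp Q" "y \<in> Sp Q"
  then obtain xs ys where "x = sumv xs" "\<forall>t\<in>set xs. valid t \<and> Q (bideg t)"
    "y = sumv ys" "\<forall>t\<in>set ys. valid t \<and> Q (bideg t)" by (auto simp: Sp_def)
  then show ?thesis using SpI[of "xs @ ys" Q] by (auto simp: sumv_append)
qed

lemma Sp_LR: 
  assumes "x \<in> Sp Q"
  shows "LA h \<otimes>\<^bsub>SL\<^esub> x \<in> Sp Q" "RA h \<otimes>\<^bsub>SL\<^esub> x \<in> Sp Q"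
proof -
  from assms obtain xs where xs: "x = sumv xs" "\<forall>t\<in>set xs. valid t \<and> Q (bideg t)" by (auto simp: Sp_def)
  have "LA h \<otimes>\<^bsub>SL\<^esub> sumv xs = sumv (map (tL h) xs)"
    by (induction xs) (simp_all add: A.r_distr)
  moreover have "RA h \<otimes>\<^bsub>SL\<^esub> sumv xs = sumv (map (tR h) xs)"
    by (induction xs) (simp_all add: A.r_distr)
  ultimately show "LA h \<otimes>\<^bsub>SL\<^esub> x \<in> Sp Q" "RA h \<otimes>\<^bsub>SL\<^esub> x \<in> Sp Q"
    unfolding xs(1) by (auto intro!: SpI dest!: xs(2)[rule_format])
qed

lemma Sp_uminus: "x \<in> Sp Q \<Longrightarrow> \<ominus>\<^bsub>SL\<^esub> x \<in> Sp Q"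
  using Sp_LR(1)[of x Q "-1"] Sp_closed[of x Q] by (simp add: A.L_uminus A.l_minus)

lemma Sp_minus: "x \<in> Sp Q \<Longrightarrow> y \<in> Sp Q \<Longrightarrow> x \<ominus>\<^bsub>SL\<^esub> y \<in> Sp Q"
  unfolding a_minus_def by (intro Sp_add Sp_uminus)

lemma smult_LA: "x \<in> carrier SL \<Longrightarrow> z \<odot>\<^bsub>SL\<^esub> x = LA (mconst z) \<otimes>\<^bsub>SL\<^esub> x"
  by (simp add: A.L_const A.smult_mult_left)

lemma Sp_smult: "x \<in> Sp Q \<Longrightarrow> z \<odot>\<^bsub>SL\<^esub> x \<in> Sp Q"
  using Sp_LR(1)[of x Q "mconst z"] Sp_closed[of x Q] by (simp add: smult_LA)

lemma tm_in_Sp: "Q (2 * k - int n, 2 * j - int n) \<Longrightarrow> A.tm n k j \<in> Sp Q"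
proof (cases "0 \<le> k \<and> k \<le> int n \<and> 0 \<le> j \<and> j \<le> int n")
  case True
  assume "Q (2 * k - int n, 2 * j - int n)"
  then show ?thesis using SpI[of "[(1, 1, n, k, j)]" Q] True by simp
next
  case False
  then have "A.tm n k j = \<zero>\<^bsub>SL\<^esub>" by (intro A.tm_eq_0) auto
  then show ?thesis by simp
qed

lemma tlow_in_Sp: "Q (2 * k - int n + 1, 2 * j - int n + 1) \<Longrightarrow> A.tlow n k j \<in> Sp Q"
  by (cases n) (auto intro!: tm_in_Sp simp: algebra_simps)

lemma R_unit_cancel:
  assumes "f \<noteq> 0" "x \<in> carrier SL" "RA f \<otimes>\<^bsub>SL\<^esub> x \<in> Sp Q"
  shows "x \<in> Sp Q"
  using Sp_LR(2)[OF assms(3), of "inverse f"] assms(1,2) by (simp add: A.R_prod)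

text \<open>The formula \<open>c_tm\<close> gives the product up to the unit [n + 1].\<close>

lemma gamma_tm_in_Sp:
  assumes "k \<le> int n" and Q: "Q (2 * k - int n - 1, 2 * j - int n + 1)"
  shows "gamma q \<otimes>\<^bsub>SL\<^esub> A.tm n k j \<in> Sp Q"
proof (rule R_unit_cancel[of "qn (int n + 1)"])
  show "RA (qn (int n + 1)) \<otimes>\<^bsub>SL\<^esub> (gamma q \<otimes>\<^bsub>SL\<^esub> A.tm n k j) \<in> Sp Q"
    unfolding A.c_tm[OF assms(1)]
    by (intro Sp_minus Sp_LR tm_in_Sp tlow_in_Sp) (use Q in \<open>auto simp: algebra_simps\<close>)
qed (use qn_nonzero[of "int n + 1"] in auto)

text \<open>The row recursions are solved for the products with \<delta> and \<beta>, the products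
  with \<gamma> and \<alpha> being known from \<open>c_tm\<close> and
  \<open>ba_step\<close>.\<close>

lemma gen_tm_in_Sp:
  assumes k: "0 \<le> k" "k \<le> int n"
  shows "Q (2 * k - int n - 1, 2 * j - int n - 1) \<Longrightarrow> delta q \<otimes>\<^bsub>SL\<^esub> A.tm n k j \<in> Sp Q"
    and "Q (2 * k - int n + 1, 2 * j - int n + 1) \<Longrightarrow> alpha q \<otimes>\<^bsub>SL\<^esub> A.tm n k j \<in> Sp Q"
    and "Q (2 * k - int n + 1, 2 * j - int n - 1) \<Longrightarrow> beta q \<otimes>\<^bsub>SL\<^esub> A.tm n k j \<in> Sp Q"
proof -
  assume Q: "Q (2 * k - int n - 1, 2 * j - int n - 1)"
  have "delta q \<otimes>\<^bsub>SL\<^esub> A.tm n k j = A.tm (Suc n) k j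
      \<ominus>\<^bsub>SL\<^esub> RA (Phi (int n + 1 - j)) \<otimes>\<^bsub>SL\<^esub> (gamma q \<otimes>\<^bsub>SL\<^esub> A.tm n k (j - 1))"
    using A.tm_row_d[OF k(2), of j] by (simp add: A.eq_diff_eq)
  also have "\<dots> \<in> Sp Q"
    by (intro Sp_minus Sp_LR gamma_tm_in_Sp tm_in_Sp) (use Q k in \<open>auto simp: algebra_simps\<close>)
  finally show "delta q \<otimes>\<^bsub>SL\<^esub> A.tm n k j \<in> Sp Q" .
next
  have *: "alpha q \<otimes>\<^bsub>SL\<^esub> A.tm n k j \<in> Sp Q" if Q: "Q (2 * k - int n + 1, 2 * j - int n + 1)" for Q j
  proof (rule R_unit_cancel[of "qn (int n + 1)"])
    show "RA (qn (int n + 1)) \<otimes>\<^bsub>SL\<^esub> (alpha q \<otimes>\<^bsub>SL\<^esub> A.tm n k j) \<in> Sp Q"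
      unfolding ba_step[OF k]
      by (intro Sp_add Sp_minus Sp_LR tm_in_Sp tlow_in_Sp) (use Q in \<open>auto simp: algebra_simps\<close>)
  qed (use qn_nonzero[of "int n + 1"] in auto)
  show "Q (2 * k - int n + 1, 2 * j - int n + 1) \<Longrightarrow> alpha q \<otimes>\<^bsub>SL\<^esub> A.tm n k j \<in> Sp Q" by (rule *)
  assume Q: "Q (2 * k - int n + 1, 2 * j - int n - 1)"
  have "beta q \<otimes>\<^bsub>SL\<^esub> A.tm n k j = LA (Phi (int n - k)) \<otimes>\<^bsub>SL\<^esub> A.tm (Suc n) (k + 1) j
      \<ominus>\<^bsub>SL\<^esub> RA (Phi (int n + 1 - j)) \<otimes>\<^bsub>SL\<^esub> (alpha q \<otimes>\<^bsub>SL\<^esub> A.tm n k (j - 1))"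
    using A.tm_row_b[OF k, of j] by (simp add: A.eq_diff_eq)
  also have "\<dots> \<in> Sp Q"
    by (intro Sp_minus Sp_LR * tm_in_Sp) (use Q in \<open>auto simp: algebra_simps\<close>)
  finally show "beta q \<otimes>\<^bsub>SL\<^esub> A.tm n k j \<in> Sp Q" .
qed

lemma Sp_gen:
  assumes x: "x \<in> Sp Q" and Q: "\<And>a b. Q (a, b) \<Longrightarrow> Q' (a + m, b + n)"
    and g: "(g, m, n) \<in> {(alpha q, 1, 1), (beta q, 1, -1), (gamma q, -1, 1), (delta q, -1, -1)}"
  shows "g \<otimes>\<^bsub>SL\<^esub> x \<in> Sp Q'"
proof -
  from g have g: "(g, m, n) = (alpha q, 1, 1) \<or> (g, m, n) = (beta q, 1, -1) \<or> (g, m, n) = (gamma q, -1, 1)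
      \<or> (g, m, n) = (delta q, -1, -1)" by auto
  then have gc: "g \<in> carrier SL" by auto
  from x obtain xs where xs: "x = sumv xs" "\<forall>t\<in>set xs. valid t \<and> Q (bideg t)" by (auto simp: Sp_def)
  from xs(2) have "g \<otimes>\<^bsub>SL\<^esub> sumv xs \<in> Sp Q'"
  proof (induction xs)
    case Nil
    then show ?case using gc by simp
  next
    case (Cons t xs)
    obtain f h N k j where t: "t = (f, h, N, k, j)" by (cases t)
    have k: "0 \<le> k" "k \<le> int N" and Qt: "Q (2 * k - int N, 2 * j - int N)" using Cons.prems by (auto simp: t)
    have "g \<otimes>\<^bsub>SL\<^esub> A.tm N k j \<in> Sp Q'"
      using g Q[OF Qt] gamma_tm_in_Sp[OF k(2), of Q' j] gen_tm_in_Sp[OF k, of Q' j]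
      by (elim disjE) (auto simp: algebra_simps)
    \<comment> \<open>A generator passes f(\<lambda>) and g(\<mu>) at the price of shifting
      them.\<close>
    moreover have "\<exists>f' h'. g \<otimes>\<^bsub>SL\<^esub> tval t = LA f' \<otimes>\<^bsub>SL\<^esub> (RA h' \<otimes>\<^bsub>SL\<^esub> (g \<otimes>\<^bsub>SL\<^esub> A.tm N k j))"
      using g by (elim disjE) (simp_all add: t A.push_left, blast+)
    ultimately have "g \<otimes>\<^bsub>SL\<^esub> tval t \<in> Sp Q'" using Sp_LR by metis
    then show ?case using Cons gc by (simp add: A.r_distr Sp_add)
  qed
  then show ?thesis using xs by simp
qed

lemma gr_in_Sp: "x \<in> gr a b \<Longrightarrow> x \<in> Sp (\<lambda>d. d = (a, b))"
proof (induction x rule: gr_induct)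
  case one
  then show ?case using tm_in_Sp[of "\<lambda>d. d = (0, 0)" 0 0 0] by simp
next
  case (gens i j g m n x)
  show ?case by (rule Sp_gen[OF gens.IH _ gens.hyps(2)]) auto
qed (auto intro: Sp_LR Sp_add Sp_smult)

lemma carrier_in_Sp: "x \<in> carrier SL \<Longrightarrow> x \<in> Sp (\<lambda>d. True)"
proof (induction x rule: SL_induct)
  case one
  then show ?case using tm_in_Sp[of "\<lambda>d. True" 0 0 0] by simp
next
  case (alpha x)
  show ?case by (rule Sp_gen[OF alpha.IH, of _ 1 1]) auto
next
  case (beta x)
  show ?case by (rule Sp_gen[OF beta.IH, of _ 1 "-1"]) auto
next
  case (gamma x)
  show ?case by (rule Sp_gen[OF gamma.IH, of _ "-1" 1]) auto
next
  case (delta x)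
  show ?case by (rule Sp_gen[OF delta.IH, of _ "-1" "-1"]) auto
qed (auto intro: Sp_LR Sp_add Sp_smult)

text \<open>The future value of the Haar functional, read off from an expansion;
  \<open>hv_unique\<close> shows that the expansion does not matter.\<close>

definition hv :: "tterm list \<Rightarrow> sl2" where
  "hv xs = A.LRsum (map (\<lambda>(f, g, n, k, j). (f, g)) (filter (\<lambda>(f, g, n, k, j). n = 0) xs))"

lemma pv_tm: "pv (A.tm n k j) (0, 0, s, \<zeta>) = (if int n = 2 * k \<and> int n = 2 * j then em (nat k) s \<zeta> else 0)"
proof (cases "int n = 2 * k \<and> int n = 2 * j")
  case True
  then have "n = 2 * nat k" "k = int (nat k)" "j = k" by auto
  then show ?thesis using True unfolding em_def by metis
next
  case False
  then show ?thesis using pv_graded[OF tm_graded[of n k j], of 0 0 s \<zeta>] by auto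
qed

text \<open>In bidegree (0, 0) the model turns the combination into a sum of r(m) times
  \<open>em m\<close>, where r(m) collects f(\<lambda>)g(\<lambda> + s) over the terms with
  t^(2m)_mm. Independence gives r(0) = 0 for every s, and separation of variables does the
  rest.\<close>

lemma sumv_zero_imp_hv_zero:
  assumes "sumv xs = \<zero>\<^bsub>SL\<^esub>" "\<forall>t\<in>set xs. valid t"
  shows "hv xs = \<zero>\<^bsub>SL\<^esub>"
proof -
  have "(\<Sum>p\<leftarrow>map (\<lambda>(f, g, n, k, j). (f, g)) (filter (\<lambda>(f, g, n, k, j). n = 0) xs). fst p * mshift s (snd p)) = 0" for s
  proof -
    define r where "r xs m = (\<Sum>(f, g, n, k, j)\<leftarrow>xs. if int n = 2 * int m \<and> k = int m \<and> j = int m then f * mshift s g else 0)" for xs m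
    \<comment> \<open>A common bound for the levels, so that all partial sums run over the same
      range of m.\<close>
    obtain M where M: "\<And>f g n k j. (f, g, n, k, j) \<in> set xs \<Longrightarrow> n \<le> M"
    proof -
      have "\<exists>M. \<forall>(f, g, n, k, j)\<in>set xs. n \<le> M"
      proof (induction xs)
        case (Cons t xs)
        then obtain M where M: "\<forall>(f, g, n, k, j)\<in>set xs. n \<le> M" by blast
        obtain f g n k j where t: "t = (f, g, n, k, j)" by (cases t)
        show ?case using M by (intro exI[of _ "max n M"]) (auto simp: t)
      qed auto
      then show ?thesis using that by fastforce
    qed
    have P: "pv (sumv ys) (0, 0, s, \<zeta>) = (\<Sum>m\<le>M. r ys m * em m s \<zeta>)"
      if "set ys \<subseteq> set xs" for ys \<zeta>
      using that
    proof (induction ys)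
      case Nil
      then show ?case by (simp add: r_def)
    next
      case (Cons t ys)
      obtain f g n k j where t: "t = (f, g, n, k, j)" by (cases t)
      have "n \<le> M" using M[of f g n k j] Cons.prems by (simp add: t)
      have "pv (tval t) (0, 0, s, \<zeta>) = f * mshift s g * (if int n = 2 * k \<and> int n = 2 * j then em (nat k) s \<zeta> else 0)"
        by (simp add: t pv_mult pv_tm)
      also have "\<dots> = (\<Sum>m\<le>M. (if int n = 2 * int m \<and> k = int m \<and> j = int m then f * mshift s g else 0) * em m s \<zeta>)"
      proof (cases "int n = 2 * k \<and> int n = 2 * j")
        case True
        then have kk: "k = int (nat k)" "j = k" "nat k \<le> M" using \<open>n \<le> M\<close> by auto
        have "(\<Sum>m\<le>M. (if int n = 2 * int m \<and> k = int m \<and> j = int m then f * mshift s g else 0) * em m s \<zeta>)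
            = (\<Sum>m\<le>M. if m = nat k then f * mshift s g * em m s \<zeta> else 0)"
          using True kk by (intro sum.cong) auto
        then show ?thesis using True kk by simp
      next
        case False
        then have neg: "\<not> (int n = 2 * int m \<and> k = int m \<and> j = int m)" for m by auto
        show ?thesis
          by (simp only: if_not_P[OF neg] if_not_P[OF False] mult_zero_left mult_zero_right sum.neutral_const)
      qed
      finally show ?case
        using Cons by (simp add: pv_add r_def t ring_distribs sum.distrib)
    qed
    have "(\<Sum>m\<le>M. r xs m * em m s \<zeta>) = 0" for \<zeta>
      using P[of xs \<zeta>] assms(1) by simp
    from em_independent[OF this, of 0] have "r xs 0 = 0" by simp
    moreover have "r xs 0 = (\<Sum>p\<leftarrow>map (\<lambda>(f, g, n, k, j). (f, g)) (filter (\<lambda>(f, g, n, k, j). n = 0) xs). fst p * mshift s (snd p))"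
      unfolding r_def using assms(2) by (induction xs) auto
    ultimately show ?thesis by simp
  qed
  then show ?thesis unfolding hv_def by (rule A.LRsum_zero_of_vanishing)
qed

lemma hv_append: "hv (xs @ ys) = hv xs \<oplus>\<^bsub>SL\<^esub> hv ys"
  by (simp add: hv_def A.LRsum_append)

lemma hv_closed [simp, intro]: "hv xs \<in> carrier SL"
  by (simp add: hv_def)

lemma hv_LR:
  "hv (map (tL h) xs) = LA h \<otimes>\<^bsub>SL\<^esub> hv xs"
  "hv (map (tR h) xs) = RA h \<otimes>\<^bsub>SL\<^esub> hv xs"
  by (induction xs) (auto simp: hv_def A.r_distr A.L_mult A.R_mult A.LR_left A.m_assoc)

lemma sumv_LR:
  "sumv (map (tL h) xs) = LA h \<otimes>\<^bsub>SL\<^esub> sumv xs"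
  "sumv (map (tR h) xs) = RA h \<otimes>\<^bsub>SL\<^esub> sumv xs"
  by (induction xs) (simp_all add: A.r_distr)

text \<open>The difference of the two expansions is itself an expansion, of zero: the second list is
  negated by multiplying with the function -1.\<close>

lemma hv_unique:
  assumes "sumv xs = sumv ys" "\<forall>t\<in>set xs. valid t" "\<forall>t\<in>set ys. valid t"
  shows "hv xs = hv ys"
proof -
  let ?ys = "map (tL (- 1)) ys"
  have m: "LA (-1) \<otimes>\<^bsub>SL\<^esub> x = \<ominus>\<^bsub>SL\<^esub> x" if "x \<in> carrier SL" for x
    using that by (simp add: A.L_uminus A.l_minus)
  have "hv (xs @ ?ys) = \<zero>\<^bsub>SL\<^esub>"
    proof (rule sumv_zero_imp_hv_zero)
    show "sumv (xs @ ?ys) = \<zero>\<^bsub>SL\<^esub>"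
      unfolding sumv_append sumv_LR m[OF sumv_closed] assms(1) by (rule A.r_neg) simp
  qed (use assms in auto)
  then have "hv xs \<ominus>\<^bsub>SL\<^esub> hv ys = \<zero>\<^bsub>SL\<^esub>"
    by (simp only: hv_append hv_LR m hv_closed a_minus_def)
  then show ?thesis by (simp add: A.minus_eq_zero_iff)
qed

text \<open>Any expansion may be chosen. Off the carrier the value is \<open>undefined\<close>
  because \<open>clinear_to_base\<close> asks for extensional maps.\<close>

definition hh :: "sl2 \<Rightarrow> sl2" where
  "hh x = (if x \<in> carrier SL then hv (SOME xs. x = sumv xs \<and> (\<forall>t\<in>set xs. valid t)) else undefined)"

lemma hh_sumv: "\<forall>t\<in>set xs. valid t \<Longrightarrow> hh (sumv xs) = hv xs"
proof -
  assume xs: "\<forall>t\<in>set xs. valid t"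
  define ys where "ys = (SOME ys. sumv xs = sumv ys \<and> (\<forall>t\<in>set ys. valid t))"
  have "sumv xs = sumv ys \<and> (\<forall>t\<in>set ys. valid t)"
    unfolding ys_def by (rule someI[of _ xs]) (use xs in auto)
  then have "hv xs = hv ys" using hv_unique[of xs ys] xs by blast
  moreover have "hh (sumv xs) = hv ys" unfolding hh_def ys_def by (simp only: sumv_closed if_True)
  ultimately show ?thesis by simp
qed

lemma hh_rep: "x \<in> carrier SL \<Longrightarrow> \<exists>xs. x = sumv xs \<and> (\<forall>t\<in>set xs. valid t) \<and> hh x = hv xs"
  using carrier_in_Sp[of x] hh_sumv by (auto simp: Sp_def)

lemma hh_closed [simp, intro]: "x \<in> carrier SL \<Longrightarrow> hh x \<in> carrier SL"
  using hh_rep[of x] by auto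

lemma hh_add: "x \<in> carrier SL \<Longrightarrow> y \<in> carrier SL \<Longrightarrow> hh (x \<oplus>\<^bsub>SL\<^esub> y) = hh x \<oplus>\<^bsub>SL\<^esub> hh y"
proof -
  assume "x \<in> carrier SL" "y \<in> carrier SL"
  then obtain xs ys where "x = sumv xs" "\<forall>t\<in>set xs. valid t" "hh x = hv xs"
    "y = sumv ys" "\<forall>t\<in>set ys. valid t" "hh y = hv ys" using hh_rep by meson
  then show ?thesis using hh_sumv[of "xs @ ys"] by (auto simp: sumv_append hv_append)
qed

lemma hh_LR:
  assumes "x \<in> carrier SL"
  shows "hh (LA f \<otimes>\<^bsub>SL\<^esub> x) = LA f \<otimes>\<^bsub>SL\<^esub> hh x" "hh (RA f \<otimes>\<^bsub>SL\<^esub> x) = RA f \<otimes>\<^bsub>SL\<^esub> hh x"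
proof -
  from hh_rep[OF assms] obtain xs where xs: "x = sumv xs" "\<forall>t\<in>set xs. valid t" "hh x = hv xs" by blast
  have "\<forall>t\<in>set (map (tL f) xs). valid t"
    "\<forall>t\<in>set (map (tR f) xs). valid t" using xs(2) by auto
  from hh_sumv[OF this(1)] hh_sumv[OF this(2)] xs(3)
  show "hh (LA f \<otimes>\<^bsub>SL\<^esub> x) = LA f \<otimes>\<^bsub>SL\<^esub> hh x" "hh (RA f \<otimes>\<^bsub>SL\<^esub> x) = RA f \<otimes>\<^bsub>SL\<^esub> hh x"
    by (simp_all add: xs(1) sumv_LR hv_LR)
qed

lemma hh_smult: "x \<in> carrier SL \<Longrightarrow> hh (z \<odot>\<^bsub>SL\<^esub> x) = z \<odot>\<^bsub>SL\<^esub> hh x"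
  by (simp add: smult_LA hh_LR)

lemma hh_tm:
  assumes "0 \<le> k" "k \<le> int n" "0 \<le> j" "j \<le> int n"
  shows "hh (A.tm n k j) = (if n = 0 then \<one>\<^bsub>SL\<^esub> else \<zero>\<^bsub>SL\<^esub>)"
  using hh_sumv[of "[(1, 1, n, k, j)]"] assms by (simp add: hv_def)

lemma hh_one: "hh \<one>\<^bsub>SL\<^esub> = \<one>\<^bsub>SL\<^esub>"
  using hh_tm[of 0 0 0] by simp

lemma base_eq: "base SL = range A.LRsum"
proof
  show "base SL \<subseteq> range A.LRsum"
  proof
    fix x assume "x \<in> base SL"
    then obtain n :: nat and f g where f: "f \<in> {..<n} \<rightarrow> carrier Mero" "g \<in> {..<n} \<rightarrow> carrier Mero"
      and x: "x = (\<Oplus>\<^bsub>SL\<^esub>i\<in>{..<n}. lmom SL (f i) \<otimes>\<^bsub>SL\<^esub> rmom SL (g i))" by (auto simp: base_def)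
    define f' g' where "f' i = mero_of (f i)" and "g' i = mero_of (g i)" for i
    have fg: "f i = mval (f' i)" "g i = mval (g' i)" if "i < n" for i
      using f that by (auto simp: f'_def g'_def Pi_iff Mero_def mero_of_inverse)
    have "x = (\<Oplus>\<^bsub>SL\<^esub>i\<in>{..<n}. LA (f' i) \<otimes>\<^bsub>SL\<^esub> RA (g' i))"
      unfolding x by (rule A.finsum_cong') (auto simp: fg lmom_SL rmom_SL)
    also have "\<dots> \<in> range A.LRsum"
    proof (induction n)
      case 0
      then show ?case by (auto intro: range_eqI[of _ _ "[]"])
    next
      case (Suc n)
      then obtain ps where "(\<Oplus>\<^bsub>SL\<^esub>i\<in>{..<n}. LA (f' i) \<otimes>\<^bsub>SL\<^esub> RA (g' i)) = A.LRsum ps" by auto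
      then have "(\<Oplus>\<^bsub>SL\<^esub>i\<in>{..<Suc n}. LA (f' i) \<otimes>\<^bsub>SL\<^esub> RA (g' i)) = A.LRsum ((f' n, g' n) # ps)"
        by (simp add: lessThan_Suc A.finsum_insert)
      then show ?case by (simp only: rangeI)
    qed
    finally show "x \<in> range A.LRsum" .
  qed
  \<comment> \<open>The list is reversed because \<open>foldr\<close> adds the head last, while the
    indexed sum is split at its largest index.\<close>
  have "A.LRsum ps = (\<Oplus>\<^bsub>SL\<^esub>i\<in>{..<length ps}. LA (fst (rev ps ! i)) \<otimes>\<^bsub>SL\<^esub> RA (snd (rev ps ! i)))" for ps
  proof (induction ps)
    case (Cons p ps)
    have "(\<Oplus>\<^bsub>SL\<^esub>i\<in>{..<length ps}. LA (fst (rev (p # ps) ! i)) \<otimes>\<^bsub>SL\<^esub> RA (snd (rev (p # ps) ! i)))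
        = (\<Oplus>\<^bsub>SL\<^esub>i\<in>{..<length ps}. LA (fst (rev ps ! i)) \<otimes>\<^bsub>SL\<^esub> RA (snd (rev ps ! i)))"
      by (rule A.finsum_cong') (auto simp: nth_append)
    then show ?case using Cons by (simp add: lessThan_Suc A.finsum_insert nth_append)
  qed simp
  then have "A.LRsum ps \<in> base SL" for ps
    unfolding base_def
    by (intro CollectI exI[of _ "length ps"] exI[of _ "\<lambda>i. mval (fst (rev ps ! i))"]
        exI[of _ "\<lambda>i. mval (snd (rev ps ! i))"]) (simp add: lmom_SL rmom_SL)
  then show "range A.LRsum \<subseteq> base SL" by auto
qed

lemma hh_base: "x \<in> carrier SL \<Longrightarrow> hh x \<in> base SL"
  using hh_rep[of x] by (auto simp: base_eq hv_def)

text \<open>Together with \<open>hh_base\<close> this makes the Haar functional a projection onto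
  the base, the property by which any integral is compared with it.\<close>

lemma hh_on_base: "x \<in> base SL \<Longrightarrow> hh x = x"
proof -
  assume "x \<in> base SL"
  then obtain ps where "x = A.LRsum ps" by (auto simp: base_eq)
  moreover have "hh (A.LRsum ps) = A.LRsum ps"
  proof (induction ps)
    case Nil
    then show ?case using hh_sumv[of "[]"] by (simp add: hv_def)
  next
    case (Cons p ps)
    have "hh (LA (fst p) \<otimes>\<^bsub>SL\<^esub> RA (snd p)) = LA (fst p) \<otimes>\<^bsub>SL\<^esub> RA (snd p)"
      using hh_LR(1)[of "RA (snd p)"] hh_LR(2)[of "\<one>\<^bsub>SL\<^esub>" "snd p"] by (simp add: hh_one)
    with Cons show ?case by (simp add: hh_add)
  qed
  ultimately show ?thesis by simp
qed

lemma base_closed: "x \<in> base SL \<Longrightarrow> x \<in> carrier SL"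
  by (auto simp: base_eq)

lemma LRsum_gr: "A.LRsum ps \<in> gr 0 0"
  by (induction ps) (auto intro!: gr_add gr_LR)

text \<open>A valid term of level 0 has bidegree (0, 0), so a homogeneous expansion in any other
  bidegree contains no such term.\<close>

lemma hh_gr:
  assumes "x \<in> gr a b"
  shows "hh x \<in> gr a b"
proof -
  from gr_in_Sp[OF assms] obtain xs where xs: "x = sumv xs" "\<forall>t\<in>set xs. valid t \<and> bideg t = (a, b)"
    by (auto simp: Sp_def)
  then have h: "hh x = hv xs" using hh_sumv[of xs] by auto
  show ?thesis
  proof (cases "(a, b) = (0, 0)")
    case True
    then show ?thesis using LRsum_gr by (auto simp: h hv_def)
  next
    case False
    have "filter (\<lambda>(f, g, n, k, j). n = 0) xs = []"
      unfolding filter_empty_conv using xs(2) False by fastforce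
    then show ?thesis by (simp add: h hv_def)
  qed
qed

end

section \<open>The tensor square\<close>

text \<open>For additive maps, because the contractions of the tensor product are not
  multiplicative.\<close>

lemma (in calg_ideal) Q_linear_universal:
  assumes "calg S" "\<And>x. x \<in> carrier R \<Longrightarrow> f x \<in> carrier S"
    and add: "\<And>x y. x \<in> carrier R \<Longrightarrow> y \<in> carrier R \<Longrightarrow> f (x \<oplus> y) = f x \<oplus>\<^bsub>S\<^esub> f y"
    and zero: "\<And>x. x \<in> I \<Longrightarrow> f x = \<zero>\<^bsub>S\<^esub>"
  shows "\<exists>\<phi>. \<forall>x\<in>carrier R. \<phi> (I +> x) = f x"
proof -
  interpret S: calg S by fact
  define \<phi> where "\<phi> X = f (SOME x. x \<in> carrier R \<and> X = I +> x)" for X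
  have "\<phi> (I +> x) = f x" if x: "x \<in> carrier R" for x
  proof -
    define y where "y = (SOME y. y \<in> carrier R \<and> I +> x = I +> y)"
    have y: "y \<in> carrier R \<and> I +> x = I +> y"
      unfolding y_def by (rule someI[of _ x]) (use x in auto)
    then have m: "x \<ominus> y \<in> I" using x by (simp flip: Q_eq_iff)
    have "x = (x \<ominus> y) \<oplus> y" using x y by (simp add: a_minus_def a_assoc l_neg)
    then have "f x = f (x \<ominus> y) \<oplus>\<^bsub>S\<^esub> f y" using add[of "x \<ominus> y" y] x y by simp
    then have "f x = f y" using zero[OF m] assms(2) y by simp
    then show ?thesis by (simp add: \<phi>_def y_def)
  qed
  then show ?thesis by blast
qed

context q_param
begin

abbreviation "PM \<equiv> (SL \<times>\<times> SL)\<lparr>carrier := composable SL SL\<rparr>"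
abbreviation "PA \<equiv> pair_algebra SL SL"
abbreviation "AA \<equiv> tensor_algebra SL SL"
abbreviation "tn \<equiv> tens SL SL"
abbreviation "cmp x y \<equiv> (x, y) \<in> composable SL SL"

lemma cmpI: "x \<in> gr a c \<Longrightarrow> y \<in> gr c b \<Longrightarrow> cmp x y"
  by (auto simp: composable_def)

lemma cmpE:
  assumes "cmp x y"
  obtains a c b where "x \<in> gr a c" "y \<in> gr c b"
  using assms by (auto simp: composable_def)

lemma cmp_carrier: "cmp x y \<Longrightarrow> x \<in> carrier SL" "cmp x y \<Longrightarrow> y \<in> carrier SL"
  by (auto elim!: cmpE)

lemma cmp_mult: "cmp x y \<Longrightarrow> cmp x' y' \<Longrightarrow> cmp (x \<otimes>\<^bsub>SL\<^esub> x') (y \<otimes>\<^bsub>SL\<^esub> y')"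
  by (elim cmpE) (rule cmpI[OF gr_mult gr_mult], auto)

lemma PM_simps: "carrier PM = composable SL SL" "(x, y) \<otimes>\<^bsub>PM\<^esub> (x', y') = (x \<otimes>\<^bsub>SL\<^esub> x', y \<otimes>\<^bsub>SL\<^esub> y')"
  "\<one>\<^bsub>PM\<^esub> = (\<one>\<^bsub>SL\<^esub>, \<one>\<^bsub>SL\<^esub>)"
  by (simp_all add: DirProd_def)

lemma PM_monoid: "monoid PM"
proof (rule monoidI)
  fix x y assume "x \<in> carrier PM" "y \<in> carrier PM"
  then show "x \<otimes>\<^bsub>PM\<^esub> y \<in> carrier PM" by (cases x; cases y) (auto simp: PM_simps cmp_mult)
next
  show "\<one>\<^bsub>PM\<^esub> \<in> carrier PM" unfolding PM_simps by (rule cmpI[OF gr_one gr_one])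
next
  fix x y z assume "x \<in> carrier PM" "y \<in> carrier PM" "z \<in> carrier PM"
  then show "x \<otimes>\<^bsub>PM\<^esub> y \<otimes>\<^bsub>PM\<^esub> z = x \<otimes>\<^bsub>PM\<^esub> (y \<otimes>\<^bsub>PM\<^esub> z)"
    by (cases x; cases y; cases z) (auto simp: PM_simps A.m_assoc cmp_carrier)
next
  fix x assume "x \<in> carrier PM"
  then show "\<one>\<^bsub>PM\<^esub> \<otimes>\<^bsub>PM\<^esub> x = x" "x \<otimes>\<^bsub>PM\<^esub> \<one>\<^bsub>PM\<^esub> = x"
    by (cases x; auto simp: PM_simps cmp_carrier)+
qed

sublocale P: monoid_alg PM rewrites "monoid_algebra PM = PA"
  using PM_monoid by (simp_all add: monoid_alg_def pair_algebra_def)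

lemma PAk: "p \<in> carrier PA \<longleftrightarrow> keys p \<subseteq> composable SL SL"
  unfolding P.simps PM_simps by blast

lemma plus_in_PA: "p \<in> carrier PA \<Longrightarrow> r \<in> carrier PA \<Longrightarrow> p + r \<in> carrier PA"
  using P.a_closed[of p r] by (simp only: P.simps(4))

lemma single_in_PA: "cmp x y \<Longrightarrow> single (x, y) z \<in> carrier PA"
  by (auto simp: P.simps PM_simps)

lemma tensor_rel_closed:
  assumes "tensor_rel SL SL p p'"
  shows "p \<in> carrier PA \<and> p' \<in> carrier PA"
  using assms
proof cases
  case (1 x a c x' y b)
  show ?thesis unfolding 1(1,2) by (intro conjI plus_in_PA single_in_PA cmpI[of _ a c _ b] gr_add 1)
next
  case (2 x a c y b y')
  show ?thesis unfolding 2(1,2) by (intro conjI plus_in_PA single_in_PA cmpI[of _ a c _ b] gr_add 2)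
next
  case (3 x a c y b s)
  then show ?thesis using cmpI gr_smult[of x a c s] by (auto intro!: single_in_PA)
next
  case (4 x a c y b s)
  then show ?thesis using cmpI gr_smult[of y c b s] by (auto intro!: single_in_PA)
next
  case (5 x a c y b f)
  obtain f' where f': "f = mval f'" using 5(5) by (auto simp: carrier_Mero)
  show ?thesis unfolding 5(1,2) f' rmom_SL lmom_SL
    by (intro conjI single_in_PA cmpI[of _ a c _ b] gr_LR 5)
qed

lemma tensor_rel_set_closed: "{p - p' | p p'. tensor_rel SL SL p p'} \<subseteq> carrier PA"
  using tensor_rel_closed by (auto simp: P.minus)

lemma tensor_calg_ideal: "calg_ideal (tensor_ideal SL SL) PA"
  unfolding calg_ideal_def tensor_ideal_def
  using P.genideal_ideal[OF tensor_rel_set_closed] P.calg_axioms by simp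

sublocale T: calg_ideal "tensor_ideal SL SL" PA rewrites "quot_algebra PA (tensor_ideal SL SL) = AA"
  using tensor_calg_ideal by (simp_all add: tensor_algebra_def)

sublocale AA: calg AA by (rule T.Q_calg)

abbreviation "tcl \<equiv> (\<lambda>p. tensor_ideal SL SL +>\<^bsub>PA\<^esub> p)"

lemma tn_def: "tn x y = tcl (single (x, y) 1)" by (simp add: tens_def)

lemma tcl_rel:
  assumes "tensor_rel SL SL p p'"
  shows "tcl p = tcl p'"
proof -
  have "p - p' \<in> tensor_ideal SL SL"
    using P.genideal_self[OF tensor_rel_set_closed] assms unfolding tensor_ideal_def by blast
  then show ?thesis using tensor_rel_closed[OF assms] by (simp only: T.Q_eq_iff P.minus)
qed

lemma tcl_closed: "p \<in> carrier PA \<Longrightarrow> tcl p \<in> carrier AA"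
  by (auto simp: T.Q_carrier)

lemma tcl_plus: "p \<in> carrier PA \<Longrightarrow> r \<in> carrier PA \<Longrightarrow> tcl (p + r) = tcl p \<oplus>\<^bsub>AA\<^esub> tcl r"
  using T.Q_add[of p r] by (simp add: P.simps)

lemma tcl_single: "cmp x y \<Longrightarrow> tcl (single (x, y) z) = z \<odot>\<^bsub>AA\<^esub> tn x y"
  using T.Q_smult[OF single_in_PA, of x y z 1] by (simp add: tn_def P.simps)

lemma tn_closed [simp, intro]: "x \<in> gr a c \<Longrightarrow> y \<in> gr c b \<Longrightarrow> tn x y \<in> carrier AA"
  unfolding tn_def by (intro tcl_closed single_in_PA cmpI)

lemma tn_cmp_closed: "cmp x y \<Longrightarrow> tn x y \<in> carrier AA"
  unfolding tn_def by (intro tcl_closed single_in_PA)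

lemma tn_add_left:
  "x \<in> gr a c \<Longrightarrow> x' \<in> gr a c \<Longrightarrow> y \<in> gr c b \<Longrightarrow> tn (x \<oplus>\<^bsub>SL\<^esub> x') y = tn x y \<oplus>\<^bsub>AA\<^esub> tn x' y"
  using tcl_rel[OF tensor_rel.intros(1)] by (simp add: tn_def tcl_plus single_in_PA cmpI)

lemma tn_add_right:
  "x \<in> gr a c \<Longrightarrow> y \<in> gr c b \<Longrightarrow> y' \<in> gr c b \<Longrightarrow> tn x (y \<oplus>\<^bsub>SL\<^esub> y') = tn x y \<oplus>\<^bsub>AA\<^esub> tn x y'"
  using tcl_rel[OF tensor_rel.intros(2)] by (simp add: tn_def tcl_plus single_in_PA cmpI)

lemma tn_smult_left: "x \<in> gr a c \<Longrightarrow> y \<in> gr c b \<Longrightarrow> tn (z \<odot>\<^bsub>SL\<^esub> x) y = z \<odot>\<^bsub>AA\<^esub> tn x y"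
  using tcl_rel[OF tensor_rel.intros(3)[of x SL a c y SL b z]] tcl_single[OF cmpI, of x a c y b z]
  unfolding tn_def by (simp only:)

lemma tn_smult_right: "x \<in> gr a c \<Longrightarrow> y \<in> gr c b \<Longrightarrow> tn x (z \<odot>\<^bsub>SL\<^esub> y) = z \<odot>\<^bsub>AA\<^esub> tn x y"
  using tcl_rel[OF tensor_rel.intros(4)[of x SL a c y SL b z]] tcl_single[OF cmpI, of x a c y b z]
  unfolding tn_def by (simp only:)

lemma tn_balanced: "x \<in> gr a c \<Longrightarrow> y \<in> gr c b \<Longrightarrow> tn (RA f \<otimes>\<^bsub>SL\<^esub> x) y = tn x (LA f \<otimes>\<^bsub>SL\<^esub> y)"
  using tcl_rel[OF tensor_rel.intros(5)[of x SL a c y SL b "mval f"]] by (simp add: tn_def lmom_SL rmom_SL)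

lemma tn_mult: "cmp x y \<Longrightarrow> cmp x' y' \<Longrightarrow> tn x y \<otimes>\<^bsub>AA\<^esub> tn x' y' = tn (x \<otimes>\<^bsub>SL\<^esub> x') (y \<otimes>\<^bsub>SL\<^esub> y')"
  using T.Q_mult[OF single_in_PA single_in_PA, of x y x' y' 1 1] by (simp add: tn_def PM_simps P.single_mult)

lemma tn_one: "\<one>\<^bsub>AA\<^esub> = tn \<one>\<^bsub>SL\<^esub> \<one>\<^bsub>SL\<^esub>"
  using T.Q_one by (simp add: tn_def P.simps PM_simps)

lemma tn_minus_left:
  "x \<in> gr a c \<Longrightarrow> x' \<in> gr a c \<Longrightarrow> y \<in> gr c b \<Longrightarrow> tn (x \<ominus>\<^bsub>SL\<^esub> x') y = tn x y \<ominus>\<^bsub>AA\<^esub> tn x' y"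
  using tn_add_left[of x a c "\<ominus>\<^bsub>SL\<^esub> x'" y b] tn_smult_left[of x' a c y b "-1"] gr_carrier[of x' a c]
  by (simp add: a_minus_def A.smult_minus_one AA.smult_minus_one gr_uminus)

lemma tn_minus_right:
  "x \<in> gr a c \<Longrightarrow> y \<in> gr c b \<Longrightarrow> y' \<in> gr c b \<Longrightarrow> tn x (y \<ominus>\<^bsub>SL\<^esub> y') = tn x y \<ominus>\<^bsub>AA\<^esub> tn x y'"
  using tn_add_right[of x a c y b "\<ominus>\<^bsub>SL\<^esub> y'"] tn_smult_right[of x a c y' b "-1"] gr_carrier[of y' c b]
  by (simp add: a_minus_def A.smult_minus_one AA.smult_minus_one gr_uminus)

text \<open>That balanced bilinear maps vanish on the two-sided ideal, and not only on the linear span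
  of the relations, uses that the moment maps are shifted by the common inner degree.\<close>

lemma tensor_lift:
  assumes cl: "\<And>x y. cmp x y \<Longrightarrow> \<theta> x y \<in> carrier SL"
    and addl: "\<And>a c b x x' y. x \<in> gr a c \<Longrightarrow> x' \<in> gr a c \<Longrightarrow> y \<in> gr c b \<Longrightarrow> \<theta> (x \<oplus>\<^bsub>SL\<^esub> x') y = \<theta> x y \<oplus>\<^bsub>SL\<^esub> \<theta> x' y"
    and addr: "\<And>a c b x y y'. x \<in> gr a c \<Longrightarrow> y \<in> gr c b \<Longrightarrow> y' \<in> gr c b \<Longrightarrow> \<theta> x (y \<oplus>\<^bsub>SL\<^esub> y') = \<theta> x y \<oplus>\<^bsub>SL\<^esub> \<theta> x y'"
    and sml: "\<And>a c b x y z. x \<in> gr a c \<Longrightarrow> y \<in> gr c b \<Longrightarrow> \<theta> (z \<odot>\<^bsub>SL\<^esub> x) y = z \<odot>\<^bsub>SL\<^esub> \<theta> x y"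
    and smr: "\<And>a c b x y z. x \<in> gr a c \<Longrightarrow> y \<in> gr c b \<Longrightarrow> \<theta> x (z \<odot>\<^bsub>SL\<^esub> y) = z \<odot>\<^bsub>SL\<^esub> \<theta> x y"
    and bal: "\<And>a c b x y f. x \<in> gr a c \<Longrightarrow> y \<in> gr c b \<Longrightarrow> \<theta> (RA f \<otimes>\<^bsub>SL\<^esub> x) y = \<theta> x (LA f \<otimes>\<^bsub>SL\<^esub> y)"
  shows "\<exists>\<Psi>. (\<forall>x y. cmp x y \<longrightarrow> \<Psi> (tn x y) = \<theta> x y)
    \<and> (\<forall>X\<in>carrier AA. \<Psi> X \<in> carrier SL)
    \<and> (\<forall>X\<in>carrier AA. \<forall>Y\<in>carrier AA. \<Psi> (X \<oplus>\<^bsub>AA\<^esub> Y) = \<Psi> X \<oplus>\<^bsub>SL\<^esub> \<Psi> Y)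
    \<and> (\<forall>X\<in>carrier AA. \<forall>z. \<Psi> (z \<odot>\<^bsub>AA\<^esub> X) = z \<odot>\<^bsub>SL\<^esub> \<Psi> X)"
proof -
  let ?\<theta> = "\<lambda>(x, y). \<theta> x y"
  let ?F = "linext SL ?\<theta>"
  have cl': "?\<theta> w \<in> carrier SL" if "w \<in> composable SL SL" for w using that cl by (cases w) auto
  note lin = A.linext_add[where X = "composable SL SL" and \<theta> = ?\<theta>, OF _ _ cl']
    A.linext_smult[where X = "composable SL SL" and \<theta> = ?\<theta>, OF _ cl']
    A.linext_closed[where X = "composable SL SL" and \<theta> = ?\<theta>, OF _ cl']
  have Fs: "?F (single (x, y) z) = z \<odot>\<^bsub>SL\<^esub> \<theta> x y" if "cmp x y" for x y z
    using A.linext_single[of ?\<theta> "(x, y)" z] cl[OF that] by simp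
  have Fadd: "?F (p + r) = ?F p \<oplus>\<^bsub>SL\<^esub> ?F r" if "p \<in> carrier PA" "r \<in> carrier PA" for p r
    using that unfolding PAk by (intro lin)
  have Fcl: "?F p \<in> carrier SL" if "p \<in> carrier PA" for p
    using that unfolding PAk by (intro lin)
  have Fsm: "?F (z \<odot>\<^bsub>PA\<^esub> p) = z \<odot>\<^bsub>SL\<^esub> ?F p" if "p \<in> carrier PA" for p z
    using that unfolding PAk P.simps(5) by (intro lin)
  have Fmin: "?F (p \<ominus>\<^bsub>PA\<^esub> r) = ?F p \<ominus>\<^bsub>SL\<^esub> ?F r" if "p \<in> carrier PA" "r \<in> carrier PA" for p r
  proof -
    have "p \<ominus>\<^bsub>PA\<^esub> r = p + ((-1) \<odot>\<^bsub>PA\<^esub> r)" using that by (simp add: a_minus_def P.smult_minus_one P.simps(4))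
    then show ?thesis using that by (simp add: Fadd Fsm a_minus_def A.smult_minus_one Fcl)
  qed
  \<comment> \<open>Related elements keep equal images after multiplication by symbols on both
    sides. For linearity relations this is immediate; balancing needs the grading.\<close>
  have key: "?F (single (x1, y1) z1 \<otimes>\<^bsub>PA\<^esub> (p \<otimes>\<^bsub>PA\<^esub> single (x2, y2) z2)) = ?F (single (x1, y1) z1 \<otimes>\<^bsub>PA\<^esub> (p' \<otimes>\<^bsub>PA\<^esub> single (x2, y2) z2))"
    if c1: "cmp x1 y1" and c2: "cmp x2 y2" and rel: "tensor_rel SL SL p p'" for x1 y1 x2 y2 z1 z2 p p'
  proof -
    from c1 obtain a1 m1 b1 where g1: "x1 \<in> gr a1 m1" "y1 \<in> gr m1 b1" by (rule cmpE)
    from c2 obtain a2 m2 b2 where g2: "x2 \<in> gr a2 m2" "y2 \<in> gr m2 b2" by (rule cmpE)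
    note gc = gr_carrier[OF g1(1)] gr_carrier[OF g1(2)] gr_carrier[OF g2(1)] gr_carrier[OF g2(2)]
    have X: "x1 \<otimes>\<^bsub>SL\<^esub> (x \<otimes>\<^bsub>SL\<^esub> x2) \<in> gr (a1 + (a + a2)) (m1 + (c + m2))" if "x \<in> gr a c" for x a c
      by (intro gr_mult g1 g2 that)
    have Y: "y1 \<otimes>\<^bsub>SL\<^esub> (y \<otimes>\<^bsub>SL\<^esub> y2) \<in> gr (m1 + (c + m2)) (b1 + (b + b2))" if "y \<in> gr c b" for y b c
      by (intro gr_mult g1 g2 that)
    have W: "?F (single (x1, y1) z1 \<otimes>\<^bsub>PA\<^esub> (single (x, y) z \<otimes>\<^bsub>PA\<^esub> single (x2, y2) z2))
        = (z1 * (z * z2)) \<odot>\<^bsub>SL\<^esub> \<theta> (x1 \<otimes>\<^bsub>SL\<^esub> (x \<otimes>\<^bsub>SL\<^esub> x2)) (y1 \<otimes>\<^bsub>SL\<^esub> (y \<otimes>\<^bsub>SL\<^esub> y2))"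
      if "cmp x y" for x y z
      using that c1 c2 by (simp add: P.single_mult PM_simps Fs cmp_mult)
    have cS: "\<theta> (x1 \<otimes>\<^bsub>SL\<^esub> (x \<otimes>\<^bsub>SL\<^esub> x2)) (y1 \<otimes>\<^bsub>SL\<^esub> (y \<otimes>\<^bsub>SL\<^esub> y2)) \<in> carrier SL" if "cmp x y" for x y
      using that c1 c2 by (intro cl cmp_mult)
    have Wadd: "?F (single (x1, y1) z1 \<otimes>\<^bsub>PA\<^esub> ((single (x, y) z + single (x', y') z') \<otimes>\<^bsub>PA\<^esub> single (x2, y2) z2))
        = ?F (single (x1, y1) z1 \<otimes>\<^bsub>PA\<^esub> (single (x, y) z \<otimes>\<^bsub>PA\<^esub> single (x2, y2) z2))
        \<oplus>\<^bsub>SL\<^esub> ?F (single (x1, y1) z1 \<otimes>\<^bsub>PA\<^esub> (single (x', y') z' \<otimes>\<^bsub>PA\<^esub> single (x2, y2) z2))"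
      if "cmp x y" "cmp x' y'" for x y z x' y' z'
      unfolding P.K_l_distr P.K_r_distr
      by (intro Fadd P.m_closed single_in_PA c1 c2 that)
    from rel show ?thesis
    proof cases
      case (1 x a c x' y b)
      note c = gr_carrier[OF 1(3)] gr_carrier[OF 1(4)] gr_carrier[OF 1(5)]
      have e: "x1 \<otimes>\<^bsub>SL\<^esub> ((x \<oplus>\<^bsub>SL\<^esub> x') \<otimes>\<^bsub>SL\<^esub> x2) = x1 \<otimes>\<^bsub>SL\<^esub> (x \<otimes>\<^bsub>SL\<^esub> x2) \<oplus>\<^bsub>SL\<^esub> x1 \<otimes>\<^bsub>SL\<^esub> (x' \<otimes>\<^bsub>SL\<^esub> x2)"
        using c gc by (simp add: A.l_distr A.r_distr)
      have cm: "cmp x y" "cmp x' y" "cmp (x \<oplus>\<^bsub>SL\<^esub> x') y"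
        by (intro cmpI[of _ a c _ b] gr_add 1(3,4,5))+
      show ?thesis
        unfolding 1(1,2) Wadd[OF cm(1,2)] W[OF cm(1)] W[OF cm(2)] W[OF cm(3)] e addl[OF X[OF 1(3)] X[OF 1(4)] Y[OF 1(5)]]
        by (rule A.smult_r_distr[OF cS[OF cm(1)] cS[OF cm(2)]])
    next
      case (2 x a c y b y')
      note c = gr_carrier[OF 2(3)] gr_carrier[OF 2(4)] gr_carrier[OF 2(5)]
      have e: "y1 \<otimes>\<^bsub>SL\<^esub> ((y \<oplus>\<^bsub>SL\<^esub> y') \<otimes>\<^bsub>SL\<^esub> y2) = y1 \<otimes>\<^bsub>SL\<^esub> (y \<otimes>\<^bsub>SL\<^esub> y2) \<oplus>\<^bsub>SL\<^esub> y1 \<otimes>\<^bsub>SL\<^esub> (y' \<otimes>\<^bsub>SL\<^esub> y2)"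
        using c gc by (simp add: A.l_distr A.r_distr)
      have cm: "cmp x y" "cmp x y'" "cmp x (y \<oplus>\<^bsub>SL\<^esub> y')"
        by (intro cmpI[of _ a c _ b] gr_add 2(3,4,5))+
      show ?thesis
        unfolding 2(1,2) Wadd[OF cm(1,2)] W[OF cm(1)] W[OF cm(2)] W[OF cm(3)] e addr[OF X[OF 2(3)] Y[OF 2(4)] Y[OF 2(5)]]
        by (rule A.smult_r_distr[OF cS[OF cm(1)] cS[OF cm(2)]])
    next
      case (3 x a c y b s)
      note c = gr_carrier[OF 3(3)] gr_carrier[OF 3(4)]
      have e: "x1 \<otimes>\<^bsub>SL\<^esub> ((s \<odot>\<^bsub>SL\<^esub> x) \<otimes>\<^bsub>SL\<^esub> x2) = s \<odot>\<^bsub>SL\<^esub> (x1 \<otimes>\<^bsub>SL\<^esub> (x \<otimes>\<^bsub>SL\<^esub> x2))"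
        using c gc by (simp add: A.smult_mult_left A.smult_mult_right)
      have cm: "cmp x y" "cmp (s \<odot>\<^bsub>SL\<^esub> x) y"
        by (intro cmpI[of _ a c _ b] gr_smult 3(3,4))+
      show ?thesis
        unfolding 3(1,2) W[OF cm(1)] W[OF cm(2)] e sml[OF X[OF 3(3)] Y[OF 3(4)]]
        using cS[OF cm(1)] by (simp add: A.smult_smult mult_ac)
    next
      case (4 x a c y b s)
      note c = gr_carrier[OF 4(3)] gr_carrier[OF 4(4)]
      have e: "y1 \<otimes>\<^bsub>SL\<^esub> ((s \<odot>\<^bsub>SL\<^esub> y) \<otimes>\<^bsub>SL\<^esub> y2) = s \<odot>\<^bsub>SL\<^esub> (y1 \<otimes>\<^bsub>SL\<^esub> (y \<otimes>\<^bsub>SL\<^esub> y2))"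
        using c gc by (simp add: A.smult_mult_left A.smult_mult_right)
      have cm: "cmp x y" "cmp x (s \<odot>\<^bsub>SL\<^esub> y)"
        by (intro cmpI[of _ a c _ b] gr_smult 4(3,4))+
      show ?thesis
        unfolding 4(1,2) W[OF cm(1)] W[OF cm(2)] e smr[OF X[OF 4(3)] Y[OF 4(4)]]
        using cS[OF cm(1)] by (simp add: A.smult_smult mult_ac)
    next
      case (5 x a c y b f)
      note c = gr_carrier[OF 5(3)] gr_carrier[OF 5(4)]
      obtain f' where f': "f = mval f'" using 5(5) by (auto simp: carrier_Mero)
      \<comment> \<open>Passing f through x1 in the left factor and through y1 in the right one
        shifts it by the same inner degree m1, so one function serves both.\<close>
      let ?h = "mshift (- of_int m1) f'"
      have e: "x1 \<otimes>\<^bsub>SL\<^esub> ((RA f' \<otimes>\<^bsub>SL\<^esub> x) \<otimes>\<^bsub>SL\<^esub> x2) = RA ?h \<otimes>\<^bsub>SL\<^esub> (x1 \<otimes>\<^bsub>SL\<^esub> (x \<otimes>\<^bsub>SL\<^esub> x2))"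
        "y1 \<otimes>\<^bsub>SL\<^esub> ((LA f' \<otimes>\<^bsub>SL\<^esub> y) \<otimes>\<^bsub>SL\<^esub> y2) = LA ?h \<otimes>\<^bsub>SL\<^esub> (y1 \<otimes>\<^bsub>SL\<^esub> (y \<otimes>\<^bsub>SL\<^esub> y2))"
        using c gc gr_comm(2)[OF g1(1), of f'] gr_comm(1)[OF g1(2), of f']
        by (simp_all add: A.m_assoc) (simp_all flip: A.m_assoc)
      have cm: "cmp (RA f' \<otimes>\<^bsub>SL\<^esub> x) y" "cmp x (LA f' \<otimes>\<^bsub>SL\<^esub> y)"
        by (intro cmpI[of _ a c _ b] gr_LR 5(3,4))+
      show ?thesis
        unfolding 5(1,2) f' rmom_SL lmom_SL W[OF cm(1)] W[OF cm(2)] e bal[OF X[OF 5(3)] Y[OF 5(4)]] ..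
    qed
  qed
  \<comment> \<open>As \<open>?F\<close> is not multiplicative, its kernel need not be an ideal; J
    consists of the elements all of whose two-sided multiples lie in the kernel.\<close>
  define J where "J = {p \<in> carrier PA. \<forall>u\<in>carrier PA. \<forall>v\<in>carrier PA. ?F (u \<otimes>\<^bsub>PA\<^esub> (p \<otimes>\<^bsub>PA\<^esub> v)) = \<zero>\<^bsub>SL\<^esub>}"
  have J: "ideal J PA"
  proof (rule idealI)
    show "ring PA" by (rule P.ring_axioms)
    show "subgroup J (add_monoid PA)"
    proof (rule P.add.subgroupI)
      show "J \<noteq> {}"
      proof -
        have "?F \<zero>\<^bsub>PA\<^esub> = \<zero>\<^bsub>SL\<^esub>" by (simp add: P.simps)
        then have "\<zero>\<^bsub>PA\<^esub> \<in> J" by (simp add: J_def P.r_null P.l_null)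
        then show ?thesis by blast
      qed
      show "\<And>a. a \<in> J \<Longrightarrow> \<ominus>\<^bsub>PA\<^esub> a \<in> J"
        using Fsm[of _ "-1"] 
        by (auto simp: J_def P.l_minus P.r_minus P.smult_minus_one[symmetric] P.smult_mult_left P.smult_mult_right)
      show "\<And>a b. a \<in> J \<Longrightarrow> b \<in> J \<Longrightarrow> a \<oplus>\<^bsub>PA\<^esub> b \<in> J"
      proof -
        fix x y assume x: "x \<in> J" and y: "y \<in> J"
        then have c: "x \<in> carrier PA" "y \<in> carrier PA" by (simp_all add: J_def)
        have "?F (u \<otimes>\<^bsub>PA\<^esub> ((x \<oplus>\<^bsub>PA\<^esub> y) \<otimes>\<^bsub>PA\<^esub> v)) = \<zero>\<^bsub>SL\<^esub>" if uv: "u \<in> carrier PA" "v \<in> carrier PA" for u v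
        proof -
          have "?F (u \<otimes>\<^bsub>PA\<^esub> (x \<otimes>\<^bsub>PA\<^esub> v)) = \<zero>\<^bsub>SL\<^esub>" "?F (u \<otimes>\<^bsub>PA\<^esub> (y \<otimes>\<^bsub>PA\<^esub> v)) = \<zero>\<^bsub>SL\<^esub>"
            using x y uv unfolding J_def by blast+
          then show ?thesis
            unfolding P.simps(4) P.K_l_distr P.K_r_distr using uv c by (simp add: Fadd P.m_closed)
        qed
        then show "x \<oplus>\<^bsub>PA\<^esub> y \<in> J" using c unfolding J_def by blast
      qed
    qed (auto simp: J_def)
    show "\<And>a x. a \<in> J \<Longrightarrow> x \<in> carrier PA \<Longrightarrow> x \<otimes>\<^bsub>PA\<^esub> a \<in> J"
    proof -
      fix a x assume a: "a \<in> J" and x: "x \<in> carrier PA"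
      then have ac: "a \<in> carrier PA" by (simp add: J_def)
      have "?F (u \<otimes>\<^bsub>PA\<^esub> ((x \<otimes>\<^bsub>PA\<^esub> a) \<otimes>\<^bsub>PA\<^esub> v)) = \<zero>\<^bsub>SL\<^esub>" if uv: "u \<in> carrier PA" "v \<in> carrier PA" for u v
      proof -
        have "u \<otimes>\<^bsub>PA\<^esub> ((x \<otimes>\<^bsub>PA\<^esub> a) \<otimes>\<^bsub>PA\<^esub> v) = (u \<otimes>\<^bsub>PA\<^esub> x) \<otimes>\<^bsub>PA\<^esub> (a \<otimes>\<^bsub>PA\<^esub> v)" using uv x ac by (simp add: P.m_assoc)
        then show ?thesis using a uv x by (simp add: J_def)
      qed
      then show "x \<otimes>\<^bsub>PA\<^esub> a \<in> J" using ac x by (simp add: J_def)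
    qed
    show "\<And>a x. a \<in> J \<Longrightarrow> x \<in> carrier PA \<Longrightarrow> a \<otimes>\<^bsub>PA\<^esub> x \<in> J"
    proof -
      fix a x assume a: "a \<in> J" and x: "x \<in> carrier PA"
      then have ac: "a \<in> carrier PA" by (simp add: J_def)
      have "?F (u \<otimes>\<^bsub>PA\<^esub> ((a \<otimes>\<^bsub>PA\<^esub> x) \<otimes>\<^bsub>PA\<^esub> v)) = \<zero>\<^bsub>SL\<^esub>" if uv: "u \<in> carrier PA" "v \<in> carrier PA" for u v
      proof -
        have "u \<otimes>\<^bsub>PA\<^esub> ((a \<otimes>\<^bsub>PA\<^esub> x) \<otimes>\<^bsub>PA\<^esub> v) = u \<otimes>\<^bsub>PA\<^esub> (a \<otimes>\<^bsub>PA\<^esub> (x \<otimes>\<^bsub>PA\<^esub> v))" using uv x ac by (simp add: P.m_assoc)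
        then show ?thesis using a uv x by (simp add: J_def)
      qed
      then show "a \<otimes>\<^bsub>PA\<^esub> x \<in> J" using ac x by (simp add: J_def)
    qed
  qed
  have "tensor_ideal SL SL \<subseteq> J"
    unfolding tensor_ideal_def
  proof (rule P.genideal_minimal[OF J], safe)
    fix p p' assume rel: "tensor_rel SL SL p p'"
    note pc = tensor_rel_closed[OF rel]
    have "?F (u \<otimes>\<^bsub>PA\<^esub> ((p \<ominus>\<^bsub>PA\<^esub> p') \<otimes>\<^bsub>PA\<^esub> v)) = \<zero>\<^bsub>SL\<^esub>" if u: "u \<in> carrier PA" and v: "v \<in> carrier PA" for u v
    proof -
      have "keys u \<subseteq> composable SL SL" using u PAk by blast
      then have "?F (u \<otimes>\<^bsub>PA\<^esub> (p \<otimes>\<^bsub>PA\<^esub> v)) = ?F (u \<otimes>\<^bsub>PA\<^esub> (p' \<otimes>\<^bsub>PA\<^esub> v))"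
      proof (induction u rule: poly_mapping_span_induct)
        case (single w z)
        obtain x1 y1 where w: "w = (x1, y1)" by (cases w)
        have c1: "cmp x1 y1" using single w by simp
        have "keys v \<subseteq> composable SL SL" using v PAk by blast
        then show ?case
        proof (induction v rule: poly_mapping_span_induct)
          case (single w' z')
          then show ?case using key[OF c1 _ rel] by (cases w') (simp add: w)
        next
          case (add v v')
          then have "v \<in> carrier PA" "v' \<in> carrier PA" using PAk by auto
          moreover have "single w z \<in> carrier PA" using c1 w by (simp add: single_in_PA)
          ultimately show ?case using add.IH pc
            by (simp add: P.K_r_distr Fadd P.m_closed)
        qed simp
      next
        case (add u u')
        then have "u \<in> carrier PA" "u' \<in> carrier PA" using PAk by auto
        then show ?case using add.IH pc v by (simp add: P.K_l_distr Fadd P.m_closed)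
      qed simp
      then show ?thesis
        using u v pc by (simp add: P.l_diff_distr P.r_diff_distr Fmin Fcl A.minus_eq_zero_iff)
    qed
    then show "p - p' \<in> J" using pc by (simp add: J_def P.minus)
  qed
  moreover have "?F p = \<zero>\<^bsub>SL\<^esub>" if "p \<in> J" for p
  proof -
    \<comment> \<open>Multiplication by 1 on both sides recovers p itself, so J lies in the
      kernel.\<close>
    have "?F (\<one>\<^bsub>PA\<^esub> \<otimes>\<^bsub>PA\<^esub> (p \<otimes>\<^bsub>PA\<^esub> \<one>\<^bsub>PA\<^esub>)) = \<zero>\<^bsub>SL\<^esub>"
      using that P.one_closed unfolding J_def by blast
    moreover have "\<one>\<^bsub>PA\<^esub> \<otimes>\<^bsub>PA\<^esub> (p \<otimes>\<^bsub>PA\<^esub> \<one>\<^bsub>PA\<^esub>) = p"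
      using that P.l_one P.r_one unfolding J_def by auto
    ultimately show ?thesis by (simp only:)
  qed
  ultimately have "\<exists>\<Psi>. \<forall>p\<in>carrier PA. \<Psi> (tcl p) = ?F p"
    by (intro T.Q_linear_universal[OF A.calg_axioms])
      (use Fcl Fadd in \<open>auto simp: P.simps(4)\<close>)
  then obtain \<Psi> where \<Psi>: "\<And>p. p \<in> carrier PA \<Longrightarrow> \<Psi> (tcl p) = ?F p" by blast
  show ?thesis
  proof (intro exI[of _ \<Psi>] conjI allI impI ballI)
    fix x y assume "cmp x y"
    then show "\<Psi> (tn x y) = \<theta> x y"
      unfolding tn_def using \<Psi>[OF single_in_PA] by (simp add: Fs cl)
  next
    fix X Y z assume "X \<in> carrier AA"
    then obtain p where p: "p \<in> carrier PA" "X = tcl p" by (auto simp: T.Q_carrier)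
    show "\<Psi> X \<in> carrier SL" using p by (simp add: \<Psi> Fcl)
    show "\<Psi> (z \<odot>\<^bsub>AA\<^esub> X) = z \<odot>\<^bsub>SL\<^esub> \<Psi> X" using p by (simp add: T.Q_smult \<Psi> Fsm)
    assume "Y \<in> carrier AA"
    then obtain r where r: "r \<in> carrier PA" "Y = tcl r" by (auto simp: T.Q_carrier)
    show "\<Psi> (X \<oplus>\<^bsub>AA\<^esub> Y) = \<Psi> X \<oplus>\<^bsub>SL\<^esub> \<Psi> Y"
      using p r by (simp add: T.Q_add \<Psi>) (simp add: P.simps(4) Fadd)
  qed
qed

end

section \<open>The coproduct\<close>

context sl2_data
begin

lemma inv_shift: "R (mshift (-1) phi) \<otimes> R (kappa - phi) = \<one>"
  using mshift_phi by (simp flip: R_mult)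

lemma phi_shift_phi: "mshift (-1) phi * phi = kappa * mshift (-1) phi - 1"
  using mshift_phi by (simp add: algebra_simps)

text \<open>In \<Delta>(\<alpha>)\<Delta>(\<beta>) the two cross terms share their left factor once
  a function has been moved over the tensor sign; this identity for the right factors is what
  remains. The same happens for \<Delta>(\<gamma>)\<Delta>(\<delta>).\<close>

lemma middle_1:
  "L (mshift (-1) phi) \<otimes> (a \<otimes> d) \<oplus> c \<otimes> b
    = R (mshift (-1) phi) \<otimes> (L (mshift (-1) phi) \<otimes> (b \<otimes> c) \<oplus> d \<otimes> a)"
proof -
  let ?p = "mshift (-1) phi"
  have k: "R ?p \<otimes> (R (kappa - phi) \<otimes> x) = x" if "x \<in> carrier S" for x
    using that inv_shift by (simp flip: m_assoc)
  have "R ?p \<otimes> (L ?p \<otimes> (b \<otimes> c) \<oplus> d \<otimes> a)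
      = R ?p \<otimes> (R (kappa - phi) \<otimes> (L (?p * phi) \<otimes> (c \<otimes> b))) \<oplus> R ?p \<otimes> (L (?p * phi) \<ominus> L ?p \<otimes> R phi) \<oplus> R ?p
        \<oplus> R ?p \<otimes> (R (kappa - phi) \<otimes> (c \<otimes> b))"
    unfolding bc da by (simp add: rs L_mult LR_left)
  also have "\<dots> = L (?p * phi) \<otimes> (c \<otimes> b) \<oplus> c \<otimes> b \<oplus> (R ?p \<otimes> L (?p * phi) \<ominus> L ?p \<otimes> R (?p * phi) \<oplus> R ?p)"
    by (simp add: k R_mult) (simp add: rs LR_left)
  also have "R ?p \<otimes> L (?p * phi) \<ominus> L ?p \<otimes> R (?p * phi) \<oplus> R ?p = L ?p"
    unfolding phi_shift_phi L_minus R_minus L_mult R_mult L_kappa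
    by (simp add: rs LR_left LR_comm[symmetric] R_comm[of ?p kappa])
  finally show ?thesis unfolding ad by (simp add: rs L_mult)
qed

text \<open>The mirror image for \<Delta>(\<alpha>)\<Delta>(\<gamma>) and
  \<Delta>(\<beta>)\<Delta>(\<delta>), where the right factors are shared.\<close>

lemma middle_2: "R phi \<otimes> (a \<otimes> d) \<oplus> b \<otimes> c = L phi \<otimes> (R phi \<otimes> (c \<otimes> b) \<oplus> d \<otimes> a)"
  unfolding ad bc da by (simp add: rs R_minus LR_left)

text \<open>Here and in \<open>middle_4\<close> the correction to \<beta>\<gamma> is a function of
  one variable, the one that can cross the tensor sign.\<close>

lemma middle_3: "b \<otimes> c = L phi \<otimes> (d \<otimes> a) \<ominus> R phi"
  unfolding bc da by (simp add: rs R_minus LR_left)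

lemma middle_4: "b \<otimes> c = R (kappa - phi) \<otimes> (a \<otimes> d) \<ominus> L (kappa - phi)"
  unfolding bc ad by (simp add: rs R_minus L_minus LR_left L_kappa)

end

section \<open>The coproducts of the generators satisfy the defining relations\<close>

context q_param
begin

abbreviation "al \<equiv> alpha q"
abbreviation "be \<equiv> beta q"
abbreviation "ga \<equiv> gamma q"
abbreviation "de \<equiv> delta q"
abbreviation mlt (infixr \<open>\<cdot>\<close> 70) where "x \<cdot> y \<equiv> x \<otimes>\<^bsub>SL\<^esub> y"

definition "Da = tn al al \<oplus>\<^bsub>AA\<^esub> tn be ga"
definition "Db = tn al be \<oplus>\<^bsub>AA\<^esub> tn be de"
definition "Dc = tn ga al \<oplus>\<^bsub>AA\<^esub> tn de ga"
definition "Dd = tn ga be \<oplus>\<^bsub>AA\<^esub> tn de de"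
definition "DL f = tn (LA f) \<one>\<^bsub>SL\<^esub>"
definition "DR f = tn \<one>\<^bsub>SL\<^esub> (RA f)"

lemma words_gr:
  "al \<cdot> al \<in> gr 2 2" "be \<cdot> be \<in> gr 2 (-2)" "ga \<cdot> ga \<in> gr (-2) 2" "de \<cdot> de \<in> gr (-2) (-2)"
  "al \<cdot> be \<in> gr 2 0" "be \<cdot> al \<in> gr 2 0" "al \<cdot> ga \<in> gr 0 2" "ga \<cdot> al \<in> gr 0 2"
  "be \<cdot> de \<in> gr 0 (-2)" "de \<cdot> be \<in> gr 0 (-2)" "ga \<cdot> de \<in> gr (-2) 0" "de \<cdot> ga \<in> gr (-2) 0"
  "al \<cdot> de \<in> gr 0 0" "de \<cdot> al \<in> gr 0 0" "be \<cdot> ga \<in> gr 0 0" "ga \<cdot> be \<in> gr 0 0"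
  by (rule gr_mult', rule gr_gens, rule gr_gens, simp, simp)+

lemma cmp_gens [simp]: "cmp al al" "cmp be ga" "cmp al be" "cmp be de" "cmp ga al" "cmp de ga" "cmp ga be" "cmp de de"
  "cmp (LA f) \<one>\<^bsub>SL\<^esub>" "cmp \<one>\<^bsub>SL\<^esub> (RA f)" "cmp \<one>\<^bsub>SL\<^esub> \<one>\<^bsub>SL\<^esub>"
  by (rule cmpI, rule gr_gens gr_one, rule gr_gens gr_one)+

lemma cmp_closed [simp, intro]: "cmp x y \<Longrightarrow> tn x y \<in> carrier AA"
  by (rule tn_cmp_closed)

lemma DL_tn: "cmp x y \<Longrightarrow> DL f \<otimes>\<^bsub>AA\<^esub> tn x y = tn (LA f \<cdot> x) y"
  and DR_tn: "cmp x y \<Longrightarrow> DR f \<otimes>\<^bsub>AA\<^esub> tn x y = tn x (RA f \<cdot> y)"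
  and tn_DL: "cmp x y \<Longrightarrow> tn x y \<otimes>\<^bsub>AA\<^esub> DL f = tn (x \<cdot> LA f) y"
  and tn_DR: "cmp x y \<Longrightarrow> tn x y \<otimes>\<^bsub>AA\<^esub> DR f = tn x (y \<cdot> RA f)"
  by (simp_all add: DL_def DR_def tn_mult cmp_carrier)

lemma D_closed [simp, intro]: "Da \<in> carrier AA" "Db \<in> carrier AA" "Dc \<in> carrier AA" "Dd \<in> carrier AA"
  "DL f \<in> carrier AA" "DR f \<in> carrier AA"
  by (simp_all add: Da_def Db_def Dc_def Dd_def DL_def DR_def)

lemmas D_defs = Da_def Db_def Dc_def Dd_def

lemma D_mult:
  assumes "cmp x y" "cmp z w" "cmp x' y'" "cmp z' w'"
  shows "(tn x y \<oplus>\<^bsub>AA\<^esub> tn z w) \<otimes>\<^bsub>AA\<^esub> (tn x' y' \<oplus>\<^bsub>AA\<^esub> tn z' w')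
    = tn (x \<cdot> x') (y \<cdot> y') \<oplus>\<^bsub>AA\<^esub> (tn (x \<cdot> z') (y \<cdot> w') \<oplus>\<^bsub>AA\<^esub> (tn (z \<cdot> x') (w \<cdot> y') \<oplus>\<^bsub>AA\<^esub> tn (z \<cdot> z') (w \<cdot> w')))"
  using assms by (simp add: AA.l_distr AA.r_distr tn_mult cmp_mult AA.a_ac)

lemma D_prods:
  "Da \<otimes>\<^bsub>AA\<^esub> Db = tn (al \<cdot> al) (al \<cdot> be) \<oplus>\<^bsub>AA\<^esub> (tn (al \<cdot> be) (al \<cdot> de) \<oplus>\<^bsub>AA\<^esub> (tn (be \<cdot> al) (ga \<cdot> be) \<oplus>\<^bsub>AA\<^esub> tn (be \<cdot> be) (ga \<cdot> de)))"
  "Db \<otimes>\<^bsub>AA\<^esub> Da = tn (al \<cdot> al) (be \<cdot> al) \<oplus>\<^bsub>AA\<^esub> (tn (al \<cdot> be) (be \<cdot> ga) \<oplus>\<^bsub>AA\<^esub> (tn (be \<cdot> al) (de \<cdot> al) \<oplus>\<^bsub>AA\<^esub> tn (be \<cdot> be) (de \<cdot> ga)))"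
  "Da \<otimes>\<^bsub>AA\<^esub> Dc = tn (al \<cdot> ga) (al \<cdot> al) \<oplus>\<^bsub>AA\<^esub> (tn (al \<cdot> de) (al \<cdot> ga) \<oplus>\<^bsub>AA\<^esub> (tn (be \<cdot> ga) (ga \<cdot> al) \<oplus>\<^bsub>AA\<^esub> tn (be \<cdot> de) (ga \<cdot> ga)))"
  "Dc \<otimes>\<^bsub>AA\<^esub> Da = tn (ga \<cdot> al) (al \<cdot> al) \<oplus>\<^bsub>AA\<^esub> (tn (ga \<cdot> be) (al \<cdot> ga) \<oplus>\<^bsub>AA\<^esub> (tn (de \<cdot> al) (ga \<cdot> al) \<oplus>\<^bsub>AA\<^esub> tn (de \<cdot> be) (ga \<cdot> ga)))"
  "Db \<otimes>\<^bsub>AA\<^esub> Dd = tn (al \<cdot> ga) (be \<cdot> be) \<oplus>\<^bsub>AA\<^esub> (tn (al \<cdot> de) (be \<cdot> de) \<oplus>\<^bsub>AA\<^esub> (tn (be \<cdot> ga) (de \<cdot> be) \<oplus>\<^bsub>AA\<^esub> tn (be \<cdot> de) (de \<cdot> de)))"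
  "Dd \<otimes>\<^bsub>AA\<^esub> Db = tn (ga \<cdot> al) (be \<cdot> be) \<oplus>\<^bsub>AA\<^esub> (tn (ga \<cdot> be) (be \<cdot> de) \<oplus>\<^bsub>AA\<^esub> (tn (de \<cdot> al) (de \<cdot> be) \<oplus>\<^bsub>AA\<^esub> tn (de \<cdot> be) (de \<cdot> de)))"
  "Dc \<otimes>\<^bsub>AA\<^esub> Dd = tn (ga \<cdot> ga) (al \<cdot> be) \<oplus>\<^bsub>AA\<^esub> (tn (ga \<cdot> de) (al \<cdot> de) \<oplus>\<^bsub>AA\<^esub> (tn (de \<cdot> ga) (ga \<cdot> be) \<oplus>\<^bsub>AA\<^esub> tn (de \<cdot> de) (ga \<cdot> de)))"
  "Dd \<otimes>\<^bsub>AA\<^esub> Dc = tn (ga \<cdot> ga) (be \<cdot> al) \<oplus>\<^bsub>AA\<^esub> (tn (ga \<cdot> de) (be \<cdot> ga) \<oplus>\<^bsub>AA\<^esub> (tn (de \<cdot> ga) (de \<cdot> al) \<oplus>\<^bsub>AA\<^esub> tn (de \<cdot> de) (de \<cdot> ga)))"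
  "Da \<otimes>\<^bsub>AA\<^esub> Dd = tn (al \<cdot> ga) (al \<cdot> be) \<oplus>\<^bsub>AA\<^esub> (tn (al \<cdot> de) (al \<cdot> de) \<oplus>\<^bsub>AA\<^esub> (tn (be \<cdot> ga) (ga \<cdot> be) \<oplus>\<^bsub>AA\<^esub> tn (be \<cdot> de) (ga \<cdot> de)))"
  "Dd \<otimes>\<^bsub>AA\<^esub> Da = tn (ga \<cdot> al) (be \<cdot> al) \<oplus>\<^bsub>AA\<^esub> (tn (ga \<cdot> be) (be \<cdot> ga) \<oplus>\<^bsub>AA\<^esub> (tn (de \<cdot> al) (de \<cdot> al) \<oplus>\<^bsub>AA\<^esub> tn (de \<cdot> be) (de \<cdot> ga)))"
  "Db \<otimes>\<^bsub>AA\<^esub> Dc = tn (al \<cdot> ga) (be \<cdot> al) \<oplus>\<^bsub>AA\<^esub> (tn (al \<cdot> de) (be \<cdot> ga) \<oplus>\<^bsub>AA\<^esub> (tn (be \<cdot> ga) (de \<cdot> al) \<oplus>\<^bsub>AA\<^esub> tn (be \<cdot> de) (de \<cdot> ga)))"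
  "Dc \<otimes>\<^bsub>AA\<^esub> Db = tn (ga \<cdot> al) (al \<cdot> be) \<oplus>\<^bsub>AA\<^esub> (tn (ga \<cdot> be) (al \<cdot> de) \<oplus>\<^bsub>AA\<^esub> (tn (de \<cdot> al) (ga \<cdot> be) \<oplus>\<^bsub>AA\<^esub> tn (de \<cdot> be) (ga \<cdot> de)))"
  unfolding D_defs by (rule D_mult; simp)+

text \<open>The pattern of the relations between two generators without constant term: of four
  tensors the outer two agree by a relation in one factor, the inner two only as a sum.\<close>

lemma middle_eq:
  assumes "X1 = Y1" "X4 = Y4" "X2 \<oplus>\<^bsub>AA\<^esub> X3 = Y2 \<oplus>\<^bsub>AA\<^esub> Y3"
    and "X1 \<in> carrier AA" "X2 \<in> carrier AA" "X3 \<in> carrier AA" "X4 \<in> carrier AA"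
    and "Y2 \<in> carrier AA" "Y3 \<in> carrier AA"
  shows "X1 \<oplus>\<^bsub>AA\<^esub> (X2 \<oplus>\<^bsub>AA\<^esub> (X3 \<oplus>\<^bsub>AA\<^esub> X4)) = Y1 \<oplus>\<^bsub>AA\<^esub> (Y2 \<oplus>\<^bsub>AA\<^esub> (Y3 \<oplus>\<^bsub>AA\<^esub> Y4))"
proof -
  have "X2 \<oplus>\<^bsub>AA\<^esub> (X3 \<oplus>\<^bsub>AA\<^esub> X4) = Y2 \<oplus>\<^bsub>AA\<^esub> (Y3 \<oplus>\<^bsub>AA\<^esub> X4)"
    using assms(3-) by (simp flip: AA.a_assoc)
  then show ?thesis using assms(1,2) by simp
qed

lemmas gw = words_gr gr_LR[OF words_gr(1)] gr_LR[OF words_gr(2)] gr_LR[OF words_gr(3)] gr_LR[OF words_gr(4)]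
  gr_LR[OF words_gr(5)] gr_LR[OF words_gr(6)] gr_LR[OF words_gr(7)] gr_LR[OF words_gr(8)]
  gr_LR[OF words_gr(9)] gr_LR[OF words_gr(10)] gr_LR[OF words_gr(11)] gr_LR[OF words_gr(12)]
  gr_LR[OF words_gr(13)] gr_LR[OF words_gr(14)] gr_LR[OF words_gr(15)] gr_LR[OF words_gr(16)]

lemma DL_sum4:
  assumes "cmp x1 y1" "cmp x2 y2" "cmp x3 y3" "cmp x4 y4"
  shows "DL f \<otimes>\<^bsub>AA\<^esub> (tn x1 y1 \<oplus>\<^bsub>AA\<^esub> (tn x2 y2 \<oplus>\<^bsub>AA\<^esub> (tn x3 y3 \<oplus>\<^bsub>AA\<^esub> tn x4 y4)))
    = tn (LA f \<cdot> x1) y1 \<oplus>\<^bsub>AA\<^esub> (tn (LA f \<cdot> x2) y2 \<oplus>\<^bsub>AA\<^esub> (tn (LA f \<cdot> x3) y3 \<oplus>\<^bsub>AA\<^esub> tn (LA f \<cdot> x4) y4))"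
    "DR f \<otimes>\<^bsub>AA\<^esub> (tn x1 y1 \<oplus>\<^bsub>AA\<^esub> (tn x2 y2 \<oplus>\<^bsub>AA\<^esub> (tn x3 y3 \<oplus>\<^bsub>AA\<^esub> tn x4 y4)))
    = tn x1 (RA f \<cdot> y1) \<oplus>\<^bsub>AA\<^esub> (tn x2 (RA f \<cdot> y2) \<oplus>\<^bsub>AA\<^esub> (tn x3 (RA f \<cdot> y3) \<oplus>\<^bsub>AA\<^esub> tn x4 (RA f \<cdot> y4)))"
  using assms by (simp_all add: AA.r_distr DL_tn DR_tn)

lemma cmp_LR: "cmp x y \<Longrightarrow> cmp (LA f \<cdot> x) y" "cmp x y \<Longrightarrow> cmp x (RA f \<cdot> y)"
  "cmp x y \<Longrightarrow> cmp (RA f \<cdot> x) y" "cmp x y \<Longrightarrow> cmp x (LA f \<cdot> y)"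
  by (auto elim!: cmpE intro: cmpI gr_LR)

lemma mid1:
  assumes x: "x \<in> gr a 0"
  defines "p \<equiv> mshift (-1) phi"
  shows "tn (RA p \<cdot> x) (al \<cdot> de) \<oplus>\<^bsub>AA\<^esub> tn x (ga \<cdot> be)
    = tn (RA p \<cdot> x) (RA p \<cdot> (be \<cdot> ga)) \<oplus>\<^bsub>AA\<^esub> tn x (RA p \<cdot> (de \<cdot> al))"
proof -
  have "tn (RA p \<cdot> x) (al \<cdot> de) \<oplus>\<^bsub>AA\<^esub> tn x (ga \<cdot> be) = tn x (LA p \<cdot> (al \<cdot> de) \<oplus>\<^bsub>SL\<^esub> ga \<cdot> be)"
    unfolding tn_balanced[OF x words_gr(13)] by (rule tn_add_right[symmetric], rule x, (rule gw)+)
  also have "\<dots> = tn x (RA p \<cdot> (LA p \<cdot> (be \<cdot> ga)) \<oplus>\<^bsub>SL\<^esub> RA p \<cdot> (de \<cdot> al))"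
    unfolding p_def A.middle_1 by (simp add: A.r_distr)
  also have "\<dots> = tn x (RA p \<cdot> (LA p \<cdot> (be \<cdot> ga))) \<oplus>\<^bsub>AA\<^esub> tn x (RA p \<cdot> (de \<cdot> al))"
    by (rule tn_add_right, rule x, rule gr_LR, (rule gw)+)
  also have "RA p \<cdot> (LA p \<cdot> (be \<cdot> ga)) = LA p \<cdot> (RA p \<cdot> (be \<cdot> ga))"
    by (simp add: A.LR_left)
  also have "tn x (LA p \<cdot> (RA p \<cdot> (be \<cdot> ga))) = tn (RA p \<cdot> x) (RA p \<cdot> (be \<cdot> ga))"
    by (rule tn_balanced[symmetric], rule x, rule gw)
  finally show ?thesis .
qed

lemma mid2:
  assumes y: "y \<in> gr 0 b"
  shows "tn (al \<cdot> de) (LA phi \<cdot> y) \<oplus>\<^bsub>AA\<^esub> tn (be \<cdot> ga) y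
    = tn (LA phi \<cdot> (ga \<cdot> be)) (LA phi \<cdot> y) \<oplus>\<^bsub>AA\<^esub> tn (LA phi \<cdot> (de \<cdot> al)) y"
proof -
  have "tn (al \<cdot> de) (LA phi \<cdot> y) \<oplus>\<^bsub>AA\<^esub> tn (be \<cdot> ga) y = tn (RA phi \<cdot> (al \<cdot> de) \<oplus>\<^bsub>SL\<^esub> be \<cdot> ga) y"
    unfolding tn_balanced[OF words_gr(13) y, symmetric] by (rule tn_add_left[symmetric], rule gw, rule gw, rule y)
  also have "\<dots> = tn (LA phi \<cdot> (RA phi \<cdot> (ga \<cdot> be)) \<oplus>\<^bsub>SL\<^esub> LA phi \<cdot> (de \<cdot> al)) y"
    unfolding A.middle_2 by (simp add: A.r_distr)
  also have "\<dots> = tn (LA phi \<cdot> (RA phi \<cdot> (ga \<cdot> be))) y \<oplus>\<^bsub>AA\<^esub> tn (LA phi \<cdot> (de \<cdot> al)) y"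
    by (rule tn_add_left, rule gr_LR, rule gw, rule gw, rule y)
  also have "LA phi \<cdot> (RA phi \<cdot> (ga \<cdot> be)) = RA phi \<cdot> (LA phi \<cdot> (ga \<cdot> be))"
    by (simp add: A.LR_left)
  also have "tn (RA phi \<cdot> (LA phi \<cdot> (ga \<cdot> be))) y = tn (LA phi \<cdot> (ga \<cdot> be)) (LA phi \<cdot> y)"
    by (rule tn_balanced, rule gw, rule y)
  finally show ?thesis .
qed

lemma D_ab: "Da \<otimes>\<^bsub>AA\<^esub> Db = DR (mshift (-1) phi) \<otimes>\<^bsub>AA\<^esub> (Db \<otimes>\<^bsub>AA\<^esub> Da)"
proof -
  have c: "cmp (al \<cdot> al) (be \<cdot> al)" "cmp (al \<cdot> be) (be \<cdot> ga)" "cmp (be \<cdot> al) (de \<cdot> al)" "cmp (be \<cdot> be) (de \<cdot> ga)"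
    by (rule cmpI, rule gw, rule gw)+
  show ?thesis
    unfolding D_prods DL_sum4(2)[OF c] unfolding A.ab A.cd
    by (rule middle_eq[OF refl refl mid1[OF words_gr(6)]]; (rule cmp_closed, rule cmpI, rule gw, rule gw))
qed

lemma D_cd: "Dc \<otimes>\<^bsub>AA\<^esub> Dd = DR (mshift (-1) phi) \<otimes>\<^bsub>AA\<^esub> (Dd \<otimes>\<^bsub>AA\<^esub> Dc)"
proof -
  have c: "cmp (ga \<cdot> ga) (be \<cdot> al)" "cmp (ga \<cdot> de) (be \<cdot> ga)" "cmp (de \<cdot> ga) (de \<cdot> al)" "cmp (de \<cdot> de) (de \<cdot> ga)"
    by (rule cmpI, rule gw, rule gw)+
  show ?thesis
    unfolding D_prods DL_sum4(2)[OF c] unfolding A.ab A.cd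
    by (rule middle_eq[OF refl refl mid1[OF words_gr(12)]]; (rule cmp_closed, rule cmpI, rule gw, rule gw))
qed

lemma D_ac: "Da \<otimes>\<^bsub>AA\<^esub> Dc = DL phi \<otimes>\<^bsub>AA\<^esub> (Dc \<otimes>\<^bsub>AA\<^esub> Da)"
proof -
  have c: "cmp (ga \<cdot> al) (al \<cdot> al)" "cmp (ga \<cdot> be) (al \<cdot> ga)" "cmp (de \<cdot> al) (ga \<cdot> al)" "cmp (de \<cdot> be) (ga \<cdot> ga)"
    by (rule cmpI, rule gw, rule gw)+
  show ?thesis
    unfolding D_prods DL_sum4(1)[OF c] unfolding A.ac A.bd
    by (rule middle_eq[OF refl refl mid2[OF words_gr(8)]]; (rule cmp_closed, rule cmpI, rule gw, rule gw))
qed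

lemma D_bd: "Db \<otimes>\<^bsub>AA\<^esub> Dd = DL phi \<otimes>\<^bsub>AA\<^esub> (Dd \<otimes>\<^bsub>AA\<^esub> Db)"
proof -
  have c: "cmp (ga \<cdot> al) (be \<cdot> be)" "cmp (ga \<cdot> be) (be \<cdot> de)" "cmp (de \<cdot> al) (de \<cdot> be)" "cmp (de \<cdot> be) (de \<cdot> de)"
    by (rule cmpI, rule gw, rule gw)+
  show ?thesis
    unfolding D_prods DL_sum4(1)[OF c] unfolding A.ac A.bd
    by (rule middle_eq[OF refl refl mid2[OF words_gr(10)]]; (rule cmp_closed, rule cmpI, rule gw, rule gw))
qed

abbreviation "kp \<equiv> kappa - phi"

text \<open>The relations \<open>ab\<close> and \<open>cd\<close> solved for the reversed product,
  \<open>kappa - phi\<close> being the inverse of the shifted \<open>phi\<close>.\<close>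

lemma ba_dc: "be \<cdot> al = RA kp \<cdot> (al \<cdot> be)" "de \<cdot> ga = RA kp \<cdot> (ga \<cdot> de)"
proof -
  have "RA kp \<cdot> (RA (mshift (-1) phi) \<cdot> x) = x" if "x \<in> carrier SL" for x
    using that mshift_phi by (simp add: A.R_prod mult.commute)
  then show "be \<cdot> al = RA kp \<cdot> (al \<cdot> be)" "de \<cdot> ga = RA kp \<cdot> (ga \<cdot> de)"
    by (simp_all add: A.ab A.cd)
qed

lemmas gw1 = gw gr_one gr_gens(5,6)

text \<open>The pattern of \<open>middle_eq\<close> with a constant term U, which is the unit or the
  difference of the two moment maps.\<close>

lemma middle_eq1:
  assumes "X1 = Y1" "X4 = Y4" "X2 \<oplus>\<^bsub>AA\<^esub> X3 = U \<oplus>\<^bsub>AA\<^esub> (Y2 \<oplus>\<^bsub>AA\<^esub> Y3)"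
    and c: "X1 \<in> carrier AA" "X2 \<in> carrier AA" "X3 \<in> carrier AA" "X4 \<in> carrier AA"
    "Y2 \<in> carrier AA" "Y3 \<in> carrier AA" "U \<in> carrier AA"
  shows "X1 \<oplus>\<^bsub>AA\<^esub> (X2 \<oplus>\<^bsub>AA\<^esub> (X3 \<oplus>\<^bsub>AA\<^esub> X4)) = U \<oplus>\<^bsub>AA\<^esub> (Y1 \<oplus>\<^bsub>AA\<^esub> (Y2 \<oplus>\<^bsub>AA\<^esub> (Y3 \<oplus>\<^bsub>AA\<^esub> Y4)))"
proof -
  have "X2 \<oplus>\<^bsub>AA\<^esub> (X3 \<oplus>\<^bsub>AA\<^esub> X4) = U \<oplus>\<^bsub>AA\<^esub> (Y2 \<oplus>\<^bsub>AA\<^esub> Y3) \<oplus>\<^bsub>AA\<^esub> X4"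
    using assms(3) c by (simp flip: AA.a_assoc)
  then show ?thesis using assms(1,2) c by (simp add: AA.a_ac)
qed

text \<open>Expanding \<alpha>\<delta> in both tensor factors produces the term \<open>?W\<close>;
  \<beta>\<gamma> = \<phi>(\<lambda>)\<delta>\<alpha> - \<phi>(\<mu>) produces it again with the
  opposite sign, after \<phi> has crossed the tensor sign.\<close>

lemma D_ad: "Da \<otimes>\<^bsub>AA\<^esub> Dd = \<one>\<^bsub>AA\<^esub> \<oplus>\<^bsub>AA\<^esub> DL phi \<otimes>\<^bsub>AA\<^esub> (Dc \<otimes>\<^bsub>AA\<^esub> Db)"
proof -
  have c: "cmp (ga \<cdot> al) (al \<cdot> be)" "cmp (ga \<cdot> be) (al \<cdot> de)" "cmp (de \<cdot> al) (ga \<cdot> be)" "cmp (de \<cdot> be) (ga \<cdot> de)"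
    by (rule cmpI, rule gw, rule gw)+
  let ?W = "tn \<one>\<^bsub>SL\<^esub> (LA phi \<cdot> (ga \<cdot> be))" and ?U = "tn \<one>\<^bsub>SL\<^esub> \<one>\<^bsub>SL\<^esub>"
    and ?Y2 = "tn (LA phi \<cdot> (ga \<cdot> be)) (al \<cdot> de)" and ?Y3 = "tn (LA phi \<cdot> (de \<cdot> al)) (ga \<cdot> be)"
  have cl: "?W \<in> carrier AA" "?U \<in> carrier AA" "?Y2 \<in> carrier AA" "?Y3 \<in> carrier AA"
    by (rule cmp_closed, rule cmpI, rule gw1, rule gw1)+
  have "tn (al \<cdot> de) (al \<cdot> de) = tn (\<one>\<^bsub>SL\<^esub> \<oplus>\<^bsub>SL\<^esub> LA phi \<cdot> (ga \<cdot> be)) (al \<cdot> de)"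
    using A.ad by (rule arg_cong)
  also have "\<dots> = tn \<one>\<^bsub>SL\<^esub> (al \<cdot> de) \<oplus>\<^bsub>AA\<^esub> ?Y2"
    by (rule tn_add_left, rule gw1, rule gw1, rule gw1)
  also have "tn \<one>\<^bsub>SL\<^esub> (al \<cdot> de) = ?U \<oplus>\<^bsub>AA\<^esub> ?W"
    unfolding A.ad by (rule tn_add_right, rule gw1, rule gw1, rule gw1)
  finally have X2: "tn (al \<cdot> de) (al \<cdot> de) = (?U \<oplus>\<^bsub>AA\<^esub> ?W) \<oplus>\<^bsub>AA\<^esub> ?Y2" .
  have "tn (be \<cdot> ga) (ga \<cdot> be) = ?Y3 \<ominus>\<^bsub>AA\<^esub> tn (RA phi) (ga \<cdot> be)"
    unfolding A.middle_3 by (rule tn_minus_left, rule gw1, rule gw1, rule gw1)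
  also have "tn (RA phi) (ga \<cdot> be) = ?W"
    using tn_balanced[OF gr_one words_gr(16), of phi] by simp
  finally have X3: "tn (be \<cdot> ga) (ga \<cdot> be) = ?Y3 \<ominus>\<^bsub>AA\<^esub> ?W" .
  have mid: "tn (al \<cdot> de) (al \<cdot> de) \<oplus>\<^bsub>AA\<^esub> tn (be \<cdot> ga) (ga \<cdot> be) = ?U \<oplus>\<^bsub>AA\<^esub> (?Y2 \<oplus>\<^bsub>AA\<^esub> ?Y3)"
    unfolding X2 X3 using cl by (simp add: AA.rs)
  show ?thesis
    unfolding D_prods DL_sum4(1)[OF c] tn_one unfolding A.ac A.bd
    by (rule middle_eq1[OF refl refl mid]; (rule cmp_closed, rule cmpI, rule gw1, rule gw1))
qed

lemma D_da: "Dd \<otimes>\<^bsub>AA\<^esub> Da = \<one>\<^bsub>AA\<^esub> \<oplus>\<^bsub>AA\<^esub> DR kp \<otimes>\<^bsub>AA\<^esub> (Dc \<otimes>\<^bsub>AA\<^esub> Db)"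
proof -
  have c: "cmp (ga \<cdot> al) (al \<cdot> be)" "cmp (ga \<cdot> be) (al \<cdot> de)" "cmp (de \<cdot> al) (ga \<cdot> be)" "cmp (de \<cdot> be) (ga \<cdot> de)"
    by (rule cmpI, rule gw, rule gw)+
  let ?W = "tn (RA kp \<cdot> (ga \<cdot> be)) \<one>\<^bsub>SL\<^esub>" and ?U = "tn \<one>\<^bsub>SL\<^esub> \<one>\<^bsub>SL\<^esub>"
    and ?Y2 = "tn (ga \<cdot> be) (RA kp \<cdot> (al \<cdot> de))" and ?Y3 = "tn (de \<cdot> al) (RA kp \<cdot> (ga \<cdot> be))"
  have cl: "?W \<in> carrier AA" "?U \<in> carrier AA" "?Y2 \<in> carrier AA" "?Y3 \<in> carrier AA"
    by (rule cmp_closed, rule cmpI, rule gw1, rule gw1)+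
  have "tn (de \<cdot> al) (de \<cdot> al) = tn (de \<cdot> al) (\<one>\<^bsub>SL\<^esub> \<oplus>\<^bsub>SL\<^esub> RA kp \<cdot> (ga \<cdot> be))"
    using A.da by (rule arg_cong)
  also have "\<dots> = tn (de \<cdot> al) \<one>\<^bsub>SL\<^esub> \<oplus>\<^bsub>AA\<^esub> ?Y3"
    by (rule tn_add_right, rule gw1, rule gw1, rule gw1)
  also have "tn (de \<cdot> al) \<one>\<^bsub>SL\<^esub> = ?U \<oplus>\<^bsub>AA\<^esub> ?W"
    unfolding A.da by (rule tn_add_left, rule gw1, rule gw1, rule gw1)
  finally have X3: "tn (de \<cdot> al) (de \<cdot> al) = (?U \<oplus>\<^bsub>AA\<^esub> ?W) \<oplus>\<^bsub>AA\<^esub> ?Y3" .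
  have "tn (ga \<cdot> be) (be \<cdot> ga) = ?Y2 \<ominus>\<^bsub>AA\<^esub> tn (ga \<cdot> be) (LA kp)"
    unfolding A.middle_4 by (rule tn_minus_right, rule gw1, rule gw1, rule gw1)
  also have "tn (ga \<cdot> be) (LA kp) = ?W"
    using tn_balanced[OF words_gr(16) gr_one, of kp] by simp
  finally have X2: "tn (ga \<cdot> be) (be \<cdot> ga) = ?Y2 \<ominus>\<^bsub>AA\<^esub> ?W" .
  have mid: "tn (ga \<cdot> be) (be \<cdot> ga) \<oplus>\<^bsub>AA\<^esub> tn (de \<cdot> al) (de \<cdot> al) = ?U \<oplus>\<^bsub>AA\<^esub> (?Y2 \<oplus>\<^bsub>AA\<^esub> ?Y3)"
    unfolding X2 X3 using cl by (simp add: AA.rs)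
  show ?thesis
    unfolding D_prods DL_sum4(2)[OF c] tn_one unfolding ba_dc
    by (rule middle_eq1[OF refl refl mid]; (rule cmp_closed, rule cmpI, rule gw1, rule gw1))
qed

lemma D_bc: "Db \<otimes>\<^bsub>AA\<^esub> Dc = DL phi \<otimes>\<^bsub>AA\<^esub> (DR kp \<otimes>\<^bsub>AA\<^esub> (Dc \<otimes>\<^bsub>AA\<^esub> Db)) \<oplus>\<^bsub>AA\<^esub> (DL phi \<ominus>\<^bsub>AA\<^esub> DR phi)"
proof -
  have c: "cmp (ga \<cdot> al) (al \<cdot> be)" "cmp (ga \<cdot> be) (al \<cdot> de)" "cmp (de \<cdot> al) (ga \<cdot> be)" "cmp (de \<cdot> be) (ga \<cdot> de)"
    by (rule cmpI, rule gw, rule gw)+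
  have c': "cmp (ga \<cdot> al) (RA kp \<cdot> (al \<cdot> be))" "cmp (ga \<cdot> be) (RA kp \<cdot> (al \<cdot> de))"
    "cmp (de \<cdot> al) (RA kp \<cdot> (ga \<cdot> be))" "cmp (de \<cdot> be) (RA kp \<cdot> (ga \<cdot> de))"
    by (rule cmpI, rule gw, rule gw)+
  let ?one = "\<one>\<^bsub>SL\<^esub>"
  define x y where "x = LA phi \<cdot> (ga \<cdot> be)" and "y = RA kp \<cdot> (ga \<cdot> be)"
  have xg: "x \<in> gr 0 0" "y \<in> gr 0 0" unfolding x_def y_def by (rule gw)+
  note g = xg gw1 gr_LR[OF xg(1)] gr_LR[OF xg(2)]
  let ?Y2 = "tn x (RA kp \<cdot> (al \<cdot> de))" and ?Y3 = "tn (LA phi \<cdot> (de \<cdot> al)) y"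
  let ?U = "DL phi \<ominus>\<^bsub>AA\<^esub> DR phi"
  let ?P = "tn ?one (be \<cdot> ga)" and ?Q = "tn (be \<cdot> ga) ?one" and ?S = "tn x (be \<cdot> ga)" and ?T = "tn (be \<cdot> ga) y"
    and ?V = "tn (RA kp \<cdot> x) ?one" and ?W = "tn ?one (LA phi \<cdot> y)"
  have cl: "?P \<in> carrier AA" "?Q \<in> carrier AA" "?S \<in> carrier AA" "?T \<in> carrier AA" "?V \<in> carrier AA" "?W \<in> carrier AA"
    "?Y2 \<in> carrier AA" "?Y3 \<in> carrier AA"
    by (rule cmp_closed, rule cmpI, rule g, rule g)+
  have X2: "tn (al \<cdot> de) (be \<cdot> ga) = ?P \<oplus>\<^bsub>AA\<^esub> ?S"
    unfolding A.ad x_def by (rule tn_add_left, rule gw1, rule gw1, rule gw1)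
  have X3: "tn (be \<cdot> ga) (de \<cdot> al) = ?Q \<oplus>\<^bsub>AA\<^esub> ?T"
    unfolding A.da y_def by (rule tn_add_right, rule gw1, rule gw1, rule gw1)
  have "RA kp \<cdot> (al \<cdot> de) = be \<cdot> ga \<oplus>\<^bsub>SL\<^esub> LA kp" unfolding A.middle_4 by (simp add: A.rs)
  then have "?Y2 = ?S \<oplus>\<^bsub>AA\<^esub> tn x (LA kp)"
    by (simp only:) (rule tn_add_right, rule g, rule g, rule g)
  also have "tn x (LA kp) = ?V" using tn_balanced[OF xg(1) gr_one, of kp] by simp
  finally have Y2: "?Y2 = ?S \<oplus>\<^bsub>AA\<^esub> ?V" .
  have "LA phi \<cdot> (de \<cdot> al) = be \<cdot> ga \<oplus>\<^bsub>SL\<^esub> RA phi" unfolding A.middle_3 by (simp add: A.rs)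
  then have "?Y3 = ?T \<oplus>\<^bsub>AA\<^esub> tn (RA phi) y"
    by (simp only:) (rule tn_add_left, rule g, rule g, rule g)
  also have "tn (RA phi) y = ?W" using tn_balanced[OF gr_one xg(2), of phi] by simp
  finally have Y3: "?Y3 = ?T \<oplus>\<^bsub>AA\<^esub> ?W" .
  have d: "LA phi \<ominus>\<^bsub>SL\<^esub> RA phi \<in> gr 0 0" by (rule gr_minus; rule g)
  \<comment> \<open>One equation in two groupings: \<open>b1\<close> is used in the left factor and
    \<open>b2\<close> in the right one, so that \<open>?V\<close> and \<open>?W\<close> match the
    extra terms of \<open>?Y2\<close> and \<open>?Y3\<close>.\<close>
  have b1: "be \<cdot> ga = RA kp \<cdot> x \<oplus>\<^bsub>SL\<^esub> (LA phi \<ominus>\<^bsub>SL\<^esub> RA phi)"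
    unfolding A.bc x_def by (simp add: A.LR_left)
  have b2: "be \<cdot> ga = LA phi \<cdot> y \<oplus>\<^bsub>SL\<^esub> (LA phi \<ominus>\<^bsub>SL\<^esub> RA phi)"
    unfolding A.bc y_def ..
  have "?Q = ?V \<oplus>\<^bsub>AA\<^esub> tn (LA phi \<ominus>\<^bsub>SL\<^esub> RA phi) ?one"
    unfolding b1 by (rule tn_add_left, rule g, rule d, rule g)
  also have "tn (LA phi \<ominus>\<^bsub>SL\<^esub> RA phi) ?one = tn (LA phi) ?one \<ominus>\<^bsub>AA\<^esub> tn (RA phi) ?one"
    by (rule tn_minus_left, rule g, rule g, rule g)
  finally have Q: "?Q = ?V \<oplus>\<^bsub>AA\<^esub> (DL phi \<ominus>\<^bsub>AA\<^esub> tn (RA phi) ?one)" by (simp only: DL_def)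
  have "?P = ?W \<oplus>\<^bsub>AA\<^esub> tn ?one (LA phi \<ominus>\<^bsub>SL\<^esub> RA phi)"
    unfolding b2 by (rule tn_add_right, rule g, rule g, rule d)
  also have "tn ?one (LA phi \<ominus>\<^bsub>SL\<^esub> RA phi) = tn ?one (LA phi) \<ominus>\<^bsub>AA\<^esub> tn ?one (RA phi)"
    by (rule tn_minus_right, rule g, rule g, rule g)
  also have "tn ?one (LA phi) = tn (RA phi) ?one" using tn_balanced[OF gr_one gr_one, of phi] by simp
  finally have P: "?P = ?W \<oplus>\<^bsub>AA\<^esub> (tn (RA phi) ?one \<ominus>\<^bsub>AA\<^esub> DR phi)" by (simp only: DR_def)
  have cl': "tn (RA phi) ?one \<in> carrier AA" by (rule cmp_closed, rule cmpI, rule g, rule g)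
  \<comment> \<open>The term \<phi>(\<mu>) \<otimes> 1 = 1 \<otimes> \<phi>(\<lambda>) cancels,
    leaving the difference of the outer moment maps.\<close>
  have mid: "tn (al \<cdot> de) (be \<cdot> ga) \<oplus>\<^bsub>AA\<^esub> tn (be \<cdot> ga) (de \<cdot> al) = ?U \<oplus>\<^bsub>AA\<^esub> (?Y2 \<oplus>\<^bsub>AA\<^esub> ?Y3)"
    unfolding X2 X3 Y2 Y3 unfolding P Q using cl cl' by (simp add: AA.rs)
  have "Db \<otimes>\<^bsub>AA\<^esub> Dc = ?U \<oplus>\<^bsub>AA\<^esub> DL phi \<otimes>\<^bsub>AA\<^esub> (DR kp \<otimes>\<^bsub>AA\<^esub> (Dc \<otimes>\<^bsub>AA\<^esub> Db))"
    unfolding D_prods DL_sum4(2)[OF c] DL_sum4(1)[OF c'] unfolding ba_dc unfolding A.ac A.bd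
    by (rule middle_eq1[OF refl refl mid[unfolded x_def y_def]];
        ((rule AA.minus_closed, rule D_closed, rule D_closed)
        | (rule cmp_closed, rule cmpI, rule gw1, rule gw1)))
  then show ?thesis by (simp add: AA.a_comm)
qed

lemma AA_sl2_data: "sl2_data q AA DL DR Da Db Dc Dd"
proof unfold_locales
  fix f g :: mero and z
  have one: "\<one>\<^bsub>SL\<^esub> \<in> gr 0 0" by simp
  show "DL f \<in> carrier AA" "DR f \<in> carrier AA" "Da \<in> carrier AA" "Db \<in> carrier AA" "Dc \<in> carrier AA" "Dd \<in> carrier AA"
    by simp_all
  show "DL (f + g) = DL f \<oplus>\<^bsub>AA\<^esub> DL g" unfolding DL_def A.L_add by (rule tn_add_left, (rule gr_gens one)+)
  show "DR (f + g) = DR f \<oplus>\<^bsub>AA\<^esub> DR g" unfolding DR_def A.R_add by (rule tn_add_right, (rule gr_gens one)+)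
  show "DL (f * g) = DL f \<otimes>\<^bsub>AA\<^esub> DL g" "DR (f * g) = DR f \<otimes>\<^bsub>AA\<^esub> DR g" "DL f \<otimes>\<^bsub>AA\<^esub> DR g = DR g \<otimes>\<^bsub>AA\<^esub> DL f"
    by (simp_all add: DL_def DR_def tn_mult A.L_mult A.R_mult)
  show "DL (mconst z) = z \<odot>\<^bsub>AA\<^esub> \<one>\<^bsub>AA\<^esub>" "DR (mconst z) = z \<odot>\<^bsub>AA\<^esub> \<one>\<^bsub>AA\<^esub>"
    unfolding DL_def DR_def A.L_const A.R_const tn_one
    by (rule tn_smult_left[OF one one], rule tn_smult_right[OF one one])
  show "DL f \<otimes>\<^bsub>AA\<^esub> Da = Da \<otimes>\<^bsub>AA\<^esub> DL (mshift 1 f)" "DR f \<otimes>\<^bsub>AA\<^esub> Da = Da \<otimes>\<^bsub>AA\<^esub> DR (mshift 1 f)"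
    "DL f \<otimes>\<^bsub>AA\<^esub> Db = Db \<otimes>\<^bsub>AA\<^esub> DL (mshift 1 f)" "DR f \<otimes>\<^bsub>AA\<^esub> Db = Db \<otimes>\<^bsub>AA\<^esub> DR (mshift (-1) f)"
    "DL f \<otimes>\<^bsub>AA\<^esub> Dc = Dc \<otimes>\<^bsub>AA\<^esub> DL (mshift (-1) f)" "DR f \<otimes>\<^bsub>AA\<^esub> Dc = Dc \<otimes>\<^bsub>AA\<^esub> DR (mshift 1 f)"
    "DL f \<otimes>\<^bsub>AA\<^esub> Dd = Dd \<otimes>\<^bsub>AA\<^esub> DL (mshift (-1) f)" "DR f \<otimes>\<^bsub>AA\<^esub> Dd = Dd \<otimes>\<^bsub>AA\<^esub> DR (mshift (-1) f)"
    by (simp_all add: D_defs AA.r_distr AA.l_distr DL_tn DR_tn tn_DL tn_DR A.La A.Ra A.Lb A.Rb A.Lc A.Rc A.Ld A.Rd)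
  show "Da \<otimes>\<^bsub>AA\<^esub> Db = DR (mshift (-1) phi) \<otimes>\<^bsub>AA\<^esub> (Db \<otimes>\<^bsub>AA\<^esub> Da)"
    "Da \<otimes>\<^bsub>AA\<^esub> Dc = DL phi \<otimes>\<^bsub>AA\<^esub> (Dc \<otimes>\<^bsub>AA\<^esub> Da)" "Db \<otimes>\<^bsub>AA\<^esub> Dd = DL phi \<otimes>\<^bsub>AA\<^esub> (Dd \<otimes>\<^bsub>AA\<^esub> Db)"
    "Dc \<otimes>\<^bsub>AA\<^esub> Dd = DR (mshift (-1) phi) \<otimes>\<^bsub>AA\<^esub> (Dd \<otimes>\<^bsub>AA\<^esub> Dc)"
    by (fact D_ab D_ac D_bd D_cd)+
  show "Da \<otimes>\<^bsub>AA\<^esub> Dd = \<one>\<^bsub>AA\<^esub> \<oplus>\<^bsub>AA\<^esub> DL phi \<otimes>\<^bsub>AA\<^esub> (Dc \<otimes>\<^bsub>AA\<^esub> Db)" by (fact D_ad)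
  show "Dd \<otimes>\<^bsub>AA\<^esub> Da = \<one>\<^bsub>AA\<^esub> \<oplus>\<^bsub>AA\<^esub> DR kp \<otimes>\<^bsub>AA\<^esub> (Dc \<otimes>\<^bsub>AA\<^esub> Db)" by (fact D_da)
  show "Db \<otimes>\<^bsub>AA\<^esub> Dc = DL phi \<otimes>\<^bsub>AA\<^esub> (DR kp \<otimes>\<^bsub>AA\<^esub> (Dc \<otimes>\<^bsub>AA\<^esub> Db)) \<oplus>\<^bsub>AA\<^esub> (DL phi \<ominus>\<^bsub>AA\<^esub> DR phi)" by (fact D_bc)
qed

end

sublocale q_param \<subseteq> D: sl2_data q "tensor_algebra (SL2 q) (SL2 q)" DL DR Da Db Dc Dd
  by (rule AA_sl2_data)

section \<open>The coproduct of the matrix elements and contractions of the tensor square\<close>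

context q_param
begin

text \<open>Existence is the universal property; generators determine a homomorphism on the carrier,
  and extensionality fixes it elsewhere. This settles the definite descriptions
  \<open>coprod\<close> and \<open>counit\<close>.\<close>

lemma ex1_hom:
  assumes "sl2_data q S L R a b c d"
  shows "\<exists>!\<phi>. \<phi> \<in> extensional (carrier SL) \<and> \<phi> \<in> alg_hom SL S \<and> \<phi> al = a \<and> \<phi> be = b \<and> \<phi> ga = c \<and> \<phi> de = d
    \<and> (\<forall>f. \<phi> (LA f) = L f) \<and> (\<forall>f. \<phi> (RA f) = R f)"
proof -
  interpret S: sl2_data q S L R a b c d by fact
  from SL2_universal_data[OF assms] obtain \<phi> where \<phi>: "\<phi> \<in> alg_hom SL S" "\<phi> al = a" "\<phi> be = b" "\<phi> ga = c" "\<phi> de = d"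
    "\<forall>f. \<phi> (LA f) = L f" "\<forall>f. \<phi> (RA f) = R f" by blast
  have "restrict \<phi> (carrier SL) \<in> alg_hom SL S"
    using \<phi>(1) by (auto simp: alg_hom_def ring_hom_def)
  then have "\<exists>\<phi>. \<phi> \<in> extensional (carrier SL) \<and> \<phi> \<in> alg_hom SL S \<and> \<phi> al = a \<and> \<phi> be = b \<and> \<phi> ga = c \<and> \<phi> de = d
    \<and> (\<forall>f. \<phi> (LA f) = L f) \<and> (\<forall>f. \<phi> (RA f) = R f)"
    using \<phi>(2-) by (intro exI[of _ "restrict \<phi> (carrier SL)"]) simp
  moreover have "\<phi> = \<psi>"
    if "\<phi> \<in> extensional (carrier SL) \<and> \<phi> \<in> alg_hom SL S \<and> \<phi> al = a \<and> \<phi> be = b \<and> \<phi> ga = c \<and> \<phi> de = d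
      \<and> (\<forall>f. \<phi> (LA f) = L f) \<and> (\<forall>f. \<phi> (RA f) = R f)"
      "\<psi> \<in> extensional (carrier SL) \<and> \<psi> \<in> alg_hom SL S \<and> \<psi> al = a \<and> \<psi> be = b \<and> \<psi> ga = c \<and> \<psi> de = d
      \<and> (\<forall>f. \<psi> (LA f) = L f) \<and> (\<forall>f. \<psi> (RA f) = R f)" for \<phi> \<psi>
    by (rule extensionalityI[of \<phi> "carrier SL" \<psi>]) (use that alg_hom_eqI[OF S.calg_axioms, of \<phi> \<psi>] in auto)
  ultimately show ?thesis by blast
qed

definition cop where "cop = coprod q"

lemma is_coproduct_iff: "is_coproduct q \<phi> \<longleftrightarrow> \<phi> \<in> alg_hom SL AA \<and> \<phi> al = Da \<and> \<phi> be = Db \<and> \<phi> ga = Dc \<and> \<phi> de = Dd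
    \<and> (\<forall>f. \<phi> (LA f) = DL f) \<and> (\<forall>f. \<phi> (RA f) = DR f)"
  unfolding is_coproduct_def Let_def D_defs DL_def DR_def carrier_Mero by (auto simp: lmom_SL rmom_SL)

lemma cop: "cop \<in> alg_hom SL AA" "cop al = Da" "cop be = Db" "cop ga = Dc" "cop de = Dd"
  "cop (LA f) = DL f" "cop (RA f) = DR f"
proof -
  from theI'[OF ex1_hom[OF AA_sl2_data]]
  show "cop \<in> alg_hom SL AA" "cop al = Da" "cop be = Db" "cop ga = Dc" "cop de = Dd"
    "cop (LA f) = DL f" "cop (RA f) = DR f"
    unfolding cop_def coprod_def is_coproduct_iff by blast+
qed

sublocale c: calg_hom SL AA cop
  using cop(1) A.calg_axioms AA.calg_axioms by (simp add: calg_hom_def calg_hom_axioms_def)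

lemma D_tn:
  assumes "cmp x y"
  shows "Da \<otimes>\<^bsub>AA\<^esub> tn x y = tn (al \<cdot> x) (al \<cdot> y) \<oplus>\<^bsub>AA\<^esub> tn (be \<cdot> x) (ga \<cdot> y)"
    "Db \<otimes>\<^bsub>AA\<^esub> tn x y = tn (al \<cdot> x) (be \<cdot> y) \<oplus>\<^bsub>AA\<^esub> tn (be \<cdot> x) (de \<cdot> y)"
    "Dc \<otimes>\<^bsub>AA\<^esub> tn x y = tn (ga \<cdot> x) (al \<cdot> y) \<oplus>\<^bsub>AA\<^esub> tn (de \<cdot> x) (ga \<cdot> y)"
    "Dd \<otimes>\<^bsub>AA\<^esub> tn x y = tn (ga \<cdot> x) (be \<cdot> y) \<oplus>\<^bsub>AA\<^esub> tn (de \<cdot> x) (de \<cdot> y)"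
  using assms by (simp_all add: D_defs AA.l_distr tn_mult)

lemma tn_zero_left: "y \<in> gr c b \<Longrightarrow> tn \<zero>\<^bsub>SL\<^esub> y = \<zero>\<^bsub>AA\<^esub>"
  using tn_smult_left[OF gr_zero[of 0 c], of y b 0] tn_closed[OF gr_zero[of 0 c], of y b] by simp

lemma tn_zero_right: "x \<in> gr a c \<Longrightarrow> tn x \<zero>\<^bsub>SL\<^esub> = \<zero>\<^bsub>AA\<^esub>"
  using tn_smult_right[OF _ gr_zero[of c 0], of x a 0] tn_closed[OF _ gr_zero[of c 0], of x a] by simp

text \<open>Re-indexing of the sums that arise when \<open>\<Delta>\<close> of a generator is multiplied from the left.\<close>

lemma sum_shift:
  fixes X Y :: "int \<Rightarrow> sl2" and n :: nat
  assumes X: "\<And>i. X i \<in> gr a (2 * i - int n)" and X0: "X (- 1) = \<zero>\<^bsub>SL\<^esub>" "X (int n + 1) = \<zero>\<^bsub>SL\<^esub>"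
    and g: "g \<in> gr a' 1" and h: "h \<in> gr a' (-1)"
    and Y: "\<And>i. Y i \<in> gr (2 * i - int n - 1) b"
  shows "(\<Oplus>\<^bsub>AA\<^esub>i\<in>{..n}. tn (RA (Phi (int n - int i)) \<cdot> (g \<cdot> X (int i))) (Y (int i + 1)) \<oplus>\<^bsub>AA\<^esub> tn (h \<cdot> X (int i)) (Y (int i)))
    = (\<Oplus>\<^bsub>AA\<^esub>i\<in>{..Suc n}. tn (h \<cdot> X (int i) \<oplus>\<^bsub>SL\<^esub> RA (Phi (int n + 1 - int i)) \<cdot> (g \<cdot> X (int i - 1))) (Y (int i)))"
proof -
  let ?G = "\<lambda>i::nat. tn (RA (Phi (int n + 1 - int i)) \<cdot> (g \<cdot> X (int i - 1))) (Y (int i))"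
  let ?H = "\<lambda>i::nat. tn (h \<cdot> X (int i)) (Y (int i))"
  have gX: "RA f \<cdot> (g \<cdot> X (i - 1)) \<in> gr (a' + a) (2 * i - int n - 1)" for i f
    by (rule gr_LR, rule gr_mult'[OF g X]) auto
  have hX: "h \<cdot> X i \<in> gr (a' + a) (2 * i - int n - 1)" for i
    by (rule gr_mult'[OF h X]) auto
  have gc: "g \<in> carrier SL" "h \<in> carrier SL" using g h by auto
  have cl: "?G i \<in> carrier AA" "?H i \<in> carrier AA" for i
    by (rule tn_closed[OF gX Y], rule tn_closed[OF hX Y])
  have "(\<Oplus>\<^bsub>AA\<^esub>i\<in>{..Suc n}. tn (h \<cdot> X (int i) \<oplus>\<^bsub>SL\<^esub> RA (Phi (int n + 1 - int i)) \<cdot> (g \<cdot> X (int i - 1))) (Y (int i)))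
      = (\<Oplus>\<^bsub>AA\<^esub>i\<in>{..Suc n}. ?H i \<oplus>\<^bsub>AA\<^esub> ?G i)"
    by (rule AA.finsum_cong') (auto simp: tn_add_left[OF hX gX Y] cl)
  also have "\<dots> = (\<Oplus>\<^bsub>AA\<^esub>i\<in>{..Suc n}. ?H i) \<oplus>\<^bsub>AA\<^esub> (\<Oplus>\<^bsub>AA\<^esub>i\<in>{..Suc n}. ?G i)"
    by (rule AA.finsum_addf) (auto simp: cl)
  also have "(\<Oplus>\<^bsub>AA\<^esub>i\<in>{..Suc n}. ?H i) = (\<Oplus>\<^bsub>AA\<^esub>i\<in>{..n}. ?H i)"
  proof -
    \<comment> \<open>The hypotheses \<open>X0\<close> kill the boundary term of each of the two
      sums, so that their ranges can be aligned.\<close>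
    have "?H (Suc n) = \<zero>\<^bsub>AA\<^esub>"
      using X0(2) gc tn_zero_left[OF Y] by (simp add: add.commute)
    then show ?thesis using AA.finsum_Suc[of ?H n] cl by (simp add: Pi_iff AA.finsum_closed)
  qed
  also have "(\<Oplus>\<^bsub>AA\<^esub>i\<in>{..Suc n}. ?G i) = (\<Oplus>\<^bsub>AA\<^esub>i\<in>{..n}. ?G (Suc i))"
  proof -
    have z: "?G 0 = \<zero>\<^bsub>AA\<^esub>" using X0(1) gc tn_zero_left[OF Y[of 0]] by simp
    have e: "(\<Oplus>\<^bsub>AA\<^esub>i\<in>{..Suc n}. ?G i) = (\<Oplus>\<^bsub>AA\<^esub>i\<in>{..n}. ?G (Suc i)) \<oplus>\<^bsub>AA\<^esub> ?G 0"
      by (rule AA.finsum_Suc2) (use cl in blast)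
    have "(\<Oplus>\<^bsub>AA\<^esub>i\<in>{..n}. ?G (Suc i)) \<in> carrier AA"
      by (rule AA.finsum_closed) (use cl in blast)
    then show ?thesis unfolding e z by (rule AA.r_zero)
  qed
  also have "(\<Oplus>\<^bsub>AA\<^esub>i\<in>{..n}. ?H i) \<oplus>\<^bsub>AA\<^esub> (\<Oplus>\<^bsub>AA\<^esub>i\<in>{..n}. ?G (Suc i)) = (\<Oplus>\<^bsub>AA\<^esub>i\<in>{..n}. ?H i \<oplus>\<^bsub>AA\<^esub> ?G (Suc i))"
    by (rule AA.finsum_addf[symmetric]) (use cl in blast)+
  also have "\<dots> = (\<Oplus>\<^bsub>AA\<^esub>i\<in>{..n}. tn (RA (Phi (int n - int i)) \<cdot> (g \<cdot> X (int i))) (Y (int i + 1)) \<oplus>\<^bsub>AA\<^esub> tn (h \<cdot> X (int i)) (Y (int i)))"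
  proof (rule AA.finsum_cong'[OF refl])
    have e: "?G (Suc i) = tn (RA (Phi (int n - int i)) \<cdot> (g \<cdot> X (int i))) (Y (int i + 1))" for i
      by (simp add: add.commute)
    show "(\<lambda>i. tn (RA (Phi (int n - int i)) \<cdot> (g \<cdot> X (int i))) (Y (int i + 1)) \<oplus>\<^bsub>AA\<^esub> tn (h \<cdot> X (int i)) (Y (int i))) \<in> {..n} \<rightarrow> carrier AA"
      unfolding e[symmetric] using cl by blast
    show "?H i \<oplus>\<^bsub>AA\<^esub> ?G (Suc i) = tn (RA (Phi (int n - int i)) \<cdot> (g \<cdot> X (int i))) (Y (int i + 1)) \<oplus>\<^bsub>AA\<^esub> tn (h \<cdot> X (int i)) (Y (int i))" for i
      unfolding e[symmetric] by (rule AA.a_comm[OF cl(2) cl(1)])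
  qed
  finally show ?thesis by simp
qed

abbreviation "tt \<equiv> A.tm"

lemma tt_cmp: "cmp (tt n k i) (tt n i j)"
  by (rule cmpI[OF tm_graded tm_graded])

lemma tt_gr_gen:
  "al \<cdot> tt n k i \<in> gr (2 * k - int n + 1) (2 * i - int n + 1)" "be \<cdot> tt n k i \<in> gr (2 * k - int n + 1) (2 * i - int n - 1)"
  "ga \<cdot> tt n k i \<in> gr (2 * k - int n - 1) (2 * i - int n + 1)" "de \<cdot> tt n k i \<in> gr (2 * k - int n - 1) (2 * i - int n - 1)"
  by (rule gr_mult'[OF gr_gens(1) tm_graded] gr_mult'[OF gr_gens(2) tm_graded]
      gr_mult'[OF gr_gens(3) tm_graded] gr_mult'[OF gr_gens(4) tm_graded]; simp)+

text \<open>The common core of both recursions for \<open>tm\<close>: (g, h) is (\<alpha>, \<beta>)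
  for the last row and (\<gamma>, \<delta>) for the others, and X is a row of level n.\<close>

lemma cop_step:
  fixes X :: "int \<Rightarrow> sl2" and n :: nat
  assumes X: "\<And>i. X i \<in> gr a (2 * i - int n)" and X0: "X (- 1) = \<zero>\<^bsub>SL\<^esub>" "X (int n + 1) = \<zero>\<^bsub>SL\<^esub>"
    and g: "g \<in> gr a' 1" and h: "h \<in> gr a' (-1)"
  shows "(\<Oplus>\<^bsub>AA\<^esub>i\<in>{..n}. tn (g \<cdot> X (int i)) (be \<cdot> tt n (int i) j) \<oplus>\<^bsub>AA\<^esub> tn (h \<cdot> X (int i)) (de \<cdot> tt n (int i) j))
    \<oplus>\<^bsub>AA\<^esub> DR (Phi (int n + 1 - j)) \<otimes>\<^bsub>AA\<^esub> (\<Oplus>\<^bsub>AA\<^esub>i\<in>{..n}. tn (g \<cdot> X (int i)) (al \<cdot> tt n (int i) (j - 1)) \<oplus>\<^bsub>AA\<^esub> tn (h \<cdot> X (int i)) (ga \<cdot> tt n (int i) (j - 1)))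
    = (\<Oplus>\<^bsub>AA\<^esub>i\<in>{..Suc n}. tn (h \<cdot> X (int i) \<oplus>\<^bsub>SL\<^esub> RA (Phi (int n + 1 - int i)) \<cdot> (g \<cdot> X (int i - 1))) (tt (Suc n) (int i) j))"
proof -
  let ?P = "Phi (int n + 1 - j)"
  have gX: "g \<cdot> X i \<in> gr (a' + a) (2 * i - int n + 1)" and hX: "h \<cdot> X i \<in> gr (a' + a) (2 * i - int n - 1)" for i
    by (rule gr_mult'[OF g X]; simp) (rule gr_mult'[OF h X]; simp)
  note t = tt_gr_gen[of n]
  let ?A = "\<lambda>i::nat. tn (g \<cdot> X (int i)) (be \<cdot> tt n (int i) j)" and ?B = "\<lambda>i::nat. tn (h \<cdot> X (int i)) (de \<cdot> tt n (int i) j)"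
    and ?C = "\<lambda>i::nat. tn (g \<cdot> X (int i)) (al \<cdot> tt n (int i) (j - 1))" and ?D = "\<lambda>i::nat. tn (h \<cdot> X (int i)) (ga \<cdot> tt n (int i) (j - 1))"
  have cl: "?A i \<in> carrier AA" "?B i \<in> carrier AA" "?C i \<in> carrier AA" "?D i \<in> carrier AA" for i
    by (rule tn_closed[OF gX t(2)], rule tn_closed[OF hX t(4)], rule tn_closed[OF gX t(1)], rule tn_closed[OF hX t(3)])
  have trm: "(?A i \<oplus>\<^bsub>AA\<^esub> ?B i) \<oplus>\<^bsub>AA\<^esub> DR ?P \<otimes>\<^bsub>AA\<^esub> (?C i \<oplus>\<^bsub>AA\<^esub> ?D i)
      = tn (RA (Phi (int n - int i)) \<cdot> (g \<cdot> X (int i))) (tt (Suc n) (int i + 1) j) \<oplus>\<^bsub>AA\<^esub> tn (h \<cdot> X (int i)) (tt (Suc n) (int i) j)"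
    if "i \<in> {..n}" for i
  proof -
    have i: "0 \<le> int i" "int i \<le> int n" using that by auto
    have cC: "cmp (g \<cdot> X (int i)) (al \<cdot> tt n (int i) (j - 1))" "cmp (h \<cdot> X (int i)) (ga \<cdot> tt n (int i) (j - 1))"
      by (rule cmpI[OF gX t(1)], rule cmpI[OF hX t(3)])
    have sh: "RA ?P \<cdot> (al \<cdot> tt n (int i) (j - 1)) \<in> gr (2 * int i - int n + 1) (2 * j - int n - 1)"
      "RA ?P \<cdot> (ga \<cdot> tt n (int i) (j - 1)) \<in> gr (2 * int i - int n - 1) (2 * j - int n - 1)"
      using gr_LR(2)[OF t(1)[of "int i" "j - 1"]] gr_LR(2)[OF t(3)[of "int i" "j - 1"]] by (simp_all add: algebra_simps)
    have T: "tt (Suc n) (int i + 1) j \<in> gr (2 * int i - int n + 1) (2 * j - int n - 1)"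
      using tm_graded[of "Suc n" "int i + 1" j] by (simp add: algebra_simps)
    have "(?A i \<oplus>\<^bsub>AA\<^esub> ?B i) \<oplus>\<^bsub>AA\<^esub> DR ?P \<otimes>\<^bsub>AA\<^esub> (?C i \<oplus>\<^bsub>AA\<^esub> ?D i)
      = (?A i \<oplus>\<^bsub>AA\<^esub> tn (g \<cdot> X (int i)) (RA ?P \<cdot> (al \<cdot> tt n (int i) (j - 1))))
        \<oplus>\<^bsub>AA\<^esub> (?B i \<oplus>\<^bsub>AA\<^esub> tn (h \<cdot> X (int i)) (RA ?P \<cdot> (ga \<cdot> tt n (int i) (j - 1))))"
      using cl[of i] cC cmp_LR(2)[OF cC(1), of ?P] cmp_LR(2)[OF cC(2), of ?P] by (simp add: AA.r_distr DR_tn AA.a_ac)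
    also have "?A i \<oplus>\<^bsub>AA\<^esub> tn (g \<cdot> X (int i)) (RA ?P \<cdot> (al \<cdot> tt n (int i) (j - 1)))
        = tn (g \<cdot> X (int i)) (be \<cdot> tt n (int i) j \<oplus>\<^bsub>SL\<^esub> RA ?P \<cdot> (al \<cdot> tt n (int i) (j - 1)))"
      by (rule tn_add_right[symmetric, OF gX t(2) sh(1)])
    also have "be \<cdot> tt n (int i) j \<oplus>\<^bsub>SL\<^esub> RA ?P \<cdot> (al \<cdot> tt n (int i) (j - 1)) = LA (Phi (int n - int i)) \<cdot> tt (Suc n) (int i + 1) j"
      by (rule A.tm_row_b[OF i, symmetric])
    \<comment> \<open>Here the factor \<open>Phi\<close> crosses the tensor sign; in the left factor
      it is exactly the coefficient in the recursion for level n + 1.\<close>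
    also have "tn (g \<cdot> X (int i)) (LA (Phi (int n - int i)) \<cdot> tt (Suc n) (int i + 1) j)
        = tn (RA (Phi (int n - int i)) \<cdot> (g \<cdot> X (int i))) (tt (Suc n) (int i + 1) j)"
      by (rule tn_balanced[symmetric, OF gX T])
    also have "?B i \<oplus>\<^bsub>AA\<^esub> tn (h \<cdot> X (int i)) (RA ?P \<cdot> (ga \<cdot> tt n (int i) (j - 1)))
        = tn (h \<cdot> X (int i)) (de \<cdot> tt n (int i) j \<oplus>\<^bsub>SL\<^esub> RA ?P \<cdot> (ga \<cdot> tt n (int i) (j - 1)))"
      by (rule tn_add_right[symmetric, OF hX t(4) sh(2)])
    also have "de \<cdot> tt n (int i) j \<oplus>\<^bsub>SL\<^esub> RA ?P \<cdot> (ga \<cdot> tt n (int i) (j - 1)) = tt (Suc n) (int i) j"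
      by (rule A.tm_row_d[OF i(2), symmetric])
    finally show ?thesis .
  qed
  have "(\<Oplus>\<^bsub>AA\<^esub>i\<in>{..n}. ?A i \<oplus>\<^bsub>AA\<^esub> ?B i) \<oplus>\<^bsub>AA\<^esub> DR ?P \<otimes>\<^bsub>AA\<^esub> (\<Oplus>\<^bsub>AA\<^esub>i\<in>{..n}. ?C i \<oplus>\<^bsub>AA\<^esub> ?D i)
      = (\<Oplus>\<^bsub>AA\<^esub>i\<in>{..n}. (?A i \<oplus>\<^bsub>AA\<^esub> ?B i) \<oplus>\<^bsub>AA\<^esub> DR ?P \<otimes>\<^bsub>AA\<^esub> (?C i \<oplus>\<^bsub>AA\<^esub> ?D i))"
    by (subst AA.finsum_rdistr) (use cl in \<open>auto simp: AA.finsum_addf\<close>)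
  also have "\<dots> = (\<Oplus>\<^bsub>AA\<^esub>i\<in>{..n}. tn (RA (Phi (int n - int i)) \<cdot> (g \<cdot> X (int i))) (tt (Suc n) (int i + 1) j) \<oplus>\<^bsub>AA\<^esub> tn (h \<cdot> X (int i)) (tt (Suc n) (int i) j))"
    by (rule AA.finsum_cong') (use cl in \<open>auto simp: trm[symmetric]\<close>)
  also have "\<dots> = (\<Oplus>\<^bsub>AA\<^esub>i\<in>{..Suc n}. tn (h \<cdot> X (int i) \<oplus>\<^bsub>SL\<^esub> RA (Phi (int n + 1 - int i)) \<cdot> (g \<cdot> X (int i - 1))) (tt (Suc n) (int i) j))"
    by (rule sum_shift[OF X X0 g h, where b = "2 * j - int n - 1"])
      (use tm_graded[of "Suc n" _ j] in \<open>simp add: algebra_simps\<close>)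
  finally show ?thesis .
qed

lemma cop_tt:
  assumes "0 \<le> k" "k \<le> int n"
  shows "cop (tt n k j) = (\<Oplus>\<^bsub>AA\<^esub>i\<in>{..n}. tn (tt n k (int i)) (tt n (int i) j))"
  using assms
proof (induction n arbitrary: k j)
  case 0
  then have "k = 0" by simp
  then show ?case
    by (cases "j = 0") (simp_all add: tn_one tn_zero_right[OF gr_one])
next
  case (Suc n)
  have cl: "(\<lambda>i. tn (tt n k (int i)) (tt n (int i) j)) \<in> {..n} \<rightarrow> carrier AA" for k j
    using tt_cmp by auto
  have dist: "D \<otimes>\<^bsub>AA\<^esub> (\<Oplus>\<^bsub>AA\<^esub>i\<in>{..n}. tn (tt n k (int i)) (tt n (int i) j)) = (\<Oplus>\<^bsub>AA\<^esub>i\<in>{..n}. D \<otimes>\<^bsub>AA\<^esub> tn (tt n k (int i)) (tt n (int i) j))"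
    if "D \<in> carrier AA" for D k j
    using AA.finsum_rdistr[OF _ that cl] by simp
  show ?case
  proof (cases "k = int n + 1")
    case True
    have "tt n (int n) (- 1) = \<zero>\<^bsub>SL\<^esub>" "tt n (int n) (int n + 1) = \<zero>\<^bsub>SL\<^esub>" by (simp_all add: A.tm_eq_0)
    note step = cop_step[OF tm_graded this gr_gens(1,2), of j]
    have "cop (tt (Suc n) k j) = Db \<otimes>\<^bsub>AA\<^esub> cop (tt n (int n) j) \<oplus>\<^bsub>AA\<^esub> DR (Phi (int n + 1 - j)) \<otimes>\<^bsub>AA\<^esub> (Da \<otimes>\<^bsub>AA\<^esub> cop (tt n (int n) (j - 1)))"
      using True by (simp add: A.tm.simps(2) cop(2-))
    also have "\<dots> = (\<Oplus>\<^bsub>AA\<^esub>i\<in>{..Suc n}. tn (be \<cdot> tt n (int n) (int i) \<oplus>\<^bsub>SL\<^esub> RA (Phi (int n + 1 - int i)) \<cdot> (al \<cdot> tt n (int n) (int i - 1))) (tt (Suc n) (int i) j))"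
      using step by (simp add: Suc.IH dist D_tn[OF tt_cmp])
    finally show ?thesis using True by (simp add: A.tm.simps(2)[of n "int n + 1"])
  next
    case False
    then have k: "0 \<le> k" "k \<le> int n" using Suc.prems by auto
    have "tt n k (- 1) = \<zero>\<^bsub>SL\<^esub>" "tt n k (int n + 1) = \<zero>\<^bsub>SL\<^esub>" by (simp_all add: A.tm_eq_0)
    note step = cop_step[OF tm_graded this gr_gens(3,4), of j]
    have "cop (tt (Suc n) k j) = Dd \<otimes>\<^bsub>AA\<^esub> cop (tt n k j) \<oplus>\<^bsub>AA\<^esub> DR (Phi (int n + 1 - j)) \<otimes>\<^bsub>AA\<^esub> (Dc \<otimes>\<^bsub>AA\<^esub> cop (tt n k (j - 1)))"
      using A.tm_row_d[OF k(2), of j] by (simp add: cop(2-))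
    also have "\<dots> = (\<Oplus>\<^bsub>AA\<^esub>i\<in>{..Suc n}. tn (de \<cdot> tt n k (int i) \<oplus>\<^bsub>SL\<^esub> RA (Phi (int n + 1 - int i)) \<cdot> (ga \<cdot> tt n k (int i - 1))) (tt (Suc n) (int i) j))"
      using step by (simp add: Suc.IH[OF k] dist D_tn[OF tt_cmp])
    finally show ?thesis using A.tm_row_d[OF k(2)] by simp
  qed
qed

lemma lift_finsum:
  assumes cl: "\<And>X. X \<in> carrier AA \<Longrightarrow> \<Psi> X \<in> carrier SL"
    and add: "\<And>X Y. X \<in> carrier AA \<Longrightarrow> Y \<in> carrier AA \<Longrightarrow> \<Psi> (X \<oplus>\<^bsub>AA\<^esub> Y) = \<Psi> X \<oplus>\<^bsub>SL\<^esub> \<Psi> Y"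
    and I: "finite I" and f: "f \<in> I \<rightarrow> carrier AA"
  shows "\<Psi> (finsum AA f I) = (\<Oplus>\<^bsub>SL\<^esub>i\<in>I. \<Psi> (f i))"
  using I f
proof (induction I rule: finite_induct)
  case empty
  have "\<Psi> \<zero>\<^bsub>AA\<^esub> \<oplus>\<^bsub>SL\<^esub> \<Psi> \<zero>\<^bsub>AA\<^esub> = \<Psi> \<zero>\<^bsub>AA\<^esub>" using add[of "\<zero>\<^bsub>AA\<^esub>" "\<zero>\<^bsub>AA\<^esub>"] by simp
  then have "\<Psi> \<zero>\<^bsub>AA\<^esub> = \<zero>\<^bsub>SL\<^esub>" using cl[of "\<zero>\<^bsub>AA\<^esub>"] by (simp add: A.add.l_cancel_one)
  then show ?case by simp
next
  case (insert i I)
  then have f: "f \<in> I \<rightarrow> carrier AA" "f i \<in> carrier AA" by auto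
  then show ?case using insert.hyps insert.IH cl
    by (simp add: AA.finsum_insert A.finsum_insert add AA.finsum_closed Pi_iff)
qed

lemma LR_mconst_mult:
  assumes "x \<in> carrier SL"
  shows "LA (mconst z * f) \<cdot> x = z \<odot>\<^bsub>SL\<^esub> (LA f \<cdot> x)" "RA (mconst z * f) \<cdot> x = z \<odot>\<^bsub>SL\<^esub> (RA f \<cdot> x)"
  unfolding A.L_prod[OF assms, symmetric] A.R_prod[OF assms, symmetric]
  using assms by (simp_all add: smult_LA A.L_const_R)

text \<open>The contraction id \<otimes> p; linearity of p over the left moment map is what the
  balancing relation demands. With p from an integral it computes the right-hand side of left
  invariance, with p from the model it isolates one matrix element.\<close>

lemma lift_right:
  assumes add: "\<And>x y. x \<in> carrier SL \<Longrightarrow> y \<in> carrier SL \<Longrightarrow> p (x \<oplus>\<^bsub>SL\<^esub> y) = p x + p y"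
    and L: "\<And>f x. x \<in> carrier SL \<Longrightarrow> p (LA f \<cdot> x) = f * p x"
  obtains \<Psi> where "\<And>x y. cmp x y \<Longrightarrow> \<Psi> (tn x y) = RA (p y) \<cdot> x"
    "\<And>X Y. X \<in> carrier AA \<Longrightarrow> Y \<in> carrier AA \<Longrightarrow> \<Psi> (X \<oplus>\<^bsub>AA\<^esub> Y) = \<Psi> X \<oplus>\<^bsub>SL\<^esub> \<Psi> Y"
    "\<And>I f. finite I \<Longrightarrow> f \<in> I \<rightarrow> carrier AA \<Longrightarrow> \<Psi> (finsum AA f I) = (\<Oplus>\<^bsub>SL\<^esub>i::nat\<in>I. \<Psi> (f i))"
proof -
  have sm: "p (z \<odot>\<^bsub>SL\<^esub> x) = mconst z * p x" if "x \<in> carrier SL" for z x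
    using that L by (simp add: smult_LA)
  have "\<exists>\<Psi>. (\<forall>x y. cmp x y \<longrightarrow> \<Psi> (tn x y) = RA (p y) \<cdot> x)
    \<and> (\<forall>X\<in>carrier AA. \<Psi> X \<in> carrier SL)
    \<and> (\<forall>X\<in>carrier AA. \<forall>Y\<in>carrier AA. \<Psi> (X \<oplus>\<^bsub>AA\<^esub> Y) = \<Psi> X \<oplus>\<^bsub>SL\<^esub> \<Psi> Y)
    \<and> (\<forall>X\<in>carrier AA. \<forall>z. \<Psi> (z \<odot>\<^bsub>AA\<^esub> X) = z \<odot>\<^bsub>SL\<^esub> \<Psi> X)"
  proof (rule tensor_lift)
    fix x y :: sl2 assume "cmp x y"
    then show "RA (p y) \<cdot> x \<in> carrier SL" by (simp add: cmp_carrier)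
  next
    fix a b c x y z assume "x \<in> gr a c" "y \<in> gr c b"
    then have c: "x \<in> carrier SL" "y \<in> carrier SL" by auto
    show "RA (p (z \<odot>\<^bsub>SL\<^esub> y)) \<cdot> x = z \<odot>\<^bsub>SL\<^esub> (RA (p y) \<cdot> x)"
      unfolding sm[OF c(2)] by (rule LR_mconst_mult(2)[OF c(1)])
    show "RA (p y) \<cdot> (z \<odot>\<^bsub>SL\<^esub> x) = z \<odot>\<^bsub>SL\<^esub> (RA (p y) \<cdot> x)"
      using c by (simp add: A.smult_mult_right)
  next
    fix a b c x y f assume "x \<in> gr a c" "y \<in> gr c b"
    then have c: "x \<in> carrier SL" "y \<in> carrier SL" by auto
    show "RA (p y) \<cdot> (RA f \<cdot> x) = RA (p (LA f \<cdot> y)) \<cdot> x"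
      using c by (simp add: L A.R_prod mult.commute)
  qed (simp_all add: add A.r_distr A.l_distr A.R_add gr_carrier)
  then show thesis
  proof (elim exE conjE)
    fix \<Psi>
    assume a: "\<forall>x y. cmp x y \<longrightarrow> \<Psi> (tn x y) = RA (p y) \<cdot> x"
      and b: "\<forall>X\<in>carrier AA. \<Psi> X \<in> carrier SL"
      and c: "\<forall>X\<in>carrier AA. \<forall>Y\<in>carrier AA. \<Psi> (X \<oplus>\<^bsub>AA\<^esub> Y) = \<Psi> X \<oplus>\<^bsub>SL\<^esub> \<Psi> Y"
    show thesis
    proof (rule that)
      show "\<Psi> (finsum AA f I) = (\<Oplus>\<^bsub>SL\<^esub>i::nat\<in>I. \<Psi> (f i))" if "finite I" "f \<in> I \<rightarrow> carrier AA" for I f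
        by (rule lift_finsum[OF _ _ that]) (use b c in simp_all)
    qed (simp_all add: a b c)
  qed
qed

text \<open>The contraction p \<otimes> id, which needs linearity over the right moment map
  instead.\<close>

lemma lift_left:
  assumes add: "\<And>x y. x \<in> carrier SL \<Longrightarrow> y \<in> carrier SL \<Longrightarrow> p (x \<oplus>\<^bsub>SL\<^esub> y) = p x + p y"
    and R: "\<And>f x. x \<in> carrier SL \<Longrightarrow> p (RA f \<cdot> x) = f * p x"
  obtains \<Psi> where "\<And>x y. cmp x y \<Longrightarrow> \<Psi> (tn x y) = LA (p x) \<cdot> y"
    "\<And>X Y. X \<in> carrier AA \<Longrightarrow> Y \<in> carrier AA \<Longrightarrow> \<Psi> (X \<oplus>\<^bsub>AA\<^esub> Y) = \<Psi> X \<oplus>\<^bsub>SL\<^esub> \<Psi> Y"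
    "\<And>I f. finite I \<Longrightarrow> f \<in> I \<rightarrow> carrier AA \<Longrightarrow> \<Psi> (finsum AA f I) = (\<Oplus>\<^bsub>SL\<^esub>i::nat\<in>I. \<Psi> (f i))"
proof -
  have sm: "p (z \<odot>\<^bsub>SL\<^esub> x) = mconst z * p x" if "x \<in> carrier SL" for z x
    using that R by (simp add: smult_LA A.L_const_R)
  have "\<exists>\<Psi>. (\<forall>x y. cmp x y \<longrightarrow> \<Psi> (tn x y) = LA (p x) \<cdot> y)
    \<and> (\<forall>X\<in>carrier AA. \<Psi> X \<in> carrier SL)
    \<and> (\<forall>X\<in>carrier AA. \<forall>Y\<in>carrier AA. \<Psi> (X \<oplus>\<^bsub>AA\<^esub> Y) = \<Psi> X \<oplus>\<^bsub>SL\<^esub> \<Psi> Y)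
    \<and> (\<forall>X\<in>carrier AA. \<forall>z. \<Psi> (z \<odot>\<^bsub>AA\<^esub> X) = z \<odot>\<^bsub>SL\<^esub> \<Psi> X)"
  proof (rule tensor_lift)
    fix x y :: sl2 assume "cmp x y"
    then show "LA (p x) \<cdot> y \<in> carrier SL" by (simp add: cmp_carrier)
  next
    fix a b c x y z assume "x \<in> gr a c" "y \<in> gr c b"
    then have c: "x \<in> carrier SL" "y \<in> carrier SL" by auto
    show "LA (p (z \<odot>\<^bsub>SL\<^esub> x)) \<cdot> y = z \<odot>\<^bsub>SL\<^esub> (LA (p x) \<cdot> y)"
      unfolding sm[OF c(1)] by (rule LR_mconst_mult(1)[OF c(2)])
    show "LA (p x) \<cdot> (z \<odot>\<^bsub>SL\<^esub> y) = z \<odot>\<^bsub>SL\<^esub> (LA (p x) \<cdot> y)"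
      using c by (simp add: A.smult_mult_right)
  next
    fix a b c x y f assume "x \<in> gr a c" "y \<in> gr c b"
    then have c: "x \<in> carrier SL" "y \<in> carrier SL" by auto
    show "LA (p (RA f \<cdot> x)) \<cdot> y = LA (p x) \<cdot> (LA f \<cdot> y)"
      using c by (simp add: R A.L_prod mult.commute)
  qed (simp_all add: add A.r_distr A.l_distr A.L_add gr_carrier)
  then show thesis
  proof (elim exE conjE)
    fix \<Psi>
    assume a: "\<forall>x y. cmp x y \<longrightarrow> \<Psi> (tn x y) = LA (p x) \<cdot> y"
      and b: "\<forall>X\<in>carrier AA. \<Psi> X \<in> carrier SL"
      and c: "\<forall>X\<in>carrier AA. \<forall>Y\<in>carrier AA. \<Psi> (X \<oplus>\<^bsub>AA\<^esub> Y) = \<Psi> X \<oplus>\<^bsub>SL\<^esub> \<Psi> Y"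
    show thesis
    proof (rule that)
      show "\<Psi> (finsum AA f I) = (\<Oplus>\<^bsub>SL\<^esub>i::nat\<in>I. \<Psi> (f i))" if "finite I" "f \<in> I \<rightarrow> carrier AA" for I f
        by (rule lift_finsum[OF _ _ that]) (use b c in simp_all)
    qed (simp_all add: a b c)
  qed
qed

section \<open>Identifying \<open>tm\<close> with the matrix elements defined through the
  coproduct\<close>

abbreviation "vv \<equiv> corep_vec q"

lemma nat_pow_Suc_SL: "x \<in> carrier SL \<Longrightarrow> x [^]\<^bsub>SL\<^esub> Suc n = x \<cdot> x [^]\<^bsub>SL\<^esub> n"
  by (rule A.nat_pow_Suc2)

lemma gc: "ga \<in> carrier SL" "al \<in> carrier SL" by simp_all

text \<open>Each \<gamma> that \<alpha> passes contributes one factor \<phi>, shifted by the number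
  of \<gamma>'s in front of it.\<close>

lemma al_ga_pow: "x \<in> carrier SL \<Longrightarrow> al \<cdot> (ga [^]\<^bsub>SL\<^esub> (m::nat) \<cdot> x) = LA (Phi (int m)) \<cdot> (ga [^]\<^bsub>SL\<^esub> m \<cdot> (al \<cdot> x))"
proof (induction m)
  case (Suc m)
  have P: "Phi (int (Suc m)) = phi * mshift 1 (Phi (int m))"
    using Phi_rec[of "int m"] by (simp add: add.commute)
  from Suc show ?case
    unfolding nat_pow_Suc_SL[OF gc(1)] P by (simp add: A.m_assoc A.push_left A.push_rel(2) A.L_prod)
qed simp

lemma vv_closed [simp, intro]: "vv n k \<in> carrier SL"
  by (simp add: corep_vec_def)

lemma ga_vv: "k \<le> n \<Longrightarrow> ga \<cdot> vv n k = vv (Suc n) k"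
  unfolding corep_vec_def Suc_diff_le nat_pow_Suc_SL[OF gc(1)] by (simp add: A.m_assoc)

lemma al_vv: "k \<le> n \<Longrightarrow> al \<cdot> vv n k = LA (Phi (int n - int k)) \<cdot> vv (Suc n) (Suc k)"
  unfolding corep_vec_def diff_Suc_Suc nat_pow_Suc_SL[OF gc(2)] by (simp add: al_ga_pow of_nat_diff)

lemma vv_0: "vv 0 0 = \<one>\<^bsub>SL\<^esub>" by (simp add: corep_vec_def)

lemma vv_top: "vv (Suc n) (Suc n) = al \<cdot> vv n n"
  by (simp add: al_vv)

lemma vv_gr: "k \<le> n \<Longrightarrow> vv n k \<in> gr (2 * int k - int n) (int n)"
proof (induction n arbitrary: k)
  case 0
  then show ?case by (simp add: vv_0)
next
  case (Suc n)
  show ?case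
  proof (cases "k = Suc n")
    case True
    show ?thesis unfolding True vv_top by (rule gr_mult'[OF gr_gens(1) Suc.IH]) auto
  next
    case False
    then have k: "k \<le> n" using Suc.prems by simp
    show ?thesis unfolding ga_vv[OF k, symmetric] by (rule gr_mult'[OF gr_gens(3) Suc.IH[OF k]]) auto
  qed
qed

text \<open>In the model \<alpha> and \<gamma> are shifts times nonzero functions, so no vector of
  the corepresentation is lost.\<close>

lemma pv_vv: "k \<le> n \<Longrightarrow> pv (vv n k) (2 * int k - int n, int n, s, \<zeta>) \<noteq> 0"
proof (induction n arbitrary: k s)
  case 0
  then show ?case by (simp add: vv_0 pv_one)
next
  case (Suc n)
  show ?case
  proof (cases "k = Suc n")
    case True
    then show ?thesis using Suc.IH[of n s] by (simp add: vv_top pv_mult)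
  next
    case False
    then have k: "k \<le> n" using Suc.prems by simp
    then show ?thesis using Suc.IH[OF k, of "s - 2"] unfolding ga_vv[OF k, symmetric] by (simp add: pv_mult)
  qed
qed

text \<open>Padding by zero, so that \<open>sum_shift\<close> with its integer indices applies to
  the vectors.\<close>

definition vi :: "nat \<Rightarrow> int \<Rightarrow> sl2" where
  "vi n i = (if 0 \<le> i \<and> i \<le> int n then vv n (nat i) else \<zero>\<^bsub>SL\<^esub>)"

lemma vi_int: "i \<le> n \<Longrightarrow> vi n (int i) = vv n i" "i \<le> n \<Longrightarrow> vi (Suc n) (int i + 1) = vv (Suc n) (Suc i)"
  by (auto simp: vi_def nat_add_distrib)

lemma vi_gr: "vi n i \<in> gr (2 * i - int n) (int n)"
  using vv_gr[of "nat i" n] by (auto simp: vi_def)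

lemma tt_vv_cmp: "j \<le> n \<Longrightarrow> cmp (tt n k (int j)) (vv n j)"
  by (rule cmpI[OF tm_graded vv_gr])

lemma cop_vv_step:
  fixes X :: "int \<Rightarrow> sl2" and n :: nat
  assumes X: "\<And>i. X i \<in> gr a (2 * i - int n)" and X0: "X (- 1) = \<zero>\<^bsub>SL\<^esub>" "X (int n + 1) = \<zero>\<^bsub>SL\<^esub>"
    and g: "g \<in> gr a' 1" and h: "h \<in> gr a' (-1)"
  shows "(\<Oplus>\<^bsub>AA\<^esub>i\<in>{..n}. tn (g \<cdot> X (int i)) (al \<cdot> vv n i) \<oplus>\<^bsub>AA\<^esub> tn (h \<cdot> X (int i)) (ga \<cdot> vv n i))
    = (\<Oplus>\<^bsub>AA\<^esub>i\<in>{..Suc n}. tn (h \<cdot> X (int i) \<oplus>\<^bsub>SL\<^esub> RA (Phi (int n + 1 - int i)) \<cdot> (g \<cdot> X (int i - 1))) (vv (Suc n) i))"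
proof -
  have gX: "g \<cdot> X i \<in> gr (a' + a) (2 * i - int n + 1)" and hX: "h \<cdot> X i \<in> gr (a' + a) (2 * i - int n - 1)" for i
    by (rule gr_mult'[OF g X]; simp) (rule gr_mult'[OF h X]; simp)
  have gX': "RA f \<cdot> (g \<cdot> X (i - 1)) \<in> gr (a' + a) (2 * i - int n - 1)" for i f
    by (rule gr_LR, rule gr_mult'[OF g X]) auto
  have v: "vi (Suc n) i \<in> gr (2 * i - int n - 1) (int n + 1)" for i
    using vi_gr[of "Suc n" i] by (simp add: algebra_simps)
  have v1: "vi (Suc n) (i + 1) \<in> gr (2 * i - int n + 1) (int n + 1)" for i
    using vi_gr[of "Suc n" "i + 1"] by (simp add: algebra_simps)
  have trm: "tn (g \<cdot> X (int i)) (al \<cdot> vv n i) \<oplus>\<^bsub>AA\<^esub> tn (h \<cdot> X (int i)) (ga \<cdot> vv n i)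
      = tn (RA (Phi (int n - int i)) \<cdot> (g \<cdot> X (int i))) (vi (Suc n) (int i + 1)) \<oplus>\<^bsub>AA\<^esub> tn (h \<cdot> X (int i)) (vi (Suc n) (int i))"
    if "i \<in> {..n}" for i
    using that tn_balanced[OF gX v1, of _ "int i"] by (simp add: al_vv ga_vv vi_int)
  have "(\<Oplus>\<^bsub>AA\<^esub>i\<in>{..n}. tn (g \<cdot> X (int i)) (al \<cdot> vv n i) \<oplus>\<^bsub>AA\<^esub> tn (h \<cdot> X (int i)) (ga \<cdot> vv n i))
      = (\<Oplus>\<^bsub>AA\<^esub>i\<in>{..n}. tn (RA (Phi (int n - int i)) \<cdot> (g \<cdot> X (int i))) (vi (Suc n) (int i + 1)) \<oplus>\<^bsub>AA\<^esub> tn (h \<cdot> X (int i)) (vi (Suc n) (int i)))"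
  proof (rule AA.finsum_cong'[OF refl _ trm])
    show "(\<lambda>i. tn (RA (Phi (int n - int i)) \<cdot> (g \<cdot> X (int i))) (vi (Suc n) (int i + 1)) \<oplus>\<^bsub>AA\<^esub> tn (h \<cdot> X (int i)) (vi (Suc n) (int i))) \<in> {..n} \<rightarrow> carrier AA"
      by (intro Pi_I AA.a_closed tn_closed[OF hX v] tn_closed[OF gr_LR(2)[OF gX] v1])
  qed
  also have "\<dots> = (\<Oplus>\<^bsub>AA\<^esub>i\<in>{..Suc n}. tn (h \<cdot> X (int i) \<oplus>\<^bsub>SL\<^esub> RA (Phi (int n + 1 - int i)) \<cdot> (g \<cdot> X (int i - 1))) (vi (Suc n) (int i)))"
    by (rule sum_shift[OF X X0 g h v])
  also have "\<dots> = (\<Oplus>\<^bsub>AA\<^esub>i\<in>{..Suc n}. tn (h \<cdot> X (int i) \<oplus>\<^bsub>SL\<^esub> RA (Phi (int n + 1 - int i)) \<cdot> (g \<cdot> X (int i - 1))) (vv (Suc n) i))"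
  proof (rule AA.finsum_cong'[OF refl])
    fix i assume "i \<in> {..Suc n}"
    then have e: "vv (Suc n) i = vi (Suc n) (int i)" using vi_int(1)[of i "Suc n"] by simp
    show "tn (h \<cdot> X (int i) \<oplus>\<^bsub>SL\<^esub> RA (Phi (int n + 1 - int i)) \<cdot> (g \<cdot> X (int i - 1))) (vi (Suc n) (int i))
      = tn (h \<cdot> X (int i) \<oplus>\<^bsub>SL\<^esub> RA (Phi (int n + 1 - int i)) \<cdot> (g \<cdot> X (int i - 1))) (vv (Suc n) i)"
      unfolding e ..
  next
    show "(\<lambda>i. tn (h \<cdot> X (int i) \<oplus>\<^bsub>SL\<^esub> RA (Phi (int n + 1 - int i)) \<cdot> (g \<cdot> X (int i - 1))) (vv (Suc n) i)) \<in> {..Suc n} \<rightarrow> carrier AA"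
    proof (rule Pi_I)
      fix i assume "i \<in> {..Suc n}"
      then have e: "vv (Suc n) i = vi (Suc n) (int i)" using vi_int(1)[of i "Suc n"] by simp
      show "tn (h \<cdot> X (int i) \<oplus>\<^bsub>SL\<^esub> RA (Phi (int n + 1 - int i)) \<cdot> (g \<cdot> X (int i - 1))) (vv (Suc n) i) \<in> carrier AA"
        unfolding e by (rule tn_closed[OF gr_add[OF hX gX'] v])
    qed
  qed
  finally show ?thesis .
qed

lemma cop_vv:
  assumes "k \<le> n"
  shows "cop (vv n k) = (\<Oplus>\<^bsub>AA\<^esub>j\<in>{..n}. tn (tt n (int k) (int j)) (vv n j))"
  using assms
proof (induction n arbitrary: k)
  case 0
  then show ?case using tn_one tt_vv_cmp[of 0 0 0] by (simp add: vv_0)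
next
  case (Suc n)
  have cl: "(\<lambda>j. tn (tt n (int k) (int j)) (vv n j)) \<in> {..n} \<rightarrow> carrier AA" for k
    using tt_vv_cmp by auto
  have dist: "D \<otimes>\<^bsub>AA\<^esub> (\<Oplus>\<^bsub>AA\<^esub>j\<in>{..n}. tn (tt n (int k) (int j)) (vv n j)) = (\<Oplus>\<^bsub>AA\<^esub>j\<in>{..n}. D \<otimes>\<^bsub>AA\<^esub> tn (tt n (int k) (int j)) (vv n j))"
    if "D \<in> carrier AA" for D k
    using AA.finsum_rdistr[OF _ that cl] by simp
  have tn0: "tt n k' (- 1) = \<zero>\<^bsub>SL\<^esub>" "tt n k' (int n + 1) = \<zero>\<^bsub>SL\<^esub>" for k' by (simp_all add: A.tm_eq_0)
  show ?case
  proof (cases "k = Suc n")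
    case True
    have "cop (vv (Suc n) k) = Da \<otimes>\<^bsub>AA\<^esub> cop (vv n n)"
      unfolding True vv_top by (simp add: cop)
    also have "\<dots> = (\<Oplus>\<^bsub>AA\<^esub>j\<in>{..n}. Da \<otimes>\<^bsub>AA\<^esub> tn (tt n (int n) (int j)) (vv n j))"
      using Suc.IH[of n] dist by simp
    also have "\<dots> = (\<Oplus>\<^bsub>AA\<^esub>j\<in>{..n}. tn (al \<cdot> tt n (int n) (int j)) (al \<cdot> vv n j) \<oplus>\<^bsub>AA\<^esub> tn (be \<cdot> tt n (int n) (int j)) (ga \<cdot> vv n j))"
      by (rule AA.finsum_cong') (auto simp: D_tn tt_vv_cmp cmp_mult)
    also have "\<dots> = (\<Oplus>\<^bsub>AA\<^esub>i\<in>{..Suc n}. tn (be \<cdot> tt n (int n) (int i) \<oplus>\<^bsub>SL\<^esub> RA (Phi (int n + 1 - int i)) \<cdot> (al \<cdot> tt n (int n) (int i - 1))) (vv (Suc n) i))"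
      by (rule cop_vv_step[OF tm_graded tn0 gr_gens(1,2)])
    finally show ?thesis using True by (simp add: A.tm.simps(2)[of n "int n + 1"] add.commute[of 1])
  next
    case False
    then have k: "k \<le> n" using Suc.prems by simp
    have "cop (vv (Suc n) k) = Dc \<otimes>\<^bsub>AA\<^esub> cop (vv n k)"
      unfolding ga_vv[OF k, symmetric] by (simp add: cop)
    also have "\<dots> = (\<Oplus>\<^bsub>AA\<^esub>j\<in>{..n}. Dc \<otimes>\<^bsub>AA\<^esub> tn (tt n (int k) (int j)) (vv n j))"
      using Suc.IH[OF k] dist by simp
    also have "\<dots> = (\<Oplus>\<^bsub>AA\<^esub>j\<in>{..n}. tn (ga \<cdot> tt n (int k) (int j)) (al \<cdot> vv n j) \<oplus>\<^bsub>AA\<^esub> tn (de \<cdot> tt n (int k) (int j)) (ga \<cdot> vv n j))"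
      by (rule AA.finsum_cong') (auto simp: D_tn tt_vv_cmp cmp_mult)
    also have "\<dots> = (\<Oplus>\<^bsub>AA\<^esub>i\<in>{..Suc n}. tn (de \<cdot> tt n (int k) (int i) \<oplus>\<^bsub>SL\<^esub> RA (Phi (int n + 1 - int i)) \<cdot> (ga \<cdot> tt n (int k) (int i - 1))) (vv (Suc n) i))"
      by (rule cop_vv_step[OF tm_graded tn0 gr_gens(3,4)])
    finally show ?thesis using k by (simp add: A.tm_row_d)
  qed
qed

lemma is_matrix_row_tt: "k \<le> n \<Longrightarrow> is_matrix_row q n k (\<lambda>j. tt n (int k) (int j))"
  unfolding is_matrix_row_def cop_def[symmetric] by (simp add: tm_graded cop_vv)

text \<open>The second tensor factor is contracted with the model value at the bidegree of the j-th
  vector: the grading kills all other terms, and what is left is the j-th entry times a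
  unit.\<close>

lemma is_matrix_row_unique:
  assumes t: "is_matrix_row q n k t" and "k \<le> n" "j \<le> n"
  shows "t j = tt n (int k) (int j)"
proof -
  \<comment> \<open>The last two entries are the parameters s and \<zeta>; \<open>pv_vv\<close>
    holds for all values, and 0 is an arbitrary choice.\<close>
  let ?p = "\<lambda>y. pv y (2 * int j - int n, int n, 0, 0)"
  obtain \<Psi> where \<Psi>: "\<And>x y. cmp x y \<Longrightarrow> \<Psi> (tn x y) = RA (?p y) \<cdot> x"
    "\<And>I f. finite I \<Longrightarrow> f \<in> I \<rightarrow> carrier AA \<Longrightarrow> \<Psi> (finsum AA f I) = (\<Oplus>\<^bsub>SL\<^esub>i::nat\<in>I. \<Psi> (f i))"
  proof (rule lift_right[of ?p])
    fix \<Psi>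
    assume "\<And>x y. cmp x y \<Longrightarrow> \<Psi> (tn x y) = RA (?p y) \<cdot> x"
      and "\<And>I f. finite I \<Longrightarrow> f \<in> I \<rightarrow> carrier AA \<Longrightarrow> \<Psi> (finsum AA f I) = (\<Oplus>\<^bsub>SL\<^esub>i::nat\<in>I. \<Psi> (f i))"
    then show thesis by (rule that)
  qed (simp_all add: pv_add pv_mult)
  have val: "\<Psi> (cop (vv n k)) = RA (?p (vv n j)) \<cdot> s j" if s: "is_matrix_row q n k s" for s
  proof -
    have gs: "s i \<in> gr (2 * int k - int n) (2 * int i - int n)" if "i \<le> n" for i
      using s that unfolding is_matrix_row_def by blast
    have cm: "cmp (s i) (vv n i)" if "i \<le> n" for i by (rule cmpI[OF gs[OF that] vv_gr[OF that]])
    have sc: "s i \<in> carrier SL" if "i \<le> n" for i using gs[OF that] by auto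
    have "cop (vv n k) = (\<Oplus>\<^bsub>AA\<^esub>i\<in>{..n}. tn (s i) (vv n i))"
      using s unfolding is_matrix_row_def cop_def by blast
    then have "\<Psi> (cop (vv n k)) = (\<Oplus>\<^bsub>SL\<^esub>i\<in>{..n}. \<Psi> (tn (s i) (vv n i)))"
      using \<Psi>(2)[of "{..n}" "\<lambda>i. tn (s i) (vv n i)"] cm by auto
    also have "\<dots> = (\<Oplus>\<^bsub>SL\<^esub>i\<in>{..n}. if j = i then RA (?p (vv n i)) \<cdot> s i else \<zero>\<^bsub>SL\<^esub>)"
    proof (rule A.finsum_cong'[OF refl])
      fix i assume "i \<in> {..n}"
      then have i: "i \<le> n" by simp
      have "?p (vv n i) = 0" if "i \<noteq> j" using pv_graded[OF vv_gr[OF i]] that by simp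
      then show "\<Psi> (tn (s i) (vv n i)) = (if j = i then RA (?p (vv n i)) \<cdot> s i else \<zero>\<^bsub>SL\<^esub>)"
        using \<Psi>(1)[OF cm[OF i]] sc[OF i] by simp
    qed (use sc in auto)
    also have "\<dots> = RA (?p (vv n j)) \<cdot> s j"
      by (rule A.finsum_singleton) (use \<open>j \<le> n\<close> sc in auto)
    finally show ?thesis .
  qed
  have "RA (?p (vv n j)) \<cdot> t j = RA (?p (vv n j)) \<cdot> tt n (int k) (int j)"
    using val[OF t] val[OF is_matrix_row_tt[OF \<open>k \<le> n\<close>]] by simp
  moreover have "t j \<in> carrier SL" using t \<open>j \<le> n\<close> unfolding is_matrix_row_def by blast
  ultimately show ?thesis by (rule A.R_cancel[OF pv_vv[OF \<open>j \<le> n\<close>] _ A.tm_closed, rotated])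
qed

lemma matel_eq: "k \<le> n \<Longrightarrow> j \<le> n \<Longrightarrow> matel q n k j = tt n (int k) (int j)"
  unfolding matel_def using is_matrix_row_tt is_matrix_row_unique by (intro the_equality) blast+

end

section \<open>The counit\<close>

text \<open>Generated one term at a time, so that closure under composition is an induction;
  \<open>carrier_Dh\<close> identifies these maps with the operators in \<open>Dh\<close>.\<close>

inductive_set diffops :: "(mero \<Rightarrow> mero) set" where
  zero: "(\<lambda>_. 0) \<in> diffops"
| plus: "t \<in> diffops \<Longrightarrow> (\<lambda>x. f * mshift a x + t x) \<in> diffops"

lemma diffops_add: "t \<in> diffops \<Longrightarrow> u \<in> diffops \<Longrightarrow> (\<lambda>x. t x + u x) \<in> diffops"
  by (induction rule: diffops.induct) (auto simp: Groups.add.assoc intro: diffops.plus)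

lemma diffops_term: "(\<lambda>x. f * mshift a x) \<in> diffops"
  using diffops.plus[OF diffops.zero] by simp

lemma diffops_left: "t \<in> diffops \<Longrightarrow> (\<lambda>x. f * mshift a (t x)) \<in> diffops"
proof (induction rule: diffops.induct)
  case (plus t g b)
  then show ?case using diffops.plus[of _ "f * mshift a g" "a + b"]
    by (simp add: distrib_left mult.assoc)
qed (simp add: diffops.zero)

lemma diffops_comp: "t \<in> diffops \<Longrightarrow> u \<in> diffops \<Longrightarrow> (\<lambda>x. t (u x)) \<in> diffops"
  by (induction rule: diffops.induct) (auto intro: diffops.zero diffops_add diffops_left)

lemma diffops_linear:
  assumes "t \<in> diffops"
  shows "t (x + y) = t x + t y" "t (mconst c * x) = mconst c * t x"
  using assms by (induction rule: diffops.induct) (simp_all add: algebra_simps)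

lemma diffops_mult: "(\<lambda>x. f * x) \<in> diffops"
  and diffops_shift: "mshift a \<in> diffops"
  and diffops_id: "(\<lambda>x. x) \<in> diffops"
  using diffops_term[of f 0] diffops_term[of 1 a] diffops_term[of 1 0] by simp_all

lemma diffops_uminus: "t \<in> diffops \<Longrightarrow> (\<lambda>x. - t x) \<in> diffops"
  using diffops_left[of t "-1" 0] by simp

definition op_of :: "(mero \<Rightarrow> mero) \<Rightarrow> (complex \<Rightarrow> complex) \<Rightarrow> complex \<Rightarrow> complex" where
  "op_of t = (\<lambda>g\<in>carrier Mero. mval (t (mero_of g)))"

lemma op_of_mval [simp]: "op_of t (mval g) = mval (t g)"
  by (simp add: op_of_def mval_inverse)

lemma op_eqI:
  assumes "D \<in> extensional (carrier Mero)" "\<And>g. D (mval g) = mval (t g)"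
  shows "D = op_of t"
  by (rule extensionalityI[OF assms(1)]) (auto simp: op_of_def carrier_Mero mval_inverse assms(2))

lemma mval_mero_of: "f \<in> carrier Mero \<Longrightarrow> mval (mero_of f) = f"
  by (auto simp: carrier_Mero mval_inverse)

lemma abelian_monoid_Mero: "abelian_monoid Mero"
  by (rule abelian_monoidI) (auto simp: carrier_Mero Mero_zero add_ac)

lemma finsum_Mero: "finite I \<Longrightarrow> (\<Oplus>\<^bsub>Mero\<^esub>i\<in>I. mval (f i)) = mval (\<Sum>i\<in>I. f i)"
proof (induction I rule: finite_induct)
  case empty
  interpret abelian_monoid Mero by (rule abelian_monoid_Mero)
  show ?case by (simp add: Mero_zero)
next
  case (insert i I)
  interpret abelian_monoid Mero by (rule abelian_monoid_Mero)
  from insert show ?case by (simp add: finsum_insert)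
qed

lemma diffops_sum: "(\<lambda>x. \<Sum>i<(n::nat). f i * mshift (a i) x) \<in> diffops"
  by (induction n) (auto intro: diffops.zero diffops_add diffops_term)

lemma diffops_sumE: "t \<in> diffops \<Longrightarrow> \<exists>(n::nat) f a. t = (\<lambda>x. \<Sum>i<n. f i * mshift (a i) x)"
proof (induction rule: diffops.induct)
  case zero
  show ?case by (rule exI[of _ 0]) simp
next
  case (plus t f a)
  then obtain n :: nat and g b where t: "t = (\<lambda>x. \<Sum>i<n. g i * mshift (b i) x)" by blast
  have "(\<lambda>x. f * mshift a x + t x) = (\<lambda>x. \<Sum>i<Suc n. (g(n := f)) i * mshift ((b(n := a)) i) x)"
    by (simp add: t Groups.add.commute)
  then show ?case by blast
qed

lemma carrier_Dh: "carrier Dh = op_of ` diffops"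
proof
  show "carrier Dh \<subseteq> op_of ` diffops"
  proof
    fix D assume "D \<in> carrier Dh"
    then obtain n :: nat and f a where f: "f \<in> {..<n} \<rightarrow> carrier Mero"
      and D: "D = (\<lambda>g\<in>carrier Mero. \<Oplus>\<^bsub>Mero\<^esub>i\<in>{..<n}. f i \<otimes>\<^bsub>Mero\<^esub> shift (a i) g)"
      by (auto simp: Dh_def)
    have "D = op_of (\<lambda>x. \<Sum>i<n. mero_of (f i) * mshift (a i) x)"
    proof (rule op_eqI)
      fix g
      interpret abelian_monoid Mero by (rule abelian_monoid_Mero)
      have "D (mval g) = (\<Oplus>\<^bsub>Mero\<^esub>i\<in>{..<n}. mval (mero_of (f i) * mshift (a i) g))"
      proof -
        have "f i = mval (mero_of (f i))" if "i < n" for i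
          using f that by (intro mval_mero_of[symmetric]) auto
        then have "f i \<otimes>\<^bsub>Mero\<^esub> shift (a i) (mval g) = mval (mero_of (f i) * mshift (a i) g)" if "i < n" for i
          using that by (metis Mero_mult shift_mval)
        then show ?thesis unfolding D by (simp, intro finsum_cong') auto
      qed
      then show "D (mval g) = mval (\<Sum>i<n. mero_of (f i) * mshift (a i) g)"
        by (simp add: finsum_Mero)
    qed (simp add: D)
    then show "D \<in> op_of ` diffops" by (rule image_eqI[OF _ diffops_sum])
  qed
  show "op_of ` diffops \<subseteq> carrier Dh"
  proof
    fix D assume "D \<in> op_of ` diffops"
    then obtain n :: nat and f a where D: "D = op_of (\<lambda>x. \<Sum>i<n. f i * mshift (a i) x)"
      using diffops_sumE by blast
    have "D = (\<lambda>g\<in>carrier Mero. \<Oplus>\<^bsub>Mero\<^esub>i\<in>{..<n}. mval (f i) \<otimes>\<^bsub>Mero\<^esub> shift (a i) g)"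
      unfolding D by (rule op_eqI[symmetric]) (simp_all add: finsum_Mero)
    then show "D \<in> carrier Dh" unfolding Dh_def
      by (simp only: partial_object.simps mem_Collect_eq, intro exI[of _ n] exI[of _ "\<lambda>i. mval (f i)"] exI[of _ a]) simp
  qed
qed

lemma Dh_ops:
  "op_of t \<oplus>\<^bsub>Dh\<^esub> op_of u = op_of (\<lambda>x. t x + u x)" "op_of t \<otimes>\<^bsub>Dh\<^esub> op_of u = op_of (\<lambda>x. t (u x))"
  "c \<odot>\<^bsub>Dh\<^esub> op_of t = op_of (\<lambda>x. mconst c * t x)" "\<one>\<^bsub>Dh\<^esub> = op_of (\<lambda>x. x)" "\<zero>\<^bsub>Dh\<^esub> = op_of (\<lambda>x. 0)"
  by (rule op_eqI; simp add: Dh_def compose_def Mero_zero)+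

lemma Dh_cases:
  assumes "D \<in> carrier Dh"
  obtains t where "D = op_of t" "t \<in> diffops"
  using assms by (auto simp: carrier_Dh)

lemma op_of_closed: "t \<in> diffops \<Longrightarrow> op_of t \<in> carrier Dh"
  by (simp add: carrier_Dh)

lemma Dh_ring: "ring Dh"
proof (rule ringI)
  show "abelian_group Dh"
  proof (rule abelian_groupI)
    fix D assume "D \<in> carrier Dh"
    then obtain t where t: "D = op_of t" "t \<in> diffops" by (rule Dh_cases)
    show "\<exists>E\<in>carrier Dh. E \<oplus>\<^bsub>Dh\<^esub> D = \<zero>\<^bsub>Dh\<^esub>"
      by (rule bexI[of _ "op_of (\<lambda>x. - t x)"]) (simp_all add: t Dh_ops op_of_closed diffops_uminus)
  qed ((elim Dh_cases)?; simp add: Dh_ops op_of_closed diffops_add diffops.zero add_ac)+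
  show "monoid Dh"
    by (rule monoidI; (elim Dh_cases)?; simp add: Dh_ops op_of_closed diffops_comp diffops_id)
qed ((elim Dh_cases)?; simp add: Dh_ops diffops_linear)+

lemma Dh_calg: "calg Dh"
  by (rule calgI[OF Dh_ring])
    (auto elim!: Dh_cases simp: Dh_ops diffops_linear mconst_add mconst_mult distrib_left distrib_right mult.assoc
      intro!: op_of_closed diffops_left[of _ _ 0, simplified])

lemma mult_op_mval: "mult_op (mval f) = op_of (\<lambda>x. f * x)"
  by (rule op_eqI) (simp_all add: mult_op_def)

lemma shift_op_eq: "shift_op a = op_of (mshift a)"
  by (rule op_eqI) (simp_all add: shift_op_def)

context q_param
begin

text \<open>With \<beta> and \<gamma> sent to 0 and both moment maps to the same multiplication, all
  correction terms vanish, and the two remaining shifts are inverse to each other.\<close>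

lemma Dh_sl2_data: "sl2_data q Dh (\<lambda>f. mult_op (mval f)) (\<lambda>f. mult_op (mval f)) (shift_op (-1)) \<zero>\<^bsub>Dh\<^esub> \<zero>\<^bsub>Dh\<^esub> (shift_op 1)"
proof -
  interpret Dh: calg Dh by (rule Dh_calg)
  \<comment> \<open>The one relation with a difference, treated apart because \<open>Dh_ops\<close>
    does not describe subtraction.\<close>
  have bc: "\<zero>\<^bsub>Dh\<^esub> \<otimes>\<^bsub>Dh\<^esub> \<zero>\<^bsub>Dh\<^esub> = op_of (\<lambda>x. phi * x) \<otimes>\<^bsub>Dh\<^esub> (op_of (\<lambda>x. (kappa - phi) * x) \<otimes>\<^bsub>Dh\<^esub> (\<zero>\<^bsub>Dh\<^esub> \<otimes>\<^bsub>Dh\<^esub> \<zero>\<^bsub>Dh\<^esub>))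
      \<oplus>\<^bsub>Dh\<^esub> (op_of (\<lambda>x. phi * x) \<ominus>\<^bsub>Dh\<^esub> op_of (\<lambda>x. phi * x))"
    unfolding a_minus_def Dh.r_neg[OF op_of_closed[OF diffops_mult]] by (simp add: Dh_ops)
  show ?thesis
    unfolding mult_op_mval shift_op_eq
    by (unfold_locales; (rule bc)?;
      (simp add: op_of_closed diffops_mult diffops_shift diffops.zero Dh_ops)?;
      (rule arg_cong[of _ _ op_of], rule ext, simp add: algebra_simps)?)
qed

lemma is_counit_iff: "is_counit q \<phi> \<longleftrightarrow> \<phi> \<in> alg_hom SL Dh \<and> \<phi> al = shift_op (-1) \<and> \<phi> be = \<zero>\<^bsub>Dh\<^esub> \<and> \<phi> ga = \<zero>\<^bsub>Dh\<^esub>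
    \<and> \<phi> de = shift_op 1 \<and> (\<forall>f. \<phi> (LA f) = mult_op (mval f)) \<and> (\<forall>f. \<phi> (RA f) = mult_op (mval f))"
  unfolding is_counit_def carrier_Mero by (auto simp: lmom_SL rmom_SL)

lemma counit: "counit q \<in> alg_hom SL Dh" "counit q (LA f) = mult_op (mval f)" "counit q (RA f) = mult_op (mval f)"
proof -
  from theI'[OF ex1_hom[OF Dh_sl2_data]]
  show "counit q \<in> alg_hom SL Dh" "counit q (LA f) = mult_op (mval f)" "counit q (RA f) = mult_op (mval f)"
    unfolding counit_def is_counit_iff by blast+
qed

text \<open>In general this is \<epsilon>(z) applied to 1, as an element of the field; on the base
  it is the restriction to \<mu> = \<lambda>.\<close>

definition rho :: "sl2 \<Rightarrow> mero" where "rho z = mero_of (diag (counit q) z)"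

lemma counit_op: "z \<in> carrier SL \<Longrightarrow> \<exists>t\<in>diffops. counit q z = op_of t"
  using counit(1) carrier_Dh by (auto simp: alg_hom_def ring_hom_def)

lemma counit_ring_hom: "counit q \<in> ring_hom SL Dh"
  using counit(1) by (simp add: alg_hom_def)

lemma rho_op: "counit q z = op_of t \<Longrightarrow> rho z = t 1"
  by (simp add: rho_def diag_def Mero_one mval_inverse)

lemma mval_rho: "z \<in> carrier SL \<Longrightarrow> diag (counit q) z = mval (rho z)"
  using counit_op[of z] by (auto simp: rho_op diag_def Mero_one)

lemma rho_add:
  assumes "x \<in> carrier SL" "y \<in> carrier SL"
  shows "rho (x \<oplus>\<^bsub>SL\<^esub> y) = rho x + rho y"
proof -
  from assms obtain t u where t: "counit q x = op_of t" "counit q y = op_of u" using counit_op by blast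
  then have "counit q (x \<oplus>\<^bsub>SL\<^esub> y) = op_of (\<lambda>x. t x + u x)"
    by (simp add: ring_hom_add[OF counit_ring_hom assms] Dh_ops)
  with t show ?thesis by (simp add: rho_op)
qed

text \<open>The counit sends both moment maps to the same multiplication. Hence \<open>rho\<close>
  composed with an integral is admissible in \<open>lift_right\<close> as well as in
  \<open>lift_left\<close>.\<close>

lemma rho_LR:
  assumes "x \<in> carrier SL"
  shows "rho (LA f \<cdot> x) = f * rho x" "rho (RA f \<cdot> x) = f * rho x"
proof -
  from assms obtain t where t: "counit q x = op_of t" using counit_op by blast
  have "counit q (LA f \<cdot> x) = op_of (\<lambda>x. f * t x)" "counit q (RA f \<cdot> x) = op_of (\<lambda>x. f * t x)"
    using assms by (simp_all add: ring_hom_mult[OF counit_ring_hom] counit t mult_op_mval Dh_ops)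
  with t show "rho (LA f \<cdot> x) = f * rho x" "rho (RA f \<cdot> x) = f * rho x" by (simp_all add: rho_op)
qed

lemma rho_one: "rho \<one>\<^bsub>SL\<^esub> = 1"
  using rho_op[of "\<one>\<^bsub>SL\<^esub>" "\<lambda>x. x"] by (simp add: ring_hom_one[OF counit_ring_hom] Dh_ops)

lemma rho_zero: "rho \<zero>\<^bsub>SL\<^esub> = 0"
  using rho_LR(1)[of "\<zero>\<^bsub>SL\<^esub>" 0] by simp

end

section \<open>Invariance and uniqueness\<close>

context q_param
begin

lemma cop_tval:
  assumes "valid (f, g, n, k, j)"
  shows "cop (tval (f, g, n, k, j)) = (\<Oplus>\<^bsub>AA\<^esub>i\<in>{..n}. tn (LA f \<cdot> tt n k (int i)) (RA g \<cdot> tt n (int i) j))"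
proof -
  have cl: "(\<lambda>i. tn (tt n k (int i)) (tt n (int i) j)) \<in> {..n} \<rightarrow> carrier AA"
    "(\<lambda>i. tn (tt n k (int i)) (RA g \<cdot> tt n (int i) j)) \<in> {..n} \<rightarrow> carrier AA"
    using tt_cmp cmp_LR(2)[OF tt_cmp] by auto
  have "cop (tval (f, g, n, k, j)) = DL f \<otimes>\<^bsub>AA\<^esub> (DR g \<otimes>\<^bsub>AA\<^esub> cop (tt n k j))"
    by (simp add: cop)
  also have "DR g \<otimes>\<^bsub>AA\<^esub> cop (tt n k j) = (\<Oplus>\<^bsub>AA\<^esub>i\<in>{..n}. DR g \<otimes>\<^bsub>AA\<^esub> tn (tt n k (int i)) (tt n (int i) j))"
    using assms AA.finsum_rdistr[OF _ _ cl(1), of "DR g"] by (simp add: cop_tt)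
  also have "\<dots> = (\<Oplus>\<^bsub>AA\<^esub>i\<in>{..n}. tn (tt n k (int i)) (RA g \<cdot> tt n (int i) j))"
    by (rule AA.finsum_cong'[OF refl cl(2)]) (rule DR_tn[OF tt_cmp])
  also have "DL f \<otimes>\<^bsub>AA\<^esub> \<dots> = (\<Oplus>\<^bsub>AA\<^esub>i\<in>{..n}. DL f \<otimes>\<^bsub>AA\<^esub> tn (tt n k (int i)) (RA g \<cdot> tt n (int i) j))"
    using AA.finsum_rdistr[OF _ _ cl(2), of "DL f"] by simp
  also have "\<dots> = (\<Oplus>\<^bsub>AA\<^esub>i\<in>{..n}. tn (LA f \<cdot> tt n k (int i)) (RA g \<cdot> tt n (int i) j))"
    by (rule AA.finsum_cong'[OF refl _ DL_tn[OF cmp_LR(2)[OF tt_cmp]]])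
      (use cmp_LR(1)[OF cmp_LR(2)[OF tt_cmp]] in auto)
  finally show ?thesis .
qed

text \<open>Additivity is enough, since the coefficients f(\<lambda>)g(\<mu>) already contain all
  scalars.\<close>

lemma additive_eqI:
  assumes add: "\<And>x y. x \<in> carrier SL \<Longrightarrow> y \<in> carrier SL \<Longrightarrow> h (x \<oplus>\<^bsub>SL\<^esub> y) = h x \<oplus>\<^bsub>SL\<^esub> h y"
    and zero: "h \<zero>\<^bsub>SL\<^esub> = \<zero>\<^bsub>SL\<^esub>"
    and tval: "\<And>t. valid t \<Longrightarrow> h (tval t) = hh (tval t)" and x: "x \<in> carrier SL"
  shows "h x = hh x"
proof -
  obtain xs where xs: "x = sumv xs" "\<forall>t\<in>set xs. valid t" using hh_rep[OF x] by blast
  have hh0: "hh \<zero>\<^bsub>SL\<^esub> = \<zero>\<^bsub>SL\<^esub>" using hh_smult[of "\<zero>\<^bsub>SL\<^esub>" 0] by simp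
  have "h (sumv xs) = hh (sumv xs)"
    using xs(2) by (induction xs) (simp_all add: zero hh0 add hh_add tval)
  then show ?thesis using xs by simp
qed

lemma hh_LA: "hh (LA f) = LA f" and hh_RA: "hh (RA f) = RA f"
  using hh_LR[of "\<one>\<^bsub>SL\<^esub>" f] by (simp_all add: hh_one)

lemma hh_tval_pos: "valid (f, g, n, k, j) \<Longrightarrow> n \<noteq> 0 \<Longrightarrow> hh (tval (f, g, n, k, j)) = \<zero>\<^bsub>SL\<^esub>"
  by (simp add: hh_LR hh_tm)

lemma hh_tval_0: "valid (f, g, 0, k, j) \<Longrightarrow> hh (tval (f, g, 0, k, j)) = LA f \<cdot> RA g"
  by (auto simp: hh_LR hh_RA)

lemma sum_tm_zero:
  assumes "\<And>i. i \<in> {..n::nat} \<Longrightarrow> F i = \<zero>\<^bsub>SL\<^esub>"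
  shows "(\<Oplus>\<^bsub>SL\<^esub>i\<in>{..n}. F i) = \<zero>\<^bsub>SL\<^esub>"
  by (subst A.finsum_cong'[where g = "\<lambda>_. \<zero>\<^bsub>SL\<^esub>" and B = "{..n}"]) (auto simp: assms)

lemma hh_finsum:
  assumes "f \<in> I \<rightarrow> carrier SL" "finite I"
  shows "hh (finsum SL f I) = (\<Oplus>\<^bsub>SL\<^esub>i\<in>I. hh (f i))"
  using assms(2,1)
proof (induction I rule: finite_induct)
  case empty
  then show ?case using hh_smult[of "\<zero>\<^bsub>SL\<^esub>" 0] by simp
next
  case (insert i I)
  then have "f \<in> I \<rightarrow> carrier SL" "f i \<in> carrier SL" by auto
  then show ?case using insert.hyps insert.IH
    by (simp add: A.finsum_insert hh_add A.finsum_closed Pi_iff)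
qed

text \<open>Stated for any contraction \<Psi>, so that the expansion of \<open>cop_tval\<close> can
  be used here and a different one in the integral.\<close>

lemma hh_left_invariant:
  assumes x: "x \<in> carrier SL" and \<Psi>: "\<And>x y. cmp x y \<Longrightarrow> \<Psi> (tn x y) = RA (rho (hh y)) \<cdot> x"
    and add: "\<And>X Y. X \<in> carrier AA \<Longrightarrow> Y \<in> carrier AA \<Longrightarrow> \<Psi> (X \<oplus>\<^bsub>AA\<^esub> Y) = \<Psi> X \<oplus>\<^bsub>SL\<^esub> \<Psi> Y"
    and sum: "\<And>I f. finite I \<Longrightarrow> f \<in> I \<rightarrow> carrier AA \<Longrightarrow> \<Psi> (finsum AA f I) = (\<Oplus>\<^bsub>SL\<^esub>i::nat\<in>I. \<Psi> (f i))"
  shows "\<Psi> (cop x) = hh x"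
proof (rule additive_eqI[where h = "\<lambda>x. \<Psi> (cop x)", OF _ _ _ x])
  show "\<Psi> (cop \<zero>\<^bsub>SL\<^esub>) = \<zero>\<^bsub>SL\<^esub>" using sum[of "{}" undefined] by simp
next
  fix t :: tterm assume v: "valid t"
  obtain f g n k j where t: "t = (f, g, n, k, j)" by (cases t)
  have kj: "0 \<le> k" "k \<le> int n" "0 \<le> j" "j \<le> int n" using v t by auto
  have c: "cmp (LA f \<cdot> tt n k (int i)) (RA g \<cdot> tt n (int i) j)" for i by (intro cmp_LR tt_cmp)
  have e: "\<Psi> (tn (LA f \<cdot> tt n k (int i)) (RA g \<cdot> tt n (int i) j)) = RA (g * rho (hh (tt n (int i) j))) \<cdot> (LA f \<cdot> tt n k (int i))" for i
    using \<Psi>[OF c] by (simp add: hh_LR rho_LR)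
  have "\<Psi> (cop (tval t)) = (\<Oplus>\<^bsub>SL\<^esub>i\<in>{..n}. \<Psi> (tn (LA f \<cdot> tt n k (int i)) (RA g \<cdot> tt n (int i) j)))"
    unfolding t cop_tval[OF v[unfolded t]] by (rule sum) (use c in auto)
  also have "\<dots> = hh (tval t)"
  proof (cases "n = 0")
    case True
    have "k = 0" "j = 0" using kj True by auto
    then show ?thesis unfolding e t using True by (simp add: hh_LR hh_LA hh_RA hh_one rho_one A.LR_comm)
  next
    case False
    show ?thesis unfolding e t hh_tval_pos[OF v[unfolded t] False]
      by (rule sum_tm_zero) (use kj False in \<open>simp add: hh_tm rho_zero\<close>)
  qed
  finally show "\<Psi> (cop (tval t)) = hh (tval t)" .
qed (simp add: add)

lemma hh_right_invariant:
  assumes x: "x \<in> carrier SL" and \<Psi>: "\<And>x y. cmp x y \<Longrightarrow> \<Psi> (tn x y) = LA (rho (hh x)) \<cdot> y"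
    and add: "\<And>X Y. X \<in> carrier AA \<Longrightarrow> Y \<in> carrier AA \<Longrightarrow> \<Psi> (X \<oplus>\<^bsub>AA\<^esub> Y) = \<Psi> X \<oplus>\<^bsub>SL\<^esub> \<Psi> Y"
    and sum: "\<And>I f. finite I \<Longrightarrow> f \<in> I \<rightarrow> carrier AA \<Longrightarrow> \<Psi> (finsum AA f I) = (\<Oplus>\<^bsub>SL\<^esub>i::nat\<in>I. \<Psi> (f i))"
  shows "\<Psi> (cop x) = hh x"
proof (rule additive_eqI[where h = "\<lambda>x. \<Psi> (cop x)", OF _ _ _ x])
  show "\<Psi> (cop \<zero>\<^bsub>SL\<^esub>) = \<zero>\<^bsub>SL\<^esub>" using sum[of "{}" undefined] by simp
next
  fix t :: tterm assume v: "valid t"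
  obtain f g n k j where t: "t = (f, g, n, k, j)" by (cases t)
  have kj: "0 \<le> k" "k \<le> int n" "0 \<le> j" "j \<le> int n" using v t by auto
  have c: "cmp (LA f \<cdot> tt n k (int i)) (RA g \<cdot> tt n (int i) j)" for i by (intro cmp_LR tt_cmp)
  have e: "\<Psi> (tn (LA f \<cdot> tt n k (int i)) (RA g \<cdot> tt n (int i) j)) = LA (f * rho (hh (tt n k (int i)))) \<cdot> (RA g \<cdot> tt n (int i) j)" for i
    using \<Psi>[OF c] by (simp add: hh_LR rho_LR)
  have "\<Psi> (cop (tval t)) = (\<Oplus>\<^bsub>SL\<^esub>i\<in>{..n}. \<Psi> (tn (LA f \<cdot> tt n k (int i)) (RA g \<cdot> tt n (int i) j)))"
    unfolding t cop_tval[OF v[unfolded t]] by (rule sum) (use c in auto)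
  also have "\<dots> = hh (tval t)"
  proof (cases "n = 0")
    case True
    have "k = 0" "j = 0" using kj True by auto
    then show ?thesis unfolding e t using True by (simp add: hh_LR hh_LA hh_RA hh_one rho_one)
  next
    case False
    show ?thesis unfolding e t hh_tval_pos[OF v[unfolded t] False]
      by (rule sum_tm_zero) (use kj False in \<open>simp add: hh_tm rho_zero\<close>)
  qed
  finally show "\<Psi> (cop (tval t)) = hh (tval t)" .
qed (simp add: add)

lemma hh_extensional: "hh \<in> extensional (carrier SL)"
  by (simp add: extensional_def hh_def)

lemma hh_clinear: "hh \<in> clinear_to_base SL"
  by (simp add: clinear_to_base_def PiE_def hh_extensional hh_base hh_add hh_smult)

lemma hh_prealgebra_hom: "hh \<in> prealgebra_hom_to_base SL"
  unfolding prealgebra_hom_to_base_def carrier_Mero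
  by (auto simp: hh_clinear hh_gr lmom_SL rmom_SL hh_LR)

text \<open>Invariance is required for every expansion of \<Delta>(x) into pure tensors. All of them
  are evaluated by one contraction, and its existence carries the independence of the
  expansion.\<close>

lemma hh_left_integral: "left_integral SL cop (counit q) hh"
  unfolding left_integral_def
proof (intro conjI ballI allI impI)
  show "hh \<in> prealgebra_hom_to_base SL" by (rule hh_prealgebra_hom)
next
  fix x n X Y assume x: "x \<in> carrier SL" and rep: "represents SL (cop x) n X Y"
  show "hh x = (\<Oplus>\<^bsub>SL\<^esub>i\<in>{..<n}. rmom SL (diag (counit q) (hh (Y i))) \<cdot> X i)"
  proof (rule lift_right[of "\<lambda>y. rho (hh y)"])
    fix \<Psi>
    assume \<Psi>: "\<And>x y. cmp x y \<Longrightarrow> \<Psi> (tn x y) = RA (rho (hh y)) \<cdot> x"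
      and add: "\<And>X Y. X \<in> carrier AA \<Longrightarrow> Y \<in> carrier AA \<Longrightarrow> \<Psi> (X \<oplus>\<^bsub>AA\<^esub> Y) = \<Psi> X \<oplus>\<^bsub>SL\<^esub> \<Psi> Y"
      and sum: "\<And>I f. finite I \<Longrightarrow> f \<in> I \<rightarrow> carrier AA \<Longrightarrow> \<Psi> (finsum AA f I) = (\<Oplus>\<^bsub>SL\<^esub>i::nat\<in>I. \<Psi> (f i))"
    have c: "cmp (X i) (Y i)" if "i \<in> {..<n}" for i using rep that by (simp add: represents_def)
    have "hh x = \<Psi> (cop x)" by (rule hh_left_invariant[OF x \<Psi> add sum, symmetric])
    also have "cop x = (\<Oplus>\<^bsub>AA\<^esub>i\<in>{..<n}. tn (X i) (Y i))" using rep by (simp add: represents_def)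
    also have "\<Psi> \<dots> = (\<Oplus>\<^bsub>SL\<^esub>i\<in>{..<n}. \<Psi> (tn (X i) (Y i)))" by (rule sum) (use c in auto)
    also have "\<dots> = (\<Oplus>\<^bsub>SL\<^esub>i\<in>{..<n}. rmom SL (diag (counit q) (hh (Y i))) \<cdot> X i)"
    proof (rule A.finsum_cong'[OF refl])
      fix i assume i: "i \<in> {..<n}"
      show "\<Psi> (tn (X i) (Y i)) = rmom SL (diag (counit q) (hh (Y i))) \<cdot> X i"
        using \<Psi>[OF c[OF i]] cmp_carrier[OF c[OF i]] by (simp add: mval_rho rmom_SL)
    qed (use cmp_carrier[OF c] in \<open>auto simp: mval_rho rmom_SL\<close>)
    finally show ?thesis .
  qed (simp_all add: hh_add rho_add hh_LR rho_LR)
qed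

lemma hh_right_integral: "right_integral SL cop (counit q) hh"
  unfolding right_integral_def
proof (intro conjI ballI allI impI)
  show "hh \<in> prealgebra_hom_to_base SL" by (rule hh_prealgebra_hom)
next
  fix x n X Y assume x: "x \<in> carrier SL" and rep: "represents SL (cop x) n X Y"
  show "hh x = (\<Oplus>\<^bsub>SL\<^esub>i\<in>{..<n}. lmom SL (diag (counit q) (hh (X i))) \<cdot> Y i)"
  proof (rule lift_left[of "\<lambda>y. rho (hh y)"])
    fix \<Psi>
    assume \<Psi>: "\<And>x y. cmp x y \<Longrightarrow> \<Psi> (tn x y) = LA (rho (hh x)) \<cdot> y"
      and add: "\<And>X Y. X \<in> carrier AA \<Longrightarrow> Y \<in> carrier AA \<Longrightarrow> \<Psi> (X \<oplus>\<^bsub>AA\<^esub> Y) = \<Psi> X \<oplus>\<^bsub>SL\<^esub> \<Psi> Y"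
      and sum: "\<And>I f. finite I \<Longrightarrow> f \<in> I \<rightarrow> carrier AA \<Longrightarrow> \<Psi> (finsum AA f I) = (\<Oplus>\<^bsub>SL\<^esub>i::nat\<in>I. \<Psi> (f i))"
    have c: "cmp (X i) (Y i)" if "i \<in> {..<n}" for i using rep that by (simp add: represents_def)
    have "hh x = \<Psi> (cop x)" by (rule hh_right_invariant[OF x \<Psi> add sum, symmetric])
    also have "cop x = (\<Oplus>\<^bsub>AA\<^esub>i\<in>{..<n}. tn (X i) (Y i))" using rep by (simp add: represents_def)
    also have "\<Psi> \<dots> = (\<Oplus>\<^bsub>SL\<^esub>i\<in>{..<n}. \<Psi> (tn (X i) (Y i)))" by (rule sum) (use c in auto)
    also have "\<dots> = (\<Oplus>\<^bsub>SL\<^esub>i\<in>{..<n}. lmom SL (diag (counit q) (hh (X i))) \<cdot> Y i)"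
    proof (rule A.finsum_cong'[OF refl])
      fix i assume i: "i \<in> {..<n}"
      show "\<Psi> (tn (X i) (Y i)) = lmom SL (diag (counit q) (hh (X i))) \<cdot> Y i"
        using \<Psi>[OF c[OF i]] cmp_carrier[OF c[OF i]] by (simp add: mval_rho lmom_SL)
    qed (use cmp_carrier[OF c] in \<open>auto simp: mval_rho lmom_SL\<close>)
    finally show ?thesis .
  qed (simp_all add: hh_add rho_add hh_LR rho_LR)
qed

section \<open>Uniqueness of the integrals and of the Haar functional\<close>

lemma clinear_eq_hh:
  assumes h: "h \<in> clinear_to_base SL" and t: "\<And>t. valid t \<Longrightarrow> h (tval t) = hh (tval t)"
  shows "h = hh"
proof (rule extensionalityI)
  show "h \<in> extensional (carrier SL)" using h by (auto simp: clinear_to_base_def PiE_def)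
  show "hh \<in> extensional (carrier SL)" by (rule hh_extensional)
  have add: "h (x \<oplus>\<^bsub>SL\<^esub> y) = h x \<oplus>\<^bsub>SL\<^esub> h y" if "x \<in> carrier SL" "y \<in> carrier SL" for x y
    using h that by (simp add: clinear_to_base_def)
  have "h \<zero>\<^bsub>SL\<^esub> \<in> base SL" "h (0 \<odot>\<^bsub>SL\<^esub> \<zero>\<^bsub>SL\<^esub>) = 0 \<odot>\<^bsub>SL\<^esub> h \<zero>\<^bsub>SL\<^esub>"
    using h A.zero_closed by (auto simp: clinear_to_base_def simp del: A.smult_zero_left A.smult_zero_right)
  then have "h \<zero>\<^bsub>SL\<^esub> = \<zero>\<^bsub>SL\<^esub>" using base_closed by simp
  then show "h x = hh x" if "x \<in> carrier SL" for x
    using additive_eqI[of h, OF add _ t that] by blast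
qed

text \<open>The value of h at a matrix element lies in the base, where the Haar functional is the
  identity; so its Haar value is all that has to be known.\<close>

lemma clinear_LR_eq_hh:
  assumes h: "h \<in> prealgebra_hom_to_base SL" and one: "h \<one>\<^bsub>SL\<^esub> = \<one>\<^bsub>SL\<^esub>"
    and tm: "\<And>n k j. n \<noteq> 0 \<Longrightarrow> 0 \<le> k \<Longrightarrow> k \<le> int n \<Longrightarrow> 0 \<le> j \<Longrightarrow> j \<le> int n \<Longrightarrow> hh (h (tt n k j)) = \<zero>\<^bsub>SL\<^esub>"
  shows "h = hh"
proof (rule clinear_eq_hh)
  show cl: "h \<in> clinear_to_base SL" using h by (simp add: prealgebra_hom_to_base_def)
  fix t :: tterm assume v: "valid t"
  obtain f g n k j where t: "t = (f, g, n, k, j)" by (cases t)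
  have kj: "0 \<le> k" "k \<le> int n" "0 \<le> j" "j \<le> int n" using v t by auto
  have LR: "h (LA f \<cdot> x) = LA f \<cdot> h x" "h (RA f \<cdot> x) = RA f \<cdot> h x" if "x \<in> carrier SL" for f x
    using h that unfolding prealgebra_hom_to_base_def carrier_Mero by (auto simp: lmom_SL rmom_SL)
  have "h (tt n k j) \<in> base SL" using cl A.tm_closed by (auto simp: clinear_to_base_def)
  then have "h (tt n k j) = hh (h (tt n k j))" by (simp add: hh_on_base)
  moreover have "hh (h (tt n k j)) = hh (tt n k j)"
  proof (cases "n = 0")
    case True
    then have "k = 0" "j = 0" using kj by auto
    then show ?thesis using True by (simp add: one hh_one)
  next
    case False
    then show ?thesis using tm[OF False kj] kj by (simp add: hh_tm)
  qed
  ultimately show "h (tval t) = hh (tval t)"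
    by (simp add: t LR hh_LR)
qed

lemma represents_tt:
  assumes "0 \<le> k" "k \<le> int n"
  shows "represents SL (cop (tt n k j)) (Suc n) (\<lambda>i. tt n k (int i)) (\<lambda>i. tt n (int i) j)"
  unfolding represents_def lessThan_Suc_atMost cop_tt[OF assms] using tt_cmp by simp

lemma left_integral_unique:
  assumes h: "left_integral SL cop (counit q) h" and one: "h \<one>\<^bsub>SL\<^esub> = \<one>\<^bsub>SL\<^esub>"
  shows "h = hh"
proof (rule clinear_LR_eq_hh)
  show "h \<one>\<^bsub>SL\<^esub> = \<one>\<^bsub>SL\<^esub>" by (rule one)
  show hom: "h \<in> prealgebra_hom_to_base SL" using h by (simp add: left_integral_def)
  have hc: "h x \<in> carrier SL" if "x \<in> carrier SL" for x
    using hom that base_closed by (auto simp: prealgebra_hom_to_base_def clinear_to_base_def)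
  fix n :: nat and k j assume n: "n \<noteq> 0" and kj: "0 \<le> k" "k \<le> int n" "0 \<le> j" "j \<le> int n"
  have m: "rmom SL (diag (counit q) (h (tt n i j))) = RA (rho (h (tt n i j)))" for i
    by (simp add: mval_rho hc rmom_SL)
  have "h (tt n k j) = (\<Oplus>\<^bsub>SL\<^esub>i\<in>{..n}. RA (rho (h (tt n (int i) j))) \<cdot> tt n k (int i))"
    using h represents_tt[OF kj(1,2), of j] A.tm_closed
    unfolding left_integral_def lessThan_Suc_atMost[symmetric] m[symmetric] by blast
  then have "hh (h (tt n k j)) = (\<Oplus>\<^bsub>SL\<^esub>i\<in>{..n}. hh (RA (rho (h (tt n (int i) j))) \<cdot> tt n k (int i)))"
    by (simp add: hh_finsum)
  \<comment> \<open>By linearity over the moment maps each summand is a multiple of the Haar value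
    of a matrix element of positive level.\<close>
  also have "\<dots> = \<zero>\<^bsub>SL\<^esub>"
    by (rule sum_tm_zero) (use n kj in \<open>simp add: hh_LR hh_tm\<close>)
  finally show "hh (h (tt n k j)) = \<zero>\<^bsub>SL\<^esub>" .
qed

lemma right_integral_unique:
  assumes h: "right_integral SL cop (counit q) h" and one: "h \<one>\<^bsub>SL\<^esub> = \<one>\<^bsub>SL\<^esub>"
  shows "h = hh"
proof (rule clinear_LR_eq_hh)
  show "h \<one>\<^bsub>SL\<^esub> = \<one>\<^bsub>SL\<^esub>" by (rule one)
  show hom: "h \<in> prealgebra_hom_to_base SL" using h by (simp add: right_integral_def)
  have hc: "h x \<in> carrier SL" if "x \<in> carrier SL" for x
    using hom that base_closed by (auto simp: prealgebra_hom_to_base_def clinear_to_base_def)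
  fix n :: nat and k j assume n: "n \<noteq> 0" and kj: "0 \<le> k" "k \<le> int n" "0 \<le> j" "j \<le> int n"
  have m: "lmom SL (diag (counit q) (h (tt n k i))) = LA (rho (h (tt n k i)))" for i
    by (simp add: mval_rho hc lmom_SL)
  have "h (tt n k j) = (\<Oplus>\<^bsub>SL\<^esub>i\<in>{..n}. LA (rho (h (tt n k (int i)))) \<cdot> tt n (int i) j)"
    using h represents_tt[OF kj(1,2), of j] A.tm_closed
    unfolding right_integral_def lessThan_Suc_atMost[symmetric] m[symmetric] by blast
  then have "hh (h (tt n k j)) = (\<Oplus>\<^bsub>SL\<^esub>i\<in>{..n}. hh (LA (rho (h (tt n k (int i)))) \<cdot> tt n (int i) j))"
    by (simp add: hh_finsum)
  also have "\<dots> = \<zero>\<^bsub>SL\<^esub>"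
    by (rule sum_tm_zero) (use n kj in \<open>simp add: hh_LR hh_tm\<close>)
  finally show "hh (h (tt n k j)) = \<zero>\<^bsub>SL\<^esub>" .
qed

text \<open>The prescribed values on a spanning family leave no choice. The work lies in translating
  the indices and grouping of \<open>matel\<close> products into those of
  \<open>tval\<close>.\<close>

lemma is_haar_iff: "is_haar q h \<longleftrightarrow> h = hh"
proof
  assume h: "is_haar q h"
  show "h = hh"
  proof (rule clinear_eq_hh)
    show "h \<in> clinear_to_base SL" using h by (simp add: is_haar_def)
    fix t :: tterm assume v: "valid t"
    obtain f g n k j where t: "t = (f, g, n, k, j)" by (cases t)
    have kj: "0 \<le> k" "k \<le> int n" "0 \<le> j" "j \<le> int n" using v t by auto
    then have nat: "nat k \<le> n" "nat j \<le> n" "int (nat k) = k" "int (nat j) = j" by auto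
    have "h (LA f \<cdot> RA g \<cdot> tt n k j) = (if n = 0 then LA f \<cdot> RA g else \<zero>\<^bsub>SL\<^esub>)"
    proof -
      have "h ((lmom SL (mval f) \<cdot> rmom SL (mval g)) \<cdot> matel q n (nat k) (nat j))
          = (if n = 0 then lmom SL (mval f) \<cdot> rmom SL (mval g) else \<zero>\<^bsub>SL\<^esub>)"
        using h nat(1,2) mval_in_carrier unfolding is_haar_def by blast
      then show ?thesis
        by (simp only: lmom_SL rmom_SL matel_eq[OF nat(1,2)] nat(3,4) A.m_assoc A.closed A.tm_closed)
    qed
    then show "h (tval t) = hh (tval t)"
      using v hh_tval_pos hh_tval_0 unfolding t by (cases "n = 0") simp_all
  qed
next
  have "hh (LA f \<cdot> RA g \<cdot> matel q N k j) = (if N = 0 then LA f \<cdot> RA g else \<zero>\<^bsub>SL\<^esub>)" if "k \<le> N" "j \<le> N" for f g N k j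
    using that by (simp add: matel_eq hh_LR hh_tm)
  moreover assume "h = hh"
  ultimately show "is_haar q h"
    unfolding is_haar_def carrier_Mero using hh_clinear by (auto simp: lmom_SL rmom_SL A.m_assoc matel_eq)
qed

lemma haar_eq: "haar q = hh"
  unfolding haar_def is_haar_iff by (rule the_eq_trivial)

end

theorem proposition7p1:
  fixes q :: real
  assumes "0 < q" and "q < 1"
  shows "left_integral (SL2 q) (coprod q) (counit q) (haar q)
       \<and> right_integral (SL2 q) (coprod q) (counit q) (haar q)
       \<and> haar q \<one>\<^bsub>SL2 q\<^esub> = \<one>\<^bsub>SL2 q\<^esub>
       \<and> (\<forall>h. left_integral (SL2 q) (coprod q) (counit q) h \<and> h \<one>\<^bsub>SL2 q\<^esub> = \<one>\<^bsub>SL2 q\<^esub> \<longrightarrow> h = haar q)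
       \<and> (\<forall>h. right_integral (SL2 q) (coprod q) (counit q) h \<and> h \<one>\<^bsub>SL2 q\<^esub> = \<one>\<^bsub>SL2 q\<^esub> \<longrightarrow> h = haar q)"
proof -
  interpret q_param q using assms by unfold_locales
  show ?thesis
    using hh_left_integral hh_right_integral hh_one left_integral_unique right_integral_unique
    unfolding haar_eq cop_def by blast
qed

end
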